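(* Let $\Omega\subset\mathbb{R}^2$ be a bounded connected polygonal domain with a bipartite map $\mathcal{G}=(\mathcal{G}_1,\mathcal{G}_2)$ satisfying the geometric assumptions in the context, let $\mathcal{T}$ be a triangulation of $\Omega$ consistent with $\mathcal{G}$, and let the coefficients $a,\beta$ satisfy the assumptions in the context. Then the discrete problem $$\text{Find } \big([\mathbf{u}_1^h,p_2^h],[\mathbf{u}_2^h,p_1^h]\big)\in\mathbf{X}_h\times\mathbf{Y}_h:\quad \begin{cases}\mathcal{A}_h[\mathbf{u}_1^h,p_2^h]+\mathcal{B}_h'[\mathbf{u}_2^h,p_1^h]=F_1 & \text{in } \mathbf{X}_h',\\ -\mathcal{B}_h[\mathbf{u}_1^h,p_2^h]+\mathcal{C}_h[\mathbf{u}_2^h,p_1^h]=F_2 & \text{in } \mathbf{Y}_h'\end{cases}$$ is well-posed: for every $F_1\in\mathbf{X}_h'$ and $F_2\in\mathbf{Y}_h'$ it has a unique solution, and there is a constant $c>0$ (independent of $F_1,F_2$) with $\|[\mathbf{u}_1^h,p_2^h]\|_{\mathbf{X}}+\|[\mathbf{u}_2^h,p_1^h]\|_{\mathbf{Y}}\le c\,(\|F_1\|_{\mathbf{X}_h'}+\|F_2\|_{\mathbf{Y}_h'})$.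
   Context: Geometry. A bipartite map of $\Omega$ is a finite collection $\mathcal{G}$ of pairwise disjoint connected open subsets with $|\Omega-\bigcup_{G\in\mathcal{G}}G|=0$ and $\overline{\Omega}=\bigcup_{G\in\mathcal{G}}\overline{G}$, partitioned into two subcollections $\mathcal{G}_1,\mathcal{G}_2$ such that the boundaries of any two distinct members of the same subcollection intersect in a set of one-dimensional measure zero. Geometric assumptions: every $G\in\mathcal{G}$ is a polygon, and with $\Omega_i=\bigcup\{G:G\in\mathcal{G}_i\}$ the closures $\overline{\Omega_1}$, $\overline{\Omega_2}$ are connected. The interface is $\Gamma=\bigcup\{\partial K:K\in\mathcal{G}\}-\partial\Omega$. On $\Gamma$, $\widehat{\mathbf{n}}$ is the unit normal outward from $\Omega_1$. A triangulation $\mathcal{T}$ (triangles taken open) is consistent with $\mathcal{G}$ if each $K\in\mathcal{T}$ satisfies $K\cap\Omega_1=\emptyset$ or $K\cap\Omega_2=\emptyset$; $h$ denotes the maximal diameter of its triangles. Coefficients. $\beta:\Gamma\to[0,\infty)$, $\beta\in L^\infty(\Gamma)$, $\|\beta\|_{L^1(\Gamma)}>0$; $a:\Omega\to(0,\infty)$ with $a\in L^\infty(\Omega)$ and $1/a\in L^\infty(\Omega)$. Discrete spaces. $\mathbf{RT}_0(\Omega_1)=\{\mathbf{v}\in\mathbf{H}_{\mathrm{div}}(\Omega_1):\mathbf{v}|_K\in\mathbf{RT}_0(K)\ \forall K\in\mathcal{T},K\subseteq\Omega_1\}$ (lowest-order Raviart–Thomas); $\mathcal{Q}(\Omega_2)=\{q_2\in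 H^1(\Omega_2): q_2=\xi|_{\Omega_2}\text{ for some }\xi\in H^1(\Omega),\ q_2|_K\in P_1(K)\ \forall K\in\mathcal{T},K\subseteq\Omega_2\}$; $\nabla\mathcal{Q}(\Omega_2)=\{\nabla q_2:q_2\in\mathcal{Q}(\Omega_2)\}$; $\mathcal{Q}(\Omega_1)=\{q_1\in L^2(\Omega_1):q_1|_K\in P_0(K)\ \forall K\in\mathcal{T},K\subseteq\Omega_1\}$. $\mathbf{X}_h=\mathbf{RT}_0(\Omega_1)\times\mathcal{Q}(\Omega_2)$ with norm $\|[\mathbf{v}_1,q_2]\|_{\mathbf{X}}=(\|\mathbf{v}_1\|^2_{\mathbf{H}_{\mathrm{div}}(\Omega_1)}+\|q_2\|^2_{H^1(\Omega_2)})^{1/2}$, and $\mathbf{Y}_h=\nabla\mathcal{Q}(\Omega_2)\times\mathcal{Q}(\Omega_1)$ with norm $\|[\mathbf{v}_2,q_1]\|_{\mathbf{Y}}=(\|\mathbf{v}_2\|^2_{\mathbf{L}^2(\Omega_2)}+\|q_1\|^2_{L^2(\Omega_1)})^{1/2}$. Operators. $\mathcal{A}_h:\mathbf{X}_h\to\mathbf{X}_h'$, $\mathcal{B}_h:\mathbf{X}_h\to\mathbf{Y}_h'$, $\mathcal{C}_h:\mathbf{Y}_h\to\mathbf{Y}_h'$ are $$\mathcal{A}_h[\mathbf{v}_1,q_2]([\mathbf{w}_1,r_2])=\int_{\Omega_1}a\,\mathbf{v}_1\cdot\mathbf{w}_1+\int_\Gamma\beta q_2r_2\,dS-\int_\Gamma(\mathbf{v}_1\cdot\widehat{\mathbf{n}})r_2\,dS+\int_\Gamma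 q_2(\mathbf{w}_1\cdot\widehat{\mathbf{n}})\,dS,$$ $$\mathcal{B}_h[\mathbf{v}_1,q_2]([\mathbf{w}_2,r_1])=\int_{\Omega_1}(\nabla\cdot\mathbf{v}_1)r_1+\int_{\Omega_2}\nabla q_2\cdot\mathbf{w}_2,\qquad \mathcal{C}_h[\mathbf{v}_2,q_1]([\mathbf{w}_2,r_1])=\int_{\Omega_2}a\,\mathbf{v}_2\cdot\mathbf{w}_2,$$ and $\mathcal{B}_h':\mathbf{Y}_h\to\mathbf{X}_h'$ is the dual operator of $\mathcal{B}_h$. *)

theory Defs
  imports "HOL-Analysis.Analysis"
begin

section \<open>One-dimensional Hausdorff measure\<close>

text \<open>Boundedness is required explicitly because \<^const>\<open>diameter\<close> is unspecified on
  unbounded sets.\<close>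

definition hausdorff1_delta :: "real \<Rightarrow> 'a::metric_space set \<Rightarrow> ennreal" where
  "hausdorff1_delta \<delta> A =
     (INF B\<in>{B :: nat \<Rightarrow> 'a set. A \<subseteq> (\<Union>i. B i) \<and> (\<forall>i. bounded (B i) \<and> diameter (B i) \<le> \<delta>)}.
        \<Sum>i. ennreal (diameter (B i)))"

definition hausdorff1_outer :: "'a::metric_space set \<Rightarrow> ennreal" where
  "hausdorff1_outer A = (SUP \<delta>\<in>{0<..}. hausdorff1_delta \<delta> A)"

definition hausdorff1 :: "'a::metric_space measure" where
  "hausdorff1 =
     measure_of UNIV (lambda_system UNIV (Pow UNIV) hausdorff1_outer) hausdorff1_outer"

lemma hausdorff1_delta_mono:
  "A \<subseteq> A' \<Longrightarrow> hausdorff1_delta \<delta> A \<le> hausdorff1_delta \<delta> A'"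
  unfolding hausdorff1_delta_def by (rule INF_superset_mono) auto

lemma hausdorff1_delta_empty: "0 < \<delta> \<Longrightarrow> hausdorff1_delta \<delta> {} = 0"
proof -
  assume "0 < \<delta>"
  then have "hausdorff1_delta \<delta> ({} :: 'a set) \<le> (\<Sum>i::nat. ennreal (diameter ({} :: 'a set)))"
    unfolding hausdorff1_delta_def by (intro INF_lower) auto
  then show ?thesis by simp
qed

lemma hausdorff1_delta_subadditive:
  fixes A :: "nat \<Rightarrow> 'a::metric_space set"
  shows "hausdorff1_delta \<delta> (\<Union>n. A n) \<le> (\<Sum>n. hausdorff1_delta \<delta> (A n))"
proof (rule ennreal_le_epsilon)
  fix e :: real
  assume fin: "(\<Sum>n. hausdorff1_delta \<delta> (A n)) < top" and e: "0 < e"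
  define cov where
    "cov n B \<longleftrightarrow> A n \<subseteq> (\<Union>i. B i) \<and> (\<forall>i. bounded (B i) \<and> diameter (B i) \<le> \<delta>)"
    for n and B :: "nat \<Rightarrow> 'a set"
  have "\<exists>B. cov n B \<and>
      (\<Sum>i. ennreal (diameter (B i))) \<le> hausdorff1_delta \<delta> (A n) + ennreal (e * (1/2)^Suc n)" for n
  proof -
    have "hausdorff1_delta \<delta> (A n) \<noteq> top"
      using ennreal_suminf_lessD[OF fin, of n] by simp
    then have "hausdorff1_delta \<delta> (A n) < hausdorff1_delta \<delta> (A n) + ennreal (e * (1/2)^Suc n)"
      using e by (simp add: ennreal_zero_less_mult_iff)
    then show ?thesis
      by (subst (asm) hausdorff1_delta_def) (auto simp: INF_less_iff cov_def intro: less_imp_le)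
  qed
  then obtain B where B: "\<And>n. cov n (B n)"
    "\<And>n. (\<Sum>i. ennreal (diameter (B n i))) \<le> hausdorff1_delta \<delta> (A n) + ennreal (e * (1/2)^Suc n)"
    by metis
  define C where "C k = (case prod_decode k of (n, i) \<Rightarrow> B n i)" for k
  have "(\<Union>n. A n) \<subseteq> (\<Union>k. C k)"
  proof
    fix x assume "x \<in> (\<Union>n. A n)"
    then obtain n i where "x \<in> B n i" using B(1) unfolding cov_def by blast
    then have "x \<in> C (prod_encode (n, i))" by (simp add: C_def)
    then show "x \<in> (\<Union>k. C k)" by blast
  qed
  moreover have "bounded (C k) \<and> diameter (C k) \<le> \<delta>" for k
    using B(1) unfolding cov_def C_def by (auto split: prod.split)
  ultimately have "hausdorff1_delta \<delta> (\<Union>n. A n) \<le> (\<Sum>k. ennreal (diameter (C k)))"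
    unfolding hausdorff1_delta_def by (intro INF_lower) auto
  also have "\<dots> = (\<Sum>n. \<Sum>i. ennreal (diameter (B n i)))"
  proof -
    have "(\<Sum>k. ennreal (diameter (C k)))
        = (\<Sum>k. (\<lambda>(n, i). ennreal (diameter (B n i))) (prod_decode k))"
      by (intro arg_cong[where f = suminf] ext) (simp add: C_def split: prod.split)
    also have "\<dots> = (\<Sum>n. \<Sum>i. ennreal (diameter (B n i)))"
      by (subst suminf_ennreal_2dimen[symmetric, of "\<lambda>n. \<Sum>i. ennreal (diameter (B n i))"
            "\<lambda>(n, i). ennreal (diameter (B n i))"]) (auto simp: comp_def)
    finally show ?thesis .
  qed
  also have "\<dots> \<le> (\<Sum>n. hausdorff1_delta \<delta> (A n) + ennreal (e * (1/2)^Suc n))"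
    by (intro suminf_le B(2)) auto
  also have "\<dots> = (\<Sum>n. hausdorff1_delta \<delta> (A n)) + (\<Sum>n. ennreal (e * (1/2)^Suc n))"
    by (intro suminf_add[symmetric]) auto
  also have "(\<Sum>n. ennreal (e * (1/2)^Suc n)) = ennreal e"
    using e sums_mult[OF power_half_series, of e]
    by (subst suminf_ennreal_eq[of _ e]) (auto simp: mult_ac)
  finally show "hausdorff1_delta \<delta> (\<Union>n. A n) \<le> (\<Sum>n. hausdorff1_delta \<delta> (A n)) + ennreal e" .
qed

lemma outer_measure_space_hausdorff1_outer:
  "outer_measure_space (Pow UNIV) (hausdorff1_outer :: 'a::metric_space set \<Rightarrow> ennreal)"
  unfolding outer_measure_space_def
proof (intro conjI)
  show "positive (Pow UNIV) (hausdorff1_outer :: 'a set \<Rightarrow> ennreal)"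
    by (simp add: positive_def hausdorff1_outer_def hausdorff1_delta_empty)
  show "increasing (Pow UNIV) (hausdorff1_outer :: 'a set \<Rightarrow> ennreal)"
    by (auto simp: increasing_def hausdorff1_outer_def intro!: SUP_mono' hausdorff1_delta_mono)
  show "countably_subadditive (Pow UNIV) (hausdorff1_outer :: 'a set \<Rightarrow> ennreal)"
    unfolding countably_subadditive_def
  proof (intro allI impI)
    fix A :: "nat \<Rightarrow> 'a set"
    show "hausdorff1_outer (\<Union>i. A i) \<le> (\<Sum>i. hausdorff1_outer (A i))"
      unfolding hausdorff1_outer_def[of "\<Union>i. A i"]
    proof (rule SUP_least)
      fix \<delta> :: real assume "\<delta> \<in> {0<..}"
      then have "hausdorff1_delta \<delta> (A i) \<le> hausdorff1_outer (A i)" for i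
        unfolding hausdorff1_outer_def by (rule SUP_upper)
      then have "(\<Sum>i. hausdorff1_delta \<delta> (A i)) \<le> (\<Sum>i. hausdorff1_outer (A i))"
        by (intro suminf_le) auto
      with hausdorff1_delta_subadditive[of \<delta> A]
      show "hausdorff1_delta \<delta> (\<Union>i. A i) \<le> (\<Sum>i. hausdorff1_outer (A i))"
        by (rule order_trans)
    qed
  qed
qed

lemma emeasure_hausdorff1:
  assumes "A \<in> lambda_system UNIV (Pow UNIV) hausdorff1_outer"
  shows "emeasure hausdorff1 A = hausdorff1_outer A"
  using sigma_algebra.caratheodory_lemma[OF sigma_algebra_Pow outer_measure_space_hausdorff1_outer]
    assms
  unfolding hausdorff1_def by (intro emeasure_measure_of_sigma) (auto simp: measure_space_def)


section \<open>Geometry\<close>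

type_synonym plane = "real^2"

text \<open>The condition that the set is the interior of its closure excludes slits: almost every
  boundary point has the polygon on exactly one side. Holes are allowed.\<close>

definition polygon :: "plane set \<Rightarrow> bool" where
  "polygon P \<longleftrightarrow> open P \<and> connected P \<and> bounded P \<and> P \<noteq> {} \<and> interior (closure P) = P \<and>
     (\<exists>S. finite S \<and> frontier P = (\<Union>(p, q)\<in>S. closed_segment p q))"

definition bipartite_map :: "plane set \<Rightarrow> plane set set \<Rightarrow> plane set set \<Rightarrow> bool" where
  "bipartite_map \<Omega> G1 G2 \<longleftrightarrow>
     finite (G1 \<union> G2) \<and> G1 \<inter> G2 = {} \<and> disjoint (G1 \<union> G2) \<and>
     (\<forall>G\<in>G1 \<union> G2. open G \<and> connected G \<and> G \<subseteq> \<Omega>) \<and>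
     negligible (\<Omega> - \<Union>(G1 \<union> G2)) \<and> closure \<Omega> = \<Union>(closure ` (G1 \<union> G2)) \<and>
     (\<forall>\<C>\<in>{G1, G2}. \<forall>G\<in>\<C>. \<forall>G'\<in>\<C>. G \<noteq> G' \<longrightarrow> frontier G \<inter> frontier G' \<in> null_sets hausdorff1)"

definition geometric_assumptions :: "plane set set \<Rightarrow> plane set set \<Rightarrow> bool" where
  "geometric_assumptions G1 G2 \<longleftrightarrow>
     (\<forall>G\<in>G1 \<union> G2. polygon G) \<and> connected (closure (\<Union>G1)) \<and> connected (closure (\<Union>G2))"

definition interface :: "plane set \<Rightarrow> plane set set \<Rightarrow> plane set set \<Rightarrow> plane set" where
  "interface \<Omega> G1 G2 = \<Union>(frontier ` (G1 \<union> G2)) - frontier \<Omega>"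

definition surface_measure :: "plane set \<Rightarrow> plane measure" where
  "surface_measure \<Gamma> = restrict_space hausdorff1 \<Gamma>"

text \<open>For a polygonal set, characterised near a boundary point that is not a vertex, where
  the set is locally an open half-disc.\<close>

definition outer_normal :: "plane set \<Rightarrow> plane \<Rightarrow> plane" where
  "outer_normal U x =
     (THE n. norm n = 1 \<and> (\<exists>r>0. U \<inter> ball x r = {y \<in> ball x r. (y - x) \<bullet> n < 0}))"

text \<open>Conforming triangulations by open triangles.\<close>

definition triangulation_of :: "plane set \<Rightarrow> plane set set \<Rightarrow> bool" where
  "triangulation_of \<Omega> \<T> \<longleftrightarrow>
     (\<forall>K\<in>\<T>. \<exists>S. 2 simplex S \<and> K = interior S) \<and>
     triangulation (closure ` \<T>) \<and> \<Union>(closure ` \<T>) = closure \<Omega>"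

definition consistent_with :: "plane set set \<Rightarrow> plane set set \<Rightarrow> plane set set \<Rightarrow> bool" where
  "consistent_with \<T> G1 G2 \<longleftrightarrow> (\<forall>K\<in>\<T>. K \<inter> \<Union>G1 = {} \<or> K \<inter> \<Union>G2 = {})"


section \<open>Function spaces\<close>

text \<open>Elements of function spaces are represented by functions on the whole plane, to be
  read modulo equality almost everywhere on the domain; values off the domain are irrelevant.\<close>

definition L2 :: "plane set \<Rightarrow> (plane \<Rightarrow> 'b::euclidean_space) set" where
  "L2 U = {f \<in> borel_measurable (lebesgue_on U). integrable (lebesgue_on U) (\<lambda>x. (norm (f x))\<^sup>2)}"

definition L2_norm :: "plane set \<Rightarrow> (plane \<Rightarrow> 'b::euclidean_space) \<Rightarrow> real" where
  "L2_norm U f = sqrt (LINT x|lebesgue_on U. (norm (f x))\<^sup>2)"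

definition Linf :: "'a measure \<Rightarrow> ('a \<Rightarrow> real) set" where
  "Linf M = {f \<in> borel_measurable M. \<exists>C. AE x in M. \<bar>f x\<bar> \<le> C}"

text \<open>\<open>D i j\<close> is the partial derivative of order \<open>i\<close> in the first and \<open>j\<close> in the second
  variable.\<close>

definition smooth :: "(plane \<Rightarrow> real) \<Rightarrow> bool" where
  "smooth \<phi> \<longleftrightarrow> (\<exists>D :: nat \<Rightarrow> nat \<Rightarrow> plane \<Rightarrow> real. D 0 0 = \<phi> \<and>
     (\<forall>i j x. (D i j has_derivative (\<lambda>h. D (Suc i) j x * h$1 + D i (Suc j) x * h$2)) (at x)))"

definition test_functions :: "plane set \<Rightarrow> (plane \<Rightarrow> real) set" where
  "test_functions U =
     {\<phi>. smooth \<phi> \<and> compact (closure {x. \<phi> x \<noteq> 0}) \<and> closure {x. \<phi> x \<noteq> 0} \<subseteq> U}"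

definition gradient :: "(plane \<Rightarrow> real) \<Rightarrow> plane \<Rightarrow> plane" where
  "gradient \<phi> x = (\<chi> i. frechet_derivative \<phi> (at x) (axis i 1))"

definition is_weak_grad :: "plane set \<Rightarrow> (plane \<Rightarrow> real) \<Rightarrow> (plane \<Rightarrow> plane) \<Rightarrow> bool" where
  "is_weak_grad U q g \<longleftrightarrow> (\<forall>\<phi>\<in>test_functions U.
     (LINT x|lebesgue_on U. q x *\<^sub>R gradient \<phi> x) = - (LINT x|lebesgue_on U. \<phi> x *\<^sub>R g x))"

definition is_weak_div :: "plane set \<Rightarrow> (plane \<Rightarrow> plane) \<Rightarrow> (plane \<Rightarrow> real) \<Rightarrow> bool" where
  "is_weak_div U v d \<longleftrightarrow> (\<forall>\<phi>\<in>test_functions U.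
     (LINT x|lebesgue_on U. v x \<bullet> gradient \<phi> x) = - (LINT x|lebesgue_on U. \<phi> x * d x))"

definition H1 :: "plane set \<Rightarrow> (plane \<Rightarrow> real) set" where
  "H1 U = {q \<in> L2 U. \<exists>g\<in>L2 U. is_weak_grad U q g}"

definition Hdiv :: "plane set \<Rightarrow> (plane \<Rightarrow> plane) set" where
  "Hdiv U = {v \<in> L2 U. \<exists>d\<in>L2 U. is_weak_div U v d}"

text \<open>Weak derivatives are unique up to null sets; any representative serves.\<close>

definition weak_grad :: "plane set \<Rightarrow> (plane \<Rightarrow> real) \<Rightarrow> plane \<Rightarrow> plane" where
  "weak_grad U q = (SOME g. g \<in> L2 U \<and> is_weak_grad U q g)"

definition weak_div :: "plane set \<Rightarrow> (plane \<Rightarrow> plane) \<Rightarrow> plane \<Rightarrow> real" where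
  "weak_div U v = (SOME d. d \<in> L2 U \<and> is_weak_div U v d)"

text \<open>The boundary trace as the limit of averages over \<open>U \<inter> ball x r\<close>. It does not depend on
  the representative; it equals the Sobolev trace almost everywhere on the polygonal boundary
  for functions in \<^term>\<open>H1 U\<close>, and the one-sided limit wherever that exists,
  in particular for piecewise polynomials off the vertices of the mesh.\<close>

definition boundary_trace ::
  "plane set \<Rightarrow> (plane \<Rightarrow> 'b::euclidean_space) \<Rightarrow> plane \<Rightarrow> 'b" where
  "boundary_trace U f x = Lim (at_right 0)
     (\<lambda>r. (LINT y|lebesgue_on (U \<inter> ball x r). f y) /\<^sub>R measure lebesgue (U \<inter> ball x r))"


section \<open>Discrete spaces and dual spaces\<close>

definition RT0 :: "plane set set \<Rightarrow> plane set \<Rightarrow> (plane \<Rightarrow> plane) set" where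
  "RT0 \<T> \<Omega>1 = {v \<in> Hdiv \<Omega>1.
     \<forall>K\<in>\<T>. K \<subseteq> \<Omega>1 \<longrightarrow> (\<exists>b c. AE x in lebesgue_on K. v x = b + c *\<^sub>R x)}"

definition Q2 :: "plane set set \<Rightarrow> plane set \<Rightarrow> plane set \<Rightarrow> (plane \<Rightarrow> real) set" where
  "Q2 \<T> \<Omega> \<Omega>2 = {q \<in> H1 \<Omega>2. (\<exists>\<xi>\<in>H1 \<Omega>. AE x in lebesgue_on \<Omega>2. q x = \<xi> x) \<and>
     (\<forall>K\<in>\<T>. K \<subseteq> \<Omega>2 \<longrightarrow> (\<exists>c b. AE x in lebesgue_on K. q x = c + b \<bullet> x))}"

definition grad_Q2 :: "plane set set \<Rightarrow> plane set \<Rightarrow> plane set \<Rightarrow> (plane \<Rightarrow> plane) set" where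
  "grad_Q2 \<T> \<Omega> \<Omega>2 = {g \<in> L2 \<Omega>2. \<exists>q\<in>Q2 \<T> \<Omega> \<Omega>2. is_weak_grad \<Omega>2 q g}"

definition Q1 :: "plane set set \<Rightarrow> plane set \<Rightarrow> (plane \<Rightarrow> real) set" where
  "Q1 \<T> \<Omega>1 = {q \<in> L2 \<Omega>1.
     \<forall>K\<in>\<T>. K \<subseteq> \<Omega>1 \<longrightarrow> (\<exists>c. AE x in lebesgue_on K. q x = c)}"

type_synonym field_pair = "(plane \<Rightarrow> plane) \<times> (plane \<Rightarrow> real)"

definition X_space :: "plane set set \<Rightarrow> plane set \<Rightarrow> plane set \<Rightarrow> plane set \<Rightarrow> field_pair set" where
  "X_space \<T> \<Omega> \<Omega>1 \<Omega>2 = RT0 \<T> \<Omega>1 \<times> Q2 \<T> \<Omega> \<Omega>2"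

definition Y_space :: "plane set set \<Rightarrow> plane set \<Rightarrow> plane set \<Rightarrow> plane set \<Rightarrow> field_pair set" where
  "Y_space \<T> \<Omega> \<Omega>1 \<Omega>2 = grad_Q2 \<T> \<Omega> \<Omega>2 \<times> Q1 \<T> \<Omega>1"

definition X_norm :: "plane set \<Rightarrow> plane set \<Rightarrow> field_pair \<Rightarrow> real" where
  "X_norm \<Omega>1 \<Omega>2 = (\<lambda>(v1, q2). sqrt
     (((L2_norm \<Omega>1 v1)\<^sup>2 + (L2_norm \<Omega>1 (weak_div \<Omega>1 v1))\<^sup>2) +
      ((L2_norm \<Omega>2 q2)\<^sup>2 + (L2_norm \<Omega>2 (weak_grad \<Omega>2 q2))\<^sup>2)))"

definition Y_norm :: "plane set \<Rightarrow> plane set \<Rightarrow> field_pair \<Rightarrow> real" where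
  "Y_norm \<Omega>1 \<Omega>2 = (\<lambda>(v2, q1). sqrt ((L2_norm \<Omega>2 v2)\<^sup>2 + (L2_norm \<Omega>1 q1)\<^sup>2))"

text \<open>Equality in the first component almost everywhere on \<open>U\<close>, in the second almost
  everywhere on \<open>V\<close>.\<close>

definition ae_eq :: "plane set \<Rightarrow> plane set \<Rightarrow> field_pair \<Rightarrow> field_pair \<Rightarrow> bool" where
  "ae_eq U V x y \<longleftrightarrow> (AE t in lebesgue_on U. fst x t = fst y t) \<and>
     (AE t in lebesgue_on V. snd x t = snd y t)"

text \<open>Bounded linear functionals. Boundedness makes them compatible with equality almost
  everywhere.\<close>

definition dual_space ::
  "field_pair set \<Rightarrow> (field_pair \<Rightarrow> real) \<Rightarrow> (field_pair \<Rightarrow> real) set" where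
  "dual_space Z N = {F.
     (\<forall>(v, q)\<in>Z. \<forall>(w, r)\<in>Z. \<forall>c d.
        F (\<lambda>t. c *\<^sub>R v t + d *\<^sub>R w t, \<lambda>t. c * q t + d * r t) = c * F (v, q) + d * F (w, r)) \<and>
     (\<exists>C. \<forall>z\<in>Z. \<bar>F z\<bar> \<le> C * N z)}"

definition dual_norm ::
  "field_pair set \<Rightarrow> (field_pair \<Rightarrow> real) \<Rightarrow> (field_pair \<Rightarrow> real) \<Rightarrow> real" where
  "dual_norm Z N F = (SUP z\<in>{z \<in> Z. N z \<le> 1}. \<bar>F z\<bar>)"


section \<open>The discrete operators\<close>

definition A_op :: "plane set \<Rightarrow> plane set \<Rightarrow> plane set \<Rightarrow> (plane \<Rightarrow> real) \<Rightarrow> (plane \<Rightarrow> real) \<Rightarrow>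
    field_pair \<Rightarrow> field_pair \<Rightarrow> real" where
  "A_op \<Omega>1 \<Omega>2 \<Gamma> a \<beta> = (\<lambda>(v1, q2) (w1, r2).
     (LINT x|lebesgue_on \<Omega>1. a x * (v1 x \<bullet> w1 x)) +
     (LINT s|surface_measure \<Gamma>. \<beta> s * boundary_trace \<Omega>2 q2 s * boundary_trace \<Omega>2 r2 s) -
     (LINT s|surface_measure \<Gamma>.
        (boundary_trace \<Omega>1 v1 s \<bullet> outer_normal \<Omega>1 s) * boundary_trace \<Omega>2 r2 s) +
     (LINT s|surface_measure \<Gamma>.
        boundary_trace \<Omega>2 q2 s * (boundary_trace \<Omega>1 w1 s \<bullet> outer_normal \<Omega>1 s)))"

definition B_op :: "plane set \<Rightarrow> plane set \<Rightarrow> field_pair \<Rightarrow> field_pair \<Rightarrow> real" where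
  "B_op \<Omega>1 \<Omega>2 = (\<lambda>(v1, q2) (w2, r1).
     (LINT x|lebesgue_on \<Omega>1. weak_div \<Omega>1 v1 x * r1 x) +
     (LINT x|lebesgue_on \<Omega>2. weak_grad \<Omega>2 q2 x \<bullet> w2 x))"

definition C_op :: "plane set \<Rightarrow> (plane \<Rightarrow> real) \<Rightarrow> field_pair \<Rightarrow> field_pair \<Rightarrow> real" where
  "C_op \<Omega>2 a = (\<lambda>(v2, q1) (w2, r1). (LINT x|lebesgue_on \<Omega>2. a x * (v2 x \<bullet> w2 x)))"

definition dual_op :: "(field_pair \<Rightarrow> field_pair \<Rightarrow> real) \<Rightarrow> field_pair \<Rightarrow> field_pair \<Rightarrow> real" where
  "dual_op B y x = B x y"

definition discrete_solution ::
  "plane set set \<Rightarrow> plane set \<Rightarrow> plane set set \<Rightarrow> plane set set \<Rightarrow>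
   (plane \<Rightarrow> real) \<Rightarrow> (plane \<Rightarrow> real) \<Rightarrow> (field_pair \<Rightarrow> real) \<Rightarrow> (field_pair \<Rightarrow> real) \<Rightarrow>
   field_pair \<Rightarrow> field_pair \<Rightarrow> bool" where
  "discrete_solution \<T> \<Omega> G1 G2 a \<beta> F1 F2 x y \<longleftrightarrow>
     (let \<Omega>1 = \<Union>G1; \<Omega>2 = \<Union>G2; \<Gamma> = interface \<Omega> G1 G2;
          X = X_space \<T> \<Omega> \<Omega>1 \<Omega>2; Y = Y_space \<T> \<Omega> \<Omega>1 \<Omega>2;
          A = A_op \<Omega>1 \<Omega>2 \<Gamma> a \<beta>; B = B_op \<Omega>1 \<Omega>2; C = C_op \<Omega>2 a
      in x \<in> X \<and> y \<in> Y \<and>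
         (\<forall>z\<in>X. A x z + dual_op B y z = F1 z) \<and>
         (\<forall>z\<in>Y. - B x z + C y z = F2 z))"

end

theory Submission
  imports Defs
begin

text \<open>The discrete problem is a square system: after the two equations are added, it asks for
  \<open>z \<in> X \<times> Y\<close> with \<open>mixed_form z w = F1 (fst w) + F2 (snd w)\<close> for all \<open>w \<in> X \<times> Y\<close>, where
  \<open>mixed_form = energy + coupling\<close> is the sum of a symmetric positive semidefinite form and an
  antisymmetric one. Up to null sets, an element of \<open>X \<times> Y\<close> is given by finitely many
  numbers, the coefficients of its four components on the triangles. In finite dimension,
  existence, uniqueness and a bound by the data all follow once the form has trivial kernel on
  both sides (locale \<open>finite_bilinear\<close>). Transposing the form changes only the sign of \<open>coupling\<close>,
  so that one argument, carried out for both signs, treats both kernels (\<open>kernel_trivial\<close>).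

  Let \<open>z\<close>, with components \<open>v1, q2, v2, q1\<close>, lie in the kernel. Testing with \<open>z\<close> itself
  kills the antisymmetric part and leaves \<open>\<integral> a \<bar>v1\<bar>\<^sup>2 + \<integral> a \<bar>v2\<bar>\<^sup>2 + \<integral> \<beta> q2\<^sup>2 = 0\<close>, so \<open>v1\<close> and \<open>v2\<close>
  vanish, and \<open>q2\<close> vanishes on the part of the interface where \<open>\<beta>\<close> is positive. Testing with
  \<open>\<nabla> q2\<close> in the third component gives \<open>\<nabla> q2 = 0\<close>. What remains is
  \<open>\<integral>\<^sub>\<Gamma> q2 (v \<cdot> n) + \<integral>\<^sub>\<Omega>\<^sub>1 (\<nabla> \<cdot> v) q1 = 0\<close> for every Raviart-Thomas field \<open>v\<close> on the first
  subdomain, and both \<open>q2\<close> and \<open>q1\<close> are constant on each triangle. These constants vanish on at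
  least one triangle, because \<open>\<beta>\<close> is not zero almost everywhere, and their vanishing passes from
  a triangle to its neighbour across an edge (\<open>vanish_across_edge\<close>):

  \<^item> inside the second subdomain, a jump of \<open>q2\<close> across the edge would contribute to its weak
    gradient;
  \<^item> inside the first subdomain, the field equal to a multiple of \<open>x - P\<close> on either side of the
    edge, with \<open>P\<close> the opposite vertex, scaled to match the fluxes, tests the difference of the
    two values of \<open>q1\<close>;
  \<^item> across the interface, the field \<open>x - P\<close> supported on the triangle in the first subdomain
    relates the value of \<open>q1\<close> there to the value of \<open>q2\<close> on the other side.

  Since \<open>\<Omega>\<close> without the finitely many vertices is connected, every triangle is reached
  (\<open>edge_connected\<close>).

  Much of the text provides what this argument presupposes. The one-dimensional Hausdorff measure
  is a Borel measure for which segments have positive and finite length. Every triangle lies in a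
  single region, and away from the vertices the mesh looks like two half-discs along an edge, so
  that normals and traces on the interface are given pointwise by the polynomial on the adjacent
  triangle. The divergence theorem is needed only for the field \<open>(x - P) \<psi> x\<close> on a triangle, where
  it reduces to the fundamental theorem of calculus (\<open>flux_through_opposite_edge\<close>).\<close>

section \<open>One-dimensional Hausdorff measure\<close>

lemma hausdorff1_outer_mono: "A \<subseteq> B \<Longrightarrow> hausdorff1_outer A \<le> hausdorff1_outer B"
  unfolding hausdorff1_outer_def by (intro SUP_mono' hausdorff1_delta_mono)

lemma hausdorff1_outer_empty: "hausdorff1_outer {} = 0"
  by (simp add: hausdorff1_outer_def hausdorff1_delta_empty)

lemma hausdorff1_outer_subadditive:
  "hausdorff1_outer (\<Union>n::nat. A n) \<le> (\<Sum>n. hausdorff1_outer (A n))"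
  unfolding hausdorff1_outer_def[of "\<Union>n. A n"]
proof (rule SUP_least)
  fix \<delta> :: real assume \<delta>: "\<delta> \<in> {0<..}"
  have "(\<Sum>n. hausdorff1_delta \<delta> (A n)) \<le> (\<Sum>n. hausdorff1_outer (A n))"
    unfolding hausdorff1_outer_def by (intro suminf_le SUP_upper \<delta>) auto
  with hausdorff1_delta_subadditive[of \<delta> A]
  show "hausdorff1_delta \<delta> (\<Union>n. A n) \<le> (\<Sum>n. hausdorff1_outer (A n))"
    by (rule order_trans)
qed

lemma hausdorff1_outer_Un: "hausdorff1_outer (A \<union> B) \<le> hausdorff1_outer A + hausdorff1_outer B"
proof -
  have "hausdorff1_outer (\<Union>n. binaryset A B n) \<le> (\<Sum>n. hausdorff1_outer (binaryset A B n))"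
    by (rule hausdorff1_outer_subadditive)
  also have "\<dots> = hausdorff1_outer A + hausdorff1_outer B"
    by (rule suminf_binaryset_eq) (rule hausdorff1_outer_empty)
  finally show ?thesis by (simp add: UN_binaryset_eq)
qed

lemma hausdorff1_delta_antimono: "\<delta> \<le> \<delta>' \<Longrightarrow> hausdorff1_delta \<delta>' A \<le> hausdorff1_delta \<delta> A"
  unfolding hausdorff1_delta_def by (rule INF_superset_mono) (auto intro: order_trans)

text \<open>A covering set of diameter at most \<open>\<delta>\<close> that meets \<open>A\<close> cannot
  meet \<open>B\<close>, so that a cover of the union splits into a cover of \<open>A\<close>
  and one of \<open>B\<close>.\<close>

lemma hausdorff1_delta_separated:
  assumes sep: "\<And>x y. x \<in> A \<Longrightarrow> y \<in> B \<Longrightarrow> \<delta> < dist x y"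
  shows "hausdorff1_delta \<delta> A + hausdorff1_delta \<delta> B \<le> hausdorff1_delta \<delta> (A \<union> B)"
  unfolding hausdorff1_delta_def[of \<delta> "A \<union> B"]
proof (rule INF_greatest, clarify)
  fix C :: "nat \<Rightarrow> 'a set"
  assume cov: "A \<union> B \<subseteq> (\<Union>i. C i)" and C: "\<forall>i. bounded (C i) \<and> diameter (C i) \<le> \<delta>"
  define CA where "CA i = (if C i \<inter> A = {} then {} else C i)" for i
  define CB where "CB i = (if C i \<inter> A = {} then C i else {})" for i
  have \<delta>: "0 \<le> \<delta>" using C by (meson diameter_ge_0 order_trans)
  have "A \<subseteq> (\<Union>i. CA i)" using cov by (fastforce simp: CA_def)
  then have 1: "hausdorff1_delta \<delta> A \<le> (\<Sum>i. ennreal (diameter (CA i)))"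
    unfolding hausdorff1_delta_def by (intro INF_lower) (use C \<delta> in \<open>auto simp: CA_def\<close>)
  have "B \<subseteq> (\<Union>i. CB i)"
  proof
    fix y assume y: "y \<in> B"
    then obtain i where i: "y \<in> C i" using cov by blast
    have "C i \<inter> A = {}"
    proof (rule ccontr)
      assume "C i \<inter> A \<noteq> {}"
      then obtain x where x: "x \<in> C i" "x \<in> A" by blast
      have "dist x y \<le> diameter (C i)" using C x i by (intro diameter_bounded_bound) auto
      then show False using sep[OF x(2) y] C by (meson not_less order_trans)
    qed
    then show "y \<in> (\<Union>i. CB i)" using i by (auto simp: CB_def)
  qed
  then have 2: "hausdorff1_delta \<delta> B \<le> (\<Sum>i. ennreal (diameter (CB i)))"
    unfolding hausdorff1_delta_def by (intro INF_lower) (use C \<delta> in \<open>auto simp: CB_def\<close>)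
  have "(\<Sum>i. ennreal (diameter (CA i))) + (\<Sum>i. ennreal (diameter (CB i)))
      = (\<Sum>i. ennreal (diameter (C i)))"
    by (subst suminf_add) (auto simp: CA_def CB_def intro!: suminf_cong)
  with add_mono[OF 1 2]
  show "hausdorff1_delta \<delta> A + hausdorff1_delta \<delta> B \<le> (\<Sum>i. ennreal (diameter (C i)))" by simp
qed

lemma hausdorff1_outer_separated:
  assumes sep: "\<And>x y. x \<in> A \<Longrightarrow> y \<in> B \<Longrightarrow> e \<le> dist x y" and "0 < e"
  shows "hausdorff1_outer A + hausdorff1_outer B \<le> hausdorff1_outer (A \<union> B)"
proof -
  have le: "hausdorff1_delta d A + hausdorff1_delta d' B \<le> hausdorff1_outer (A \<union> B)"
    if "0 < d" "0 < d'" for d d'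
  proof -
    define m where "m = min (min d d') (e / 2)"
    have m: "0 < m" "m \<le> d" "m \<le> d'" "m < e" using that \<open>0 < e\<close> by (auto simp: m_def)
    have "hausdorff1_delta d A + hausdorff1_delta d' B \<le> hausdorff1_delta m A + hausdorff1_delta m B"
      using m by (intro add_mono hausdorff1_delta_antimono)
    also have "\<dots> \<le> hausdorff1_delta m (A \<union> B)"
      using sep m by (intro hausdorff1_delta_separated) (meson less_le_trans)
    also have "\<dots> \<le> hausdorff1_outer (A \<union> B)"
      unfolding hausdorff1_outer_def using m by (intro SUP_upper) auto
    finally show ?thesis .
  qed
  have ne: "{0::real<..} \<noteq> {}" by simp
  have "hausdorff1_delta d A + hausdorff1_outer B \<le> hausdorff1_outer (A \<union> B)" if "0 < d" for d
    unfolding hausdorff1_outer_def[of B] ennreal_SUP_add_right[OF ne]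
    using le that by (auto intro!: SUP_least)
  then show ?thesis
    unfolding hausdorff1_outer_def[of A] ennreal_SUP_add_left[OF ne, symmetric]
    by (auto intro!: SUP_least)
qed

text \<open>Caratheodory's criterion for metric outer measures. A set \<open>T\<close> is cut into its part
  in the sublevel set, the part where \<open>f\<close> is large, and thin layers in between.
  Layers whose indices have the same parity are a positive distance apart, so that their
  measures add up to at most that of \<open>T\<close>. Hence the series over all layers
  converges, and its tail, which bounds the defect of additivity, is arbitrarily small.\<close>

lemma sublevel_in_lambda_system:
  fixes f :: "'a::metric_space \<Rightarrow> real"
  assumes lip: "\<And>x y. \<bar>f x - f y\<bar> \<le> dist x y"
  shows "{x. f x \<le> 0} \<in> lambda_system UNIV (Pow UNIV) hausdorff1_outer"
proof -
  let ?H = "hausdorff1_outer :: 'a set \<Rightarrow> ennreal"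
  let ?L = "{x. f x \<le> 0}"
  have le: "?H (T \<inter> ?L) + ?H (T - ?L) \<le> ?H T" if fin: "?H T \<noteq> top" for T
  proof -
    define t where "t k = 1 / (real k + 1)" for k
    have t_pos: "0 < t k" for k by (simp add: t_def)
    have t_less: "t l < t k" if "k < l" for k l using that by (simp add: t_def field_simps)
    have t_le: "t l \<le> t k" if "k \<le> l" for k l using that by (simp add: t_def field_simps)
    have far: "e \<le> dist x y" if "b + e \<le> f x" "f y \<le> b" for x y b e
      using lip[of x y] that by linarith
    (* The layer of points of T where f lies between two consecutive levels t. *)
    define R where "R k = {x \<in> T. t (Suc k) \<le> f x \<and> f x < t k}" for k
    have part: "(\<Sum>j<N. ?H (R (2 * j + m))) \<le> ?H (\<Union>j<N. R (2 * j + m))" for N m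
    proof (induction N)
      case (Suc N)
      have sub: "t (2 * N + m - 1) \<le> f x" if "x \<in> (\<Union>j<N. R (2 * j + m))" for x
      proof -
        from that obtain j where "j < N" "t (Suc (2 * j + m)) \<le> f x" by (auto simp: R_def)
        moreover then have "t (2 * N + m - 1) \<le> t (Suc (2 * j + m))" by (intro t_le) linarith
        ultimately show ?thesis by linarith
      qed
      have "?H (\<Union>j<N. R (2 * j + m)) + ?H (R (2 * N + m))
        \<le> ?H ((\<Union>j<N. R (2 * j + m)) \<union> R (2 * N + m))"
      proof (cases "N = 0")
        case False
        show ?thesis
        proof (rule hausdorff1_outer_separated)
          show "0 < t (2 * N + m - 1) - t (2 * N + m)" using t_less False by simp
          fix x y assume x: "x \<in> (\<Union>j<N. R (2 * j + m))" and y: "y \<in> R (2 * N + m)"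
          show "t (2 * N + m - 1) - t (2 * N + m) \<le> dist x y"
            using sub[OF x] y by (intro far[of "t (2 * N + m)"]) (auto simp: R_def)
        qed
      qed (simp add: hausdorff1_outer_empty)
      also have "(\<Union>j<N. R (2 * j + m)) \<union> R (2 * N + m) = (\<Union>j<Suc N. R (2 * j + m))"
        by (auto simp: lessThan_Suc)
      finally show ?case
        unfolding sum.lessThan_Suc by (rule order_trans[OF add_right_mono[OF Suc]])
    qed (simp add: hausdorff1_outer_empty)
    have half: "(\<Sum>j. ?H (R (2 * j + m))) \<le> ?H T" for m
    proof (rule suminf_le_const)
      show "(\<Sum>j<N. ?H (R (2 * j + m))) \<le> ?H T" for N
        by (rule order_trans[OF part hausdorff1_outer_mono]) (auto simp: R_def)
    qed simp
    have RT: "?H (R k) \<noteq> top" for k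
      using hausdorff1_outer_mono[of "R k" T] fin by (auto simp: R_def top_unique)
    define g where "g k = enn2real (?H (R k))" for k
    have g: "?H (R k) = ennreal (g k)" "0 \<le> g k" for k
      using RT by (simp_all add: g_def ennreal_enn2real_if)
    have summ: "summable (\<lambda>j. g (2 * j + m))" for m
      by (rule summable_suminf_not_top) (use half[of m] fin g in \<open>auto simp: top_unique\<close>)
    have "summable g"
    proof (rule summableI_nonneg_bounded)
      fix n
      have "(\<Sum>k<n. g k) \<le> (\<Sum>k<2*n. g k)" by (rule sum_mono2) (auto simp: g)
      also have "\<dots> = (\<Sum>j<n. g (2 * j + 0)) + (\<Sum>j<n. g (2 * j + 1))"
        by (induction n) (auto simp: numeral_2_eq_2)
      also have "\<dots> \<le> (\<Sum>j. g (2 * j + 0)) + (\<Sum>j. g (2 * j + 1))"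
        using summ[of 0] summ[of 1] by (intro add_mono sum_le_suminf) (auto simp: g)
      finally show "(\<Sum>k<n. g k) \<le> (\<Sum>j. g (2 * j + 0)) + (\<Sum>j. g (2 * j + 1))" .
    qed (rule g)
    show ?thesis
    proof (rule ennreal_le_epsilon)
      fix e :: real assume "0 < e"
      then obtain N where N: "\<And>n. N \<le> n \<Longrightarrow> norm (\<Sum>i. g (i + n)) < e"
        using suminf_exist_split[OF _ \<open>summable g\<close>] by blast
      define D where "D = {x \<in> T. t N \<le> f x}"
      have tail: "(\<Sum>i. ?H (R (i + N))) \<le> ennreal e"
        unfolding g using N[of N] \<open>summable g\<close> g
        by (subst suminf_ennreal2) (auto simp: summable_iff_shift intro!: ennreal_leI)
      have "T - ?L \<subseteq> D \<union> (\<Union>i. R (i + N))"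
      proof
        fix x assume x: "x \<in> T - ?L"
        show "x \<in> D \<union> (\<Union>i. R (i + N))"
        proof (cases "t N \<le> f x")
          case False
          have "\<exists>k. t k \<le> f x"
          proof -
            obtain k where "inverse (real (Suc k)) < f x"
              using reals_Archimedean[of "f x"] x by auto
            then have "t k \<le> f x" by (simp add: t_def inverse_eq_divide add.commute)
            then show ?thesis ..
          qed
          then have lk: "t (LEAST k. t k \<le> f x) \<le> f x" by (rule LeastI_ex)
          define k where "k = (LEAST k. t k \<le> f x)"
          have "\<not> k \<le> N" using lk False t_le[of k N] by (auto simp: k_def)
          then have "N < k" by simp
          then have k: "k = Suc (k - 1)" "k - 1 = (k - 1 - N) + N" by auto
          have "k - 1 < k" using \<open>N < k\<close> by simp
          from not_less_Least[OF this[unfolded k_def]] have "f x < t (k - 1)"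
            by (simp add: k_def)
          then have "x \<in> R (k - 1)" using lk k(1) x by (simp add: R_def k_def)
          then show ?thesis using k(2) by auto
        qed (use x in \<open>auto simp: D_def\<close>)
      qed
      then have "?H (T - ?L) \<le> ?H D + ?H (\<Union>i. R (i + N))"
        by (meson hausdorff1_outer_mono hausdorff1_outer_Un order_trans)
      also have "\<dots> \<le> ?H D + ennreal e"
        using hausdorff1_outer_subadditive[of "\<lambda>i. R (i + N)"] tail
        by (intro add_left_mono) (rule order_trans)
      finally have 1: "?H (T - ?L) \<le> ?H D + ennreal e" .
      have "?H (T \<inter> ?L) + ?H D = ?H D + ?H (T \<inter> ?L)" by (rule add.commute)
      also have "\<dots> \<le> ?H (D \<union> T \<inter> ?L)"
        by (rule hausdorff1_outer_separated[of _ _ "t N"]) (auto simp: D_def t_pos intro!: far[of 0])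
      also have "\<dots> \<le> ?H T" by (rule hausdorff1_outer_mono) (auto simp: D_def)
      finally have "?H (T \<inter> ?L) + ?H D \<le> ?H T" .
      then show "?H (T \<inter> ?L) + ?H (T - ?L) \<le> ?H T + ennreal e"
        using order_trans[OF add_left_mono[OF 1, of "?H (T \<inter> ?L)"]] add_right_mono[of _ "?H T" "ennreal e"]
        by (simp add: add.assoc[symmetric])
    qed
  qed
  have "?H (?L \<inter> T) + ?H ((UNIV - ?L) \<inter> T) = ?H T" for T
  proof (rule antisym)
    have eq: "?L \<inter> T = T \<inter> ?L" "(UNIV - ?L) \<inter> T = T - ?L" by auto
    show "?H (?L \<inter> T) + ?H ((UNIV - ?L) \<inter> T) \<le> ?H T"
      unfolding eq using le[of T] by (cases "?H T = top") auto
    show "?H T \<le> ?H (?L \<inter> T) + ?H ((UNIV - ?L) \<inter> T)"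
      using hausdorff1_outer_Un[of "?L \<inter> T" "(UNIV - ?L) \<inter> T"]
      by (simp add: Int_Un_distrib2[symmetric])
  qed
  then show ?thesis by (simp add: lambda_system_def)
qed

lemma space_hausdorff1 [simp]: "space hausdorff1 = UNIV"
  by (simp add: hausdorff1_def)

lemma sigma_algebra_lambda_system:
  "sigma_algebra UNIV (lambda_system UNIV (Pow UNIV) (hausdorff1_outer :: 'a::metric_space set \<Rightarrow> _))"
  by (rule conjunct1[OF sigma_algebra.caratheodory_lemma[OF sigma_algebra_Pow
        outer_measure_space_hausdorff1_outer, unfolded measure_space_def]])

lemma sets_hausdorff1:
  "sets hausdorff1 = lambda_system UNIV (Pow UNIV) (hausdorff1_outer :: 'a::metric_space set \<Rightarrow> _)"
  using sigma_algebra.sets_measure_of_eq[OF sigma_algebra_lambda_system]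
  by (simp add: hausdorff1_def)

text \<open>A closed set is the zero sublevel set of the distance to it.\<close>

lemma borel_subset_hausdorff1: "sets borel \<subseteq> sets (hausdorff1 :: 'a::metric_space measure)"
proof -
  have "S \<in> sets hausdorff1" if "closed S" for S :: "'a set"
  proof (cases "S = {}")
    case False
    have "{x. infdist x S \<le> 0} \<in> sets hausdorff1"
      unfolding sets_hausdorff1
      by (rule sublevel_in_lambda_system) (metis abs_minus_commute dist_commute infdist_triangle_abs)
    moreover have "{x. infdist x S \<le> 0} = S"
      using in_closed_iff_infdist_zero[OF that False] infdist_nonneg[of _ S] by (auto simp: order_antisym_conv)
    ultimately show ?thesis by simp
  qed simp
  then have "sigma_sets UNIV (Collect closed) \<subseteq> sets (hausdorff1 :: 'a measure)"
    by (intro sets.sigma_sets_subset'[of _ hausdorff1 UNIV, simplified]) auto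
  then show ?thesis by (simp add: borel_eq_closed)
qed

lemma borel_sets_hausdorff1: "A \<in> sets borel \<Longrightarrow> A \<in> sets hausdorff1"
  using borel_subset_hausdorff1 by blast

lemma emeasure_hausdorff1_borel: "A \<in> sets borel \<Longrightarrow> emeasure hausdorff1 A = hausdorff1_outer A"
  by (rule emeasure_hausdorff1) (use borel_sets_hausdorff1 in \<open>auto simp: sets_hausdorff1\<close>)

lemma hausdorff1_null_sets_iff: 
  "A \<in> sets borel \<Longrightarrow> A \<in> null_sets hausdorff1 \<longleftrightarrow> hausdorff1_outer A = 0"
  by (simp add: null_sets_def emeasure_hausdorff1_borel borel_sets_hausdorff1)

lemma hausdorff1_outer_singleton: "hausdorff1_outer {x} = 0"
proof -
  have "hausdorff1_delta \<delta> {x} \<le> 0" if "0 < \<delta>" for \<delta>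
  proof -
    have "hausdorff1_delta \<delta> {x} \<le> (\<Sum>i::nat. ennreal (diameter {x}))"
      unfolding hausdorff1_delta_def by (intro INF_lower) (use that in auto)
    then show ?thesis by simp
  qed
  then show ?thesis by (auto simp: hausdorff1_outer_def)
qed

lemma finite_null_hausdorff1: 
  assumes "finite A" shows "A \<in> null_sets (hausdorff1 :: 'a::metric_space measure)"
proof -
  have "{x} \<in> null_sets (hausdorff1 :: 'a measure)" for x
    by (simp add: hausdorff1_null_sets_iff hausdorff1_outer_singleton)
  then have "(\<Union>x\<in>A. {x}) \<in> null_sets (hausdorff1 :: 'a measure)"
    using assms by (intro null_sets_UN') (auto simp: countable_finite)
  then show ?thesis by simp
qed

lemma diameter_closed_segment_le:
  fixes a b :: "'a::euclidean_space"
  shows "diameter (closed_segment a b) \<le> dist a b"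
proof (rule diameter_le)
  fix x y assume "x \<in> closed_segment a b" "y \<in> closed_segment a b"
  then obtain u v where u: "0 \<le> u" "u \<le> 1" "x = a + u *\<^sub>R (b - a)"
    and v: "0 \<le> v" "v \<le> 1" "y = a + v *\<^sub>R (b - a)"
    by (auto simp: closed_segment_def algebra_simps)
  have "norm (x - y) = norm ((u - v) *\<^sub>R (b - a))" by (simp add: u v algebra_simps)
  also have "\<dots> = \<bar>u - v\<bar> * norm (b - a)" by simp
  also have "\<dots> \<le> 1 * norm (b - a)" using u v by (intro mult_right_mono) auto
  finally show "norm (x - y) \<le> dist a b" by (simp add: dist_norm norm_minus_commute)
qed simp

text \<open>Subdivision into \<open>N\<close> equal pieces gives covers of any given fineness with total
  diameter \<open>dist a b\<close>.\<close>

lemma hausdorff1_outer_segment: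
  fixes a b :: "'a::euclidean_space"
  shows "hausdorff1_outer (closed_segment a b) \<le> ennreal (dist a b)"
  unfolding hausdorff1_outer_def
proof (rule SUP_least)
  fix \<delta> :: real assume "\<delta> \<in> {0<..}"
  then have \<delta>: "0 < \<delta>" by simp
  obtain N where N: "dist a b / \<delta> < real N" using reals_Archimedean2 by blast
  then have N0: "0 < N" using \<delta> by (cases N) (auto simp: divide_less_0_iff not_less)
  define p where "p i = a + (real i / real N) *\<^sub>R (b - a)" for i
  define B where "B i = (if i < N then closed_segment (p i) (p (Suc i)) else {})" for i
  have d: "dist (p i) (p (Suc i)) = dist a b / real N" for i
  proof -
    have "p i - p (Suc i) = (- (1 / real N)) *\<^sub>R (b - a)"
      using N0 by (simp add: p_def algebra_simps add_divide_distrib)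
    then show ?thesis using N0
      by (simp add: dist_norm norm_minus_commute)
  qed
  have "closed_segment a b \<subseteq> (\<Union>i. B i)"
  proof
    fix x assume "x \<in> closed_segment a b"
    then obtain u where u: "0 \<le> u" "u \<le> 1" "x = a + u *\<^sub>R (b - a)"
      by (auto simp: closed_segment_def algebra_simps)
    define i where "i = min (nat \<lfloor>u * real N\<rfloor>) (N - 1)"
    have i: "i < N" "real i \<le> u * real N" "u * real N \<le> real i + 1"
    proof -
      show "i < N" using N0 by (auto simp: i_def)
      have "real (nat \<lfloor>u * real N\<rfloor>) \<le> u * real N" using u by simp
      then show "real i \<le> u * real N" by (simp add: i_def min_def)
      have "u * real N \<le> real (nat \<lfloor>u * real N\<rfloor>) + 1" using u by linarith
      moreover have "u * real N \<le> real (N - 1) + 1" using u N0 mult_right_mono[of u 1 "real N"] by simp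
      ultimately show "u * real N \<le> real i + 1" by (simp add: i_def min_def)
    qed
    have "x \<in> closed_segment (p i) (p (Suc i))"
      unfolding closed_segment_def
    proof (clarify, intro exI conjI)
      define s where "s = u * real N - real i"
      show "0 \<le> s" "s \<le> 1" using i by (auto simp: s_def)
      have eq: "u = real i / real N + s / real N" using N0 by (simp add: s_def field_simps)
      show "x = (1 - s) *\<^sub>R p i + s *\<^sub>R p (Suc i)"
      proof -
        have "(1 - s) *\<^sub>R p i + s *\<^sub>R p (Suc i)
            = a + ((1 - s) * (real i / real N) + s * (real (Suc i) / real N)) *\<^sub>R (b - a)"
          by (simp add: p_def algebra_simps)
        also have "(1 - s) * (real i / real N) + s * (real (Suc i) / real N) = u"
          unfolding eq using N0 by (simp add: field_simps)
        finally show ?thesis by (simp add: u(3))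
      qed
    qed
    then show "x \<in> (\<Union>i. B i)" using i(1) by (auto simp: B_def)
  qed
  moreover have "bounded (B i) \<and> diameter (B i) \<le> \<delta>" for i
  proof -
    have "dist a b / real N \<le> \<delta>" using N N0 \<delta> by (simp add: field_simps)
    then show ?thesis
      using diameter_closed_segment_le[of "p i" "p (Suc i)"] \<delta>
      by (auto simp: B_def d intro!: compact_imp_bounded)
  qed
  ultimately have "hausdorff1_delta \<delta> (closed_segment a b) \<le> (\<Sum>i. ennreal (diameter (B i)))"
    unfolding hausdorff1_delta_def by (intro INF_lower) auto
  also have "\<dots> = (\<Sum>i<N. ennreal (diameter (B i)))"
    by (rule suminf_finite) (auto simp: B_def)
  also have "\<dots> \<le> (\<Sum>i<N. ennreal (dist a b / real N))"
    by (intro sum_mono ennreal_leI)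
      (use diameter_closed_segment_le[of "p i" "p (Suc i)" for i] in \<open>auto simp: B_def d\<close>)
  also have "\<dots> = ennreal (dist a b)"
    using N0 by (simp add: ennreal_of_nat_eq_real_of_nat ennreal_mult[symmetric])
  finally show "hausdorff1_delta \<delta> (closed_segment a b) \<le> ennreal (dist a b)" .
qed

text \<open>The images of covering sets under a 1-Lipschitz function lie in intervals no longer than the
  diameters of the sets, and these intervals cover \<open>{c..d}\<close>. This is the only
  source of lower bounds for the measure below.\<close>

lemma hausdorff1_outer_projection:
  fixes f :: "'a::metric_space \<Rightarrow> real"
  assumes lip: "\<And>x y. \<bar>f x - f y\<bar> \<le> dist x y" and sub: "{c..d} \<subseteq> f ` A" and "c \<le> d"
  shows "ennreal (d - c) \<le> hausdorff1_outer A"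
proof -
  have "ennreal (d - c) \<le> hausdorff1_delta 1 A"
    unfolding hausdorff1_delta_def
  proof (rule INF_greatest, clarify)
    fix B :: "nat \<Rightarrow> 'a set"
    assume cov: "A \<subseteq> (\<Union>i. B i)" and B: "\<forall>i. bounded (B i) \<and> diameter (B i) \<le> 1"
    define J where "J i = {Inf (f ` B i)..Inf (f ` B i) + diameter (B i)}" for i
    have "f ` B i \<subseteq> J i" for i
    proof
      fix y assume "y \<in> f ` B i"
      then obtain x where x: "x \<in> B i" "y = f x" by auto
      have ub: "y \<le> f x' + diameter (B i)" if "x' \<in> B i" for x'
      proof -
        have "dist x x' \<le> diameter (B i)" using B x that by (intro diameter_bounded_bound) auto
        then show ?thesis using lip[of x x'] x by linarith
      qed
      have lb: "y - diameter (B i) \<le> z" if z: "z \<in> f ` B i" for z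
      proof -
        from z obtain x' where "x' \<in> B i" "z = f x'" by blast
        then show ?thesis using ub[of x'] by linarith
      qed
      have "Inf (f ` B i) \<le> y"
        by (rule cInf_lower) (use x lb in \<open>auto intro!: bdd_belowI\<close>)
      moreover have "y - diameter (B i) \<le> Inf (f ` B i)"
        by (rule cInf_greatest) (use x lb in auto)
      ultimately show "y \<in> J i" by (simp add: J_def)
    qed
    then have "f ` (\<Union>i. B i) \<subseteq> (\<Union>i. J i)" unfolding image_UN by (intro UN_mono) auto
    then have "{c..d} \<subseteq> (\<Union>i. J i)" using sub image_mono[OF cov, of f] by order
    then have "emeasure lborel {c..d} \<le> emeasure lborel (\<Union>i. J i)"
      by (intro emeasure_mono) (auto simp: J_def)
    also have "\<dots> \<le> (\<Sum>i. emeasure lborel (J i))"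
      by (rule emeasure_subadditive_countably) (auto simp: J_def)
    also have "\<dots> = (\<Sum>i. ennreal (diameter (B i)))"
      using B by (intro suminf_cong) (auto simp: J_def diameter_ge_0)
    finally show "ennreal (d - c) \<le> (\<Sum>i. ennreal (diameter (B i)))" using \<open>c \<le> d\<close> by simp
  qed
  also have "\<dots> \<le> hausdorff1_outer A" unfolding hausdorff1_outer_def by (rule SUP_upper) simp
  finally show ?thesis .
qed

section \<open>Bump functions and the fundamental lemma of the calculus of variations\<close>

definition smooth_real :: "(real \<Rightarrow> real) \<Rightarrow> bool" where
  "smooth_real f \<longleftrightarrow> (\<exists>D :: nat \<Rightarrow> real \<Rightarrow> real. D 0 = f \<and>
     (\<forall>n x. (D n has_real_derivative D (Suc n) x) (at x)))"

lemma smooth_real_coinduct: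
  assumes "f \<in> S" and step: "\<And>g. g \<in> S \<Longrightarrow> \<exists>g'\<in>S. \<forall>x. (g has_real_derivative g' x) (at x)"
  shows "smooth_real f"
proof -
  have "\<forall>g. \<exists>g'. g \<in> S \<longrightarrow> g' \<in> S \<and> (\<forall>x. (g has_real_derivative g' x) (at x))"
    using step by blast
  from choice[OF this] obtain d where
    d: "\<And>g. g \<in> S \<Longrightarrow> d g \<in> S \<and> (\<forall>x. (g has_real_derivative d g x) (at x))" by blast
  have "(d ^^ n) f \<in> S" for n by (induction n) (use assms(1) d in auto)
  then show ?thesis
    unfolding smooth_real_def by (intro exI[of _ "\<lambda>n. (d ^^ n) f"]) (use d in auto)
qed

text \<open>For \<open>p = 1\<close> this is the classical smooth function \<open>exp (- 1 / t)\<close>,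
  extended by zero. The polynomial factor makes the family closed under differentiation, which
  gives smoothness at once by \<open>smooth_real_coinduct\<close>.\<close>

definition cutoff :: "real poly \<Rightarrow> real \<Rightarrow> real" where
  "cutoff p t = (if 0 < t then poly p (1 / t) * exp (- (1 / t)) else 0)"

text \<open>In terms of \<open>u = 1 / t\<close>, the polynomial \<open>u\<^sup>2 (p - p')\<close>, where
  \<open>p'\<close> is the derivative of \<open>p\<close>.\<close>

definition cutoff_deriv :: "real poly \<Rightarrow> real poly" where
  "cutoff_deriv p = pCons 0 (pCons 0 (p - pderiv p))"

lemma poly_over_exp_tendsto_0: "((\<lambda>u::real. poly p u * exp (- u)) \<longlongrightarrow> 0) at_top"
proof -
  have "((\<lambda>u. \<Sum>i\<le>degree p. coeff p i * (u ^ i / exp u)) \<longlongrightarrow> (\<Sum>i\<le>degree p. coeff p i * 0)) at_top"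
    by (intro tendsto_sum tendsto_mult tendsto_const tendsto_power_div_exp_0)
  then show ?thesis by (simp add: poly_altdef exp_minus divide_inverse sum_distrib_right mult.assoc)
qed

lemma cutoff_has_derivative: "(cutoff p has_real_derivative cutoff (cutoff_deriv p) t) (at t)"
proof -
  consider "t < 0" | "t = 0" | "0 < t" by linarith
  then show ?thesis
  proof cases
    case 1
    have "((\<lambda>_. 0) has_real_derivative 0) (at t)" by simp
    then have "(cutoff p has_real_derivative 0) (at t)"
      by (rule DERIV_cong_ev[OF refl _ refl, THEN iffD1, rotated])
        (use eventually_nhds_in_open[of "{..<0}" t] 1 in \<open>auto simp: cutoff_def elim!: eventually_mono\<close>)
    then show ?thesis using 1 by (simp add: cutoff_def)
  next
    case 3
    have "((\<lambda>t. poly p (1 / t) * exp (- (1 / t))) has_real_derivative cutoff (cutoff_deriv p) t) (at t)"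
      using 3 by (auto intro!: derivative_eq_intros DERIV_chain2[OF poly_DERIV]
          simp: cutoff_def cutoff_deriv_def field_simps power2_eq_square)
    then show ?thesis
      by (rule DERIV_cong_ev[OF refl _ refl, THEN iffD1, rotated])
        (use eventually_nhds_in_open[of "{0<..}" t] 3 in \<open>auto simp: cutoff_def elim!: eventually_mono\<close>)
  next
    case 2
    have "((\<lambda>h. cutoff p h / h) \<longlongrightarrow> 0) (at_right 0)"
    proof -
      have "((\<lambda>u. poly (pCons 0 p) u * exp (- u)) \<longlongrightarrow> 0) at_top" by (rule poly_over_exp_tendsto_0)
      then have "((\<lambda>h. poly (pCons 0 p) (inverse h) * exp (- inverse h)) \<longlongrightarrow> 0) (at_right (0::real))"
        by (rule filterlim_compose) (rule filterlim_inverse_at_top_right)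
      then show ?thesis
        by (rule Lim_transform_eventually)
          (auto simp: eventually_at_right_less cutoff_def field_simps intro!: eventually_at_rightI[of 0 1])
    qed
    moreover have "((\<lambda>h. cutoff p h / h) \<longlongrightarrow> 0) (at_left 0)"
      by (rule Lim_transform_eventually[OF tendsto_const])
        (auto simp: cutoff_def intro!: eventually_at_leftI[of "-1" 0])
    ultimately have "((\<lambda>h. cutoff p h / h) \<longlongrightarrow> 0) (at 0)"
      by (simp add: filterlim_at_split)
    then show ?thesis using 2 by (simp add: DERIV_def cutoff_def)
  qed
qed

text \<open>Positive exactly between \<open>\<alpha>\<close> and \<open>\<beta>\<close> if \<open>k\<close>
  is positive; as \<open>k\<close> grows, it tends to the indicator function of that interval.\<close>

definition bump :: "real \<Rightarrow> real \<Rightarrow> real \<Rightarrow> real \<Rightarrow> real" where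
  "bump k \<alpha> \<beta> x = cutoff 1 (k * (x - \<alpha>)) * cutoff 1 (k * (\<beta> - x))"

lemma smooth_bump: "smooth_real (bump k \<alpha> \<beta>)"
proof (rule smooth_real_coinduct)
  define F where "F ps x = (\<Sum>(p, q)\<leftarrow>ps. cutoff p (k * (x - \<alpha>)) * cutoff q (k * (\<beta> - x)))" for ps x
  show "bump k \<alpha> \<beta> \<in> range F"
    by (rule image_eqI[of _ _ "[(1, 1)]"]) (auto simp: F_def bump_def)
  have ex: "\<exists>qs. \<forall>x. (F ps has_real_derivative F qs x) (at x)" for ps
  proof (induction ps)
    case Nil
    show ?case by (intro exI[of _ "[]"]) (simp add: F_def)
  next
    case (Cons a ps)
    obtain p q where a: "a = (p, q)" by force
    obtain qs where qs: "\<And>x. (F ps has_real_derivative F qs x) (at x)" using Cons by blast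
    have smult: "cutoff (smult c p) t = c * cutoff p t" for c p t by (simp add: cutoff_def)
    have uminus: "cutoff (- p) t = - cutoff p t" for p t by (simp add: cutoff_def)
    have 1: "((\<lambda>x. cutoff p (k * (x - \<alpha>))) has_real_derivative k * cutoff (cutoff_deriv p) (k * (x - \<alpha>))) (at x)" for x
      by (rule DERIV_cong[OF DERIV_chain2[OF cutoff_has_derivative]]) (auto intro!: derivative_eq_intros)
    have 2: "((\<lambda>x. cutoff q (k * (\<beta> - x))) has_real_derivative (- k) * cutoff (cutoff_deriv q) (k * (\<beta> - x))) (at x)" for x
      by (rule DERIV_cong[OF DERIV_chain2[OF cutoff_has_derivative]]) (auto intro!: derivative_eq_intros)
    let ?qs = "(smult k (cutoff_deriv p), q) # (p, smult (- k) (cutoff_deriv q)) # qs"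
    have "(F (a # ps) has_real_derivative F ?qs x) (at x)" for x
    proof -
      have "F (a # ps) = (\<lambda>x. cutoff p (k * (x - \<alpha>)) * cutoff q (k * (\<beta> - x)) + F ps x)"
        by (auto simp: F_def a)
      moreover have "F ?qs x = (cutoff p (k * (x - \<alpha>)) * ((- k) * cutoff (cutoff_deriv q) (k * (\<beta> - x)))
        + k * cutoff (cutoff_deriv p) (k * (x - \<alpha>)) * cutoff q (k * (\<beta> - x))) + F qs x"
        by (simp add: F_def smult uminus)
      ultimately show ?thesis using DERIV_add[OF DERIV_mult'[OF 1 2] qs] by simp
    qed
    then show ?case by blast
  qed
  show "\<exists>g'\<in>range F. \<forall>x. (g has_real_derivative g' x) (at x)" if "g \<in> range F" for g
    using that ex by blast
qed

lemma smooth_product: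
  assumes "smooth_real f" "smooth_real g"
  shows "smooth (\<lambda>x. f (x$1) * g (x$2))"
proof -
  obtain F where F: "F 0 = f" "\<And>n x. (F n has_real_derivative F (Suc n) x) (at x)"
    using assms(1) unfolding smooth_real_def by blast
  obtain G where G: "G 0 = g" "\<And>n x. (G n has_real_derivative G (Suc n) x) (at x)"
    using assms(2) unfolding smooth_real_def by blast
  have "((\<lambda>x::plane. F i (x$1) * G j (x$2)) has_derivative
     (\<lambda>h. F (Suc i) (x$1) * G j (x$2) * h$1 + F i (x$1) * G (Suc j) (x$2) * h$2)) (at x)" for i j x
  proof -
    have c: "((\<lambda>x::plane. x$l) has_derivative (\<lambda>h. h$l)) (at x)" for l
      by (rule bounded_linear.has_derivative[OF bounded_linear_vec_nth has_derivative_ident, of l])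
    have 1: "((\<lambda>x::plane. F i (x$1)) has_derivative (\<lambda>h. F (Suc i) (x$1) * h$1)) (at x)"
      by (rule has_derivative_compose[OF c F(2)[unfolded has_field_derivative_def]])
    have 2: "((\<lambda>x::plane. G j (x$2)) has_derivative (\<lambda>h. G (Suc j) (x$2) * h$2)) (at x)"
      by (rule has_derivative_compose[OF c G(2)[unfolded has_field_derivative_def]])
    show ?thesis
      by (rule has_derivative_eq_rhs[OF has_derivative_mult[OF 1 2]]) (auto simp: algebra_simps)
  qed
  then show ?thesis unfolding smooth_def
    by (intro exI[of _ "\<lambda>i j x. F i (x$1) * G j (x$2)"]) (use F G in auto)
qed

definition box_bump :: "real \<Rightarrow> plane \<Rightarrow> plane \<Rightarrow> plane \<Rightarrow> real" where
  "box_bump k l u x = bump k (l$1) (u$1) (x$1) * bump k (l$2) (u$2) (x$2)"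

lemma mem_box_plane: "x \<in> box l u \<longleftrightarrow> l$1 < x$1 \<and> x$1 < u$1 \<and> l$2 < x$2 \<and> x$2 < (u::plane)$2"
  by (auto simp: mem_box_cart forall_2)

lemma cutoff_1: "0 \<le> cutoff 1 t" "cutoff 1 t \<le> 1" "0 < cutoff 1 t \<longleftrightarrow> 0 < t"
  by (auto simp: cutoff_def)

lemma bump_props: 
  "0 \<le> bump k \<alpha> \<beta> x" "bump k \<alpha> \<beta> x \<le> 1"
  "0 < k \<Longrightarrow> 0 < bump k \<alpha> \<beta> x \<longleftrightarrow> \<alpha> < x \<and> x < \<beta>"
proof -
  show "0 \<le> bump k \<alpha> \<beta> x" "bump k \<alpha> \<beta> x \<le> 1"
    by (auto simp: bump_def cutoff_1 intro!: mult_le_one)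
  assume "0 < k"
  have "0 < bump k \<alpha> \<beta> x \<longleftrightarrow> 0 < cutoff 1 (k * (x - \<alpha>)) \<and> 0 < cutoff 1 (k * (\<beta> - x))"
    using cutoff_1(1) by (smt (verit) bump_def mult_pos_pos mult_eq_0_iff)
  then show "0 < bump k \<alpha> \<beta> x \<longleftrightarrow> \<alpha> < x \<and> x < \<beta>"
    using \<open>0 < k\<close> by (simp add: cutoff_1 zero_less_mult_iff)
qed

lemma box_bump_bounds: "0 \<le> box_bump k l u x" "box_bump k l u x \<le> 1"
  by (auto simp: box_bump_def bump_props intro!: mult_le_one)

lemma box_bump_pos_iff: "0 < k \<Longrightarrow> 0 < box_bump k l u x \<longleftrightarrow> x \<in> box l u"
  using bump_props(1)[of k "l$1" "u$1" "x$1"] bump_props(1)[of k "l$2" "u$2" "x$2"]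
    bump_props(3)[of k "l$1" "u$1" "x$1"] bump_props(3)[of k "l$2" "u$2" "x$2"]
  unfolding box_bump_def mem_box_plane by (auto simp: zero_less_mult_iff)

lemma box_bump_zero: "0 < k \<Longrightarrow> x \<notin> box l u \<Longrightarrow> box_bump k l u x = 0"
  using box_bump_pos_iff[of k l u x] box_bump_bounds(1)[of k l u x] by force

lemma box_bump_test_function:
  assumes "0 < k" "cbox l u \<subseteq> U"
  shows "box_bump k l u \<in> test_functions U"
proof -
  have "closure {x. box_bump k l u x \<noteq> 0} \<subseteq> cbox l u"
    by (rule closure_minimal) (use box_bump_zero[OF assms(1)] box_subset_cbox in fastforce)+
  moreover from this have "compact (closure {x. box_bump k l u x \<noteq> 0})"
    by (simp add: bounded_subset[OF bounded_cbox] compact_eq_bounded_closed)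
  moreover have "smooth (box_bump k l u)"
    using smooth_product[OF smooth_bump smooth_bump] by (simp add: box_bump_def[abs_def])
  ultimately show ?thesis using assms(2) by (auto simp: test_functions_def)
qed

lemma box_bump_tendsto_indicator:
  "(\<lambda>n. box_bump (real (Suc n)) l u x) \<longlonglongrightarrow> indicator (box l u) x"
proof (cases "x \<in> box l u")
  case True
  have c: "(\<lambda>n. cutoff 1 (real (Suc n) * t)) \<longlonglongrightarrow> 1" if "0 < t" for t
  proof -
    have "(\<lambda>n. exp (- ((1 / t) * (1 / real (Suc n))))) \<longlonglongrightarrow> exp (- ((1 / t) * 0))"
      by (intro tendsto_intros LIMSEQ_inverse_real_of_nat[unfolded inverse_eq_divide])
    then show ?thesis using that by (simp add: cutoff_def zero_less_mult_iff mult.commute)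
  qed
  have "(\<lambda>n. box_bump (real (Suc n)) l u x) \<longlonglongrightarrow> (1 * 1) * (1 * 1)"
    unfolding box_bump_def bump_def by (intro tendsto_mult c) (use True in \<open>auto simp: mem_box_plane\<close>)
  then show ?thesis using True by simp
qed (simp add: box_bump_zero del: of_nat_Suc)

lemma smooth_imp_continuous: "smooth \<phi> \<Longrightarrow> continuous_on UNIV \<phi>"
proof -
  assume "smooth \<phi>"
  then obtain D where D: "D 0 0 = \<phi>"
    "\<And>i j x. (D i j has_derivative (\<lambda>h. D (Suc i) j x * h$1 + D i (Suc j) x * h$2)) (at x)"
    unfolding smooth_def by blast
  show ?thesis unfolding continuous_on_eq_continuous_at[OF open_UNIV] D(1)[symmetric]
    using has_derivative_continuous[OF D(2)] by blast
qed

lemma test_function_continuous: "\<phi> \<in> test_functions U \<Longrightarrow> continuous_on UNIV \<phi>"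
  by (simp add: test_functions_def smooth_imp_continuous)

text \<open>The fundamental lemma of the calculus of variations. Box bumps increase in steepness to
  indicator functions of boxes, so that \<open>d\<close> has integral zero over every box
  compactly inside \<open>U\<close>; boxes generate the Borel sets, and countably many of them
  cover \<open>U\<close>.\<close>

lemma orthogonal_to_test_functions_imp_AE_zero:
  fixes d :: "plane \<Rightarrow> real"
  assumes "open U" and int: "integrable (lebesgue_on U) d"
    and orth: "\<And>\<phi>. \<phi> \<in> test_functions U \<Longrightarrow> (LINT x|lebesgue_on U. \<phi> x * d x) = 0"
  shows "AE x in lebesgue_on U. d x = 0"
proof -
  have U: "U \<in> sets lebesgue" using \<open>open U\<close> by simp
  have dU: "integrable lebesgue (\<lambda>x. indicator U x * d x)"
    using int U by (simp add: integrable_restrict_space)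
  (* A Borel version of d, extended by zero, so that the integrals can be taken over Borel sets. *)
  obtain g where g: "g \<in> borel_measurable lborel" "AE x in lborel. indicator U x * d x = g x"
    using completion_ex_borel_measurable_real[of "\<lambda>x. indicator U x * d x" lborel] dU by auto
  have ae: "AE x in lebesgue. indicator U x * d x = g x" using g(2) by (rule AE_completion)
  have gi: "integrable lborel g"
  proof -
    have "integrable lebesgue g"
      by (rule integrable_cong_AE_imp[OF dU])
        (use ae g(1) in \<open>auto intro: measurable_completion elim: eventually_mono\<close>)
    then show ?thesis using g(1) by (simp add: integrable_completion)
  qed
  have box0: "(LINT x:box l u|lborel. g x) = 0" if sub: "cbox l u \<subseteq> U" for l u
  proof -
    have lim: "(\<lambda>n. LINT x|lborel. box_bump (real (Suc n)) l u x * g x) \<longlonglongrightarrow> (LINT x|lborel. indicator (box l u) x * g x)"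
    proof (rule integral_dominated_convergence[of _ _ _ "\<lambda>x. norm (g x)"])
      have "box_bump (real (Suc n)) l u \<in> borel_measurable borel" for n
        by (intro borel_measurable_continuous_onI test_function_continuous[of _ U] box_bump_test_function sub) simp
      then show "(\<lambda>x. box_bump (real (Suc n)) l u x * g x) \<in> borel_measurable lborel" for n
        using g(1) by simp
      show "AE x in lborel. (\<lambda>n. box_bump (real (Suc n)) l u x * g x) \<longlonglongrightarrow> indicator (box l u) x * g x"
        by (intro AE_I2 tendsto_mult box_bump_tendsto_indicator tendsto_const)
      show "AE x in lborel. norm (box_bump (real (Suc n)) l u x * g x) \<le> norm (g x)" for n
        using box_bump_bounds by (intro AE_I2) (auto simp: abs_mult intro!: mult_left_le_one_le)
    qed (use g gi in auto)
    have "(LINT x|lborel. \<phi> x * g x) = 0" if \<phi>: "\<phi> \<in> test_functions U" "\<phi> \<in> borel_measurable borel" for \<phi>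
    proof -
      have "(LINT x|lborel. \<phi> x * g x) = (LINT x|lebesgue. \<phi> x * g x)"
        using g(1) \<phi>(2) by (subst integral_completion) auto
      also have "\<dots> = (LINT x|lebesgue. indicator U x *\<^sub>R (\<phi> x * d x))"
      proof (rule integral_cong_AE)
        show "AE x in lebesgue. \<phi> x * g x = indicator U x *\<^sub>R (\<phi> x * d x)"
          using ae by eventually_elim (auto simp: algebra_simps)
        show "(\<lambda>x. \<phi> x * g x) \<in> borel_measurable lebesgue"
          using g(1) \<phi>(2) by (intro measurable_completion) auto
        have "(\<lambda>x. \<phi> x * (indicator U x * d x)) \<in> borel_measurable lebesgue"
          using \<phi>(2) by (intro borel_measurable_times[OF _ borel_measurable_integrable[OF dU]])
            (auto intro: measurable_completion)
        then show "(\<lambda>x. indicator U x *\<^sub>R (\<phi> x * d x)) \<in> borel_measurable lebesgue"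
          by (simp add: mult.left_commute)
      qed
      also have "\<dots> = (LINT x|lebesgue_on U. \<phi> x * d x)"
        using U by (simp add: integral_restrict_space)
      finally show ?thesis using orth[OF \<phi>(1)] by simp
    qed
    note this[OF box_bump_test_function[OF _ sub]]
    moreover have "box_bump (real (Suc n)) l u \<in> borel_measurable borel" for n
      by (intro borel_measurable_continuous_onI test_function_continuous[of _ U] box_bump_test_function sub) simp
    ultimately have "(LINT x|lborel. box_bump (real (Suc n)) l u x * g x) = 0" for n by simp
    with lim show ?thesis by (simp add: set_lebesgue_integral_def LIMSEQ_const_iff)
  qed
  have Q0: "AE x in lborel. x \<in> box l u \<longrightarrow> g x = 0" if sub: "cbox l u \<subseteq> U" for l u
  proof -
    let ?f = "\<lambda>x. indicator (box l u) x * g x"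
    have fi: "integrable lborel ?f"
      using integrable_mult_indicator[OF _ gi, of "box l u"] by simp
    have si: "set_integrable lborel A ?f" if "A \<in> sets borel" for A
      unfolding set_integrable_def by (rule integrable_mult_indicator[OF _ fi]) (use that in simp)
    have zero: "(LINT x:A|lborel. ?f x) = 0" if "A \<in> sets borel" for A
    proof -
      have "Int_stable (range (\<lambda>(a, b::plane). box a b))"
      proof (rule Int_stableI, clarify)
        fix a b c d :: plane
        have "box a b \<inter> box c d = (\<lambda>(a, b). box a b)
          (\<Sum>i\<in>Basis. max (a \<bullet> i) (c \<bullet> i) *\<^sub>R i, \<Sum>i\<in>Basis. min (b \<bullet> i) (d \<bullet> i) *\<^sub>R i)"
          by (simp add: box_Int_box)
        then show "box a b \<inter> box c d \<in> range (\<lambda>(a, b). box a b)" by (rule range_eqI)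
      qed
      moreover have "range (\<lambda>(a, b::plane). box a b) \<subseteq> Pow UNIV" by simp
      moreover have "A \<in> sigma_sets UNIV (range (\<lambda>(a, b). box a b))"
        using that unfolding borel_eq_box by simp
      ultimately show ?thesis
      proof (induction rule: sigma_sets_induct_disjoint)
        case (basic A)
        then obtain a b where A: "A = box a b" by auto
        obtain l' u' where Q: "box a b \<inter> box l u = box l' u'" by (simp add: box_Int_box)
        have "(LINT x:A|lborel. ?f x) = (LINT x:box l' u'|lborel. g x)"
          unfolding set_lebesgue_integral_def A
          by (intro Bochner_Integration.integral_cong refl) (use Q in \<open>auto split: split_indicator\<close>)
        also have "\<dots> = 0"
        proof (cases "box l' u' = {}")
          case False
          have "cbox l' u' = closure (box l' u')" using False by simp
          also have "\<dots> \<subseteq> closure (box l u)" using Q by (intro closure_mono) auto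
          also have "\<dots> \<subseteq> cbox l u" by (intro closure_minimal box_subset_cbox closed_cbox)
          finally show ?thesis using sub by (intro box0) auto
        qed (simp add: set_lebesgue_integral_def)
        finally show ?case .
      next
        case empty
        then show ?case by (simp add: set_lebesgue_integral_def)
      next
        case (compl A)
        then have A: "A \<in> sets borel" by (simp add: borel_eq_box)
        have "(LINT x:UNIV - A|lborel. ?f x) = (LINT x:UNIV|lborel. ?f x) - (LINT x:A|lborel. ?f x)"
        proof -
          have "(LINT x:UNIV|lborel. ?f x) = (LINT x:(UNIV - A) \<union> A|lborel. ?f x)" by simp
          also have "\<dots> = (LINT x:UNIV - A|lborel. ?f x) + (LINT x:A|lborel. ?f x)"
            by (rule set_integral_Un) (use A si in auto)
          finally show ?thesis by simp
        qed
        moreover have "(LINT x:UNIV|lborel. ?f x) = (LINT x:box l u|lborel. g x)"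
          by (simp add: set_lebesgue_integral_def)
        ultimately show ?case using compl box0[OF sub] by simp
      next
        case (union A)
        then have A: "A i \<in> sets borel" for i by (auto simp: borel_eq_box)
        have "(LINT x:(\<Union>i. A i)|lborel. ?f x) = (\<Sum>i. (LINT x:A i|lborel. ?f x))"
          by (rule lebesgue_integral_countable_add) (use A si union in \<open>auto simp: disjoint_family_on_def\<close>)
        then show ?case using union by simp
      qed
    qed
    have "AE x in lborel. ?f x = 0"
      by (rule density_unique_real[OF fi]) (use zero in \<open>auto simp: set_lebesgue_integral_def\<close>)
    then show ?thesis by eventually_elim (auto split: split_indicator_asm)
  qed
  have Qc: "AE x in lborel. x \<in> cbox l u \<longrightarrow> g x = 0" if sub: "cbox l u \<subseteq> U" for l u
  proof -
    have "cbox l u - box l u \<in> null_sets lborel"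
      using negligible_frontier_interval[of l u] by (auto simp: negligible_iff_null_sets null_sets_completion_iff)
    from AE_not_in[OF this] Q0[OF sub] show ?thesis by eventually_elim auto
  qed
  obtain \<D> where D: "countable \<D>" "\<D> \<subseteq> Pow U" "\<And>X. X \<in> \<D> \<Longrightarrow> \<exists>a b. X = cbox a b" "\<Union>\<D> = U"
    using open_countable_Union_open_cbox[OF \<open>open U\<close>] by metis
  have "AE x in lborel. \<forall>X\<in>\<D>. x \<in> X \<longrightarrow> g x = 0"
    unfolding AE_ball_countable[OF D(1)]
  proof
    fix X assume X: "X \<in> \<D>"
    then obtain a b where "X = cbox a b" using D(3) by blast
    then show "AE x in lborel. x \<in> X \<longrightarrow> g x = 0" using Qc[of a b] D(2) X by auto
  qed
  then have "AE x in lborel. x \<in> U \<longrightarrow> g x = 0" by eventually_elim (use D(4) in auto)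
  from AE_completion[OF this] ae have "AE x in lebesgue. x \<in> U \<longrightarrow> d x = 0"
    by eventually_elim auto
  then show ?thesis using U by (simp add: AE_restrict_space_iff)
qed

section \<open>Flux through the edges of a triangle\<close>

definition cross2 :: "plane \<Rightarrow> plane \<Rightarrow> real" where
  "cross2 u v = u$1 * v$2 - u$2 * v$1"

definition tri :: "plane \<Rightarrow> plane \<Rightarrow> plane \<Rightarrow> plane set" where
  "tri P A B = {P + s *\<^sub>R (A - P) + t *\<^sub>R (B - P) | s t. 0 < s \<and> 0 < t \<and> s + t < 1}"

text \<open>The integral over the segment from \<open>A\<close> to \<open>B\<close>, divided by its length.\<close>

definition edge_integral :: "(plane \<Rightarrow> real) \<Rightarrow> plane \<Rightarrow> plane \<Rightarrow> real" where
  "edge_integral \<psi> A B = (LINT r|lborel. indicator {0<..<1} r * \<psi> (A + r *\<^sub>R (B - A)))"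

lemma measurable_vector_2:
  "(\<lambda>(s::real, t::real). vector [s, t] :: plane) \<in> measurable (lborel \<Otimes>\<^sub>M lborel) borel"
proof -
  have "(\<lambda>(s::real, t::real). vector [s, t] :: plane) = (\<lambda>z. fst z *\<^sub>R axis 1 1 + snd z *\<^sub>R axis 2 1)"
    by (rule ext) (simp add: vec_eq_iff forall_2 axis_def case_prod_beta')
  moreover have "(\<lambda>z :: real \<times> real. fst z *\<^sub>R axis 1 1 + snd z *\<^sub>R axis 2 1 :: plane) \<in> borel_measurable borel"
    by (intro borel_measurable_continuous_onI continuous_intros)
  ultimately have "(\<lambda>(s::real, t::real). vector [s, t] :: plane) \<in> borel_measurable borel"
    by simp
  then show ?thesis by (simp add: lborel_prod)
qed

lemma lborel_plane_eq_pair: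
  "lborel = distr (lborel \<Otimes>\<^sub>M lborel) borel (\<lambda>(s, t). vector [s, t] :: plane)"
proof (rule lborel_eqI)
  note meas = measurable_vector_2
  fix l u :: plane assume le: "\<And>b. b \<in> Basis \<Longrightarrow> l \<bullet> b \<le> u \<bullet> b"
  have B: "(Basis :: plane set) = {axis 1 1, axis 2 1}" 
    by (auto simp: Basis_vec_def forall_2 exhaust_2 UNIV_2)
  have ne: "axis 1 1 \<noteq> (axis 2 1 :: plane)" by (simp add: axis_eq_axis)
  have le': "l$1 \<le> u$1" "l$2 \<le> u$2"
    using le[of "axis 1 1"] le[of "axis 2 1"] by (auto simp: B inner_axis)
  have "(\<lambda>(s::real, t::real). vector [s, t] :: plane) -` box l u = {l$1<..<u$1} \<times> {l$2<..<u$2}"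
    by (auto simp: mem_box_cart forall_2)
  then have "emeasure (distr (lborel \<Otimes>\<^sub>M lborel) borel (\<lambda>(s, t). vector [s, t] :: plane)) (box l u)
     = emeasure (lborel \<Otimes>\<^sub>M lborel) ({l$1<..<u$1} \<times> {l$2<..<u$2})"
    using meas by (subst emeasure_distr) (auto simp: space_pair_measure)
  also have "\<dots> = ennreal (u$1 - l$1) * ennreal (u$2 - l$2)"
    using le' by (subst lborel.emeasure_pair_measure_Times) auto
  also have "\<dots> = (\<Prod>b\<in>Basis. (u - l) \<bullet> b)"
    using le' ne by (simp add: B inner_axis ennreal_mult)
  finally show "emeasure (distr (lborel \<Otimes>\<^sub>M lborel) borel (\<lambda>(s, t). vector [s, t] :: plane)) (box l u)
     = (\<Prod>b\<in>Basis. (u - l) \<bullet> b)" .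
qed simp

lemma lborel_linear_image:
  fixes f :: "plane \<Rightarrow> plane"
  assumes "linear f" and det: "det (matrix f) \<noteq> 0"
  shows "lborel = density (distr lborel borel f) (\<lambda>_. ennreal \<bar>det (matrix f)\<bar>)"
proof (rule lborel_eqI)
  fix l u :: plane assume le: "\<And>b. b \<in> Basis \<Longrightarrow> l \<bullet> b \<le> u \<bullet> b"
  have cont: "continuous_on UNIV f" using \<open>linear f\<close> by (simp add: linear_continuous_on linear_conv_bounded_linear)
  then have m: "f \<in> borel_measurable borel" by (rule borel_measurable_continuous_onI)
  obtain h where h: "linear h" "\<And>x. h (f x) = x" "\<And>x. f (h x) = x"
    using linear_injective_isomorphism[OF \<open>linear f\<close>] det det_nz_iff_inj[OF \<open>linear f\<close>] by metis
  have img: "f -` box l u = h ` box l u" using h by (auto simp: image_iff) metis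
  have dets: "det (matrix f) * det (matrix h) = 1"
  proof -
    have "f \<circ> h = (\<lambda>x. x)" using h by auto
    then have "matrix f ** matrix h = mat 1"
      using matrix_compose[OF \<open>linear h\<close> \<open>linear f\<close>] by (simp add: matrix_id_mat_1[unfolded id_def])
    then show ?thesis by (metis det_I det_mul)
  qed
  have lm: "box l u \<in> lmeasurable" by simp
  have "emeasure (density (distr lborel borel f) (\<lambda>_. ennreal \<bar>det (matrix f)\<bar>)) (box l u)
     = ennreal \<bar>det (matrix f)\<bar> * emeasure lborel (f -` box l u)"
    using m by (simp add: emeasure_density nn_integral_cmult_indicator emeasure_distr)
  also have "emeasure lborel (f -` box l u) = emeasure lebesgue (h ` box l u)"
    using measurable_sets[OF m, of "box l u"] by (simp add: img)
  also have "\<dots> = ennreal (measure lebesgue (h ` box l u))"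
    using measurable_linear_image[OF \<open>linear h\<close> lm] by (simp add: emeasure_eq_measure2)
  also have "measure lebesgue (h ` box l u) = \<bar>det (matrix h)\<bar> * measure lebesgue (box l u)"
    by (rule measure_linear_image[OF \<open>linear h\<close> lm])
  also have "ennreal \<bar>det (matrix f)\<bar> * ennreal (\<bar>det (matrix h)\<bar> * measure lebesgue (box l u))
     = ennreal (\<bar>det (matrix f) * det (matrix h)\<bar> * measure lebesgue (box l u))"
    by (simp add: ennreal_mult'[symmetric] abs_mult mult.assoc)
  also have "\<dots> = ennreal (\<Prod>b\<in>Basis. (u - l) \<bullet> b)"
    using le by (simp add: dets)
  finally show "emeasure (density (distr lborel borel f) (\<lambda>_. ennreal \<bar>det (matrix f)\<bar>)) (box l u)
     = ennreal (\<Prod>b\<in>Basis. (u - l) \<bullet> b)" .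
qed simp

text \<open>The coordinates \<open>(s, t)\<close> along \<open>u\<close> and \<open>v\<close> turn a
  triangle with apex \<open>P\<close> into the unit triangle; the Jacobian is \<open>cross2 u
  v\<close>.\<close>

lemma integral_plane_affine_coordinates:
  fixes f :: "plane \<Rightarrow> real"
  assumes f: "f \<in> borel_measurable borel" and D: "cross2 u v \<noteq> 0"
  shows "(LINT x|lborel. f x)
    = \<bar>cross2 u v\<bar> * integral\<^sup>L (lborel \<Otimes>\<^sub>M lborel) (\<lambda>(s, t). f (P + s *\<^sub>R u + t *\<^sub>R v))"
proof -
  define L where "L x = x$1 *\<^sub>R u + x$2 *\<^sub>R v" for x :: plane
  have lin: "linear L" by (rule linearI) (auto simp: L_def algebra_simps)
  have det: "det (matrix L) = cross2 u v"
    by (simp add: det_2 matrix_def L_def cross2_def axis_def algebra_simps)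
  have mL: "L \<in> borel_measurable borel"
    using lin by (intro borel_measurable_continuous_onI) (simp add: linear_continuous_on linear_conv_bounded_linear)
  have mf: "(\<lambda>x. f (P + x)) \<in> borel_measurable borel"
    by (rule measurable_compose[OF _ f]) simp
  have mfL: "(\<lambda>x. f (P + L x)) \<in> borel_measurable borel"
    by (rule measurable_compose[OF mL mf])
  note meas = measurable_vector_2
  have "(LINT x|lborel. f x) = (LINT x|distr lborel borel ((+) P). f x)"
    by (simp add: lborel_distr_plus)
  also have "\<dots> = (LINT x|lborel. f (P + x))" using f by (subst integral_distr) auto
  also have "\<dots> = (LINT x|density (distr lborel borel L) (\<lambda>_. ennreal \<bar>cross2 u v\<bar>). f (P + x))"
    using lborel_linear_image[OF lin] D det by simp
  also have "\<dots> = (LINT x|distr lborel borel L. \<bar>cross2 u v\<bar> * f (P + x))"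
    using mf by (subst integral_real_density) auto
  also have "\<dots> = (LINT x|lborel. \<bar>cross2 u v\<bar> * f (P + L x))"
    using mf mL by (subst integral_distr) auto
  also have "\<dots> = \<bar>cross2 u v\<bar> * (LINT x|lborel. f (P + L x))" by simp
  also have "(LINT x|lborel. f (P + L x))
      = (LINT x|distr (lborel \<Otimes>\<^sub>M lborel) borel (\<lambda>(s, t). vector [s, t] :: plane). f (P + L x))"
    by (simp flip: lborel_plane_eq_pair)
  also have "\<dots> = integral\<^sup>L (lborel \<Otimes>\<^sub>M lborel) (\<lambda>z. f (P + L ((\<lambda>(s, t). vector [s, t]) z)))"
    using meas mfL by (subst integral_distr) auto
  finally show ?thesis by (simp add: L_def case_prod_beta' add.assoc)
qed

lemma open_tri: "open (tri P A B)" if D: "cross2 (A - P) (B - P) \<noteq> 0"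
proof -
  let ?u = "A - P" and ?v = "B - P"
  define S where "S x = cross2 (x - P) ?v / cross2 ?u ?v" for x
  define T where "T x = cross2 ?u (x - P) / cross2 ?u ?v" for x
  have "tri P A B = {x. 0 < S x \<and> 0 < T x \<and> S x + T x < 1}"
  proof safe
    fix x assume "x \<in> tri P A B"
    then obtain s t where x: "x = P + s *\<^sub>R ?u + t *\<^sub>R ?v" "0 < s" "0 < t" "s + t < 1"
      by (auto simp: tri_def)
    have "cross2 (x - P) ?v = s * cross2 ?u ?v" "cross2 ?u (x - P) = t * cross2 ?u ?v"
      by (simp_all add: x cross2_def algebra_simps)
    then have "S x = s" "T x = t" using D by (simp_all add: S_def T_def)
    then show "0 < S x" "0 < T x" "S x + T x < 1" using x by auto
  next
    fix x assume x: "0 < S x" "0 < T x" "S x + T x < 1"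
    have "x = P + S x *\<^sub>R ?u + T x *\<^sub>R ?v"
    proof -
      have "cross2 ?u ?v *\<^sub>R (x - P) = cross2 (x - P) ?v *\<^sub>R ?u + cross2 ?u (x - P) *\<^sub>R ?v"
        by (simp add: vec_eq_iff forall_2 cross2_def algebra_simps)
      then have "x - P = (1 / cross2 ?u ?v) *\<^sub>R (cross2 (x - P) ?v *\<^sub>R ?u + cross2 ?u (x - P) *\<^sub>R ?v)"
        using D by (metis (no_types, lifting) divide_self_if scaleR_one scaleR_scaleR times_divide_eq_left mult_1)
      then show ?thesis by (simp add: S_def T_def algebra_simps)
    qed
    then show "x \<in> tri P A B" using x unfolding tri_def by blast
  qed
  moreover have "continuous_on UNIV S" "continuous_on UNIV T"
    using D unfolding S_def T_def cross2_def[of "x - P" for x] cross2_def[of "A - P" "x - P" for x]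
    by (auto intro!: continuous_intros)
  ultimately show ?thesis by (auto intro!: open_Collect_conj open_Collect_less continuous_intros)
qed

text \<open>The coordinates are unique, since the two edges at \<open>P\<close> are independent.\<close>

lemma mem_tri_coordinates:
  assumes D: "cross2 (A - P) (B - P) \<noteq> 0"
  shows "P + s *\<^sub>R (A - P) + t *\<^sub>R (B - P) \<in> tri P A B \<longleftrightarrow> 0 < s \<and> 0 < t \<and> s + t < 1"
proof
  let ?u = "A - P" and ?v = "B - P"
  assume "P + s *\<^sub>R ?u + t *\<^sub>R ?v \<in> tri P A B"
  then obtain s' t' where st: "P + s *\<^sub>R ?u + t *\<^sub>R ?v = P + s' *\<^sub>R ?u + t' *\<^sub>R ?v" "0 < s'" "0 < t'" "s' + t' < 1"
    by (auto simp: tri_def)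
  then have e: "s *\<^sub>R ?u + t *\<^sub>R ?v = s' *\<^sub>R ?u + t' *\<^sub>R ?v" by (simp add: add.assoc)
  have "cross2 (s *\<^sub>R ?u + t *\<^sub>R ?v) ?v = s * cross2 ?u ?v" "cross2 ?u (s *\<^sub>R ?u + t *\<^sub>R ?v) = t * cross2 ?u ?v" for s t
    by (simp_all add: cross2_def algebra_simps)
  then have "s = s'" "t = t'" using e D by (metis mult_right_cancel)+
  then show "0 < s \<and> 0 < t \<and> s + t < 1" using st by simp
qed (auto simp: tri_def)

lemma integral_open_interval_FTC:
  fixes F f :: "real \<Rightarrow> real"
  assumes "a \<le> b" "\<And>x. (F has_real_derivative f x) (at x)" "continuous_on UNIV f"
  shows "(LINT x|lborel. indicator {a<..<b} x * f x) = F b - F a"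
proof -
  have "(LINT x|lborel. indicator {a<..<b} x * f x) = (LINT x|lborel. f x * indicator {a..b} x)"
  proof (rule integral_cong_AE)
    have "f \<in> borel_measurable borel" using assms(3) by (rule borel_measurable_continuous_onI)
    then show "(\<lambda>x. indicator {a<..<b} x * f x) \<in> borel_measurable lborel"
      "(\<lambda>x. f x * indicator {a..b} x) \<in> borel_measurable lborel" by auto
    show "AE x in lborel. indicator {a<..<b} x * f x = f x * indicator {a..b} x"
      using AE_lborel_singleton[of a] AE_lborel_singleton[of b]
      by eventually_elim (auto split: split_indicator)
  qed
  also have "\<dots> = F b - F a"
    using assms by (intro integral_FTC_Icc_real) (auto simp: continuous_on_eq_continuous_at)
  finally show ?thesis .
qed

lemma integrable_continuous_on_bounded_set:
  fixes f :: "'a::euclidean_space \<Rightarrow> real"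
  assumes "S \<in> sets borel" "S \<subseteq> C" "compact C" "continuous_on UNIV f"
  shows "integrable lborel (\<lambda>x. indicator S x * f x)"
proof -
  have "integrable lborel (\<lambda>x. indicator C x *\<^sub>R f x)"
    using assms(3,4) by (intro borel_integrable_compact) (auto intro: continuous_on_subset)
  then have "integrable lborel (\<lambda>x. indicator S x *\<^sub>R (indicator C x *\<^sub>R f x))"
    using assms(1) by (intro integrable_mult_indicator[of S lborel]) simp
  moreover have "(\<lambda>x. indicator S x *\<^sub>R (indicator C x *\<^sub>R f x)) = (\<lambda>x. indicator S x * f x)"
    using assms(2) by (intro ext) (auto split: split_indicator)
  ultimately show ?thesis by simp
qed

text \<open>The divergence theorem for the field \<open>(s, t) \<omega>\<close>. The integrand is
  \<open>\<partial>\<^sub>s (s \<omega>) + \<partial>\<^sub>t (t \<omega>)\<close>, and the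
  fundamental theorem of calculus applies to either summand after integrating in
  \<open>s\<close> or \<open>t\<close> first. The legs contribute nothing because there \<open>s
  = 0\<close> or \<open>t = 0\<close>; the two contributions of the hypotenuse carry the weights
  \<open>1 - t\<close> and \<open>t\<close>, which add up to one.\<close>

lemma flux_unit_triangle:
  fixes \<omega> \<omega>s \<omega>t :: "real \<Rightarrow> real \<Rightarrow> real"
  assumes ds: "\<And>s t. ((\<lambda>s. \<omega> s t) has_real_derivative \<omega>s s t) (at s)"
    and dt: "\<And>s t. ((\<lambda>t. \<omega> s t) has_real_derivative \<omega>t s t) (at t)"
    and cs: "continuous_on UNIV (\<lambda>(s, t). \<omega>s s t)" and ct: "continuous_on UNIV (\<lambda>(s, t). \<omega>t s t)"
    and c: "continuous_on UNIV (\<lambda>(s, t). \<omega> s t)"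
  shows "integral\<^sup>L (lborel \<Otimes>\<^sub>M lborel) (\<lambda>(s, t). indicator {(s, t). 0 < s \<and> 0 < t \<and> s + t < 1} (s, t) *
      (s * \<omega>s s t + t * \<omega>t s t + 2 * \<omega> s t))
    = (LINT t|lborel. indicator {0<..<1} t * \<omega> (1 - t) t)"
proof -
  let ?\<Delta> = "{(s::real, t::real). 0 < s \<and> 0 < t \<and> s + t < 1}"
  have "open ?\<Delta>" unfolding case_prod_beta'
    by (intro open_Collect_conj open_Collect_less continuous_intros)
  then have \<Delta>: "?\<Delta> \<in> sets borel" by simp
  have int: "integrable (lborel \<Otimes>\<^sub>M lborel) (\<lambda>(s, t). indicator ?\<Delta> (s, t) * f s t)"
    if "continuous_on UNIV (\<lambda>(s, t). f s t)" for f :: "real \<Rightarrow> real \<Rightarrow> real"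
  proof -
    have "integrable lborel (\<lambda>z. indicator ?\<Delta> z * (\<lambda>(s, t). f s t) z)"
      by (rule integrable_continuous_on_bounded_set[OF \<Delta> _ _ that, of "{0..1} \<times> {0..1}"])
        (auto intro: compact_Times)
    moreover have "(\<lambda>z. indicator ?\<Delta> z * (\<lambda>(s, t). f s t) z) = (\<lambda>(s, t). indicator ?\<Delta> (s, t) * f s t)"
      by (auto split: split_indicator)
    ultimately show ?thesis by (simp add: lborel_prod)
  qed
  have cfst: "continuous_on UNIV (\<lambda>(s, t). \<omega> s t + s * \<omega>s s t)"
    and csnd: "continuous_on UNIV (\<lambda>(s, t). \<omega> s t + t * \<omega>t s t)"
    using c cs ct by (auto simp: case_prod_beta' intro!: continuous_intros)
  have slice_s: "continuous_on UNIV (\<lambda>s. f s t)" "continuous_on UNIV (\<lambda>t. f s t)"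
    if "continuous_on UNIV (\<lambda>(s, t). f s t)" for f :: "real \<Rightarrow> real \<Rightarrow> real" and s t
  proof -
    have "continuous_on UNIV (\<lambda>s. (\<lambda>(s, t). f s t) (s, t))" "continuous_on UNIV (\<lambda>t. (\<lambda>(s, t). f s t) (s, t))"
      by (intro continuous_on_compose2[OF that] continuous_intros; simp)+
    then show "continuous_on UNIV (\<lambda>s. f s t)" "continuous_on UNIV (\<lambda>t. f s t)" by simp_all
  qed
  have 1: "(LINT s|lborel. indicator ?\<Delta> (s, t) * (\<omega> s t + s * \<omega>s s t)) = indicator {0<..<1} t * ((1 - t) * \<omega> (1 - t) t)" for t
  proof (cases "0 < t \<and> t < 1")
    case True
    have "(LINT s|lborel. indicator ?\<Delta> (s, t) * (\<omega> s t + s * \<omega>s s t))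
      = (LINT s|lborel. indicator {0<..<1 - t} s * (\<omega> s t + s * \<omega>s s t))"
      using True by (intro Bochner_Integration.integral_cong refl) (auto split: split_indicator)
    also have "\<dots> = (1 - t) * \<omega> (1 - t) t - 0 * \<omega> 0 t"
      using True by (intro integral_open_interval_FTC slice_s(1)[OF cfst])
        (auto intro!: derivative_eq_intros ds)
    finally show ?thesis using True by simp
  next
    case False
    then have "(\<lambda>s. indicator ?\<Delta> (s, t) * (\<omega> s t + s * \<omega>s s t)) = (\<lambda>s. 0)"
      by (auto split: split_indicator)
    then show ?thesis using False by (auto split: split_indicator)
  qed
  have 2: "(LINT t|lborel. indicator ?\<Delta> (s, t) * (\<omega> s t + t * \<omega>t s t)) = indicator {0<..<1} s * ((1 - s) * \<omega> s (1 - s))" for s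
  proof (cases "0 < s \<and> s < 1")
    case True
    have "(LINT t|lborel. indicator ?\<Delta> (s, t) * (\<omega> s t + t * \<omega>t s t))
      = (LINT t|lborel. indicator {0<..<1 - s} t * (\<omega> s t + t * \<omega>t s t))"
      using True by (intro Bochner_Integration.integral_cong refl) (auto split: split_indicator)
    also have "\<dots> = (1 - s) * \<omega> s (1 - s) - 0 * \<omega> s 0"
      using True by (intro integral_open_interval_FTC slice_s(2)[OF csnd])
        (auto intro!: derivative_eq_intros dt)
    finally show ?thesis using True by simp
  next
    case False
    then have "(\<lambda>t. indicator ?\<Delta> (s, t) * (\<omega> s t + t * \<omega>t s t)) = (\<lambda>s. 0)"
      by (auto split: split_indicator)
    then show ?thesis using False by (auto split: split_indicator)
  qed
  have diag: "integrable lborel (\<lambda>t. indicator {0<..<1::real} t * f t)" if "continuous_on UNIV f" for f :: "real \<Rightarrow> real"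
    by (rule integrable_continuous_on_bounded_set[OF _ _ _ that, of _ "{0..1}"]) auto
  have cd: "continuous_on UNIV (\<lambda>t. \<omega> (1 - t) t)"
  proof -
    have "continuous_on UNIV (\<lambda>t. (\<lambda>(s, t). \<omega> s t) (1 - t, t))"
      by (intro continuous_on_compose2[OF c] continuous_intros) simp
    then show ?thesis by simp
  qed
  have "integral\<^sup>L (lborel \<Otimes>\<^sub>M lborel) (\<lambda>(s, t). indicator ?\<Delta> (s, t) * (s * \<omega>s s t + t * \<omega>t s t + 2 * \<omega> s t))
    = integral\<^sup>L (lborel \<Otimes>\<^sub>M lborel) (\<lambda>z. (\<lambda>(s, t). indicator ?\<Delta> (s, t) * (\<omega> s t + s * \<omega>s s t)) z +
        (\<lambda>(s, t). indicator ?\<Delta> (s, t) * (\<omega> s t + t * \<omega>t s t)) z)"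
    by (intro Bochner_Integration.integral_cong refl) (auto simp: algebra_simps)
  also have "\<dots> = integral\<^sup>L (lborel \<Otimes>\<^sub>M lborel) (\<lambda>(s, t). indicator ?\<Delta> (s, t) * (\<omega> s t + s * \<omega>s s t)) +
        integral\<^sup>L (lborel \<Otimes>\<^sub>M lborel) (\<lambda>(s, t). indicator ?\<Delta> (s, t) * (\<omega> s t + t * \<omega>t s t))"
    by (intro Bochner_Integration.integral_add int cfst csnd)
  also have "integral\<^sup>L (lborel \<Otimes>\<^sub>M lborel) (\<lambda>(s, t). indicator ?\<Delta> (s, t) * (\<omega> s t + s * \<omega>s s t))
      = (LINT t|lborel. indicator {0<..<1} t * ((1 - t) * \<omega> (1 - t) t))"
    using lborel_pair.integral_snd[OF int[OF cfst]] by (simp only: 1)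
  also have "integral\<^sup>L (lborel \<Otimes>\<^sub>M lborel) (\<lambda>(s, t). indicator ?\<Delta> (s, t) * (\<omega> s t + t * \<omega>t s t))
      = (LINT s|lborel. indicator {0<..<1} s * ((1 - s) * \<omega> s (1 - s)))"
    using lborel_pair.integral_fst'[OF int[OF csnd]] by (simp only: 2 prod.case)
  also have "\<dots> = (LINT t|lborel. indicator {0<..<1} t * (t * \<omega> (1 - t) t))"
    by (subst lborel_integral_real_affine[where c = "-1" and t = 1])
      (auto intro!: Bochner_Integration.integral_cong split: split_indicator)
  also have "(LINT t|lborel. indicator {0<..<1} t * ((1 - t) * \<omega> (1 - t) t)) +
      (LINT t|lborel. indicator {0<..<1} t * (t * \<omega> (1 - t) t))
    = (LINT t|lborel. indicator {0<..<1} t * ((1 - t) * \<omega> (1 - t) t) + indicator {0<..<1} t * (t * \<omega> (1 - t) t))"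
    by (rule Bochner_Integration.integral_add[symmetric])
      (intro diag continuous_intros cd)+
  also have "\<dots> = (LINT t|lborel. indicator {0<..<1} t * \<omega> (1 - t) t)"
    by (intro Bochner_Integration.integral_cong refl) (auto simp: algebra_simps split: split_indicator)
  finally show ?thesis .
qed

text \<open>The divergence theorem for the field \<open>(x - P) \<psi> x\<close> on a triangle with vertex
  \<open>P\<close>. It is tangential to the two edges through \<open>P\<close>, so that only the
  edge from \<open>A\<close> to \<open>B\<close> contributes. Every integration by parts below
  is an instance of this formula.\<close>

lemma flux_through_opposite_edge:
  assumes deriv: "\<And>x. (\<psi> has_derivative (\<lambda>h. g x \<bullet> h)) (at x)" and cont: "continuous_on UNIV g"
    and D: "cross2 (A - P) (B - P) \<noteq> 0"
  shows "(LINT x|lebesgue_on (tri P A B). g x \<bullet> (x - P) + 2 * \<psi> x)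
    = \<bar>cross2 (A - P) (B - P)\<bar> * edge_integral \<psi> A B"
proof -
  let ?u = "A - P" and ?v = "B - P"
  let ?X = "\<lambda>s t. P + s *\<^sub>R ?u + t *\<^sub>R ?v"
  have K: "open (tri P A B)" by (rule open_tri[OF D])
  have c\<psi>: "continuous_on UNIV \<psi>"
    using deriv by (auto simp: continuous_on_eq_continuous_at intro: has_derivative_continuous)
  have m: "(\<lambda>x. g x \<bullet> (x - P) + 2 * \<psi> x) \<in> borel_measurable borel"
    by (intro borel_measurable_continuous_onI continuous_intros cont c\<psi>)
  then have mi: "(\<lambda>x. indicator (tri P A B) x * (g x \<bullet> (x - P) + 2 * \<psi> x)) \<in> borel_measurable borel"
    using K by (intro borel_measurable_times) auto
  have "(LINT x|lebesgue_on (tri P A B). g x \<bullet> (x - P) + 2 * \<psi> x)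
     = (LINT x|lebesgue. indicator (tri P A B) x * (g x \<bullet> (x - P) + 2 * \<psi> x))"
    using K by (simp add: integral_restrict_space)
  also have "\<dots> = (LINT x|lborel. indicator (tri P A B) x * (g x \<bullet> (x - P) + 2 * \<psi> x))"
    using mi by (intro integral_completion) simp
  also have "\<dots> = \<bar>cross2 ?u ?v\<bar> * integral\<^sup>L (lborel \<Otimes>\<^sub>M lborel) (\<lambda>(s, t).
      indicator (tri P A B) (?X s t) * (g (?X s t) \<bullet> (?X s t - P) + 2 * \<psi> (?X s t)))"
    by (rule integral_plane_affine_coordinates[OF mi D])
  also have "integral\<^sup>L (lborel \<Otimes>\<^sub>M lborel) (\<lambda>(s, t).
      indicator (tri P A B) (?X s t) * (g (?X s t) \<bullet> (?X s t - P) + 2 * \<psi> (?X s t)))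
    = integral\<^sup>L (lborel \<Otimes>\<^sub>M lborel) (\<lambda>(s, t). indicator {(s, t). 0 < s \<and> 0 < t \<and> s + t < 1} (s, t) *
      (s * (g (?X s t) \<bullet> ?u) + t * (g (?X s t) \<bullet> ?v) + 2 * \<psi> (?X s t)))"
  proof (intro Bochner_Integration.integral_cong refl, clarify)
    fix s t :: real
    have "g x \<bullet> (s *\<^sub>R ?u + t *\<^sub>R ?v) = s * (g x \<bullet> ?u) + t * (g x \<bullet> ?v)" for x
      by (simp add: inner_add_right)
    then show "indicator (tri P A B) (?X s t) * (g (?X s t) \<bullet> (?X s t - P) + 2 * \<psi> (?X s t))
      = indicator {(s, t). 0 < s \<and> 0 < t \<and> s + t < 1} (s, t) *
        (s * (g (?X s t) \<bullet> ?u) + t * (g (?X s t) \<bullet> ?v) + 2 * \<psi> (?X s t))"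
      using mem_tri_coordinates[OF D, of s t] by (simp add: indicator_def add.assoc)
  qed
  also have "\<dots> = (LINT t|lborel. indicator {0<..<1} t * \<psi> (?X (1 - t) t))"
  proof (rule flux_unit_triangle)
    have X: "continuous_on UNIV (\<lambda>z. ?X (fst z) (snd z))" by (intro continuous_intros)
    note comp = continuous_on_compose2[OF _ X subset_UNIV]
    show "continuous_on UNIV (\<lambda>(s, t). g (?X s t) \<bullet> ?u)" "continuous_on UNIV (\<lambda>(s, t). g (?X s t) \<bullet> ?v)"
      "continuous_on UNIV (\<lambda>(s, t). \<psi> (?X s t))"
      unfolding case_prod_beta' by (intro continuous_intros comp[OF cont] comp[OF c\<psi>])+
    show "((\<lambda>s. \<psi> (?X s t)) has_real_derivative g (?X s t) \<bullet> ?u) (at s)" for s t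
      unfolding has_field_derivative_def
      by (rule has_derivative_eq_rhs[OF has_derivative_compose[OF _ deriv]])
        (auto intro!: derivative_eq_intros)
    show "((\<lambda>t. \<psi> (?X s t)) has_real_derivative g (?X s t) \<bullet> ?v) (at t)" for s t
      unfolding has_field_derivative_def
      by (rule has_derivative_eq_rhs[OF has_derivative_compose[OF _ deriv]])
        (auto intro!: derivative_eq_intros)
  qed
  also have "\<dots> = edge_integral \<psi> A B"
    unfolding edge_integral_def
    by (intro Bochner_Integration.integral_cong refl) (simp add: algebra_simps)
  finally show ?thesis .
qed

lemma edge_integral_zero:
  assumes "\<And>x. x \<in> open_segment A B \<Longrightarrow> \<psi> x = 0" "A \<noteq> B"
  shows "edge_integral \<psi> A B = 0"
proof -
  have "(\<lambda>r. indicator {0<..<1} r * \<psi> (A + r *\<^sub>R (B - A))) = (\<lambda>r. 0)"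
  proof
    fix r :: real
    show "indicator {0<..<1} r * \<psi> (A + r *\<^sub>R (B - A)) = 0"
    proof (cases "0 < r \<and> r < 1")
      case True
      then have "A + r *\<^sub>R (B - A) \<in> open_segment A B"
        using assms(2) by (auto simp: in_segment algebra_simps intro!: exI[of _ r])
      then show ?thesis using assms(1) by simp
    qed auto
  qed
  then show ?thesis by (simp add: edge_integral_def)
qed

lemma edge_integral_pos:
  assumes c: "continuous_on UNIV \<psi>" and nn: "\<And>x. 0 \<le> \<psi> x"
    and x: "x \<in> open_segment A B" "0 < \<psi> x"
  shows "0 < edge_integral \<psi> A B"
proof -
  let ?f = "\<lambda>r. indicator {0<..<1} r * \<psi> (A + r *\<^sub>R (B - A))"
  have cf: "continuous_on UNIV (\<lambda>r. \<psi> (A + r *\<^sub>R (B - A)))"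
    by (rule continuous_on_compose2[OF c]) (auto intro!: continuous_intros)
  have int: "integrable lborel ?f"
    by (rule integrable_continuous_on_bounded_set[OF _ _ _ cf, of _ "{0..1}"]) auto
  have "edge_integral \<psi> A B \<noteq> 0"
  proof
    assume "edge_integral \<psi> A B = 0"
    then have ae: "AE r in lborel. ?f r = 0"
      unfolding edge_integral_def
      using integral_nonneg_eq_0_iff_AE[OF int] nn by auto
    obtain r where r: "0 < r" "r < 1" "x = A + r *\<^sub>R (B - A)"
      using x(1) by (auto simp: in_segment algebra_simps)
    let ?W = "{0<..<1} \<inter> {r. 0 < \<psi> (A + r *\<^sub>R (B - A))}"
    have "open ?W" by (intro open_Int open_Collect_less cf continuous_intros open_greaterThanLessThan)
    moreover have "r \<in> ?W" using r x(2) by auto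
    ultimately have "\<not> negligible ?W" using open_not_negligible by blast
    moreover have "AE r in lborel. r \<notin> ?W" using ae by eventually_elim auto
    ultimately show False
      using \<open>open ?W\<close> AE_iff_null_sets[of ?W lborel]
      by (simp add: negligible_iff_null_sets null_sets_completion_iff)
  qed
  moreover have "0 \<le> edge_integral \<psi> A B"
    unfolding edge_integral_def using nn by (intro Bochner_Integration.integral_nonneg) auto
  ultimately show ?thesis by simp
qed

section \<open>Bilinear systems of finite rank\<close>

text \<open>Fields are functions on the whole plane that matter only almost everywhere on a subdomain, and
  therefore they form no vector space type. Linearity is expressed through an operation
  \<open>lc\<close>, with \<open>lc c z d w\<close> in the role of \<open>c z + d w\<close>,
  which is seen only through the functionals that respect it.\<close>

definition closed_under :: "(real \<Rightarrow> 'z \<Rightarrow> real \<Rightarrow> 'z \<Rightarrow> 'z) \<Rightarrow> 'z set \<Rightarrow> bool" where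
  "closed_under lc Z \<longleftrightarrow> Z \<noteq> {} \<and> (\<forall>z\<in>Z. \<forall>w\<in>Z. \<forall>c d. lc c z d w \<in> Z)"

definition functional_on :: "(real \<Rightarrow> 'z \<Rightarrow> real \<Rightarrow> 'z \<Rightarrow> 'z) \<Rightarrow> 'z set \<Rightarrow> ('z \<Rightarrow> real) \<Rightarrow> bool" where
  "functional_on lc Z F \<longleftrightarrow> (\<forall>z\<in>Z. \<forall>w\<in>Z. \<forall>c d. F (lc c z d w) = c * F z + d * F w)"

lemma closed_underD: "closed_under lc Z \<Longrightarrow> z \<in> Z \<Longrightarrow> w \<in> Z \<Longrightarrow> lc c z d w \<in> Z"
  by (simp add: closed_under_def)

lemma functional_onD:
  "functional_on lc Z F \<Longrightarrow> z \<in> Z \<Longrightarrow> w \<in> Z \<Longrightarrow> F (lc c z d w) = c * F z + d * F w"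
  by (simp add: functional_on_def)

lemma functional_on_sum:
  assumes "\<And>i. i \<in> I \<Longrightarrow> functional_on lc Z (\<phi> i)"
  shows "functional_on lc Z (\<lambda>z. \<Sum>i\<in>I. a i * \<phi> i z)"
proof -
  have "(\<Sum>i\<in>I. a i * \<phi> i (lc c z d w)) = c * (\<Sum>i\<in>I. a i * \<phi> i z) + d * (\<Sum>i\<in>I. a i * \<phi> i w)"
    if "z \<in> Z" "w \<in> Z" for z w c d
    unfolding sum_distrib_left sum.distrib[symmetric]
    by (intro sum.cong refl) (simp add: functional_onD[OF assms that] algebra_simps)
  then show ?thesis by (simp add: functional_on_def)
qed

text \<open>A functional that vanishes on the common kernel of finitely many functionals is a linear
  combination of them. By induction, this holds on the kernel of one of them; the remaining
  difference vanishes on that kernel, hence is a multiple of it.\<close>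

lemma functional_is_combination:
  assumes "finite I" and "closed_under lc Z" and "functional_on lc Z F"
    and "\<And>i. i \<in> I \<Longrightarrow> functional_on lc Z (\<phi> i)"
    and "\<And>z. z \<in> Z \<Longrightarrow> (\<And>i. i \<in> I \<Longrightarrow> \<phi> i z = 0) \<Longrightarrow> F z = 0"
  shows "\<exists>a. \<forall>z\<in>Z. F z = (\<Sum>i\<in>I. a i * \<phi> i z)"
  using assms
proof (induction I arbitrary: Z)
  case empty
  then show ?case by simp
next
  case (insert j I)
  let ?Z' = "{z \<in> Z. \<phi> j z = 0}"
  note lin = functional_onD[of lc Z]
  have zero: "lc 0 z 0 z \<in> ?Z'" if "z \<in> Z" for z
    using closed_underD[OF insert.prems(1) that that] lin[OF insert.prems(3)[of j] that that]
    by simp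
  have "closed_under lc ?Z'"
    unfolding closed_under_def
  proof (intro conjI ballI allI)
    obtain z where "z \<in> Z" using insert.prems(1) by (auto simp: closed_under_def)
    then show "?Z' \<noteq> {}" using zero by blast
    show "lc c z d w \<in> ?Z'" if "z \<in> ?Z'" "w \<in> ?Z'" for z w c d
      using that closed_underD[OF insert.prems(1)] lin[OF insert.prems(3)[of j]] by simp
  qed
  moreover have "functional_on lc ?Z' F" "\<And>i. i \<in> I \<Longrightarrow> functional_on lc ?Z' (\<phi> i)"
    using insert.prems(2,3) by (auto simp: functional_on_def)
  ultimately have "\<exists>a. \<forall>z\<in>?Z'. F z = (\<Sum>i\<in>I. a i * \<phi> i z)"
    by (rule insert.IH) (use insert.prems(4) in auto)
  then obtain a where a: "\<And>z. z \<in> ?Z' \<Longrightarrow> F z = (\<Sum>i\<in>I. a i * \<phi> i z)" by blast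
  define G where "G z = F z - (\<Sum>i\<in>I. a i * \<phi> i z)" for z
  have G: "functional_on lc Z G"
    using insert.prems(2) functional_on_sum[of I lc Z \<phi> a] insert.prems(3)
    by (simp add: functional_on_def G_def algebra_simps)
  have "\<exists>t. \<forall>z\<in>Z. G z = t * \<phi> j z"
  proof (cases "\<exists>z0\<in>Z. \<phi> j z0 \<noteq> 0")
    case True
    then obtain z0 where z0: "z0 \<in> Z" "\<phi> j z0 \<noteq> 0" by auto
    have "G z = G z0 / \<phi> j z0 * \<phi> j z" if "z \<in> Z" for z
    proof -
      let ?w = "lc 1 z (- \<phi> j z / \<phi> j z0) z0"
      have "?w \<in> ?Z'"
        using closed_underD[OF insert.prems(1) that z0(1)] lin[OF insert.prems(3)[of j] that z0(1)] z0
        by simp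
      then have "G ?w = 0" using a by (simp add: G_def)
      then show ?thesis using lin[OF G that z0(1)] z0 by (simp add: field_simps)
    qed
    then show ?thesis by blast
  next
    case False
    then show ?thesis using a by (auto simp: G_def)
  qed
  then obtain t where "\<And>z. z \<in> Z \<Longrightarrow> G z = t * \<phi> j z" by auto
  then have "F z = (\<Sum>i\<in>insert j I. (a(j := t)) i * \<phi> i z)" if "z \<in> Z" for z
    using that insert.hyps by (subst sum.insert) (auto simp: G_def algebra_simps intro!: sum.cong)
  then show ?case by blast
qed

text \<open>Finitely many elements realise all values of finitely many functionals. A new functional either
  depends on the previous ones, and then the same elements suffice, or is nonzero on some
  \<open>z0\<close> where the others vanish, and then \<open>z0\<close> is added.\<close>

lemma finite_spanning_set:
  assumes "finite I" and "closed_under lc Z"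
    and "\<And>i. i \<in> I \<Longrightarrow> functional_on lc Z (\<phi> i)"
  shows "\<exists>S. finite S \<and> S \<subseteq> Z \<and>
    (\<forall>z\<in>Z. \<exists>c. \<forall>i\<in>I. \<phi> i z = (\<Sum>s\<in>S. c s * \<phi> i s))"
  using assms
proof (induction I)
  case empty
  then show ?case by (intro exI[of _ "{}"]) auto
next
  case (insert j I)
  then obtain S where S: "finite S" "S \<subseteq> Z"
    "\<And>z. z \<in> Z \<Longrightarrow> \<exists>c. \<forall>i\<in>I. \<phi> i z = (\<Sum>s\<in>S. c s * \<phi> i s)" by auto
  show ?case
  proof (cases "\<forall>z\<in>Z. (\<forall>i\<in>I. \<phi> i z = 0) \<longrightarrow> \<phi> j z = 0")
    case True
    then obtain a where a: "\<And>z. z \<in> Z \<Longrightarrow> \<phi> j z = (\<Sum>i\<in>I. a i * \<phi> i z)"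
      using functional_is_combination[of I lc Z "\<phi> j" \<phi>] insert.prems insert.hyps by auto
    have "\<exists>c. \<forall>i\<in>insert j I. \<phi> i z = (\<Sum>s\<in>S. c s * \<phi> i s)" if z: "z \<in> Z" for z
    proof -
      obtain c where c: "\<And>i. i \<in> I \<Longrightarrow> \<phi> i z = (\<Sum>s\<in>S. c s * \<phi> i s)" using S(3)[OF z] by auto
      have "\<phi> j z = (\<Sum>i\<in>I. a i * (\<Sum>s\<in>S. c s * \<phi> i s))" using a[OF z] c by simp
      also have "\<dots> = (\<Sum>s\<in>S. c s * (\<Sum>i\<in>I. a i * \<phi> i s))"
        by (subst sum_distrib_left, subst sum.swap) (simp add: sum_distrib_left algebra_simps)
      also have "\<dots> = (\<Sum>s\<in>S. c s * \<phi> j s)" using a S(2) by (auto intro!: sum.cong)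
      finally show ?thesis using c by auto
    qed
    then show ?thesis using S by blast
  next
    case False
    then obtain z0 where z0: "z0 \<in> Z" "\<And>i. i \<in> I \<Longrightarrow> \<phi> i z0 = 0" "\<phi> j z0 \<noteq> 0" by auto
    have "\<exists>c. \<forall>i\<in>insert j I. \<phi> i z = (\<Sum>s\<in>insert z0 S. c s * \<phi> i s)" if z: "z \<in> Z" for z
    proof -
      obtain c where c: "\<And>i. i \<in> I \<Longrightarrow> \<phi> i z = (\<Sum>s\<in>S. c s * \<phi> i s)" using S(3)[OF z] by auto
      define t where "t = (\<phi> j z - (\<Sum>s\<in>S - {z0}. c s * \<phi> j s)) / \<phi> j z0"
      have split: "(\<Sum>s\<in>insert z0 S. (c(z0 := t)) s * \<phi> i s)
          = t * \<phi> i z0 + (\<Sum>s\<in>S - {z0}. c s * \<phi> i s)" for i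
        using S(1) by (subst sum.insert_remove) (auto intro!: sum.cong)
      have "\<phi> i z = (\<Sum>s\<in>S - {z0}. c s * \<phi> i s)" if "i \<in> I" for i
        using c[OF that] z0(2)[OF that] sum.remove[OF S(1), of z0 "\<lambda>s. c s * \<phi> i s"]
        by (cases "z0 \<in> S") simp_all
      then have "\<forall>i\<in>insert j I. \<phi> i z = (\<Sum>s\<in>insert z0 S. (c(z0 := t)) s * \<phi> i s)"
        unfolding split using z0 by (auto simp: t_def)
      then show ?thesis by blast
    qed
    moreover have "finite (insert z0 S)" "insert z0 S \<subseteq> Z" using S z0 by auto
    ultimately show ?thesis by blast
  qed
qed

lemma combination_exists:
  assumes "closed_under lc Z" "finite S" "S \<subseteq> Z"
  shows "\<exists>z\<in>Z. \<forall>F. functional_on lc Z F \<longrightarrow> F z = (\<Sum>s\<in>S. c s * F s)"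
  using assms(2,3)
proof (induction S)
  case empty
  obtain z where "z \<in> Z" using assms(1) by (auto simp: closed_under_def)
  then show ?case using assms(1)
    by (intro bexI[of _ "lc 0 z 0 z"]) (auto simp: closed_underD functional_onD)
next
  case (insert s S)
  then obtain z where z: "z \<in> Z" "\<And>F. functional_on lc Z F \<Longrightarrow> F z = (\<Sum>s\<in>S. c s * F s)" by auto
  have s: "s \<in> Z" using insert.prems by simp
  have "F (lc (c s) s 1 z) = (\<Sum>s\<in>insert s S. c s * F s)" if "functional_on lc Z F" for F
    using functional_onD[OF that s z(1)] z(2)[OF that] insert.hyps by simp
  then show ?case using closed_underD[OF assms(1) s z(1)] by blast
qed

text \<open>The finitely many functionals \<open>\<kappa>\<close> serve as coordinates: an element on which
  they all vanish counts as zero. The form \<open>M\<close> depends on the coordinates only, and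
  its left and right kernels are zero in this sense.\<close>

locale finite_bilinear =
  fixes lc :: "real \<Rightarrow> 'z \<Rightarrow> real \<Rightarrow> 'z \<Rightarrow> 'z" and Z :: "'z set"
    and I :: "'i set" and \<kappa> :: "'i \<Rightarrow> 'z \<Rightarrow> real" and M :: "'z \<Rightarrow> 'z \<Rightarrow> real"
  assumes closed: "closed_under lc Z" and finite_I: "finite I"
    and coord: "\<And>i. i \<in> I \<Longrightarrow> functional_on lc Z (\<kappa> i)"
    and left: "\<And>w. w \<in> Z \<Longrightarrow> functional_on lc Z (\<lambda>z. M z w)"
    and right: "\<And>z. z \<in> Z \<Longrightarrow> functional_on lc Z (M z)"
    and left_null: "\<And>z w. z \<in> Z \<Longrightarrow> w \<in> Z \<Longrightarrow> (\<And>i. i \<in> I \<Longrightarrow> \<kappa> i z = 0) \<Longrightarrow> M z w = 0"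
    and right_null: "\<And>z w. z \<in> Z \<Longrightarrow> w \<in> Z \<Longrightarrow> (\<And>i. i \<in> I \<Longrightarrow> \<kappa> i w = 0) \<Longrightarrow> M z w = 0"
    and left_kernel: "\<And>z i. z \<in> Z \<Longrightarrow> (\<And>w. w \<in> Z \<Longrightarrow> M z w = 0) \<Longrightarrow> i \<in> I \<Longrightarrow> \<kappa> i z = 0"
    and right_kernel: "\<And>w i. w \<in> Z \<Longrightarrow> (\<And>z. z \<in> Z \<Longrightarrow> M z w = 0) \<Longrightarrow> i \<in> I \<Longrightarrow> \<kappa> i w = 0"
begin

definition determined :: "('z \<Rightarrow> real) \<Rightarrow> bool" where
  "determined F \<longleftrightarrow>
     functional_on lc Z F \<and> (\<forall>z\<in>Z. (\<forall>i\<in>I. \<kappa> i z = 0) \<longrightarrow> F z = 0)"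

text \<open>One finite set spans all of \<open>Z\<close> for all determined functionals simultaneously,
  since these are combinations of the coordinates.\<close>

lemma spanning_set:
  "\<exists>S. finite S \<and> S \<subseteq> Z \<and> (\<forall>z\<in>Z. \<exists>c. \<forall>F. determined F \<longrightarrow> F z = (\<Sum>s\<in>S. c s * F s))"
proof -
  obtain S where S: "finite S" "S \<subseteq> Z"
    "\<And>z. z \<in> Z \<Longrightarrow> \<exists>c. \<forall>i\<in>I. \<kappa> i z = (\<Sum>s\<in>S. c s * \<kappa> i s)"
    using finite_spanning_set[where \<phi> = \<kappa>, OF finite_I closed coord] by auto
  have "\<exists>c. \<forall>F. determined F \<longrightarrow> F z = (\<Sum>s\<in>S. c s * F s)" if z: "z \<in> Z" for z
  proof -
    obtain c where c: "\<And>i. i \<in> I \<Longrightarrow> \<kappa> i z = (\<Sum>s\<in>S. c s * \<kappa> i s)" using S(3)[OF z] by blast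
    have "F z = (\<Sum>s\<in>S. c s * F s)" if F: "determined F" for F
    proof -
      have "\<exists>a. \<forall>z\<in>Z. F z = (\<Sum>i\<in>I. a i * \<kappa> i z)"
        by (rule functional_is_combination[OF finite_I closed])
          (use F coord in \<open>auto simp: determined_def\<close>)
      then obtain a where a: "\<And>z. z \<in> Z \<Longrightarrow> F z = (\<Sum>i\<in>I. a i * \<kappa> i z)" by blast
      have "F z = (\<Sum>i\<in>I. a i * (\<Sum>s\<in>S. c s * \<kappa> i s))" using a[OF z] c by simp
      also have "\<dots> = (\<Sum>s\<in>S. c s * (\<Sum>i\<in>I. a i * \<kappa> i s))"
        by (subst sum_distrib_left, subst sum.swap) (simp add: sum_distrib_left algebra_simps)
      also have "\<dots> = (\<Sum>s\<in>S. c s * F s)" using a S(2) by (auto intro!: sum.cong)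
      finally show ?thesis .
    qed
    then show ?thesis by blast
  qed
  with S(1,2) show ?thesis by blast
qed

text \<open>The functionals \<open>M s\<close>, for \<open>s\<close> in a finite spanning set, have trivial
  common kernel because the right kernel of \<open>M\<close> is trivial. Hence \<open>F\<close>
  is a combination of them, and the same combination of the elements \<open>s\<close> solves the
  equation.\<close>

lemma solvable:
  assumes F: "determined F"
  shows "\<exists>z\<in>Z. \<forall>w\<in>Z. M z w = F w"
proof -
  obtain S where S: "finite S" "S \<subseteq> Z"
    "\<And>z. z \<in> Z \<Longrightarrow> \<exists>c. \<forall>F. determined F \<longrightarrow> F z = (\<Sum>s\<in>S. c s * F s)"
    using spanning_set by blast
  have "\<exists>c. \<forall>w\<in>Z. F w = (\<Sum>s\<in>S. c s * M s w)"
  proof (rule functional_is_combination[OF S(1) closed])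
    show "functional_on lc Z F" using F by (simp add: determined_def)
    show "functional_on lc Z (M s)" if "s \<in> S" for s using right that S(2) by blast
    fix w assume w: "w \<in> Z" and Sw: "\<And>s. s \<in> S \<Longrightarrow> M s w = 0"
    have "M z w = 0" if z: "z \<in> Z" for z
    proof -
      have "determined (\<lambda>z. M z w)"
        using left[OF w] left_null[OF _ w] by (simp add: determined_def)
      with S(3)[OF z] obtain c where "M z w = (\<Sum>s\<in>S. c s * M s w)" by blast
      then show ?thesis using Sw by simp
    qed
    then have "\<kappa> i w = 0" if "i \<in> I" for i using right_kernel[OF w _ that] by simp
    then show "F w = 0" using F w by (simp add: determined_def)
  qed
  then obtain c where c: "\<And>w. w \<in> Z \<Longrightarrow> F w = (\<Sum>s\<in>S. c s * M s w)" by blast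
  obtain z where z: "z \<in> Z" "\<And>G. functional_on lc Z G \<Longrightarrow> G z = (\<Sum>s\<in>S. c s * G s)"
    using combination_exists[OF closed S(1,2), of c] by blast
  have "M z w = F w" if "w \<in> Z" for w
    using z(2)[OF left[OF that]] c[OF that] by simp
  then show ?thesis using z(1) by blast
qed

text \<open>Quantitative uniqueness: the left kernel of \<open>M\<close> being trivial, every coordinate is
  a fixed combination of the values of \<open>M z\<close> on finitely many test elements. This
  yields the bound of a solution by the data.\<close>

lemma coordinates_from_tests:
  "\<exists>S b. finite S \<and> S \<subseteq> Z \<and> (\<forall>i\<in>I. \<forall>z\<in>Z. \<kappa> i z = (\<Sum>s\<in>S. b i s * M z s))"
proof -
  obtain S where S: "finite S" "S \<subseteq> Z"
    "\<And>z. z \<in> Z \<Longrightarrow> \<exists>c. \<forall>F. determined F \<longrightarrow> F z = (\<Sum>s\<in>S. c s * F s)"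
    using spanning_set by blast
  have "\<exists>b. \<forall>z\<in>Z. \<kappa> i z = (\<Sum>s\<in>S. b s * M z s)" if i: "i \<in> I" for i
  proof (rule functional_is_combination[OF S(1) closed coord[OF i]])
    show "functional_on lc Z (\<lambda>z. M z s)" if "s \<in> S" for s using left that S(2) by blast
    fix z assume z: "z \<in> Z" and Sz: "\<And>s. s \<in> S \<Longrightarrow> M z s = 0"
    show "\<kappa> i z = 0"
    proof (rule left_kernel[OF z _ i])
      fix w assume w: "w \<in> Z"
      have "determined (M z)"
        using right[OF z] right_null[OF z] by (simp add: determined_def)
      with S(3)[OF w] obtain c where "M z w = (\<Sum>s\<in>S. c s * M z s)" by blast
      then show "M z w = 0" using Sz by simp
    qed
  qed
  then have "\<forall>i\<in>I. \<exists>b. \<forall>z\<in>Z. \<kappa> i z = (\<Sum>s\<in>S. b s * M z s)" by blast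
  from bchoice[OF this] obtain b where "\<forall>i\<in>I. \<forall>z\<in>Z. \<kappa> i z = (\<Sum>s\<in>S. b i s * M z s)" by blast
  with S(1,2) show ?thesis by blast
qed

end

section \<open>Triangles\<close>

definition triangle :: "plane set \<Rightarrow> plane \<Rightarrow> plane \<Rightarrow> plane \<Rightarrow> bool" where
  "triangle K P A B \<longleftrightarrow> cross2 (A - P) (B - P) \<noteq> 0 \<and> K = tri P A B"

lemma cross2_zero_parallel:
  assumes "cross2 u v = 0" "u \<noteq> 0" shows "\<exists>c. v = c *\<^sub>R u"
proof (cases "u$1 = 0")
  case True
  then have "u$2 \<noteq> 0" using assms(2) by (auto simp: vec_eq_iff forall_2)
  then show ?thesis using assms(1) True
    by (intro exI[of _ "v$2 / u$2"]) (auto simp: vec_eq_iff forall_2 cross2_def field_simps)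
next
  case False
  then show ?thesis using assms(1)
    by (intro exI[of _ "v$1 / u$1"]) (auto simp: vec_eq_iff forall_2 cross2_def field_simps)
qed

lemma noncollinear_iff_cross2: "\<not> collinear {P, A, B} \<longleftrightarrow> cross2 (A - P) (B - P) \<noteq> 0"
proof -
  have "collinear {P, A, B} \<longleftrightarrow> collinear {A, P, B}" by (simp add: insert_commute)
  also have "\<dots> \<longleftrightarrow> A - P = 0 \<or> B - P = 0 \<or> (\<exists>c. B - P = c *\<^sub>R (A - P))"
    by (subst collinear_3) (auto simp: collinear_lemma)
  also have "\<dots> \<longleftrightarrow> cross2 (A - P) (B - P) = 0"
  proof -
    have "cross2 u (c *\<^sub>R u) = 0" "cross2 0 u = 0" "cross2 u 0 = 0" for u c by (simp_all add: cross2_def)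
    then show ?thesis using cross2_zero_parallel[of "A - P" "B - P"] by metis
  qed
  finally show ?thesis by simp
qed

lemma interior_convex_hull_tri:
  assumes D: "cross2 (A - P) (B - P) \<noteq> 0"
  shows "interior (convex hull {P, A, B}) = tri P A B"
proof -
  have "interior (convex hull {P, A, B}) = {v. \<exists>x y z. 0 < x \<and> 0 < y \<and> 0 < z \<and> x + y + z = 1 \<and>
      x *\<^sub>R P + y *\<^sub>R A + z *\<^sub>R B = v}"
    by (rule interior_convex_hull_3_minimal) (use D noncollinear_iff_cross2 in auto)
  also have "\<dots> = tri P A B"
  proof safe
    fix x y z :: real assume *: "0 < x" "0 < y" "0 < z" "x + y + z = 1"
    then have x: "x = 1 - y - z" by simp
    have "x *\<^sub>R P + y *\<^sub>R A + z *\<^sub>R B = P + y *\<^sub>R (A - P) + z *\<^sub>R (B - P)"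
      by (simp add: x algebra_simps)
    then show "x *\<^sub>R P + y *\<^sub>R A + z *\<^sub>R B \<in> tri P A B" using * unfolding tri_def by force
  next
    fix v assume "v \<in> tri P A B"
    then obtain s t where v: "v = P + s *\<^sub>R (A - P) + t *\<^sub>R (B - P)" "0 < s" "0 < t" "s + t < 1"
      by (auto simp: tri_def)
    then show "\<exists>x y z. 0 < x \<and> 0 < y \<and> 0 < z \<and> x + y + z = 1 \<and> x *\<^sub>R P + y *\<^sub>R A + z *\<^sub>R B = v"
      by (intro exI[of _ "1 - s - t"] exI[of _ s] exI[of _ t]) (auto simp: algebra_simps)
  qed
  finally show ?thesis .
qed

lemma triangle_eq_interior:
  "triangle K P A B \<longleftrightarrow> \<not> collinear {P, A, B} \<and> K = interior (convex hull {P, A, B})"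
  using interior_convex_hull_tri[of A P B] noncollinear_iff_cross2[of P A B]
  by (auto simp: triangle_def)

lemma triangle_open: "triangle K P A B \<Longrightarrow> open K"
  by (auto simp: triangle_eq_interior)

lemma triangle_convex: "triangle K P A B \<Longrightarrow> convex K"
  by (simp add: triangle_eq_interior convex_interior)

lemma triangle_nonempty: "triangle K P A B \<Longrightarrow> K \<noteq> {}"
proof -
  assume "triangle K P A B"
  then have "P + (1/3) *\<^sub>R (A - P) + (1/3) *\<^sub>R (B - P) \<in> K"
    using mem_tri_coordinates[of A P B "1/3" "1/3"] by (simp add: triangle_def)
  then show ?thesis by blast
qed

lemma triangle_closure: "triangle K P A B \<Longrightarrow> closure K = convex hull {P, A, B}"
proof -
  assume t: "triangle K P A B"
  then have ne: "interior (convex hull {P, A, B}) \<noteq> {}"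
    using triangle_nonempty by (auto simp: triangle_eq_interior)
  have "closure (interior (convex hull {P, A, B})) = closure (convex hull {P, A, B})"
    by (rule convex_closure_interior[OF convex_convex_hull ne])
  also have "\<dots> = convex hull {P, A, B}"
    by (rule closure_closed) (simp add: compact_convex_hull compact_imp_closed finite_imp_compact)
  finally show ?thesis using t by (simp add: triangle_eq_interior)
qed

lemma triangle_interior_closure: "triangle K P A B \<Longrightarrow> interior (closure K) = K"
  using triangle_closure[of K P A B] by (simp add: triangle_eq_interior)

lemma triangle_distinct: "triangle K P A B \<Longrightarrow> P \<noteq> A \<and> P \<noteq> B \<and> A \<noteq> B"
  by (auto simp: triangle_def cross2_def)

lemma triangle_extreme:
  assumes "triangle K P A B"
  shows "x extreme_point_of closure K \<longleftrightarrow> x \<in> {P, A, B}"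
proof -
  have "\<not> affine_dependent {P, A, B}"
    using assms triangle_distinct[OF assms] collinear_3_eq_affine_dependent[of P A B]
    by (simp add: triangle_eq_interior)
  from extreme_point_of_convex_hull_affine_independent[OF this]
  show ?thesis by (simp add: triangle_closure[OF assms])
qed

lemma triangle_boundary_cases:
  assumes t: "triangle K P A B" and x: "x \<in> closure K" "x \<notin> K"
  shows "x \<in> {P, A, B} \<or> x \<in> open_segment A B \<or> x \<in> open_segment P A \<or> x \<in> open_segment P B"
proof -
  obtain u v w where u: "0 \<le> u" "0 \<le> v" "0 \<le> w" "u + v + w = 1" "x = u *\<^sub>R P + v *\<^sub>R A + w *\<^sub>R B"
    using x(1) triangle_closure[OF t] by (auto simp: convex_hull_3)
  note d = triangle_distinct[OF t]
  have seg: "x \<in> {X, Y} \<or> x \<in> open_segment X Y" if "X \<noteq> Y" "0 \<le> c" "0 \<le> d" "c + d = 1" "x = c *\<^sub>R X + d *\<^sub>R Y"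
    for X Y c d
  proof (cases "c = 0 \<or> d = 0")
    case False
    then have "x \<in> open_segment X Y" using that by (auto simp: in_segment intro!: exI[of _ d])
    then show ?thesis ..
  qed (use that in auto)
  consider "u = 0" | "v = 0" | "w = 0" | "0 < u" "0 < v" "0 < w" using u by linarith
  then show ?thesis
  proof cases
    case 1
    then show ?thesis using seg[of A B v w] u d by auto
  next
    case 2
    then show ?thesis using seg[of P B u w] u d by auto
  next
    case 3
    then show ?thesis using seg[of P A u v] u d by auto
  next
    case 4
    have e: "u = 1 - v - w" using u by simp
    have "x = P + v *\<^sub>R (A - P) + w *\<^sub>R (B - P)" unfolding u(5) e by (simp add: algebra_simps)
    then have "x \<in> tri P A B" using 4 u(4) unfolding tri_def by force
    then show ?thesis using x(2) t by (simp add: triangle_def)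
  qed
qed

definition rot :: "plane \<Rightarrow> plane" where "rot w = vector [- w$2, w$1]"

lemma inner_rot: "y \<bullet> rot w = cross2 w y"
  by (simp add: rot_def inner_vec_def sum_2 cross2_def)

lemma unit_normal_exists:
  assumes t: "triangle K P A B"
  shows "\<exists>n. norm n = 1 \<and> (B - A) \<bullet> n = 0 \<and> (P - A) \<bullet> n < 0"
proof -
  define c m where "c = cross2 (B - A) (P - A)" and "m = rot (B - A)"
  have c: "c \<noteq> 0" using t by (simp add: c_def triangle_def cross2_def algebra_simps)
  have Pm: "(P - A) \<bullet> m = c" by (simp add: m_def c_def inner_rot)
  have Bm: "(B - A) \<bullet> m = 0" by (simp add: m_def inner_rot cross2_def)
  have m: "m \<noteq> 0" using c Pm by auto
  let ?n = "(- sgn c / norm m) *\<^sub>R m"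
  have "norm ?n = 1" using m c by (simp add: sgn_if)
  moreover have "(B - A) \<bullet> ?n = 0" by (simp add: Bm)
  moreover have "(P - A) \<bullet> ?n < 0"
  proof -
    have "(P - A) \<bullet> ?n = - (\<bar>c\<bar> / norm m)" by (simp add: Pm abs_sgn mult.commute)
    then show ?thesis using c m by simp
  qed
  ultimately show ?thesis by blast
qed

lemma open_segment_normal:
  assumes "x \<in> open_segment A B" "(B - A) \<bullet> n = 0"
  shows "A \<bullet> n = x \<bullet> n" "B \<bullet> n = x \<bullet> n"
proof -
  from assms obtain u where "x = (1 - u) *\<^sub>R A + u *\<^sub>R B" by (auto simp: in_segment)
  then have x: "x = A + u *\<^sub>R (B - A)" by (simp add: algebra_simps)
  show "A \<bullet> n = x \<bullet> n" "B \<bullet> n = x \<bullet> n"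
    using assms(2) by (auto simp: x inner_add_left inner_diff_left)
qed

text \<open>In barycentric coordinates, the conditions for the two edges through \<open>P\<close> are strict
  at \<open>x\<close> and remain valid nearby; the third one is the sign condition on the normal
  coordinate.\<close>

lemma triangle_half_disc:
  assumes t: "triangle K P A B" and x: "x \<in> open_segment A B"
    and n: "(B - A) \<bullet> n = 0" "(P - x) \<bullet> n < 0"
  shows "\<exists>r>0. \<forall>y\<in>ball x r. y \<in> K \<longleftrightarrow> (y - x) \<bullet> n < 0"
proof -
  let ?u = "A - P" and ?v = "B - P"
  have D: "cross2 ?u ?v \<noteq> 0" and K: "K = tri P A B" using t by (auto simp: triangle_def)
  define S where "S y = cross2 (y - P) ?v / cross2 ?u ?v" for y
  define T where "T y = cross2 ?u (y - P) / cross2 ?u ?v" for y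
  have rep: "y = P + S y *\<^sub>R ?u + T y *\<^sub>R ?v" for y
  proof -
    have "cross2 ?u ?v *\<^sub>R (y - P) = cross2 (y - P) ?v *\<^sub>R ?u + cross2 ?u (y - P) *\<^sub>R ?v"
      by (simp add: vec_eq_iff forall_2 cross2_def algebra_simps)
    note e = this
    have "y - P = (1 / cross2 ?u ?v) *\<^sub>R (cross2 ?u ?v *\<^sub>R (y - P))" using D by simp
    also have "\<dots> = S y *\<^sub>R ?u + T y *\<^sub>R ?v"
      unfolding e scaleR_add_right scaleR_scaleR S_def T_def by simp
    finally have "y = S y *\<^sub>R ?u + T y *\<^sub>R ?v + P" unfolding diff_eq_eq .
    then show ?thesis unfolding add.commute[of _ P] add.assoc .
  qed
  have mem: "y \<in> K \<longleftrightarrow> 0 < S y \<and> 0 < T y \<and> S y + T y < 1" for y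
    using mem_tri_coordinates[OF D, of "S y" "T y"] by (simp only: rep[of y, symmetric] K)
  note An = open_segment_normal[OF x n(1)]
  (* The normal coordinate is the barycentric coordinate of P, up to a factor. *)
  have lin: "(y - x) \<bullet> n = (1 - S y - T y) * ((P - x) \<bullet> n)" for y
  proof -
    have "(y - x) \<bullet> n = (P + S y *\<^sub>R ?u + T y *\<^sub>R ?v - x) \<bullet> n" by (simp only: rep[of y, symmetric])
    also have "\<dots> = P \<bullet> n + S y * (A \<bullet> n - P \<bullet> n) + T y * (B \<bullet> n - P \<bullet> n) - x \<bullet> n"
      by (simp only: inner_add_left inner_diff_left inner_scaleR_left)
    also have "\<dots> = (1 - S y - T y) * (P \<bullet> n - x \<bullet> n)"
    proof -
      have "p + s * (q - p) + t * (q - p) - q = (1 - s - t) * (p - q)" for p q s t :: real by algebra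
      then show ?thesis unfolding An by blast
    qed
    also have "\<dots> = (1 - S y - T y) * ((P - x) \<bullet> n)" by (simp only: inner_diff_left)
    finally show ?thesis .
  qed
  obtain c where c: "0 < c" "c < 1" "x = (1 - c) *\<^sub>R A + c *\<^sub>R B"
    using x by (auto simp: in_segment)
  have "cross2 (x - P) ?v = (1 - c) * cross2 ?u ?v" "cross2 ?u (x - P) = c * cross2 ?u ?v"
    unfolding c(3) by (simp_all add: cross2_def algebra_simps)
  then have "0 < S x" "0 < T x" using c(1,2) D by (simp_all add: S_def T_def)
  moreover have "continuous_on UNIV S" "continuous_on UNIV T"
  proof -
    have "continuous_on UNIV (\<lambda>y. cross2 (y - P) ?v)" "continuous_on UNIV (\<lambda>y. cross2 ?u (y - P))"
      unfolding cross2_def by (intro continuous_intros)+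
    then show "continuous_on UNIV S" "continuous_on UNIV T"
      unfolding S_def T_def using D by (simp_all add: continuous_on_divide)
  qed
  ultimately have "open ({y. 0 < S y} \<inter> {y. 0 < T y})" "x \<in> {y. 0 < S y} \<inter> {y. 0 < T y}"
    using open_Collect_less[OF continuous_on_const, of S 0] open_Collect_less[OF continuous_on_const, of T 0]
    by auto
  then obtain r where r: "0 < r" "ball x r \<subseteq> {y. 0 < S y} \<inter> {y. 0 < T y}"
    by (rule openE)
  have "y \<in> K \<longleftrightarrow> (y - x) \<bullet> n < 0" if "y \<in> ball x r" for y
  proof -
    have "0 < S y" "0 < T y" using r(2) that by auto
    then show ?thesis using n(2) by (auto simp: mem lin[of y] mult_less_0_iff)
  qed
  then show ?thesis using r(1) by blast
qed

text \<open>Otherwise the vertices would be collinear.\<close>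

lemma triangle_apex_off_line:
  assumes t: "triangle K P A B" and x: "x \<in> open_segment A B" and n: "(B - A) \<bullet> n = 0" "n \<noteq> 0"
  shows "(P - x) \<bullet> n \<noteq> 0"
proof
  assume 0: "(P - x) \<bullet> n = 0"
  have "(P - A) \<bullet> n = 0" using 0 open_segment_normal(1)[OF x n(1)] by (simp add: inner_diff_left)
  then have "(B - A)$1 * n$1 + (B - A)$2 * n$2 = 0" "(P - A)$1 * n$1 + (P - A)$2 * n$2 = 0"
    using n(1) by (simp_all add: inner_vec_def sum_2)
  moreover have "(a * q - b * p) * c = 0 \<and> (a * q - b * p) * d = 0"
    if "a * c + b * d = 0" "p * c + q * d = 0" for a b c d p q :: real
    using that by algebra
  ultimately have "cross2 (B - A) (P - A) * n$1 = 0" "cross2 (B - A) (P - A) * n$2 = 0"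
    unfolding cross2_def by blast+
  moreover have "cross2 (B - A) (P - A) \<noteq> 0"
    using t by (simp add: triangle_def cross2_def algebra_simps)
  ultimately show False using n(2) by (simp add: vec_eq_iff forall_2)
qed

section \<open>The mesh\<close>

lemma half_disc_line_not_null:
  fixes x n :: plane
  assumes n: "norm n = 1" and r: "0 < r"
  shows "0 < hausdorff1_outer {y \<in> ball x r. (y - x) \<bullet> n = 0}"
proof -
  have nn: "n \<noteq> 0" using n by auto
  define m where "m = rot n"
  have mn: "m \<bullet> n = 0" by (simp add: m_def inner_commute inner_rot cross2_def)
  have mm: "m \<bullet> m = 1"
  proof -
    have "m \<bullet> m = n \<bullet> n" by (simp add: m_def rot_def inner_vec_def sum_2)
    then show ?thesis using n by (simp add: norm_eq_1)
  qed
  have nm: "norm m = 1" using mm by (simp add: norm_eq_1)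
  let ?A = "{y \<in> ball x r. (y - x) \<bullet> n = 0}"
  have "ennreal (r / 2 - 0) \<le> hausdorff1_outer ?A"
  proof (rule hausdorff1_outer_projection[where f = "\<lambda>y. (y - x) \<bullet> m"])
    fix y z
    have "\<bar>(y - z) \<bullet> m\<bar> \<le> norm (y - z) * norm m" by (rule Cauchy_Schwarz_ineq2)
    moreover have "(y - x) \<bullet> m - (z - x) \<bullet> m = (y - z) \<bullet> m" by (simp add: inner_diff_left)
    ultimately show "\<bar>(y - x) \<bullet> m - (z - x) \<bullet> m\<bar> \<le> dist y z" by (simp add: nm dist_norm)
  next
    show "{0..r / 2} \<subseteq> (\<lambda>y. (y - x) \<bullet> m) ` ?A"
    proof
      fix t assume t: "t \<in> {0..r / 2}"
      have "x + t *\<^sub>R m \<in> ?A" using t r by (simp add: mn dist_norm nm)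
      moreover have "t = (x + t *\<^sub>R m - x) \<bullet> m" by (simp add: mm)
      ultimately show "t \<in> (\<lambda>y. (y - x) \<bullet> m) ` ?A" by blast
    qed
  qed (use r in simp)
  moreover have "0 < ennreal (r / 2 - 0)" using r by simp
  ultimately show ?thesis by (rule less_le_trans[rotated])
qed

lemma connected_cover_by_disjoint_open:
  assumes "connected S" "\<And>U. U \<in> \<U> \<Longrightarrow> open U" "disjoint \<U>" "S \<subseteq> \<Union>\<U>" "U \<in> \<U>" "S \<inter> U \<noteq> {}"
  shows "S \<subseteq> U"
proof (rule ccontr)
  assume "\<not> S \<subseteq> U"
  let ?V = "\<Union>(\<U> - {U})"
  have "open U" "open ?V" using assms(2,5) by auto
  moreover have "U \<inter> ?V \<inter> S = {}" using assms(3,5) by (auto simp: disjoint_def)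
  moreover have "S \<subseteq> U \<union> ?V" using assms(4) by blast
  moreover have "?V \<inter> S \<noteq> {}" using \<open>\<not> S \<subseteq> U\<close> assms(4) by blast
  ultimately show False using assms(1,6) connectedD[of S U ?V] by blast
qed

locale bipartite_mesh =
  fixes \<Omega> :: "plane set" and G1 G2 \<T> :: "plane set set"
  assumes polygon_\<Omega>: "polygon \<Omega>" and map: "bipartite_map \<Omega> G1 G2"
    and geom: "geometric_assumptions G1 G2" and triang: "triangulation_of \<Omega> \<T>"
    and consistent: "consistent_with \<T> G1 G2"
begin

abbreviation "\<Omega>\<^sub>1 \<equiv> \<Union>G1"
abbreviation "\<Omega>\<^sub>2 \<equiv> \<Union>G2"
abbreviation "\<Gamma> \<equiv> interface \<Omega> G1 G2"

definition mesh_vertices :: "plane set" where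
  "mesh_vertices = {x. \<exists>K\<in>\<T>. x extreme_point_of closure K}"

lemma open_\<Omega>: "open \<Omega>" and bounded_\<Omega>: "bounded \<Omega>" and connected_\<Omega>: "connected \<Omega>"
  and interior_closure_\<Omega>: "interior (closure \<Omega>) = \<Omega>"
  using polygon_\<Omega> by (auto simp: polygon_def)

lemma finite_regions: "finite (G1 \<union> G2)"
  and region_open: "G \<in> G1 \<union> G2 \<Longrightarrow> open G"
  and region_subset: "G \<in> G1 \<union> G2 \<Longrightarrow> G \<subseteq> \<Omega>"
  and regions_disjoint: "disjoint (G1 \<union> G2)"
  and closure_regions: "closure \<Omega> = (\<Union>G\<in>G1 \<union> G2. closure G)"
  and colours_disjoint: "G1 \<inter> G2 = {}"
  using map unfolding bipartite_map_def by auto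

lemma region_interior_closure: "G \<in> G1 \<union> G2 \<Longrightarrow> interior (closure G) = G"
  using geom unfolding geometric_assumptions_def polygon_def by blast

lemma regions_Int: "G \<in> G1 \<union> G2 \<Longrightarrow> G' \<in> G1 \<union> G2 \<Longrightarrow> G \<noteq> G' \<Longrightarrow> G \<inter> G' = {}"
  using regions_disjoint unfolding disjoint_def by blast

text \<open>This is where the colouring enters the geometry of the mesh: it excludes that two regions of the
  same colour share an edge.\<close>

lemma same_colour_null:
  assumes "\<C> = G1 \<or> \<C> = G2" "G \<in> \<C>" "G' \<in> \<C>" "G \<noteq> G'"
  shows "hausdorff1_outer (frontier G \<inter> frontier G') = 0"
proof -
  have "\<C> \<in> {G1, G2}" using assms(1) by blast
  moreover have "\<forall>\<C>\<in>{G1, G2}. \<forall>G\<in>\<C>. \<forall>G'\<in>\<C>. G \<noteq> G' \<longrightarrow> frontier G \<inter> frontier G' \<in> null_sets hausdorff1"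
    using map unfolding bipartite_map_def by (elim conjE)
  ultimately have "\<forall>G\<in>\<C>. \<forall>G'\<in>\<C>. G \<noteq> G' \<longrightarrow> frontier G \<inter> frontier G' \<in> null_sets hausdorff1"
    by (rule bspec[rotated])
  then have "frontier G \<inter> frontier G' \<in> null_sets hausdorff1"
    using assms(2-4) by simp
  then show ?thesis by (subst (asm) hausdorff1_null_sets_iff) auto
qed

lemma open_\<Omega>1: "open \<Omega>\<^sub>1" and open_\<Omega>2: "open \<Omega>\<^sub>2"
  using region_open by auto

lemma \<Omega>1_subset: "\<Omega>\<^sub>1 \<subseteq> \<Omega>" and \<Omega>2_subset: "\<Omega>\<^sub>2 \<subseteq> \<Omega>"
  using region_subset by auto

lemma \<Omega>12_disjoint: "\<Omega>\<^sub>1 \<inter> \<Omega>\<^sub>2 = {}"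
proof -
  have "G \<inter> G' = {}" if "G \<in> G1" "G' \<in> G2" for G G'
    using regions_Int[of G G'] colours_disjoint that by blast
  then show ?thesis by blast
qed

lemma element_triangle: "K \<in> \<T> \<Longrightarrow> \<exists>P A B. triangle K P A B"
proof -
  assume "K \<in> \<T>"
  then obtain S where S: "2 simplex S" "K = interior S"
    using triang unfolding triangulation_of_def by blast
  then obtain C where C: "\<not> affine_dependent C" "int (card C) = 3" "S = convex hull C"
    unfolding simplex_def by auto
  then have "card C = 3" by simp
  then obtain P A B where PAB: "C = {P, A, B}" "P \<noteq> A" "P \<noteq> B" "A \<noteq> B"
    unfolding card_3_iff by blast
  then have "\<not> collinear {P, A, B}"
    using C(1) collinear_3_eq_affine_dependent[of P A B] by simp
  then have "triangle K P A B" using S C PAB by (simp add: triangle_eq_interior)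
  then show ?thesis by blast
qed

lemma
  assumes "K \<in> \<T>"
  shows element_open: "open K" and element_convex: "convex K"
    and element_nonempty: "K \<noteq> {}" and element_interior_closure: "interior (closure K) = K"
proof -
  obtain P A B where "triangle K P A B" using element_triangle[OF assms] by blast
  then show "open K" "convex K" "K \<noteq> {}" "interior (closure K) = K"
    by (rule triangle_open triangle_convex triangle_nonempty triangle_interior_closure)+
qed

lemma finite_\<T>: "finite \<T>"
proof -
  have "finite (closure ` \<T>)"
    using triang unfolding triangulation_of_def triangulation_def by blast
  moreover have "inj_on closure \<T>"
    by (rule inj_on_inverseI[of _ interior]) (rule element_interior_closure)
  ultimately show ?thesis by (rule finite_imageD)
qed

lemma closure_elements: "(\<Union>K\<in>\<T>. closure K) = closure \<Omega>"
  using triang unfolding triangulation_of_def by blast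

lemma element_Int_face: "K \<in> \<T> \<Longrightarrow> K' \<in> \<T> \<Longrightarrow> (closure K \<inter> closure K') face_of closure K"
  using triang unfolding triangulation_of_def triangulation_def by blast

lemma element_subset_\<Omega>: "K \<in> \<T> \<Longrightarrow> K \<subseteq> \<Omega>"
proof -
  assume K: "K \<in> \<T>"
  have "K \<subseteq> closure \<Omega>" using K closure_elements closure_subset[of K] by blast
  then have "K \<subseteq> interior (closure \<Omega>)" using element_open[OF K] by (rule interior_maximal)
  then show ?thesis by (simp add: interior_closure_\<Omega>)
qed

text \<open>Conformity of the triangulation: the intersection of two closed triangles is a face of both, and
  a face that meets the interior is everything.\<close>

lemma elements_meet_eq:
  assumes "K \<in> \<T>" "K' \<in> \<T>" "K \<inter> closure K' \<noteq> {}"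
  shows "K = K'"
proof -
  have "K \<inter> K' \<noteq> {}"
    using assms(3) open_Int_closure_eq_empty[OF element_open[OF assms(1)], of K'] by simp
  then obtain z where z: "z \<in> K" "z \<in> K'" by blast
  have eq: "closure K1 \<inter> closure K2 = closure K1" if "K1 \<in> \<T>" "K2 \<in> \<T>" "z \<in> K1" "z \<in> K2" for K1 K2
  proof (rule ccontr)
    assume ne: "closure K1 \<inter> closure K2 \<noteq> closure K1"
    have "(closure K1 \<inter> closure K2) \<inter> interior (closure K1) = {}"
      by (rule face_of_disjoint_interior[OF element_Int_face[OF that(1,2)] ne])
    moreover have "z \<in> closure K1" "z \<in> closure K2"
      using that(3,4) by (auto intro: subsetD[OF closure_subset])
    moreover have "z \<in> interior (closure K1)"
      using that(3) element_interior_closure[OF that(1)] by simp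
    ultimately show False by blast
  qed
  have "closure K \<subseteq> closure K'" "closure K' \<subseteq> closure K"
    using eq[OF assms(1,2) z] eq[OF assms(2,1) z(2,1)] unfolding le_iff_inf .
  then have "interior (closure K) = interior (closure K')" by (intro arg_cong[of _ _ interior] equalityI)
  then show ?thesis
    unfolding element_interior_closure[OF assms(1)] element_interior_closure[OF assms(2)] .
qed

lemma finite_mesh_vertices: "finite mesh_vertices"
proof -
  have "finite {x. x extreme_point_of closure K}" if K: "K \<in> \<T>" for K
  proof -
    obtain P A B where "triangle K P A B" using element_triangle[OF K] by blast
    then have "{x. x extreme_point_of closure K} = {P, A, B}" using triangle_extreme by blast
    then show ?thesis by simp
  qed
  moreover have "mesh_vertices = (\<Union>K\<in>\<T>. {x. x extreme_point_of closure K})" unfolding mesh_vertices_def by blast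
  ultimately show ?thesis using finite_\<T> by simp
qed

text \<open>Regions of one colour are separated inside \<open>K\<close> by the set \<open>N\<close> of
  points common to two of their boundaries, and \<open>N\<close> has length zero. If
  \<open>K\<close> met two of them, small discs around points \<open>p\<close> and
  \<open>q\<close> of either would be joined, within the convex set \<open>K\<close>, by
  parallel segments that all meet \<open>N\<close>. Then the projection of \<open>N\<close> to
  the direction \<open>m\<close> orthogonal to \<open>q - p\<close> would contain an interval,
  and \<open>N\<close> would have positive length.\<close>

lemma element_in_region:
  assumes K: "K \<in> \<T>" and col: "\<C> = G1 \<or> \<C> = G2" and sub: "K \<subseteq> (\<Union>G\<in>\<C>. closure G)"
  shows "\<exists>G\<in>\<C>. K \<subseteq> G"
proof -
  have fin: "finite \<C>" using col finite_regions by auto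
  have reg: "G \<in> G1 \<union> G2" if "G \<in> \<C>" for G using that col by blast
  define N where "N = (\<Union>G\<in>\<C>. \<Union>G'\<in>\<C> - {G}. frontier G \<inter> frontier G')"
  have N0: "hausdorff1_outer N = 0"
  proof -
    have "frontier G \<inter> frontier G' \<in> null_sets hausdorff1" if "G \<in> \<C>" "G' \<in> \<C> - {G}" for G G'
      using same_colour_null[OF col that(1), of G'] that by (subst hausdorff1_null_sets_iff) auto
    then have "N \<in> null_sets hausdorff1"
      unfolding N_def using fin by (intro null_sets_UN') (auto simp: countable_finite)
    moreover have "closed N" unfolding N_def using fin by (intro closed_UN closed_Int) auto
    ultimately show ?thesis by (simp add: hausdorff1_null_sets_iff)
  qed
  (* Off N, a point of K has a neighbourhood in the closure of a single region, hence lies in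
     that region, which is the interior of its closure. *)
  have KN: "K - N \<subseteq> \<Union>\<C>"
  proof
    fix x assume x: "x \<in> K - N"
    obtain G where G: "G \<in> \<C>" "x \<in> closure G" using x sub by blast
    show "x \<in> \<Union>\<C>"
    proof (rule ccontr)
      assume no: "x \<notin> \<Union>\<C>"
      have fr: "x \<in> frontier G'" if "G' \<in> \<C>" "x \<in> closure G'" for G'
        using that no region_open[OF reg[OF that(1)]] by (auto simp: frontier_def interior_open)
      have other: "x \<notin> closure G'" if "G' \<in> \<C>" "G' \<noteq> G" for G'
      proof
        assume "x \<in> closure G'"
        then have "x \<in> N" unfolding N_def using fr[OF G] fr[OF that(1)] G that by blast
        then show False using x by blast
      qed
      let ?W = "K - (\<Union>G'\<in>\<C> - {G}. closure G')"
      have "open ?W" using element_open[OF K] fin by (intro open_Diff closed_UN) auto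
      moreover have "x \<in> ?W" using x other by blast
      moreover have "?W \<subseteq> closure G" using sub by blast
      ultimately have "x \<in> interior (closure G)" by (rule interiorI)
      then have "x \<in> G" using region_interior_closure[OF reg[OF G(1)]] by simp
      then show False using no G by blast
    qed
  qed
  have disj: "disjoint \<C>" using regions_disjoint col by (auto simp: disjoint_def)
  have sep: "G = G'" if G: "G \<in> \<C>" "G' \<in> \<C>" "p \<in> G \<inter> K" "q \<in> G' \<inter> K" for G G' p q
  proof (rule ccontr)
    assume ne: "G \<noteq> G'"
    have pq: "p \<noteq> q" using regions_Int[OF reg[OF G(1)] reg[OF G(2)] ne] G by blast
    have "open (G \<inter> K)" by (rule open_Int[OF region_open[OF reg[OF G(1)]] element_open[OF K]])
    then obtain r1 where r1: "0 < r1" "ball p r1 \<subseteq> G \<inter> K" using G(3) by (rule openE)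
    have "open (G' \<inter> K)" by (rule open_Int[OF region_open[OF reg[OF G(2)]] element_open[OF K]])
    then obtain r2 where r2: "0 < r2" "ball q r2 \<subseteq> G' \<inter> K" using G(4) by (rule openE)
    note r = r1 r2
    define r where "r = min r1 r2 / 2"
    have rr: "0 < r" "r < r1" "r < r2" using r by (auto simp: r_def)
    define m where "m = (1 / norm (rot (q - p))) *\<^sub>R rot (q - p)"
    have "rot (q - p) \<noteq> 0" using pq by (auto simp: rot_def vec_eq_iff forall_2)
    then have nm: "norm m = 1" by (simp add: m_def)
    then have mm: "m \<bullet> m = 1" by (simp add: norm_eq_1)
    have qm: "(q - p) \<bullet> m = 0" by (simp add: m_def inner_rot cross2_def)
    (* The segment from p to q, shifted by t m, would otherwise be a connected subset of the
       disjoint regions that meets two of them. *)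
    have hit: "\<exists>y\<in>N. (y - p) \<bullet> m = t" if t: "0 \<le> t" "t \<le> r" for t
    proof (rule ccontr)
      assume no: "\<not> (\<exists>y\<in>N. (y - p) \<bullet> m = t)"
      let ?S = "closed_segment (p + t *\<^sub>R m) (q + t *\<^sub>R m)"
      have pt: "p + t *\<^sub>R m \<in> G \<inter> K" and qt: "q + t *\<^sub>R m \<in> G' \<inter> K"
        using r t rr by (auto simp: subset_iff dist_norm nm)
      have SK: "?S \<subseteq> K"
        using pt qt element_convex[OF K] by (simp add: closed_segment_subset)
      have "(y - p) \<bullet> m = t" if "y \<in> ?S" for y
      proof -
        from that obtain u where u: "y = (1 - u) *\<^sub>R (p + t *\<^sub>R m) + u *\<^sub>R (q + t *\<^sub>R m)"
          by (auto simp: closed_segment_def)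
        have "y - p = u *\<^sub>R (q - p) + t *\<^sub>R m" unfolding u by (simp add: algebra_simps)
        then show ?thesis by (simp add: inner_add_left qm mm)
      qed
      then have "?S \<inter> N = {}" using no by blast
      then have "?S \<subseteq> \<Union>\<C>" using SK KN by blast
      moreover have "?S \<inter> G \<noteq> {}" using pt by auto
      ultimately have "?S \<subseteq> G"
        using connected_cover_by_disjoint_open[of ?S \<C> G] region_open[OF reg] disj G(1)
        by (simp add: connected_segment)
      moreover have "q + t *\<^sub>R m \<in> ?S" by simp
      ultimately show False using qt regions_Int[OF reg[OF G(1)] reg[OF G(2)] ne] by blast
    qed
    have "ennreal (r - 0) \<le> hausdorff1_outer N"
    proof (rule hausdorff1_outer_projection[where f = "\<lambda>y. (y - p) \<bullet> m"])
      fix y z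
      have "\<bar>(y - z) \<bullet> m\<bar> \<le> norm (y - z) * norm m" by (rule Cauchy_Schwarz_ineq2)
      moreover have "(y - p) \<bullet> m - (z - p) \<bullet> m = (y - z) \<bullet> m" by (simp add: inner_diff_left)
      ultimately show "\<bar>(y - p) \<bullet> m - (z - p) \<bullet> m\<bar> \<le> dist y z" by (simp add: nm dist_norm)
    next
      show "{0..r} \<subseteq> (\<lambda>y. (y - p) \<bullet> m) ` N" 
      proof
        fix t assume "t \<in> {0..r}"
        then obtain y where "y \<in> N" "(y - p) \<bullet> m = t" using hit[of t] by auto
        then show "t \<in> (\<lambda>y. (y - p) \<bullet> m) ` N" by blast
      qed
    qed (use rr in simp)
    then show False using N0 rr by simp
  qed
  obtain x where "x \<in> K" using element_nonempty[OF K] by blast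
  then obtain G where G: "G \<in> \<C>" "x \<in> closure G" using sub by blast
  then have "G \<inter> K \<noteq> {}" using open_Int_closure_eq_empty[OF element_open[OF K], of G] \<open>x \<in> K\<close> by auto
  then obtain p where p: "p \<in> G \<inter> K" by blast
  have "K \<subseteq> closure G"
  proof
    fix y assume y: "y \<in> K"
    then obtain G' where G': "G' \<in> \<C>" "y \<in> closure G'" using sub by blast
    then have "G' \<inter> K \<noteq> {}" using open_Int_closure_eq_empty[OF element_open[OF K], of G'] y by auto
    then obtain q where "q \<in> G' \<inter> K" by blast
    then have "G = G'" using sep[OF G(1) G'(1) p] by blast
    then show "y \<in> closure G" using G' by blast
  qed
  then have "K \<subseteq> interior (closure G)" using element_open[OF K] by (rule interior_maximal)
  then show ?thesis using region_interior_closure[OF reg[OF G(1)]] G(1) by auto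
qed

text \<open>Consistency excludes one of the colours, and the closures of the remaining regions still cover
  \<open>K\<close>.\<close>

lemma element_cases:
  assumes K: "K \<in> \<T>"
  shows "(\<exists>G\<in>G1. K \<subseteq> G) \<or> (\<exists>G\<in>G2. K \<subseteq> G)"
proof -
  have KO: "K \<subseteq> (\<Union>G\<in>G1 \<union> G2. closure G)"
    unfolding closure_regions[symmetric]
    by (rule order_trans[OF element_subset_\<Omega>[OF K] closure_subset])
  have avoid: "K \<inter> closure G = {}" if "K \<inter> G = {}" for G
    using that open_Int_closure_eq_empty[OF element_open[OF K], of G] by simp
  have "K \<inter> \<Omega>\<^sub>1 = {} \<or> K \<inter> \<Omega>\<^sub>2 = {}" using consistent K unfolding consistent_with_def by blast
  then show ?thesis
  proof
    assume "K \<inter> \<Omega>\<^sub>1 = {}"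
    then have "K \<inter> closure G = {}" if "G \<in> G1" for G using that by (intro avoid) blast
    then have "K \<subseteq> (\<Union>G\<in>G2. closure G)" using KO by blast
    then have "\<exists>G\<in>G2. K \<subseteq> G" by (rule element_in_region[OF K disjI2[OF refl]])
    then show ?thesis ..
  next
    assume "K \<inter> \<Omega>\<^sub>2 = {}"
    then have "K \<inter> closure G = {}" if "G \<in> G2" for G using that by (intro avoid) blast
    then have "K \<subseteq> (\<Union>G\<in>G1. closure G)" using KO by blast
    then have "\<exists>G\<in>G1. K \<subseteq> G" by (rule element_in_region[OF K disjI1[OF refl]])
    then show ?thesis ..
  qed
qed

lemma element_colour:
  assumes "K \<in> \<T>"
  shows "K \<subseteq> \<Omega>\<^sub>1 \<or> K \<subseteq> \<Omega>\<^sub>2"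
  using element_cases[OF assms] by blast

lemma element_not_both:
  assumes "K \<in> \<T>" "K \<subseteq> \<Omega>\<^sub>1" shows "\<not> K \<subseteq> \<Omega>\<^sub>2" "K \<inter> \<Omega>\<^sub>2 = {}"
  using assms element_nonempty[OF assms(1)] \<Omega>12_disjoint by blast+

lemma element_region:
  assumes "K \<in> \<T>" "K \<subseteq> \<Union>\<C>" "\<C> = G1 \<or> \<C> = G2"
  shows "\<exists>G\<in>\<C>. K \<subseteq> G"
proof -
  have "K \<noteq> {}" using element_nonempty[OF assms(1)] .
  moreover have "\<Union>G1 \<inter> \<Union>G2 = {}" by (rule \<Omega>12_disjoint)
  ultimately show ?thesis using element_cases[OF assms(1)] assms(2,3) by blast
qed

section \<open>Edges of the mesh\<close>

text \<open>Away from the vertices, the mesh near a point of the skeleton consists of the two half-discs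
  cut out by the two elements sharing the edge through that point. The normal \<open>n\<close> points from \<open>K\<close>
  to \<open>K'\<close>, and \<open>P\<close>, \<open>P'\<close> are the vertices opposite to the edge from \<open>A\<close> to \<open>B\<close>.\<close>

definition edge_nbhd ::
  "plane \<Rightarrow> plane set \<Rightarrow> plane set \<Rightarrow> plane \<Rightarrow> plane \<Rightarrow> plane \<Rightarrow> plane \<Rightarrow> plane \<Rightarrow> real \<Rightarrow> bool" where
  "edge_nbhd x K K' P P' A B n r \<longleftrightarrow>
     K \<in> \<T> \<and> K' \<in> \<T> \<and> K \<noteq> K' \<and> triangle K P A B \<and> triangle K' P' A B \<and> x \<in> open_segment A B \<and>
     norm n = 1 \<and> (B - A) \<bullet> n = 0 \<and> 0 < r \<and> ball x r \<subseteq> \<Omega> \<and>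
     (\<forall>y\<in>ball x r. y \<in> K \<longleftrightarrow> (y - x) \<bullet> n < 0) \<and>
     (\<forall>y\<in>ball x r. y \<in> K' \<longleftrightarrow> 0 < (y - x) \<bullet> n) \<and>
     (\<forall>L\<in>\<T>. L \<noteq> K \<longrightarrow> L \<noteq> K' \<longrightarrow> closure L \<inter> ball x r = {})"

lemma point_in_opposite_half:
  fixes x n :: plane
  assumes "norm n = 1" "0 < r"
  shows "x + (r / 2) *\<^sub>R n \<in> ball x r" "(x + (r / 2) *\<^sub>R n - x) \<bullet> n = r / 2"
    "x - (r / 2) *\<^sub>R n \<in> ball x r" "(x - (r / 2) *\<^sub>R n - x) \<bullet> n = - (r / 2)"
  using assms by (auto simp: dist_norm dot_square_norm)

lemma closure_half_disc:
  assumes "\<And>y. y \<in> ball x r \<Longrightarrow> y \<in> K \<Longrightarrow> (y - x) \<bullet> n \<le> 0" "y \<in> closure K" "y \<in> ball x r"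
  shows "(y - x) \<bullet> n \<le> (0::real)"
proof -
  have "y \<in> closure (ball x r \<inter> K)"
    using open_Int_closure_subset[of "ball x r" K] assms(2,3) by auto
  moreover have "ball x r \<inter> K \<subseteq> {y. (y - x) \<bullet> n \<le> 0}" using assms(1) by blast
  moreover have "closed {y. (y - x) \<bullet> n \<le> 0}"
    by (intro closed_Collect_le continuous_intros)
  ultimately have "y \<in> {y. (y - x) \<bullet> n \<le> 0}"
    using closure_minimal[of "ball x r \<inter> K" "{y. (y - x) \<bullet> n \<le> 0}"] by (meson subsetD)
  then show ?thesis by simp
qed

text \<open>The common face of \<open>K\<close> and \<open>L\<close> contains an interior point of the edge
  from \<open>A\<close> to \<open>B\<close>, hence both end points. They are extreme points of
  \<open>K\<close>, thus of the face and of \<open>L\<close>, so that they are vertices of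
  \<open>L\<close>.\<close>

lemma adjacent_triangle:
  assumes K: "K \<in> \<T>" and t: "triangle K P A B" and x: "x \<in> open_segment A B"
    and L: "L \<in> \<T>" "x \<in> closure L"
  shows "\<exists>P'. triangle L P' A B"
proof -
  let ?F = "closure K \<inter> closure L"
  have FK: "?F face_of closure K" by (rule element_Int_face[OF K L(1)])
  have FL: "?F face_of closure L"
    using element_Int_face[OF L(1) K] by (simp add: Int_commute)
  have cl: "closure K = convex hull {P, A, B}" by (rule triangle_closure[OF t])
  have AK: "A \<in> closure K" "B \<in> closure K" unfolding cl by (auto intro: hull_inc)
  have "x \<in> closed_segment A B" using x by (rule subsetD[OF segment_open_subset_closed])
  moreover have "closed_segment A B \<subseteq> closure K"
    using AK by (simp add: closed_segment_subset cl)
  ultimately have "x \<in> ?F" using L(2) by blast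
  then have AB: "A \<in> ?F" "B \<in> ?F" using face_ofD[OF FK x AK] by auto
  have "A extreme_point_of closure K" "B extreme_point_of closure K"
    using triangle_extreme[OF t] by auto
  then have "A extreme_point_of ?F" "B extreme_point_of ?F"
    using extreme_point_of_face[OF FK] AB by auto
  then have ext: "A extreme_point_of closure L" "B extreme_point_of closure L"
    using extreme_point_of_face[OF FL] by auto
  obtain P' A' B' where t': "triangle L P' A' B'" using element_triangle[OF L(1)] by blast
  have mem: "A \<in> {P', A', B'}" "B \<in> {P', A', B'}" "A \<noteq> B"
    using ext triangle_extreme[OF t'] triangle_distinct[OF t] by auto
  have sym: "triangle L X Y Z" if "{X, Y, Z} = {P', A', B'}" for X Y Z
    using t' that by (simp add: triangle_eq_interior)
  show ?thesis
  proof -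
    consider "A = P'" "B = A'" | "A = P'" "B = B'" | "A = A'" "B = P'" | "A = A'" "B = B'"
      | "A = B'" "B = P'" | "A = B'" "B = A'" using mem by auto
    then show ?thesis
    proof cases
      case 1 then show ?thesis by (intro exI[of _ B'] sym) auto
    next
      case 2 then show ?thesis by (intro exI[of _ A'] sym) auto
    next
      case 3 then show ?thesis by (intro exI[of _ B'] sym) auto
    next
      case 4 then show ?thesis by (intro exI[of _ P'] sym) auto
    next
      case 5 then show ?thesis by (intro exI[of _ A'] sym) auto
    next
      case 6 then show ?thesis by (intro exI[of _ P'] sym) auto
    qed
  qed
qed

lemma boundary_point_on_edge:
  assumes K: "K \<in> \<T>" and x: "x \<in> closure K" "x \<notin> K" "x \<notin> mesh_vertices"
  shows "\<exists>P A B. triangle K P A B \<and> x \<in> open_segment A B"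
proof -
  obtain P A B where t: "triangle K P A B" using element_triangle[OF K] by blast
  have "x \<notin> {P, A, B}" using x(3) triangle_extreme[OF t] K unfolding mesh_vertices_def by blast
  then consider "x \<in> open_segment A B" | "x \<in> open_segment P A" | "x \<in> open_segment P B"
    using triangle_boundary_cases[OF t x(1,2)] by blast
  then show ?thesis
  proof cases
    case 1 then show ?thesis using t by blast
  next
    case 2
    have "triangle K B P A" using t by (simp add: triangle_eq_interior insert_commute)
    with 2 show ?thesis by blast
  next
    case 3
    have "triangle K A P B" using t by (simp add: triangle_eq_interior insert_commute)
    with 3 show ?thesis by blast
  qed
qed

text \<open>Every element whose closure contains \<open>x\<close> is a triangle over the same edge and fills
  a half-disc at \<open>x\<close>. Two elements on the same side would overlap, and the other
  side is covered because \<open>x\<close> is an interior point of \<open>\<Omega>\<close>.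
  Hence there are exactly two.\<close>

lemma edge_nbhd_exists:
  assumes x: "x \<in> \<Omega>" "x \<notin> mesh_vertices" and K: "K \<in> \<T>" "x \<in> closure K" "x \<notin> K"
  shows "\<exists>K' P P' A B n r. edge_nbhd x K K' P P' A B n r"
proof -
  obtain P A B where t: "triangle K P A B" and xAB: "x \<in> open_segment A B"
    using boundary_point_on_edge[OF K x(2)] by blast
  obtain n where n: "norm n = 1" "(B - A) \<bullet> n = 0" "(P - A) \<bullet> n < 0"
    using unit_normal_exists[OF t] by blast
  have n0: "n \<noteq> 0" using n(1) by auto
  have Px: "(P - x) \<bullet> n < 0"
    using n(3) open_segment_normal(1)[OF xAB n(2)] by (simp add: inner_diff_left)
  obtain r1 where r1: "0 < r1" "\<And>y. y \<in> ball x r1 \<Longrightarrow> y \<in> K \<longleftrightarrow> (y - x) \<bullet> n < 0"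
    using triangle_half_disc[OF t xAB n(2) Px] by blast
  let ?far = "\<Union>L\<in>{L\<in>\<T>. x \<notin> closure L}. closure L"
  have "closed ?far" using finite_\<T> by (intro closed_UN) auto
  then have "open (\<Omega> - ?far)" using open_\<Omega> by (intro open_Diff)
  moreover have "x \<in> \<Omega> - ?far" using x by blast
  ultimately obtain r2 where r2: "0 < r2" "ball x r2 \<subseteq> \<Omega> - ?far" by (rule openE)
  define r where "r = min r1 r2"
  have r: "0 < r" "r \<le> r1" "r \<le> r2" using r1 r2 by (auto simp: r_def)
  have br: "ball x r \<subseteq> \<Omega> - ?far" using subset_ball[OF r(3), of x] r2(2) by blast
  have far: "x \<in> closure L" if "L \<in> \<T>" "closure L \<inter> ball x r \<noteq> {}" for L
  proof (rule ccontr)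
    assume "x \<notin> closure L"
    then have "closure L \<subseteq> ?far" using that by blast
    then show False using that(2) br by blast
  qed
  have Kr: "y \<in> K \<longleftrightarrow> (y - x) \<bullet> n < 0" if "y \<in> ball x r" for y
    using r1(2)[of y] that r(2) by auto
  note pts = point_in_opposite_half[OF n(1) r(1), of x]
  (* Two elements over the edge with apex on the same side overlap and are therefore equal. *)
  have same: "L = K" if L: "L \<in> \<T>" "triangle L P' A B" "(P' - x) \<bullet> n < 0" for L P'
  proof -
    obtain s where s: "0 < s" "\<And>y. y \<in> ball x s \<Longrightarrow> y \<in> L \<longleftrightarrow> (y - x) \<bullet> n < 0"
      using triangle_half_disc[OF L(2) xAB n(2) L(3)] by blast
    define s' where "s' = min r s"
    have s': "0 < s'" using r s by (simp add: s'_def)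
    note q = point_in_opposite_half[OF n(1) s', of x]
    have "x - (s' / 2) *\<^sub>R n \<in> L" "x - (s' / 2) *\<^sub>R n \<in> K"
      using s(2)[of "x - (s' / 2) *\<^sub>R n"] Kr[of "x - (s' / 2) *\<^sub>R n"] q(3,4) s'
      by (auto simp: s'_def)
    then have "L \<inter> closure K \<noteq> {}" using closure_subset[of K] by blast
    then show "L = K" using elements_meet_eq[OF L(1) K(1)] by blast
  qed
  (* A point on the far side of the edge lies in the closure of the second element. *)
  let ?y = "x + (r / 2) *\<^sub>R n"
  have "?y \<in> \<Omega>" using subsetD[OF br pts(1)] by blast
  then obtain K' where K': "K' \<in> \<T>" "?y \<in> closure K'"
    using closure_elements closure_subset[of \<Omega>] by blast
  have KK': "K \<noteq> K'"
  proof
    assume "K = K'"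
    then have "?y \<in> closure K" using K'(2) by simp
    then have "(?y - x) \<bullet> n \<le> 0"
      by (rule closure_half_disc[rotated, OF _ pts(1)]) (use Kr in auto)
    then show False using pts(2) r(1) by simp
  qed
  have xK': "x \<in> closure K'" using far[OF K'(1)] K'(2) pts(1) by blast
  obtain P' where t': "triangle K' P' A B" using adjacent_triangle[OF K(1) t xAB K'(1) xK'] by blast
  have P'x: "0 < (P' - x) \<bullet> n"
    using triangle_apex_off_line[OF t' xAB n(2) n0] same[OF K'(1) t'] KK'
    by (cases "(P' - x) \<bullet> n < 0") auto
  then have P'x': "(P' - x) \<bullet> (- n) < 0" by simp
  obtain r3 where r3: "0 < r3" "\<And>y. y \<in> ball x r3 \<Longrightarrow> y \<in> K' \<longleftrightarrow> (y - x) \<bullet> (- n) < 0"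
    using triangle_half_disc[OF t' xAB _ P'x'] n(2) by auto
  have others: "L = K \<or> L = K'" if L: "L \<in> \<T>" "x \<in> closure L" for L
  proof -
    obtain Q where tL: "triangle L Q A B" using adjacent_triangle[OF K(1) t xAB L] by blast
    have "(Q - x) \<bullet> n \<noteq> 0" by (rule triangle_apex_off_line[OF tL xAB n(2) n0])
    then consider "(Q - x) \<bullet> n < 0" | "0 < (Q - x) \<bullet> n" by linarith
    then show ?thesis
    proof cases
      case 1
      then show ?thesis using same[OF L(1) tL] by blast
    next
      case 2
      then have Q: "(Q - x) \<bullet> (- n) < 0" by simp
      obtain s where s: "0 < s" "\<And>y. y \<in> ball x s \<Longrightarrow> y \<in> L \<longleftrightarrow> (y - x) \<bullet> (- n) < 0"
        using triangle_half_disc[OF tL xAB _ Q] n(2) by auto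
      define s' where "s' = min r3 s"
      have s': "0 < s'" using r3 s by (simp add: s'_def)
      note q = point_in_opposite_half[OF n(1) s', of x]
      have "x + (s' / 2) *\<^sub>R n \<in> L" "x + (s' / 2) *\<^sub>R n \<in> K'"
        using s(2)[of "x + (s' / 2) *\<^sub>R n"] r3(2)[of "x + (s' / 2) *\<^sub>R n"] q(1,2) s'
        by (auto simp: s'_def)
      then have "L \<inter> closure K' \<noteq> {}" using closure_subset[of K'] by blast
      then show ?thesis using elements_meet_eq[OF L(1) K'(1)] by blast
    qed
  qed
  define \<rho> where "\<rho> = min r r3"
  have \<rho>: "0 < \<rho>" "\<rho> \<le> r" "\<rho> \<le> r3" using r r3 by (auto simp: \<rho>_def)
  have "edge_nbhd x K K' P P' A B n \<rho>"
    unfolding edge_nbhd_def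
  proof (intro conjI ballI impI)
    show "ball x \<rho> \<subseteq> \<Omega>" using subset_ball[OF \<rho>(2), of x] br by blast
    fix y assume y: "y \<in> ball x \<rho>"
    show "y \<in> K \<longleftrightarrow> (y - x) \<bullet> n < 0" using Kr[of y] y \<rho> by auto
    show "y \<in> K' \<longleftrightarrow> 0 < (y - x) \<bullet> n" using r3(2)[of y] y \<rho> by auto
  next
    fix L assume L: "L \<in> \<T>" "L \<noteq> K" "L \<noteq> K'"
    show "closure L \<inter> ball x \<rho> = {}"
    proof (rule ccontr)
      assume "closure L \<inter> ball x \<rho> \<noteq> {}"
      then have "closure L \<inter> ball x r \<noteq> {}" using \<rho>(2) by auto
      from far[OF L(1) this] others[OF L(1)] L show False by blast
    qed
  qed (use K(1) K'(1) KK' t t' xAB n \<rho> in auto)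
  then show ?thesis by blast
qed

end

section \<open>Boundary traces and the interface\<close>

text \<open>Averages of a continuous function over shrinking discs, intersected with \<open>U\<close>, tend
  to its value at the centre.\<close>

lemma boundary_trace_eqI:
  fixes f h :: "plane \<Rightarrow> 'b::euclidean_space"
  assumes U: "open U" "s \<in> closure U" and r: "0 < r"
    and f: "f \<in> borel_measurable (lebesgue_on U)"
    and ae: "AE x in lebesgue_on (U \<inter> ball s r). f x = h x" and h: "continuous_on UNIV h"
  shows "boundary_trace U f s = h s"
  unfolding boundary_trace_def
proof (rule tendsto_Lim)
  show "\<not> trivial_limit (at_right (0::real))" by simp
  let ?avg = "\<lambda>\<rho>. (LINT y|lebesgue_on (U \<inter> ball s \<rho>). f y) /\<^sub>R measure lebesgue (U \<inter> ball s \<rho>)"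
  show "(?avg \<longlongrightarrow> h s) (at_right 0)"
  proof (rule tendstoI)
    fix e :: real assume "0 < e"
    obtain d where d: "0 < d" "\<And>y. dist y s < d \<Longrightarrow> dist (h y) (h s) < e / 2"
      using h \<open>0 < e\<close> unfolding continuous_on_iff by (metis UNIV_I half_gt_zero)
    have "dist (?avg \<rho>) (h s) < e" if \<rho>: "0 < \<rho>" "\<rho> < min d r" for \<rho>
    proof -
      let ?S = "U \<inter> ball s \<rho>"
      have S: "open ?S" using U(1) by blast
      have Sne: "?S \<noteq> {}"
      proof
        assume "?S = {}"
        then have "ball s \<rho> \<inter> closure U = {}" using open_Int_closure_eq_empty[OF open_ball, of s \<rho> U] by auto
        then show False using U(2) centre_in_ball[of s \<rho>] \<rho> by blast
      qed
      have Slm: "?S \<in> lmeasurable"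
        using S by (intro bounded_set_imp_lmeasurable) (auto intro: bounded_subset[OF bounded_ball])
      have mpos: "0 < measure lebesgue ?S"
      proof -
        have "\<not> negligible ?S" using S Sne open_not_negligible by blast
        then have "measure lebesgue ?S \<noteq> 0" using Slm by (simp add: negligible_iff_measure)
        then show ?thesis using measure_nonneg[of lebesgue ?S] by linarith
      qed
      have Ssets: "?S \<in> sets lebesgue" using Slm by auto
      have fm: "f \<in> borel_measurable (lebesgue_on ?S)"
        by (rule measurable_restrict_mono[OF f]) simp
      have hm: "h \<in> borel_measurable (lebesgue_on ?S)"
        using borel_measurable_continuous_onI[OF h] by (intro measurable_restrict_space1 measurable_completion) simp
      have aeS: "AE x in lebesgue_on ?S. f x = h x"
      proof -
        have "AE x in lebesgue. x \<in> U \<inter> ball s r \<longrightarrow> f x = h x"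
          using ae U(1) by (subst (asm) AE_restrict_space_iff) auto
        then have "AE x in lebesgue. x \<in> ?S \<longrightarrow> f x = h x"
          by eventually_elim (use \<rho> in auto)
        then show ?thesis using Ssets by (subst AE_restrict_space_iff) auto
      qed
      interpret finite_measure "lebesgue_on ?S"
        using Slm by (rule finite_measure_lebesgue_on)
      have bound: "norm (h x - h s) \<le> e / 2" if "x \<in> ?S" for x
        using d(2)[of x] that \<rho> by (auto simp: dist_norm norm_minus_commute dist_commute)
      have hi: "integrable (lebesgue_on ?S) (\<lambda>x. h x - h s)"
        by (rule integrable_const_bound[of _ "e / 2"])
          (use hm bound in \<open>auto simp: space_restrict_space\<close>)
      then have "integrable (lebesgue_on ?S) (\<lambda>x. (h x - h s) + h s)"
        by (intro Bochner_Integration.integrable_add integrable_const)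
      then have hi': "integrable (lebesgue_on ?S) h" by simp
      have ms: "measure (lebesgue_on ?S) (space (lebesgue_on ?S)) = measure lebesgue ?S"
        using Ssets by (simp add: measure_restrict_space space_restrict_space)
      have "(LINT y|lebesgue_on ?S. f y) = (LINT y|lebesgue_on ?S. h y)"
        by (rule integral_cong_AE[OF fm hm aeS])
      also have "\<dots> = (LINT y|lebesgue_on ?S. h y - h s) + measure lebesgue ?S *\<^sub>R h s"
        using Bochner_Integration.integral_diff[OF hi', of "\<lambda>_. h s"] ms by simp
      finally have "?avg \<rho> - h s = (LINT y|lebesgue_on ?S. h y - h s) /\<^sub>R measure lebesgue ?S"
        using mpos by (simp add: scaleR_right_distrib)
      moreover have "norm (LINT y|lebesgue_on ?S. h y - h s) \<le> e / 2 * measure lebesgue ?S"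
      proof -
        have "norm (LINT y|lebesgue_on ?S. h y - h s) \<le> (LINT y|lebesgue_on ?S. norm (h y - h s))"
          by (rule Bochner_Integration.integral_norm_bound)
        also have "\<dots> \<le> (LINT y|lebesgue_on ?S. e / 2)"
          using hi bound by (intro integral_mono) (auto simp: space_restrict_space)
        finally have "norm (LINT y|lebesgue_on ?S. h y - h s) \<le> (LINT y|lebesgue_on ?S. e / 2)" .
        then show ?thesis using ms by (simp add: mult.commute)
      qed
      ultimately have "norm (?avg \<rho> - h s) \<le> e / 2"
        using mpos by (simp add: field_simps)
      then show ?thesis using \<open>0 < e\<close> by (simp add: dist_norm)
    qed
    moreover have "0 < min d r" using d r by simp
    ultimately show "\<forall>\<^sub>F \<rho> in at_right 0. dist (?avg \<rho>) (h s) < e"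
      by (intro eventually_at_rightI[of 0 "min d r"]) auto
  qed
qed

context bipartite_mesh
begin

lemma edge_nbhdD:
  assumes "edge_nbhd x K K' P P' A B n r"
  shows "K \<in> \<T>" "K' \<in> \<T>" "K \<noteq> K'" "triangle K P A B" "triangle K' P' A B" "x \<in> open_segment A B"
    "norm n = 1" "(B - A) \<bullet> n = 0" "0 < r" "ball x r \<subseteq> \<Omega>"
    "\<And>y. y \<in> ball x r \<Longrightarrow> y \<in> K \<longleftrightarrow> (y - x) \<bullet> n < 0"
    "\<And>y. y \<in> ball x r \<Longrightarrow> y \<in> K' \<longleftrightarrow> 0 < (y - x) \<bullet> n"
    "\<And>L. L \<in> \<T> \<Longrightarrow> L \<noteq> K \<Longrightarrow> L \<noteq> K' \<Longrightarrow> closure L \<inter> ball x r = {}"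
  using assms unfolding edge_nbhd_def by simp_all

lemma edge_nbhd_swap: "edge_nbhd x K K' P P' A B n r \<Longrightarrow> edge_nbhd x K' K P' P A B (- n) r"
  unfolding edge_nbhd_def by auto

text \<open>A point of the dividing line is approached from inside the half-disc.\<close>

lemma on_line_in_closure:
  assumes half: "\<And>y. y \<in> ball x r \<Longrightarrow> 0 < (y - x) \<bullet> n \<Longrightarrow> y \<in> K" and n: "norm n = 1"
    and y: "y \<in> ball x r" "(y - x) \<bullet> n = 0"
  shows "y \<in> closure K"
  unfolding closure_approachable
proof (intro allI impI)
  fix e :: real assume "0 < e"
  define t where "t = min e (r - dist x y) / 2"
  have t: "0 < t" "t < e" "t < r - dist x y" using \<open>0 < e\<close> y by (auto simp: t_def)
  have "dist x (y + t *\<^sub>R n) \<le> dist x y + dist y (y + t *\<^sub>R n)" by (rule dist_triangle)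
  also have "dist y (y + t *\<^sub>R n) = t" using t n by (simp add: dist_norm)
  finally have "y + t *\<^sub>R n \<in> ball x r" using t by simp
  moreover have "0 < (y + t *\<^sub>R n - x) \<bullet> n"
  proof -
    have "(y + t *\<^sub>R n - x) \<bullet> n = (y - x) \<bullet> n + t * (n \<bullet> n)"
      by (simp add: inner_diff_left inner_add_left)
    then show ?thesis using y n t by (simp add: norm_eq_1)
  qed
  ultimately have "y + t *\<^sub>R n \<in> K" by (rule half)
  then show "\<exists>z\<in>K. dist z y < e" using t n by (intro bexI[of _ "y + t *\<^sub>R n"]) (auto simp: dist_norm)
qed

lemma edge_nbhd_line:
  assumes e: "edge_nbhd x K K' P P' A B n r" and y: "y \<in> ball x r" "(y - x) \<bullet> n = 0"
  shows "y \<in> closure K" "y \<in> closure K'"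
proof -
  note e' = edge_nbhdD[OF e]
  show "y \<in> closure K'"
    by (rule on_line_in_closure[of x r n K' y]) (use e' y in auto)
  show "y \<in> closure K"
    by (rule on_line_in_closure[of x r "- n" K y]) (use e' y in auto)
qed

lemma frontier_region_avoids_region:
  assumes "G \<in> G1 \<union> G2" "G' \<in> G1 \<union> G2" shows "G \<inter> frontier G' = {}"
proof (cases "G = G'")
  case True
  then show ?thesis using region_open[OF assms(1)] by (auto simp: frontier_def interior_open)
next
  case False
  then have "G \<inter> closure G' = {}"
    using regions_Int[OF assms False] open_Int_closure_eq_empty[OF region_open[OF assms(1)], of G'] by simp
  then show ?thesis by (auto simp: frontier_def)
qed

lemma interface_avoids: "\<Gamma> \<inter> \<Omega>\<^sub>1 = {}" "\<Gamma> \<inter> \<Omega>\<^sub>2 = {}"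
  using frontier_region_avoids_region unfolding interface_def by blast+

lemma interface_subset: "\<Gamma> \<subseteq> \<Omega>"
proof
  fix s assume s: "s \<in> \<Gamma>"
  then obtain G where "G \<in> G1 \<union> G2" "s \<in> frontier G" "s \<notin> frontier \<Omega>" unfolding interface_def by blast
  then have "s \<in> closure \<Omega>" using closure_regions by (auto simp: frontier_def)
  then show "s \<in> \<Omega>" using \<open>s \<notin> frontier \<Omega>\<close> open_\<Omega> by (auto simp: frontier_def interior_open)
qed

lemma interface_borel: "\<Gamma> \<in> sets borel"
  unfolding interface_def using finite_regions
  by (intro sets.Diff sets.finite_Union) (auto intro: borel_closed)

text \<open>Two different regions of the same colour would both have the diameter of the disc in their
  boundary, which has positive length. Hence \<open>K\<close> and \<open>K'\<close> lie in the
  same region, whose closure contains the disc, and a region is the interior of its closure.\<close>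

lemma same_colour_edge_interior:
  assumes e: "edge_nbhd x K K' P P' A B n r" and col: "\<C> = G1 \<or> \<C> = G2"
    and K: "K \<subseteq> \<Union>\<C>" and K': "K' \<subseteq> \<Union>\<C>"
  shows "\<exists>G\<in>\<C>. ball x r \<subseteq> G"
proof -
  note e' = edge_nbhdD[OF e]
  obtain G where G: "G \<in> \<C>" "K \<subseteq> G" using element_region[OF e'(1) K col] by blast
  obtain G' where G': "G' \<in> \<C>" "K' \<subseteq> G'" using element_region[OF e'(2) K' col] by blast
  have reg: "G \<in> G1 \<union> G2" "G' \<in> G1 \<union> G2" using G(1) G'(1) col by blast+
  let ?L = "{y \<in> ball x r. (y - x) \<bullet> n = 0}"
  have eq: "G = G'"
  proof (rule ccontr)
    assume ne: "G \<noteq> G'"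
    have "?L \<subseteq> frontier G \<inter> frontier G'"
    proof
      fix y assume y: "y \<in> ?L"
      have cl: "y \<in> closure G" "y \<in> closure G'"
        using edge_nbhd_line[OF e, of y] y closure_mono[OF G(2)] closure_mono[OF G'(2)] by auto
      have "G \<inter> closure G' = {}" "G' \<inter> closure G = {}"
        using regions_Int[OF reg ne] open_Int_closure_eq_empty[OF region_open[OF reg(1)], of G']
          open_Int_closure_eq_empty[OF region_open[OF reg(2)], of G] by auto
      then show "y \<in> frontier G \<inter> frontier G'"
        using cl region_open[OF reg(1)] region_open[OF reg(2)] by (auto simp: frontier_def interior_open)
    qed
    then have "hausdorff1_outer ?L \<le> 0"
      using hausdorff1_outer_mono[of ?L "frontier G \<inter> frontier G'"] same_colour_null[OF col G(1) G'(1) ne] by simp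
    then show False using half_disc_line_not_null[OF e'(7) e'(9), of x] by simp
  qed
  have "ball x r \<subseteq> closure G"
  proof
    fix y assume y: "y \<in> ball x r"
    consider "(y - x) \<bullet> n < 0" | "(y - x) \<bullet> n = 0" | "0 < (y - x) \<bullet> n" by linarith
    then show "y \<in> closure G"
    proof cases
      case 1
      then have "y \<in> K" using e'(11)[OF y] by simp
      then show ?thesis using G(2) closure_subset[of G] by blast
    next
      case 2
      then show ?thesis using edge_nbhd_line(1)[OF e y] closure_mono[OF G(2)] by blast
    next
      case 3
      then have "y \<in> K'" using e'(12)[OF y] by simp
      then show ?thesis using G'(2) eq closure_subset[of G] by blast
    qed
  qed
  then have "ball x r \<subseteq> interior (closure G)" by (rule interior_maximal) simp
  then show ?thesis using region_interior_closure[OF reg(1)] G(1) by auto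
qed

text \<open>Near \<open>s\<close> the interface is a straight line with normal \<open>n\<close>, the two
  subdomains are half-discs, and each half-disc lies in a single element. In contrast to
  \<open>edge_nbhd\<close>, this refers to the subdomains and not to the vertices of the
  triangles.\<close>

definition flat :: "plane \<Rightarrow> plane set \<Rightarrow> plane set \<Rightarrow> plane \<Rightarrow> real \<Rightarrow> bool" where
  "flat s K1 K2 n r \<longleftrightarrow>
     K1 \<in> \<T> \<and> K2 \<in> \<T> \<and> K1 \<subseteq> \<Omega>\<^sub>1 \<and> K2 \<subseteq> \<Omega>\<^sub>2 \<and> norm n = 1 \<and> 0 < r \<and>
     (\<forall>y\<in>ball s r. y \<in> \<Omega>\<^sub>1 \<longleftrightarrow> (y - s) \<bullet> n < 0) \<and> (\<forall>y\<in>ball s r. y \<in> K1 \<longleftrightarrow> (y - s) \<bullet> n < 0) \<and>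
     (\<forall>y\<in>ball s r. y \<in> \<Omega>\<^sub>2 \<longleftrightarrow> 0 < (y - s) \<bullet> n) \<and> (\<forall>y\<in>ball s r. y \<in> K2 \<longleftrightarrow> 0 < (y - s) \<bullet> n) \<and>
     (\<forall>y\<in>ball s r. y \<in> \<Gamma> \<longleftrightarrow> (y - s) \<bullet> n = 0) \<and>
     (\<forall>L\<in>\<T>. L \<noteq> K1 \<longrightarrow> L \<noteq> K2 \<longrightarrow> closure L \<inter> ball s r = {})"

lemma flatD:
  assumes "flat s K1 K2 n r"
  shows "K1 \<in> \<T>" "K2 \<in> \<T>" "K1 \<subseteq> \<Omega>\<^sub>1" "K2 \<subseteq> \<Omega>\<^sub>2" "norm n = 1" "0 < r"
    "\<And>y. y \<in> ball s r \<Longrightarrow> y \<in> \<Omega>\<^sub>1 \<longleftrightarrow> (y - s) \<bullet> n < 0" "\<And>y. y \<in> ball s r \<Longrightarrow> y \<in> K1 \<longleftrightarrow> (y - s) \<bullet> n < 0"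
    "\<And>y. y \<in> ball s r \<Longrightarrow> y \<in> \<Omega>\<^sub>2 \<longleftrightarrow> 0 < (y - s) \<bullet> n" "\<And>y. y \<in> ball s r \<Longrightarrow> y \<in> K2 \<longleftrightarrow> 0 < (y - s) \<bullet> n"
    "\<And>y. y \<in> ball s r \<Longrightarrow> y \<in> \<Gamma> \<longleftrightarrow> (y - s) \<bullet> n = 0"
    "\<And>L. L \<in> \<T> \<Longrightarrow> L \<noteq> K1 \<Longrightarrow> L \<noteq> K2 \<Longrightarrow> closure L \<inter> ball s r = {}"
proof -
  note f = assms[unfolded flat_def]
  note g = f[THEN conjunct2, THEN conjunct2, THEN conjunct2, THEN conjunct2, THEN conjunct2, THEN conjunct2,
          THEN conjunct2]
  show "K1 \<in> \<T>" "K2 \<in> \<T>" "K1 \<subseteq> \<Omega>\<^sub>1" "K2 \<subseteq> \<Omega>\<^sub>2" "norm n = 1" "0 < r"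
    "\<And>y. y \<in> ball s r \<Longrightarrow> y \<in> \<Omega>\<^sub>1 \<longleftrightarrow> (y - s) \<bullet> n < 0" "\<And>y. y \<in> ball s r \<Longrightarrow> y \<in> K1 \<longleftrightarrow> (y - s) \<bullet> n < 0"
    "\<And>y. y \<in> ball s r \<Longrightarrow> y \<in> \<Omega>\<^sub>2 \<longleftrightarrow> 0 < (y - s) \<bullet> n" "\<And>y. y \<in> ball s r \<Longrightarrow> y \<in> K2 \<longleftrightarrow> 0 < (y - s) \<bullet> n"
    "\<And>y. y \<in> ball s r \<Longrightarrow> y \<in> \<Gamma> \<longleftrightarrow> (y - s) \<bullet> n = 0"
    "\<And>L. L \<in> \<T> \<Longrightarrow> L \<noteq> K1 \<Longrightarrow> L \<noteq> K2 \<Longrightarrow> closure L \<inter> ball s r = {}"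
    by (rule f[THEN conjunct1] f[THEN conjunct2, THEN conjunct1]
        f[THEN conjunct2, THEN conjunct2, THEN conjunct1]
        f[THEN conjunct2, THEN conjunct2, THEN conjunct2, THEN conjunct1]
        f[THEN conjunct2, THEN conjunct2, THEN conjunct2, THEN conjunct2, THEN conjunct1]
        f[THEN conjunct2, THEN conjunct2, THEN conjunct2, THEN conjunct2, THEN conjunct2, THEN conjunct1]
        f[THEN conjunct2, THEN conjunct2, THEN conjunct2, THEN conjunct2, THEN conjunct2, THEN conjunct2,
          THEN conjunct1, THEN bspec]
        g[THEN conjunct1, THEN bspec] g[THEN conjunct2, THEN conjunct1, THEN bspec]
        g[THEN conjunct2, THEN conjunct2, THEN conjunct1, THEN bspec]
        g[THEN conjunct2, THEN conjunct2, THEN conjunct2, THEN conjunct1, THEN bspec]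
        g[THEN conjunct2, THEN conjunct2, THEN conjunct2, THEN conjunct2, rule_format]; assumption)+
qed

lemma edge_nbhd_flat:
  assumes e: "edge_nbhd s K1 K2 P P' A B n r" and K1: "K1 \<subseteq> \<Omega>\<^sub>1" and K2: "K2 \<subseteq> \<Omega>\<^sub>2"
  shows "flat s K1 K2 n r"
proof -
  note e' = edge_nbhdD[OF e]
  have dis: "\<Omega>\<^sub>1 \<inter> closure K2 = {}" "\<Omega>\<^sub>2 \<inter> closure K1 = {}"
  proof -
    have "\<Omega>\<^sub>1 \<inter> K2 = {}" "\<Omega>\<^sub>2 \<inter> K1 = {}" using \<Omega>12_disjoint K1 K2 by blast+
    then show "\<Omega>\<^sub>1 \<inter> closure K2 = {}" "\<Omega>\<^sub>2 \<inter> closure K1 = {}"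
      by (simp_all only: open_Int_closure_eq_empty[OF open_\<Omega>1] open_Int_closure_eq_empty[OF open_\<Omega>2])
  qed
  have neg: "y \<in> K1" "y \<in> \<Omega>\<^sub>1" "y \<notin> \<Omega>\<^sub>2" if "y \<in> ball s r" "(y - s) \<bullet> n < 0" for y
    using e'(11)[OF that(1)] that(2) K1 \<Omega>12_disjoint by blast+
  have pos: "y \<in> K2" "y \<in> \<Omega>\<^sub>2" "y \<notin> \<Omega>\<^sub>1" if "y \<in> ball s r" "0 < (y - s) \<bullet> n" for y
    using e'(12)[OF that(1)] that(2) K2 \<Omega>12_disjoint by blast+
  have zero: "y \<notin> \<Omega>\<^sub>1" "y \<notin> \<Omega>\<^sub>2" if "y \<in> ball s r" "(y - s) \<bullet> n = 0" for y
    using edge_nbhd_line[OF e that] dis by blast+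
  have zero\<Gamma>: "y \<in> \<Gamma>" if y: "y \<in> ball s r" "(y - s) \<bullet> n = 0" for y
  proof -
    obtain G where G: "G \<in> G1" "K1 \<subseteq> G" using element_region[OF e'(1) K1 disjI1[OF refl]] by blast
    have "y \<in> closure G" using edge_nbhd_line(1)[OF e y] closure_mono[OF G(2)] by blast
    moreover have "y \<notin> G" using zero(1)[OF y] G(1) by blast
    ultimately have "y \<in> frontier G" using region_open[of G] G(1) by (simp add: frontier_def interior_open)
    moreover have "y \<notin> frontier \<Omega>"
      using subsetD[OF e'(10) y(1)] open_\<Omega> by (simp add: frontier_def interior_open)
    ultimately show ?thesis unfolding interface_def using G(1) by blast
  qed
  have cases: "y \<in> ball s r \<Longrightarrow> (y \<in> \<Omega>\<^sub>1 \<longleftrightarrow> (y - s) \<bullet> n < 0) \<and> (y \<in> \<Omega>\<^sub>2 \<longleftrightarrow> 0 < (y - s) \<bullet> n) \<and>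
     (y \<in> \<Gamma> \<longleftrightarrow> (y - s) \<bullet> n = 0)" for y
  proof -
    assume y: "y \<in> ball s r"
    consider "(y - s) \<bullet> n < 0" | "(y - s) \<bullet> n = 0" | "0 < (y - s) \<bullet> n" by linarith
    then show ?thesis
    proof cases
      case 1
      then have "y \<notin> \<Gamma>" using neg(2)[OF y 1] interface_avoids(1) by blast
      then show ?thesis using neg[OF y 1] 1 by simp
    next
      case 2
      then show ?thesis using zero[OF y 2] zero\<Gamma>[OF y 2] by simp
    next
      case 3
      then have "y \<notin> \<Gamma>" using pos(2)[OF y 3] interface_avoids(2) by blast
      then show ?thesis using pos[OF y 3] 3 by simp
    qed
  qed
  then show ?thesis unfolding flat_def using e' K1 K2 by simp
qed

lemma covered: "x \<in> \<Omega> \<Longrightarrow> \<exists>K\<in>\<T>. x \<in> closure K"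
  using closure_elements closure_subset[of \<Omega>] by blast

lemma interface_not_in_element:
  assumes "K \<in> \<T>" "s \<in> \<Gamma>" shows "s \<notin> K"
  using element_colour[OF assms(1)] interface_avoids assms(2) by blast

text \<open>The two elements at the edge through \<open>s\<close> have different colours, since otherwise a
  neighbourhood of \<open>s\<close> would lie in one region and \<open>s\<close> would not be on
  the interface.\<close>

lemma interface_flat:
  assumes s: "s \<in> \<Gamma>" "s \<notin> mesh_vertices"
  shows "\<exists>K1 K2 n r. flat s K1 K2 n r"
proof -
  have s\<Omega>: "s \<in> \<Omega>" using s(1) interface_subset by blast
  obtain K where K: "K \<in> \<T>" "s \<in> closure K" using covered[OF s\<Omega>] by blast
  obtain K' P P' A B n r where e: "edge_nbhd s K K' P P' A B n r"
    using edge_nbhd_exists[OF s\<Omega> s(2) K interface_not_in_element[OF K(1) s(1)]] by blast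
  note e' = edge_nbhdD[OF e]
  have no: "\<not> (K \<subseteq> \<Union>\<C> \<and> K' \<subseteq> \<Union>\<C>)" if col: "\<C> = G1 \<or> \<C> = G2" for \<C>
  proof
    assume "K \<subseteq> \<Union>\<C> \<and> K' \<subseteq> \<Union>\<C>"
    then obtain G where "G \<in> \<C>" "ball s r \<subseteq> G" using same_colour_edge_interior[OF e col] by blast
    moreover have "s \<in> ball s r" using e'(9) by simp
    ultimately have "s \<in> \<Omega>\<^sub>1 \<or> s \<in> \<Omega>\<^sub>2" using col by blast
    then show False using interface_avoids s(1) by blast
  qed
  have "K' \<in> \<T>" by (rule e')
  from element_colour[OF K(1)] element_colour[OF this] no[OF disjI1[OF refl]] no[OF disjI2[OF refl]]
  consider "K \<subseteq> \<Omega>\<^sub>1" "K' \<subseteq> \<Omega>\<^sub>2" | "K \<subseteq> \<Omega>\<^sub>2" "K' \<subseteq> \<Omega>\<^sub>1" by argo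
  then show ?thesis
  proof cases
    case 1
    then show ?thesis using edge_nbhd_flat[OF e] by blast
  next
    case 2
    then show ?thesis using edge_nbhd_flat[OF edge_nbhd_swap[OF e]] by blast
  qed
qed

lemma flat_shift:
  assumes f: "flat s K1 K2 n r" and s': "s' \<in> \<Gamma>" "s' \<in> ball s r"
  shows "flat s' K1 K2 n (r - dist s s')"
proof -
  note f' = flatD[OF f]
  have 0: "(s' - s) \<bullet> n = 0" using f'(11)[OF s'(2)] s'(1) by simp
  have eq: "(y - s') \<bullet> n = (y - s) \<bullet> n" for y using 0 by (simp add: inner_diff_left)
  have sub: "y \<in> ball s r" if "y \<in> ball s' (r - dist s s')" for y
    using that dist_triangle[of s y s'] by simp
  have "ball s' (r - dist s s') \<subseteq> ball s r" using sub by blast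
  moreover have "0 < r - dist s s'" using s'(2) by simp
  moreover have "closure L \<inter> ball s' (r - dist s s') = {}" if "L \<in> \<T>" "L \<noteq> K1" "L \<noteq> K2" for L
    using f'(12)[OF that] calculation(1) by blast
  ultimately show ?thesis unfolding flat_def eq using f'(1-5) f'(7-11)[OF sub] by simp
qed

text \<open>Uniqueness of the normal: two different unit vectors \<open>m\<close> and \<open>n\<close>
  define different half-discs, as the direction \<open>m - n\<close> shows.\<close>

lemma flat_outer_normal:
  assumes f: "flat s K1 K2 n r"
  shows "outer_normal \<Omega>\<^sub>1 s = n"
  unfolding outer_normal_def
proof (rule the_equality)
  note f' = flatD[OF f]
  have "\<Omega>\<^sub>1 \<inter> ball s r = {y \<in> ball s r. (y - s) \<bullet> n < 0}" using f'(7) by blast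
  then show "norm n = 1 \<and> (\<exists>r>0. \<Omega>\<^sub>1 \<inter> ball s r = {y \<in> ball s r. (y - s) \<bullet> n < 0})"
    using f'(5,6) by blast
  fix m assume m: "norm m = 1 \<and> (\<exists>r>0. \<Omega>\<^sub>1 \<inter> ball s r = {y \<in> ball s r. (y - s) \<bullet> m < 0})"
  then obtain r' where r': "0 < r'" "\<Omega>\<^sub>1 \<inter> ball s r' = {y \<in> ball s r'. (y - s) \<bullet> m < 0}" by blast
  show "m = n"
  proof (rule ccontr)
    assume ne: "m \<noteq> n"
    have nn: "n \<bullet> n = 1" "m \<bullet> m = 1" using f'(5) m by (simp_all add: norm_eq_1)
    have "0 < (m - n) \<bullet> (m - n)" using ne by simp
    also have "(m - n) \<bullet> (m - n) = m \<bullet> m - m \<bullet> n - (n \<bullet> m - n \<bullet> n)"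
      by (simp only: inner_diff_left inner_diff_right)
    finally have lt: "m \<bullet> n < 1" using nn inner_commute[of n m] by linarith
    define t where "t = min r r' / (2 * norm (m - n))"
    have npos: "0 < norm (m - n)" using ne by simp
    have rpos: "0 < r" by (rule f'(6))
    have t: "0 < t" using npos rpos r'(1) by (simp add: t_def)
    have tn: "t * norm (m - n) = min r r' / 2" using npos by (simp add: t_def)
    have "norm (t *\<^sub>R (m - n)) = min r r' / 2" using t tn by simp
    then have y: "s + t *\<^sub>R (m - n) \<in> ball s r" "s + t *\<^sub>R (m - n) \<in> ball s r'"
      using rpos r'(1) by (auto simp: dist_norm)
    have "(s + t *\<^sub>R (m - n) - s) \<bullet> n = t * (m \<bullet> n - 1)" "(s + t *\<^sub>R (m - n) - s) \<bullet> m = t * (1 - m \<bullet> n)"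
    proof -
      have *: "(s + t *\<^sub>R (m - n) - s) \<bullet> w = t * (m \<bullet> w - n \<bullet> w)" for w
        by (simp only: add_diff_cancel_left' inner_scaleR_left inner_diff_left)
      show "(s + t *\<^sub>R (m - n) - s) \<bullet> n = t * (m \<bullet> n - 1)" "(s + t *\<^sub>R (m - n) - s) \<bullet> m = t * (1 - m \<bullet> n)"
        unfolding * nn inner_commute[of n m] by simp_all
    qed
    moreover have "t * (m \<bullet> n - 1) < 0" "\<not> t * (1 - m \<bullet> n) < 0"
      using t lt by (simp_all add: mult_less_0_iff not_less)
    ultimately have "s + t *\<^sub>R (m - n) \<in> \<Omega>\<^sub>1" "\<not> (s + t *\<^sub>R (m - n) - s) \<bullet> m < 0"
      using f'(7)[OF y(1)] by metis+
    then show False using y(2) r'(2) by blast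
  qed
qed

lemma flat_on_boundary:
  assumes f: "flat s K1 K2 n r"
  shows "s \<in> closure K1" "s \<in> closure K2" "s \<in> \<Gamma>"
proof -
  note f' = flatD[OF f]
  have s: "s \<in> ball s r" using f'(6) by simp
  show "s \<in> closure K2"
    by (rule on_line_in_closure[of s r n K2 s]) (use f'(5,10) s in auto)
  show "s \<in> closure K1"
    by (rule on_line_in_closure[of s r "- n" K1 s]) (use f'(5,8) s in auto)
  show "s \<in> \<Gamma>" using f'(11)[OF s] by simp
qed

lemma flat_elements:
  assumes f: "flat s K1 K2 n r" and L: "L \<in> \<T>" "s \<in> closure L"
  shows "L = K1 \<or> L = K2"
proof -
  have "s \<in> ball s r" using flatD(6)[OF f] by simp
  then show ?thesis using flatD(12)[OF f L(1)] L(2) by blast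
qed

lemma flat_trace:
  fixes h h' :: "plane \<Rightarrow> 'b::euclidean_space"
  assumes f: "flat s K1 K2 n r"
  shows "v \<in> borel_measurable (lebesgue_on \<Omega>\<^sub>1) \<Longrightarrow> AE x in lebesgue_on K1. v x = h x \<Longrightarrow>
      continuous_on UNIV h \<Longrightarrow> boundary_trace \<Omega>\<^sub>1 v s = h s"
    and "q \<in> borel_measurable (lebesgue_on \<Omega>\<^sub>2) \<Longrightarrow> AE x in lebesgue_on K2. q x = h' x \<Longrightarrow>
      continuous_on UNIV h' \<Longrightarrow> boundary_trace \<Omega>\<^sub>2 q s = h' s"
proof -
  note f' = flatD[OF f]
  have K: "K1 \<in> sets lebesgue" "K2 \<in> sets lebesgue" using element_open[OF f'(1)] element_open[OF f'(2)] by auto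
  have r: "0 < r" by (rule f'(6))
  {
    assume v: "v \<in> borel_measurable (lebesgue_on \<Omega>\<^sub>1)" "AE x in lebesgue_on K1. v x = h x" "continuous_on UNIV h"
    have eq: "\<Omega>\<^sub>1 \<inter> ball s r = K1 \<inter> ball s r" using f'(7,8) by blast
    have "AE x in lebesgue. x \<in> K1 \<longrightarrow> v x = h x" using v(2) K by (subst (asm) AE_restrict_space_iff) auto
    then have "AE x in lebesgue. x \<in> \<Omega>\<^sub>1 \<inter> ball s r \<longrightarrow> v x = h x" unfolding eq by eventually_elim auto
    then have ae: "AE x in lebesgue_on (\<Omega>\<^sub>1 \<inter> ball s r). v x = h x"
      using open_\<Omega>1 by (subst AE_restrict_space_iff) auto
    have "s \<in> closure \<Omega>\<^sub>1" using flat_on_boundary(1)[OF f] closure_mono[OF f'(3)] by blast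
    from boundary_trace_eqI[OF open_\<Omega>1 this r v(1) ae v(3)] show "boundary_trace \<Omega>\<^sub>1 v s = h s" .
  }
  {
    assume q: "q \<in> borel_measurable (lebesgue_on \<Omega>\<^sub>2)" "AE x in lebesgue_on K2. q x = h' x" "continuous_on UNIV h'"
    have eq: "\<Omega>\<^sub>2 \<inter> ball s r = K2 \<inter> ball s r" using f'(9,10) by blast
    have "AE x in lebesgue. x \<in> K2 \<longrightarrow> q x = h' x" using q(2) K by (subst (asm) AE_restrict_space_iff) auto
    then have "AE x in lebesgue. x \<in> \<Omega>\<^sub>2 \<inter> ball s r \<longrightarrow> q x = h' x" unfolding eq by eventually_elim auto
    then have ae: "AE x in lebesgue_on (\<Omega>\<^sub>2 \<inter> ball s r). q x = h' x"
      using open_\<Omega>2 by (subst AE_restrict_space_iff) auto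
    have "s \<in> closure \<Omega>\<^sub>2" using flat_on_boundary(2)[OF f] closure_mono[OF f'(4)] by blast
    from boundary_trace_eqI[OF open_\<Omega>2 this r q(1) ae q(3)] show "boundary_trace \<Omega>\<^sub>2 q s = h' s" .
  }
qed

text \<open>The elements in \<open>Z\<close> and the remaining ones would have closures that split
  \<open>\<Omega> - mesh_vertices\<close> into two relatively closed sets; these are disjoint,
  since at a common point one could cross an edge out of \<open>Z\<close>. But removing finitely
  many points does not disconnect \<open>\<Omega>\<close>.\<close>

lemma edge_connected:
  assumes ZT: "Z \<subseteq> \<T>" "Z \<noteq> {}"
    and cross: "\<And>x K K' P P' A B n r. K \<in> Z \<Longrightarrow> edge_nbhd x K K' P P' A B n r \<Longrightarrow> K' \<in> Z"
  shows "Z = \<T>"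
proof (rule ccontr)
  assume "Z \<noteq> \<T>"
  let ?S = "\<Union>K\<in>Z. closure K" and ?S' = "\<Union>K\<in>\<T> - Z. closure K"
  have "closed ?S" "closed ?S'" using finite_\<T> ZT by (auto intro!: closed_UN intro: finite_subset)
  moreover have conn: "connected (\<Omega> - mesh_vertices)"
    using connected_open_diff_countable[of \<Omega> mesh_vertices] open_\<Omega> connected_\<Omega> finite_mesh_vertices by (simp add: countable_finite)
  moreover have "\<Omega> - mesh_vertices \<subseteq> ?S \<union> ?S'" using covered by blast
  moreover have "?S \<inter> ?S' \<inter> (\<Omega> - mesh_vertices) = {}"
  proof (rule ccontr)
    assume "?S \<inter> ?S' \<inter> (\<Omega> - mesh_vertices) \<noteq> {}"
    then obtain x K L where x: "x \<in> \<Omega>" "x \<notin> mesh_vertices" and K: "K \<in> Z" "x \<in> closure K"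
      and L: "L \<in> \<T>" "L \<notin> Z" "x \<in> closure L" by blast
    have KT: "K \<in> \<T>" using K ZT by blast
    have "K \<noteq> L" using K L by blast
    then have xK: "x \<notin> K" using elements_meet_eq[OF KT L(1)] L(3) by blast
    obtain K' P P' A B n r where e: "edge_nbhd x K K' P P' A B n r"
      using edge_nbhd_exists[OF x KT K(2) xK] by blast
    have "x \<in> ball x r" using edge_nbhdD(9)[OF e] by simp
    then have "L = K'" using edge_nbhdD(13)[OF e L(1)] L(3) \<open>K \<noteq> L\<close> by blast
    then show False using cross[OF K(1) e] L(2) by blast
  qed
  moreover have meets: "closure K \<inter> (\<Omega> - mesh_vertices) \<noteq> {}" if K: "K \<in> \<T>" for K
  proof -
    have "infinite K"
      using element_open[OF K] element_nonempty[OF K] finite_imp_not_open by blast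
    then have "K - mesh_vertices \<noteq> {}" using finite_mesh_vertices finite_subset[of K mesh_vertices] by blast
    then show ?thesis using element_subset_\<Omega>[OF K] closure_subset[of K] by blast
  qed
  moreover obtain K where "K \<in> Z" using ZT by blast
  moreover obtain K' where "K' \<in> \<T> - Z" using ZT \<open>Z \<noteq> \<T>\<close> by blast
  moreover have "?S \<inter> (\<Omega> - mesh_vertices) \<noteq> {}" using meets \<open>K \<in> Z\<close> ZT by blast
  moreover have "?S' \<inter> (\<Omega> - mesh_vertices) \<noteq> {}" using meets \<open>K' \<in> \<T> - Z\<close> by blast
  ultimately show False unfolding connected_closed by blast
qed

end

section \<open>Square-integrable functions and weak derivatives\<close>

lemma L2_measurable: "f \<in> L2 U \<Longrightarrow> f \<in> borel_measurable (lebesgue_on U)"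
  by (simp add: L2_def)

lemma L2_square_integrable: "f \<in> L2 U \<Longrightarrow> integrable (lebesgue_on U) (\<lambda>x. (norm (f x))\<^sup>2)"
  by (simp add: L2_def)

lemma mult_le_sum_squares: "x * y \<le> x\<^sup>2 + (y::real)\<^sup>2"
  using sum_squares_bound[of x y] zero_le_power2[of x] zero_le_power2[of y] by linarith

lemma L2_inner_integrable:
  fixes f g :: "plane \<Rightarrow> 'b::euclidean_space"
  assumes "f \<in> L2 U" "g \<in> L2 U"
  shows "integrable (lebesgue_on U) (\<lambda>x. f x \<bullet> g x)"
proof (rule Bochner_Integration.integrable_bound)
  show "integrable (lebesgue_on U) (\<lambda>x. (norm (f x))\<^sup>2 + (norm (g x))\<^sup>2)"
    using assms by (intro Bochner_Integration.integrable_add L2_square_integrable)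
  show "(\<lambda>x. f x \<bullet> g x) \<in> borel_measurable (lebesgue_on U)"
    using assms by (intro borel_measurable_inner L2_measurable)
  have "norm (f x \<bullet> g x) \<le> norm ((norm (f x))\<^sup>2 + (norm (g x))\<^sup>2)" for x
    using Cauchy_Schwarz_ineq2[of "f x" "g x"] mult_le_sum_squares[of "norm (f x)" "norm (g x)"] by simp
  then show "AE x in lebesgue_on U. norm (f x \<bullet> g x) \<le> norm ((norm (f x))\<^sup>2 + (norm (g x))\<^sup>2)" by simp
qed

lemma L2_mult_integrable:
  fixes f g :: "plane \<Rightarrow> real"
  assumes "f \<in> L2 U" "g \<in> L2 U"
  shows "integrable (lebesgue_on U) (\<lambda>x. f x * g x)"
  using L2_inner_integrable[OF assms] by simp

lemma L2_scaleR_integrable: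
  fixes f :: "plane \<Rightarrow> real" and g :: "plane \<Rightarrow> 'b::euclidean_space"
  assumes "f \<in> L2 U" "g \<in> L2 U"
  shows "integrable (lebesgue_on U) (\<lambda>x. f x *\<^sub>R g x)"
proof (rule Bochner_Integration.integrable_bound)
  show "integrable (lebesgue_on U) (\<lambda>x. (norm (f x))\<^sup>2 + (norm (g x))\<^sup>2)"
    using assms by (intro Bochner_Integration.integrable_add L2_square_integrable)
  show "(\<lambda>x. f x *\<^sub>R g x) \<in> borel_measurable (lebesgue_on U)"
    using assms by (intro borel_measurable_scaleR L2_measurable)
  have "norm (f x *\<^sub>R g x) \<le> norm ((norm (f x))\<^sup>2 + (norm (g x))\<^sup>2)" for x
    using mult_le_sum_squares[of "norm (f x)" "norm (g x)"] by simp
  then show "AE x in lebesgue_on U. norm (f x *\<^sub>R g x) \<le> norm ((norm (f x))\<^sup>2 + (norm (g x))\<^sup>2)" by simp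
qed

lemma Linf_mult_integrable:
  fixes f :: "'a \<Rightarrow> real"
  assumes a: "a \<in> Linf M" and f: "integrable M f"
  shows "integrable M (\<lambda>x. a x * f x)"
proof -
  obtain C where C: "AE x in M. \<bar>a x\<bar> \<le> C" and m: "a \<in> borel_measurable M"
    using a by (auto simp: Linf_def)
  show ?thesis
  proof (rule Bochner_Integration.integrable_bound)
    show "integrable M (\<lambda>x. C * f x)" using f by simp
    show "(\<lambda>x. a x * f x) \<in> borel_measurable M"
      using m borel_measurable_integrable[OF f] by (rule borel_measurable_times)
    show "AE x in M. norm (a x * f x) \<le> norm (C * f x)"
      using C
    proof eventually_elim
      case (elim x)
      then have "\<bar>a x\<bar> * \<bar>f x\<bar> \<le> \<bar>C\<bar> * \<bar>f x\<bar>" by (intro mult_right_mono) auto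
      then show ?case by (simp add: abs_mult)
    qed
  qed
qed

lemma L2_lincomb:
  fixes f g :: "plane \<Rightarrow> 'b::euclidean_space"
  assumes "f \<in> L2 U" "g \<in> L2 U"
  shows "(\<lambda>x. c *\<^sub>R f x + d *\<^sub>R g x) \<in> L2 U"
proof -
  have m: "(\<lambda>x. c *\<^sub>R f x + d *\<^sub>R g x) \<in> borel_measurable (lebesgue_on U)"
    using assms by (intro borel_measurable_add borel_measurable_scaleR borel_measurable_const L2_measurable)
  have "(norm (c *\<^sub>R f x + d *\<^sub>R g x))\<^sup>2 = c * c * (f x \<bullet> f x) + 2 * c * d * (f x \<bullet> g x) + d * d * (g x \<bullet> g x)" for x
    by (simp add: power2_norm_eq_inner inner_add_left inner_add_right inner_commute[of "g x" "f x"] algebra_simps)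
  moreover have "integrable (lebesgue_on U)
      (\<lambda>x. c * c * (f x \<bullet> f x) + 2 * c * d * (f x \<bullet> g x) + d * d * (g x \<bullet> g x))"
    using assms by (intro Bochner_Integration.integrable_add integrable_mult_right L2_inner_integrable)
  ultimately show ?thesis using m by (simp add: L2_def)
qed

lemma L2_lincomb_real:
  fixes f g :: "plane \<Rightarrow> real"
  shows "f \<in> L2 U \<Longrightarrow> g \<in> L2 U \<Longrightarrow> (\<lambda>x. c * f x + d * g x) \<in> L2 U"
  using L2_lincomb[of f U g c d] by simp

lemma L2_AE_bounded:
  fixes f :: "plane \<Rightarrow> 'b::euclidean_space"
  assumes U: "U \<in> lmeasurable" and m: "f \<in> borel_measurable (lebesgue_on U)"
    and C: "AE x in lebesgue_on U. norm (f x) \<le> C"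
  shows "f \<in> L2 U" "0 \<le> C \<Longrightarrow> L2_norm U f \<le> C * sqrt (measure lebesgue U)"
proof -
  interpret finite_measure "lebesgue_on U" using U by (rule finite_measure_lebesgue_on)
  have le: "AE x in lebesgue_on U. (norm (f x))\<^sup>2 \<le> C\<^sup>2"
    using C by eventually_elim (simp add: power_mono)
  have i: "integrable (lebesgue_on U) (\<lambda>x. (norm (f x))\<^sup>2)"
    by (rule integrable_const_bound[of _ "C\<^sup>2"]) (use le m in auto)
  then show "f \<in> L2 U" using m by (simp add: L2_def)
  assume "0 \<le> C"
  have "(LINT x|lebesgue_on U. (norm (f x))\<^sup>2) \<le> (LINT x|lebesgue_on U. C\<^sup>2)"
    using i le by (intro integral_mono_AE) auto
  also have "\<dots> = C\<^sup>2 * measure lebesgue U"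
    using U by (simp add: measure_restrict_space fmeasurableD mult.commute)
  finally have "L2_norm U f \<le> sqrt (C\<^sup>2 * measure lebesgue U)"
    unfolding L2_norm_def by (rule real_sqrt_le_mono)
  then show "L2_norm U f \<le> C * sqrt (measure lebesgue U)"
    using \<open>0 \<le> C\<close> by (simp add: real_sqrt_mult)
qed

lemma L2_norm_nonneg: "0 \<le> L2_norm U f"
  unfolding L2_norm_def by (intro real_sqrt_ge_zero Bochner_Integration.integral_nonneg) simp

lemma continuous_imp_measurable_lebesgue_on:
  fixes f :: "plane \<Rightarrow> 'b::euclidean_space"
  shows "continuous_on UNIV f \<Longrightarrow> f \<in> borel_measurable (lebesgue_on U)"
  using borel_measurable_continuous_onI[of f]
  by (intro measurable_restrict_space1 measurable_completion) simp

lemma continuous_L2: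
  fixes f :: "plane \<Rightarrow> 'b::euclidean_space"
  assumes "continuous_on UNIV f" "open U" "bounded U"
  shows "f \<in> L2 U"
proof -
  have "compact (f ` closure U)"
    using assms by (intro compact_continuous_image) (auto intro: continuous_on_subset)
  then obtain C where C: "\<And>y. y \<in> f ` closure U \<Longrightarrow> norm y \<le> C"
    using compact_imp_bounded bounded_iff by metis
  have "U \<in> lmeasurable" using assms by (intro bounded_set_imp_lmeasurable) auto
  moreover have "norm (f x) \<le> C" if "x \<in> U" for x
    using C[of "f x"] that closure_subset[of U] by blast
  then have "AE x in lebesgue_on U. norm (f x) \<le> C" by (intro AE_I2) (simp add: space_restrict_space)
  ultimately show ?thesis
    using L2_AE_bounded(1)[OF _ continuous_imp_measurable_lebesgue_on[OF assms(1)]] by blast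
qed

lemma test_function_gradient:
  assumes "\<phi> \<in> test_functions U"
  shows "(\<phi> has_derivative (\<lambda>h. gradient \<phi> x \<bullet> h)) (at x)" "continuous_on UNIV (gradient \<phi>)"
proof -
  obtain D where D: "D 0 0 = \<phi>"
    "\<And>i j x. (D i j has_derivative (\<lambda>h. D (Suc i) j x * h$1 + D i (Suc j) x * h$2)) (at x)"
    using assms unfolding test_functions_def smooth_def by blast
  have fd: "frechet_derivative \<phi> (at x) = (\<lambda>h. D 1 0 x * h$1 + D 0 1 x * h$2)" for x
    using frechet_derivative_at[OF D(2)[of 0 0 x]] D(1) by simp
  have g1: "gradient \<phi> x $ 1 = D 1 0 x" "gradient \<phi> x $ 2 = D 0 1 x" for x
    unfolding gradient_def fd by (simp_all add: axis_def)
  show "(\<phi> has_derivative (\<lambda>h. gradient \<phi> x \<bullet> h)) (at x)"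
    using D(2)[of 0 0 x] D(1) by (simp add: inner_vec_def sum_2 g1)
  have c: "continuous_on UNIV (D i j)" for i j
    unfolding continuous_on_eq_continuous_at[OF open_UNIV] using has_derivative_continuous[OF D(2)] by blast
  have "gradient \<phi> = (\<lambda>x. D 1 0 x *\<^sub>R axis 1 1 + D 0 1 x *\<^sub>R axis 2 1)"
    by (rule ext) (simp add: vec_eq_iff forall_2 g1 axis_def)
  then show "continuous_on UNIV (gradient \<phi>)" using c by (simp add: continuous_intros)
qed

lemma test_function_L2:
  assumes "\<phi> \<in> test_functions U" "open W" "bounded W"
  shows "\<phi> \<in> L2 W" "gradient \<phi> \<in> L2 W"
  using continuous_L2[OF test_function_continuous[OF assms(1)] assms(2,3)]
    continuous_L2[OF test_function_gradient(2)[OF assms(1)] assms(2,3)] by blast+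

lemma test_function_outside:
  assumes \<phi>: "\<phi> \<in> test_functions U" and x: "x \<notin> U"
  shows "\<phi> x = 0" "gradient \<phi> x = 0"
proof -
  let ?S = "closure {x. \<phi> x \<noteq> 0}"
  have xS: "x \<in> - ?S" using \<phi> x by (auto simp: test_functions_def)
  have zero: "\<phi> y = 0" if "y \<in> - ?S" for y
  proof (rule ccontr)
    assume "\<phi> y \<noteq> 0"
    then have "y \<in> {x. \<phi> x \<noteq> 0}" by simp
    then have "y \<in> ?S" by (rule subsetD[OF closure_subset])
    with that show False by simp
  qed
  show "\<phi> x = 0" using zero[OF xS] .
  have "((\<lambda>_. 0) has_derivative (\<lambda>h. 0)) (at x)" by (rule has_derivative_const)
  then have "(\<phi> has_derivative (\<lambda>h. 0)) (at x)"
    by (rule has_derivative_transform_within_open[OF _ open_Compl[OF closed_closure] xS zero[symmetric]])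
  from has_derivative_unique[OF this test_function_gradient(1)[OF \<phi>]]
  have "(\<lambda>h. 0) = (\<lambda>h. gradient \<phi> x \<bullet> h)" .
  then have "0 = gradient \<phi> x \<bullet> gradient \<phi> x" by (rule fun_cong)
  then show "gradient \<phi> x = 0" by simp
qed

lemma test_functions_mono: "U \<subseteq> W \<Longrightarrow> test_functions U \<subseteq> test_functions W"
  unfolding test_functions_def by blast

lemma integral_vanishing_outside:
  fixes f :: "plane \<Rightarrow> 'b::euclidean_space"
  assumes "open U" "open W" "W \<subseteq> U" "\<And>x. x \<in> U - W \<Longrightarrow> f x = 0"
  shows "(LINT x|lebesgue_on U. f x) = (LINT x|lebesgue_on W. f x)"
proof -
  have "(LINT x|lebesgue_on U. f x) = (LINT x|lebesgue. indicator U x *\<^sub>R f x)"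
    using assms by (intro integral_restrict_space) simp
  also have "(\<lambda>x. indicator U x *\<^sub>R f x) = (\<lambda>x. indicator W x *\<^sub>R f x)"
    using assms(3,4) by (intro ext) (auto split: split_indicator)
  also have "(LINT x|lebesgue. indicator W x *\<^sub>R f x) = (LINT x|lebesgue_on W. f x)"
    using assms by (intro integral_restrict_space[symmetric]) simp
  finally show ?thesis .
qed

lemma integrable_on_open_subset:
  fixes f :: "plane \<Rightarrow> 'b::euclidean_space"
  assumes "integrable (lebesgue_on U) f" "open U" "open W" "W \<subseteq> U"
  shows "integrable (lebesgue_on W) f"
proof -
  have "integrable lebesgue (\<lambda>x. indicator U x *\<^sub>R f x)"
    using assms(1,2) by (subst (asm) integrable_restrict_space) simp_all
  then have "integrable lebesgue (\<lambda>x. indicator W x *\<^sub>R (indicator U x *\<^sub>R f x))"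
    by (rule integrable_mult_indicator[rotated]) (use assms(3) in simp)
  moreover have "(\<lambda>x. indicator W x *\<^sub>R (indicator U x *\<^sub>R f x)) = (\<lambda>x. indicator W x *\<^sub>R f x)"
    using assms(4) by (intro ext) (auto split: split_indicator)
  ultimately have "integrable lebesgue (\<lambda>x. indicator W x *\<^sub>R f x)" by metis
  then show ?thesis using assms(3) by (subst integrable_restrict_space) simp_all
qed

lemma L2_subset:
  fixes f :: "plane \<Rightarrow> 'b::euclidean_space"
  assumes "f \<in> L2 U" "open U" "open W" "W \<subseteq> U" shows "f \<in> L2 W"
proof -
  have "f \<in> borel_measurable (lebesgue_on W)"
    by (rule measurable_restrict_mono[OF L2_measurable[OF assms(1)] assms(4)])
  then show ?thesis
    using integrable_on_open_subset[OF L2_square_integrable[OF assms(1)] assms(2-4)] by (simp add: L2_def)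
qed

lemma L2_integrable:
  fixes f :: "plane \<Rightarrow> 'b::euclidean_space"
  assumes "f \<in> L2 U" "open U" "bounded U"
  shows "integrable (lebesgue_on U) f"
proof -
  have "(\<lambda>x. 1::real) \<in> L2 U" using assms by (intro continuous_L2) auto
  from L2_scaleR_integrable[OF this assms(1)] show ?thesis by simp
qed

lemma is_weak_div_lincomb:
  assumes U: "open U" "bounded U" and "v \<in> L2 U" "w \<in> L2 U" "d \<in> L2 U" "e \<in> L2 U"
    and vd: "is_weak_div U v d" and we: "is_weak_div U w e"
  shows "is_weak_div U (\<lambda>x. c *\<^sub>R v x + c' *\<^sub>R w x) (\<lambda>x. c * d x + c' * e x)"
  unfolding is_weak_div_def
proof
  fix \<phi> assume \<phi>: "\<phi> \<in> test_functions U"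
  note L = test_function_L2[OF \<phi> U]
  have "(LINT x|lebesgue_on U. (c *\<^sub>R v x + c' *\<^sub>R w x) \<bullet> gradient \<phi> x)
    = (LINT x|lebesgue_on U. c * (v x \<bullet> gradient \<phi> x) + c' * (w x \<bullet> gradient \<phi> x))"
    by (simp add: inner_add_left)
  also have "\<dots> = c * (LINT x|lebesgue_on U. v x \<bullet> gradient \<phi> x) + c' * (LINT x|lebesgue_on U. w x \<bullet> gradient \<phi> x)"
    using L2_inner_integrable[OF assms(3) L(2)] L2_inner_integrable[OF assms(4) L(2)] by simp
  also have "\<dots> = - (c * (LINT x|lebesgue_on U. \<phi> x * d x) + c' * (LINT x|lebesgue_on U. \<phi> x * e x))"
    using vd we \<phi> by (simp add: is_weak_div_def)
  also have "\<dots> = - (LINT x|lebesgue_on U. c * (\<phi> x * d x) + c' * (\<phi> x * e x))"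
    using L2_mult_integrable[OF L(1) assms(5)] L2_mult_integrable[OF L(1) assms(6)] by simp
  also have "(\<lambda>x. c * (\<phi> x * d x) + c' * (\<phi> x * e x)) = (\<lambda>x. \<phi> x * (c * d x + c' * e x))"
    by (rule ext) (simp add: algebra_simps)
  finally show "(LINT x|lebesgue_on U. (c *\<^sub>R v x + c' *\<^sub>R w x) \<bullet> gradient \<phi> x)
    = - (LINT x|lebesgue_on U. \<phi> x * (c * d x + c' * e x))" .
qed

lemma is_weak_grad_lincomb:
  assumes U: "open U" "bounded U" and "q \<in> L2 U" "r \<in> L2 U" "g \<in> L2 U" "h \<in> L2 U"
    and qg: "is_weak_grad U q g" and rh: "is_weak_grad U r h"
  shows "is_weak_grad U (\<lambda>x. c * q x + c' * r x) (\<lambda>x. c *\<^sub>R g x + c' *\<^sub>R h x)"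
  unfolding is_weak_grad_def
proof
  fix \<phi> assume \<phi>: "\<phi> \<in> test_functions U"
  note L = test_function_L2[OF \<phi> U]
  have "(LINT x|lebesgue_on U. (c * q x + c' * r x) *\<^sub>R gradient \<phi> x)
    = (LINT x|lebesgue_on U. c *\<^sub>R (q x *\<^sub>R gradient \<phi> x) + c' *\<^sub>R (r x *\<^sub>R gradient \<phi> x))"
    by (simp add: scaleR_add_left)
  also have "\<dots> = c *\<^sub>R (LINT x|lebesgue_on U. q x *\<^sub>R gradient \<phi> x) + c' *\<^sub>R (LINT x|lebesgue_on U. r x *\<^sub>R gradient \<phi> x)"
    using L2_scaleR_integrable[OF assms(3) L(2)] L2_scaleR_integrable[OF assms(4) L(2)]
    by (simp del: scaleR_scaleR)
  also have "\<dots> = - (c *\<^sub>R (LINT x|lebesgue_on U. \<phi> x *\<^sub>R g x) + c' *\<^sub>R (LINT x|lebesgue_on U. \<phi> x *\<^sub>R h x))"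
    using qg rh \<phi> by (simp add: is_weak_grad_def)
  also have "\<dots> = - (LINT x|lebesgue_on U. c *\<^sub>R (\<phi> x *\<^sub>R g x) + c' *\<^sub>R (\<phi> x *\<^sub>R h x))"
    using L2_scaleR_integrable[OF L(1) assms(5)] L2_scaleR_integrable[OF L(1) assms(6)]
    by (simp del: scaleR_scaleR)
  also have "(\<lambda>x. c *\<^sub>R (\<phi> x *\<^sub>R g x) + c' *\<^sub>R (\<phi> x *\<^sub>R h x)) = (\<lambda>x. \<phi> x *\<^sub>R (c *\<^sub>R g x + c' *\<^sub>R h x))"
    by (rule ext) (simp add: scaleR_add_right mult.commute)
  finally show "(LINT x|lebesgue_on U. (c * q x + c' * r x) *\<^sub>R gradient \<phi> x)
    = - (LINT x|lebesgue_on U. \<phi> x *\<^sub>R (c *\<^sub>R g x + c' *\<^sub>R h x))" .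
qed

text \<open>Two candidates for a weak derivative coincide almost everywhere.\<close>

lemma AE_zero_of_orthogonal_L2:
  assumes U: "open U" "bounded U" and "d \<in> L2 U" "e \<in> L2 U"
    and orth: "\<And>\<phi>. \<phi> \<in> test_functions U \<Longrightarrow>
      (LINT x|lebesgue_on U. \<phi> x * d x) = (LINT x|lebesgue_on U. \<phi> x * e x)"
  shows "AE x in lebesgue_on U. d x = e x"
proof -
  have i: "integrable (lebesgue_on U) (\<lambda>x. d x - e x)"
    using L2_integrable[OF assms(3) U] L2_integrable[OF assms(4) U] by (rule Bochner_Integration.integrable_diff)
  have "AE x in lebesgue_on U. d x - e x = 0"
  proof (rule orthogonal_to_test_functions_imp_AE_zero[OF U(1) i])
    fix \<phi> assume \<phi>: "\<phi> \<in> test_functions U"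
    note L = test_function_L2(1)[OF \<phi> U]
    have "(LINT x|lebesgue_on U. \<phi> x * d x - \<phi> x * e x) = 0"
      using L2_mult_integrable[OF L assms(3)] L2_mult_integrable[OF L assms(4)] orth[OF \<phi>] by simp
    then show "(LINT x|lebesgue_on U. \<phi> x * (d x - e x)) = 0" by (simp add: right_diff_distrib)
  qed
  then show ?thesis by eventually_elim simp
qed

lemma edge_points_not_in_tri:
  assumes "triangle K P A B" "x \<in> open_segment A B" shows "x \<notin> K"
proof -
  have D: "cross2 (A - P) (B - P) \<noteq> 0" and K: "K = tri P A B" using assms(1) by (auto simp: triangle_def)
  obtain u where u: "x = (1 - u) *\<^sub>R A + u *\<^sub>R B" using assms(2) by (auto simp: in_segment)
  have "x = P + (1 - u) *\<^sub>R (A - P) + u *\<^sub>R (B - P)" unfolding u by (simp add: algebra_simps)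
  then show ?thesis using mem_tri_coordinates[OF D, of "1 - u" u] by (simp add: K)
qed

lemma triangle_flux:
  assumes "triangle K P A B" and deriv: "\<And>x. (\<psi> has_derivative (\<lambda>h. g x \<bullet> h)) (at x)"
    and cont: "continuous_on UNIV g"
  shows "(LINT x|lebesgue_on K. g x \<bullet> (x - P) + 2 * \<psi> x)
    = \<bar>cross2 (A - P) (B - P)\<bar> * edge_integral \<psi> A B"
  using flux_through_opposite_edge[OF deriv cont, of A P B] assms(1) by (simp add: triangle_def)

lemma triangle_bounded: "triangle K P A B \<Longrightarrow> bounded K"
  using triangle_closure[of K P A B] closure_subset[of K] bounded_subset[of "convex hull {P, A, B}" K]
  by (simp add: bounded_convex_hull)

text \<open>The flux formula holds with each of the three vertices as apex, with right-hand side zero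
  because \<open>\<psi>\<close> vanishes on the boundary. The differences of the three
  identities say that the integral of the gradient is orthogonal to two independent edges.\<close>

lemma triangle_integral_C1_vanishing:
  assumes t: "triangle K P A B" and deriv: "\<And>x. (\<psi> has_derivative (\<lambda>h. g x \<bullet> h)) (at x)"
    and cont: "continuous_on UNIV g" and zero: "\<And>x. x \<notin> K \<Longrightarrow> \<psi> x = 0"
  shows "(LINT x|lebesgue_on K. g x) = 0" "(LINT x|lebesgue_on K. g x \<bullet> x) = - 2 * (LINT x|lebesgue_on K. \<psi> x)"
proof -
  have K: "open K" "bounded K" using triangle_open[OF t] triangle_bounded[OF t] by auto
  have c\<psi>: "continuous_on UNIV \<psi>"
    using has_derivative_continuous[OF deriv] by (simp add: continuous_on_eq_continuous_at)
  have i\<psi>: "integrable (lebesgue_on K) \<psi>" and ig: "integrable (lebesgue_on K) g"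
    using continuous_L2[OF c\<psi> K] continuous_L2[OF cont K] L2_integrable K by blast+
  have igx: "integrable (lebesgue_on K) (\<lambda>x. g x \<bullet> x)"
    using continuous_L2[OF cont K] continuous_L2[OF continuous_on_id K] L2_inner_integrable by fastforce
  let ?I = "LINT x|lebesgue_on K. g x" and ?J = "LINT x|lebesgue_on K. g x \<bullet> x"
  have eq: "?J - ?I \<bullet> Q + 2 * (LINT x|lebesgue_on K. \<psi> x) = 0" if tQ: "triangle K Q X Y" for Q X Y
  proof -
    have "edge_integral \<psi> X Y = 0"
      by (rule edge_integral_zero) (use zero edge_points_not_in_tri[OF tQ] triangle_distinct[OF tQ] in auto)
    then have "(LINT x|lebesgue_on K. g x \<bullet> (x - Q) + 2 * \<psi> x) = 0"
      using triangle_flux[OF tQ deriv cont] by simp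
    moreover have "(LINT x|lebesgue_on K. g x \<bullet> (x - Q) + 2 * \<psi> x)
        = (LINT x|lebesgue_on K. (g x \<bullet> x - g x \<bullet> Q) + 2 * \<psi> x)" by (simp add: inner_diff_right)
    moreover have "\<dots> = (?J - ?I \<bullet> Q) + 2 * (LINT x|lebesgue_on K. \<psi> x)"
      using igx ig i\<psi> by simp
    ultimately show ?thesis by simp
  qed
  have tA: "triangle K A P B" and tB: "triangle K B P A"
    using t by (simp_all add: triangle_eq_interior insert_commute)
  have e: "?I \<bullet> A = ?I \<bullet> P" "?I \<bullet> B = ?I \<bullet> P" using eq[OF t] eq[OF tA] eq[OF tB] by linarith+
  show I0: "?I = 0"
  proof -
    define u v n where "u = A - P" and "v = B - P" and "n = ?I"
    have nn: "u$1 * n$1 + u$2 * n$2 = 0" "v$1 * n$1 + v$2 * n$2 = 0"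
      using e unfolding u_def v_def n_def[symmetric] by (simp_all add: inner_vec_def sum_2 algebra_simps)
    have "(a * q - b * p) * c = 0 \<and> (a * q - b * p) * d = 0"
      if "a * c + b * d = 0" "p * c + q * d = 0" for a b c d p q :: real using that by algebra
    from this[OF nn] have "cross2 u v * n$1 = 0 \<and> cross2 u v * n$2 = 0" unfolding cross2_def .
    moreover have "cross2 u v \<noteq> 0" using t by (simp add: triangle_def u_def v_def)
    ultimately have "n$1 = 0 \<and> n$2 = 0" by simp
    then show ?thesis by (simp add: vec_eq_iff forall_2 n_def)
  qed
  show "?J = - 2 * (LINT x|lebesgue_on K. \<psi> x)" using eq[OF t] I0 by simp
qed

text \<open>Weak derivatives are local: on each triangle they are the classical ones.\<close>

lemma weak_div_affine_on_triangle:
  assumes U: "open U" "bounded U" and t: "triangle K P A B" and KU: "K \<subseteq> U"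
    and d: "d \<in> L2 U" and vd: "is_weak_div U v d" and vL: "v \<in> L2 U"
    and ae: "AE x in lebesgue_on K. v x = b + c *\<^sub>R x"
  shows "AE x in lebesgue_on K. d x = 2 * c"
proof -
  have K: "open K" "bounded K" using triangle_open[OF t] triangle_bounded[OF t] by auto
  show ?thesis
  proof (rule AE_zero_of_orthogonal_L2[OF K L2_subset[OF d U(1) K(1) KU]])
    show "(\<lambda>x. 2 * c) \<in> L2 K" using K by (intro continuous_L2) auto
    fix \<phi> assume \<phi>: "\<phi> \<in> test_functions K"
    then have \<phi>U: "\<phi> \<in> test_functions U" using test_functions_mono[OF KU] by blast
    note g = test_function_gradient[OF \<phi>]
    note out = test_function_outside[OF \<phi>]
    note L = test_function_L2[OF \<phi> K]
    note C1 = triangle_integral_C1_vanishing[OF t g out(1)]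
    have "(LINT x|lebesgue_on K. \<phi> x * d x) = (LINT x|lebesgue_on U. \<phi> x * d x)"
      by (rule integral_vanishing_outside[OF U(1) K(1) KU, symmetric]) (use out in auto)
    also have "\<dots> = - (LINT x|lebesgue_on U. v x \<bullet> gradient \<phi> x)"
      using vd \<phi>U by (simp add: is_weak_div_def)
    also have "(LINT x|lebesgue_on U. v x \<bullet> gradient \<phi> x) = (LINT x|lebesgue_on K. v x \<bullet> gradient \<phi> x)"
      by (rule integral_vanishing_outside[OF U(1) K(1) KU]) (use out in auto)
    also have "\<dots> = (LINT x|lebesgue_on K. gradient \<phi> x \<bullet> b + c * (gradient \<phi> x \<bullet> x))"
    proof (rule integral_cong_AE)
      show "(\<lambda>x. v x \<bullet> gradient \<phi> x) \<in> borel_measurable (lebesgue_on K)"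
        using L2_inner_integrable[OF L2_subset[OF vL U(1) K(1) KU] L(2)] by (rule borel_measurable_integrable)
      show "(\<lambda>x. gradient \<phi> x \<bullet> b + c * (gradient \<phi> x \<bullet> x)) \<in> borel_measurable (lebesgue_on K)"
        by (intro continuous_imp_measurable_lebesgue_on continuous_intros g)
      show "AE x in lebesgue_on K. v x \<bullet> gradient \<phi> x = gradient \<phi> x \<bullet> b + c * (gradient \<phi> x \<bullet> x)"
        using ae
      proof eventually_elim
        case (elim x)
        then show ?case by (simp add: inner_add_left inner_commute[of "gradient \<phi> x"])
      qed
    qed
    also have "\<dots> = (LINT x|lebesgue_on K. gradient \<phi> x) \<bullet> b + c * (LINT x|lebesgue_on K. gradient \<phi> x \<bullet> x)"
    proof -
      have "integrable (lebesgue_on K) (gradient \<phi>)" by (rule L2_integrable[OF L(2) K])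
      moreover have "integrable (lebesgue_on K) (\<lambda>x. gradient \<phi> x \<bullet> x)"
        by (rule L2_inner_integrable[OF L(2) continuous_L2[OF continuous_on_id K]])
      ultimately show ?thesis by simp
    qed
    also have "\<dots> = - (LINT x|lebesgue_on K. \<phi> x * (2 * c))" using C1 by simp
    finally show "(LINT x|lebesgue_on K. \<phi> x * d x) = (LINT x|lebesgue_on K. \<phi> x * (2 * c))" by simp
  qed
qed

lemma weak_grad_affine_on_triangle:
  assumes U: "open U" "bounded U" and t: "triangle K P A B" and KU: "K \<subseteq> U"
    and h: "h \<in> L2 U" and qh: "is_weak_grad U q h" and qL: "q \<in> L2 U"
    and ae: "AE x in lebesgue_on K. q x = c + b \<bullet> x"
  shows "AE x in lebesgue_on K. h x = b"
proof -
  have K: "open K" "bounded K" using triangle_open[OF t] triangle_bounded[OF t] by auto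
  have comp: "AE x in lebesgue_on K. h x \<bullet> e = b \<bullet> e" for e :: plane
  proof (rule AE_zero_of_orthogonal_L2[OF K])
    have hK: "h \<in> L2 K" by (rule L2_subset[OF h U(1) K(1) KU])
    have inner_L2: "(\<lambda>x. f x \<bullet> e) \<in> L2 K" if "f \<in> L2 K" for f :: "plane \<Rightarrow> plane"
    proof -
      have m: "(\<lambda>x. f x \<bullet> e) \<in> borel_measurable (lebesgue_on K)"
        using L2_measurable[OF that] by (intro borel_measurable_inner borel_measurable_const)
      have "integrable (lebesgue_on K) (\<lambda>x. (norm (f x \<bullet> e))\<^sup>2)"
      proof (rule Bochner_Integration.integrable_bound)
        show "integrable (lebesgue_on K) (\<lambda>x. (norm e)\<^sup>2 * (norm (f x))\<^sup>2)"
          using L2_square_integrable[OF that] by simp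
        show "(\<lambda>x. (norm (f x \<bullet> e))\<^sup>2) \<in> borel_measurable (lebesgue_on K)" using m by simp
        have "norm ((norm (f x \<bullet> e))\<^sup>2) \<le> norm ((norm e)\<^sup>2 * (norm (f x))\<^sup>2)" for x
        proof -
          have "\<bar>f x \<bullet> e\<bar> \<le> norm (f x) * norm e" by (rule Cauchy_Schwarz_ineq2)
          then have "(\<bar>f x \<bullet> e\<bar>)\<^sup>2 \<le> (norm (f x) * norm e)\<^sup>2" by (rule power_mono) simp
          then show ?thesis by (simp add: power_mult_distrib mult.commute)
        qed
        then show "AE x in lebesgue_on K. norm ((norm (f x \<bullet> e))\<^sup>2) \<le> norm ((norm e)\<^sup>2 * (norm (f x))\<^sup>2)" by simp
      qed
      then show ?thesis using m by (simp add: L2_def)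
    qed
    show "(\<lambda>x. h x \<bullet> e) \<in> L2 K" by (rule inner_L2[OF hK])
    show "(\<lambda>x. b \<bullet> e) \<in> L2 K" using K by (intro continuous_L2) auto
    fix \<phi> assume \<phi>: "\<phi> \<in> test_functions K"
    then have \<phi>U: "\<phi> \<in> test_functions U" using test_functions_mono[OF KU] by blast
    note g = test_function_gradient[OF \<phi>]
    note out = test_function_outside[OF \<phi>]
    note L = test_function_L2[OF \<phi> K]
    have d\<psi>: "((\<lambda>x. (c + b \<bullet> x) * \<phi> x) has_derivative (\<lambda>y. ((c + b \<bullet> x) *\<^sub>R gradient \<phi> x + \<phi> x *\<^sub>R b) \<bullet> y)) (at x)" for x
      by (rule has_derivative_eq_rhs[OF has_derivative_mult[OF _ g(1)]])
        (auto intro!: derivative_eq_intros simp: inner_add_left)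
    have c\<psi>: "continuous_on UNIV (\<lambda>x. (c + b \<bullet> x) *\<^sub>R gradient \<phi> x + \<phi> x *\<^sub>R b)"
      by (intro continuous_intros g test_function_continuous[OF \<phi>])
    have cg: "continuous_on UNIV (\<lambda>x. (c + b \<bullet> x) *\<^sub>R gradient \<phi> x)" by (intro continuous_intros g)
    have z: "(LINT x|lebesgue_on K. (c + b \<bullet> x) *\<^sub>R gradient \<phi> x + \<phi> x *\<^sub>R b) = 0"
      by (rule triangle_integral_C1_vanishing(1)[OF t d\<psi> c\<psi>]) (use out in auto)
    have ib: "integrable (lebesgue_on K) (\<lambda>x. \<phi> x *\<^sub>R b)"
      using L2_integrable[OF L(1) K] by simp
    have "(LINT x|lebesgue_on K. (c + b \<bullet> x) *\<^sub>R gradient \<phi> x) = - (LINT x|lebesgue_on K. \<phi> x *\<^sub>R b)"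
      using z Bochner_Integration.integral_add[OF L2_integrable[OF continuous_L2[OF cg K] K] ib]
      by (simp add: add_eq_0_iff2)
    moreover have "(LINT x|lebesgue_on K. q x *\<^sub>R gradient \<phi> x) = (LINT x|lebesgue_on K. (c + b \<bullet> x) *\<^sub>R gradient \<phi> x)"
    proof (rule integral_cong_AE)
      show "(\<lambda>x. q x *\<^sub>R gradient \<phi> x) \<in> borel_measurable (lebesgue_on K)"
        using L2_scaleR_integrable[OF L2_subset[OF qL U(1) K(1) KU] L(2)] by (rule borel_measurable_integrable)
      show "(\<lambda>x. (c + b \<bullet> x) *\<^sub>R gradient \<phi> x) \<in> borel_measurable (lebesgue_on K)"
        by (rule continuous_imp_measurable_lebesgue_on[OF cg])
      show "AE x in lebesgue_on K. q x *\<^sub>R gradient \<phi> x = (c + b \<bullet> x) *\<^sub>R gradient \<phi> x"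
        using ae by eventually_elim simp
    qed
    moreover have "(LINT x|lebesgue_on U. q x *\<^sub>R gradient \<phi> x) = (LINT x|lebesgue_on K. q x *\<^sub>R gradient \<phi> x)"
      by (rule integral_vanishing_outside[OF U(1) K(1) KU]) (use out in auto)
    moreover have "(LINT x|lebesgue_on U. \<phi> x *\<^sub>R h x) = (LINT x|lebesgue_on K. \<phi> x *\<^sub>R h x)"
      by (rule integral_vanishing_outside[OF U(1) K(1) KU]) (use out in auto)
    moreover have "(LINT x|lebesgue_on U. q x *\<^sub>R gradient \<phi> x) = - (LINT x|lebesgue_on U. \<phi> x *\<^sub>R h x)"
      using qh \<phi>U by (simp add: is_weak_grad_def)
    ultimately have "(LINT x|lebesgue_on K. \<phi> x *\<^sub>R h x) \<bullet> e = (LINT x|lebesgue_on K. \<phi> x *\<^sub>R b) \<bullet> e" by simp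
    then show "(LINT x|lebesgue_on K. \<phi> x * (h x \<bullet> e)) = (LINT x|lebesgue_on K. \<phi> x * (b \<bullet> e))"
      using integral_inner_left[OF L2_scaleR_integrable[OF L(1) hK], of e]
        integral_inner_left[OF ib, of e] by simp
  qed
  have "AE x in lebesgue_on K. h x $ 1 = b $ 1" "AE x in lebesgue_on K. h x $ 2 = b $ 2"
    using comp[of "axis 1 1"] comp[of "axis 2 1"] by (simp_all add: inner_axis)
  then show ?thesis by eventually_elim (simp add: vec_eq_iff forall_2)
qed

section \<open>Coefficients of piecewise polynomial functions\<close>

text \<open>The last clause makes the parameter recoverable from the values almost everywhere on an element,
  so that coefficients are well defined.\<close>

definition shape :: "('p::euclidean_space \<Rightarrow> plane \<Rightarrow> 'b::euclidean_space) \<Rightarrow> bool" where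
  "shape E \<longleftrightarrow> (\<forall>x. linear (\<lambda>p. E p x)) \<and> (\<forall>p. continuous_on UNIV (E p)) \<and>
     (\<forall>p K. open K \<longrightarrow> K \<noteq> {} \<longrightarrow> (\<forall>x\<in>K. E p x = 0) \<longrightarrow> p = 0)"

definition RT_shape :: "plane \<times> real \<Rightarrow> plane \<Rightarrow> plane" where
  "RT_shape p x = fst p + snd p *\<^sub>R x"

definition P1_shape :: "real \<times> plane \<Rightarrow> plane \<Rightarrow> real" where
  "P1_shape p x = fst p + snd p \<bullet> x"

text \<open>A constant has its value as parameter; treating it as a shape lets the lemmas on coefficients
  apply to all four components.\<close>

definition const_shape :: "'b::euclidean_space \<Rightarrow> plane \<Rightarrow> 'b" where
  "const_shape p x = p"

lemma const_shape_apply: "const_shape p x = p"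
  by (simp add: const_shape_def)

text \<open>The parameter is unique for shapes, by \<open>coef_eqI\<close>, and does not change when
  \<open>f\<close> is modified on a null set.\<close>

definition coef :: "('p::euclidean_space \<Rightarrow> plane \<Rightarrow> 'b::euclidean_space) \<Rightarrow> (plane \<Rightarrow> 'b) \<Rightarrow> plane set \<Rightarrow> 'p" where
  "coef E f K = (THE p. AE x in lebesgue_on K. f x = E p x)"

lemma open_nearby_point:
  fixes x u :: plane
  assumes "open K" "x \<in> K"
  shows "\<exists>t>0. x + t *\<^sub>R u \<in> K"
proof -
  obtain r where r: "0 < r" "ball x r \<subseteq> K" using assms by (rule openE)
  define t where "t = r / (2 * (norm u + 1))"
  have t: "0 < t" unfolding t_def using r by (simp add: add_nonneg_pos)
  have "t * norm u < r"
  proof -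
    have "t * norm u \<le> t * (norm u + 1)" using t by simp
    also have "\<dots> = r / 2"
      using norm_ge_zero[of u] by (simp add: t_def field_simps add_nonneg_eq_0_iff)
    finally show ?thesis using r by simp
  qed
  then have "x + t *\<^sub>R u \<in> ball x r" using t by (simp add: dist_norm)
  then show ?thesis using r t by blast
qed

lemma shape_RT: "shape RT_shape"
  unfolding shape_def
proof (intro conjI allI impI)
  show "linear (\<lambda>p. RT_shape p x)" for x
    by (rule linearI) (simp_all add: RT_shape_def algebra_simps)
  show "continuous_on UNIV (RT_shape p)" for p unfolding RT_shape_def by (intro continuous_intros)
  fix p K assume K: "open K" "K \<noteq> {}" "\<forall>x\<in>K. RT_shape p x = 0"
  obtain x where x: "x \<in> K" using K(2) by blast
  obtain t where t: "0 < t" "x + t *\<^sub>R axis 1 1 \<in> K" using open_nearby_point[OF K(1) x] by blast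
  have "fst p + snd p *\<^sub>R x = 0" "fst p + snd p *\<^sub>R (x + t *\<^sub>R axis 1 1) = 0"
    using K(3) x t unfolding RT_shape_def by blast+
  then have "(snd p * t) *\<^sub>R (axis 1 1 :: plane) = 0" by (simp add: scaleR_add_right add.assoc[symmetric])
  then have "snd p = 0" using t by (simp add: axis_eq_0_iff)
  then show "p = 0" using \<open>fst p + snd p *\<^sub>R x = 0\<close> by (simp add: prod_eq_iff)
qed

lemma shape_P1: "shape P1_shape"
  unfolding shape_def
proof (intro conjI allI impI)
  show "linear (\<lambda>p. P1_shape p x)" for x
    by (rule linearI) (simp_all add: P1_shape_def inner_add_left algebra_simps)
  show "continuous_on UNIV (P1_shape p)" for p unfolding P1_shape_def by (intro continuous_intros)
  fix p K assume K: "open K" "K \<noteq> {}" "\<forall>x\<in>K. P1_shape p x = 0"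
  obtain x where x: "x \<in> K" using K(2) by blast
  obtain t where t: "0 < t" "x + t *\<^sub>R snd p \<in> K" using open_nearby_point[OF K(1) x] by blast
  have e: "fst p + snd p \<bullet> x = 0" "fst p + snd p \<bullet> (x + t *\<^sub>R snd p) = 0"
    using K(3) x t unfolding P1_shape_def by blast+
  then have "t * (snd p \<bullet> snd p) = 0" unfolding inner_add_right inner_scaleR_right by linarith
  then have "snd p = 0" using t by simp
  then show "p = 0" using e by (simp add: prod_eq_iff)
qed

lemma shape_const: "shape const_shape"
  unfolding shape_def const_shape_def by (auto simp: linear_iff intro: continuous_intros)

lemma AE_equal_continuous:
  fixes f h :: "plane \<Rightarrow> 'b::euclidean_space"
  assumes K: "open K" and c: "continuous_on UNIV f" "continuous_on UNIV h"
    and ae: "AE x in lebesgue_on K. f x = h x" and x: "x \<in> K"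
  shows "f x = h x"
proof (rule ccontr)
  assume ne: "f x \<noteq> h x"
  let ?W = "K \<inter> {x. f x \<noteq> h x}"
  have "open {x. f x \<noteq> h x}" by (rule open_Collect_neq[OF c])
  then have W: "open ?W" using K by blast
  moreover have "x \<in> ?W" using ne x by blast
  ultimately have "\<not> negligible ?W" using open_not_negligible[of ?W] by blast
  moreover have "AE x in lebesgue. x \<notin> ?W"
    using ae K by (subst (asm) AE_restrict_space_iff) auto
  then have "?W \<in> null_sets lebesgue" using AE_iff_null_sets[of ?W lebesgue] W by simp
  ultimately show False by (simp add: negligible_iff_null_sets)
qed

lemma shape_linear:
  assumes "shape E"
  shows "E (c *\<^sub>R p + d *\<^sub>R q) x = c *\<^sub>R E p x + d *\<^sub>R E q x" "E 0 x = 0" "E (p - q) x = E p x - E q x"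
proof -
  have l: "linear (\<lambda>p. E p x)" using assms by (simp add: shape_def)
  show "E (c *\<^sub>R p + d *\<^sub>R q) x = c *\<^sub>R E p x + d *\<^sub>R E q x"
    by (simp add: linear_add[OF l] linear_cmul[OF l])
  show "E 0 x = 0" by (rule linear_0[OF l])
  show "E (p - q) x = E p x - E q x" by (rule linear_diff[OF l])
qed

lemma shape_continuous: "shape E \<Longrightarrow> continuous_on UNIV (E p)"
  by (simp add: shape_def)

lemma coef_eqI:
  assumes E: "shape E" and K: "open K" "K \<noteq> {}" and ae: "AE x in lebesgue_on K. f x = E p x"
  shows "coef E f K = p"
  unfolding coef_def
proof (rule the_equality[where P = "\<lambda>p. AE x in lebesgue_on K. f x = E p x", OF ae])
  fix q assume q: "AE x in lebesgue_on K. f x = E q x"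
  have "AE x in lebesgue_on K. E q x = E p x" using ae q by eventually_elim simp
  then have "E q x = E p x" if "x \<in> K" for x
    using AE_equal_continuous[OF K(1) shape_continuous[OF E] shape_continuous[OF E] _ that] by blast
  then have "\<forall>x\<in>K. E (q - p) x = 0" by (simp add: shape_linear(3)[OF E])
  then have "q - p = 0" using E K unfolding shape_def by blast
  then show "q = p" by simp
qed

lemma coef_AE:
  assumes E: "shape E" and K: "open K" "K \<noteq> {}" and ex: "\<exists>p. AE x in lebesgue_on K. f x = E p x"
  shows "AE x in lebesgue_on K. f x = E (coef E f K) x"
proof -
  obtain p where p: "AE x in lebesgue_on K. f x = E p x" using ex by blast
  show ?thesis unfolding coef_eqI[OF E K p] by (rule p)
qed

lemma AE_lincomb_shape:
  assumes E: "shape E" and "AE x in lebesgue_on K. f x = E p x" "AE x in lebesgue_on K. g x = E q x"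
  shows "AE x in lebesgue_on K. c *\<^sub>R f x + d *\<^sub>R g x = E (c *\<^sub>R p + d *\<^sub>R q) x"
  using assms(2,3) by eventually_elim (simp add: shape_linear(1)[OF E])

lemma coef_lincomb:
  assumes E: "shape E" and K: "open K" "K \<noteq> {}" and f: "\<exists>p. AE x in lebesgue_on K. f x = E p x"
    and g: "\<exists>p. AE x in lebesgue_on K. g x = E p x"
  shows "coef E (\<lambda>x. c *\<^sub>R f x + d *\<^sub>R g x) K = c *\<^sub>R coef E f K + d *\<^sub>R coef E g K"
  by (rule coef_eqI[OF E K AE_lincomb_shape[OF E coef_AE[OF E K f] coef_AE[OF E K g]]])

lemma RT_shape_bound: "norm x \<le> R \<Longrightarrow> norm (RT_shape p x) \<le> norm p * (1 + R)"
proof -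
  assume R: "norm x \<le> R"
  have "norm (RT_shape p x) \<le> norm (fst p) + \<bar>snd p\<bar> * norm x"
    unfolding RT_shape_def using norm_triangle_ineq[of "fst p" "snd p *\<^sub>R x"] by simp
  also have "\<dots> \<le> norm p + norm p * R"
    using norm_fst_le[of "fst p" "snd p"] norm_snd_le[of "snd p" "fst p"] R by (intro add_mono mult_mono) auto
  finally show ?thesis by (simp add: algebra_simps)
qed

lemma P1_shape_bound: "norm x \<le> R \<Longrightarrow> norm (P1_shape p x) \<le> norm p * (1 + R)"
proof -
  assume R: "norm x \<le> R"
  have "norm (P1_shape p x) \<le> norm (fst p) + norm (snd p) * norm x"
    unfolding P1_shape_def using norm_triangle_ineq[of "fst p" "snd p \<bullet> x"] Cauchy_Schwarz_ineq2[of "snd p" x] by simp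
  also have "\<dots> \<le> norm p + norm p * R"
    using norm_fst_le[of "fst p" "snd p"] norm_snd_le[of "snd p" "fst p"] R by (intro add_mono mult_mono) auto
  finally show ?thesis by (simp add: algebra_simps)
qed

section \<open>Pairs of fields and bounded functionals\<close>

text \<open>Linear combinations of pairs of fields, in the pointwise form that \<open>dual_space\<close>
  uses.\<close>

definition lc_pair :: "real \<Rightarrow> field_pair \<Rightarrow> real \<Rightarrow> field_pair \<Rightarrow> field_pair" where
  "lc_pair c z d w = (\<lambda>t. c *\<^sub>R fst z t + d *\<^sub>R fst w t, \<lambda>t. c * snd z t + d * snd w t)"

definition lc :: "real \<Rightarrow> field_pair \<times> field_pair \<Rightarrow> real \<Rightarrow> field_pair \<times> field_pair \<Rightarrow> field_pair \<times> field_pair" where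
  "lc c z d w = (lc_pair c (fst z) d (fst w), lc_pair c (snd z) d (snd w))"

lemma dual_functional:
  assumes "F \<in> dual_space Z N"
  shows "functional_on lc_pair Z F"
  using assms by (simp add: dual_space_def functional_on_def lc_pair_def case_prod_beta)

lemma dual_bounded:
  assumes "F \<in> dual_space Z N"
  obtains D where "\<And>w. w \<in> Z \<Longrightarrow> \<bar>F w\<bar> \<le> D * N w"
  using assms unfolding dual_space_def mem_Collect_eq by blast

text \<open>A small multiple of \<open>s\<close> lies in the unit ball. The hypothesis on multiples takes
  the place of homogeneity of \<open>N\<close>, and the constant \<open>C + 1\<close> is nonzero
  even if \<open>N s = 0\<close>.\<close>

lemma dual_norm_test:
  assumes F: "F \<in> dual_space Z N" and Z: "closed_under lc_pair Z" and s: "s \<in> Z"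
    and N: "\<And>z. 0 \<le> N z" and C: "0 \<le> C" "\<And>t. N (lc_pair t s 0 s) \<le> \<bar>t\<bar> * C"
  shows "\<bar>F s\<bar> \<le> (C + 1) * dual_norm Z N F" "0 \<le> dual_norm Z N F"
proof -
  define z where "z = lc_pair (1 / (C + 1)) s 0 s"
  have zZ: "z \<in> Z" unfolding z_def by (rule closed_underD[OF Z s s])
  have "N z \<le> \<bar>1 / (C + 1)\<bar> * C" unfolding z_def by (rule C(2))
  also have "\<dots> \<le> 1" using C(1) by (simp add: field_simps)
  finally have Nz: "N z \<le> 1" .
  obtain D where D: "\<And>w. w \<in> Z \<Longrightarrow> \<bar>F w\<bar> \<le> D * N w" using dual_bounded[OF F] by blast
  have "\<bar>F w\<bar> \<le> \<bar>D\<bar>" if "w \<in> Z" "N w \<le> 1" for w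
  proof -
    have "D * N w \<le> \<bar>D\<bar> * N w" by (rule mult_right_mono[OF abs_ge_self N])
    also have "\<dots> \<le> \<bar>D\<bar> * 1" by (rule mult_left_mono[OF that(2) abs_ge_zero])
    finally show ?thesis using D[OF that(1)] by simp
  qed
  then have bdd: "bdd_above ((\<lambda>w. \<bar>F w\<bar>) ` {w \<in> Z. N w \<le> 1})" by (intro bdd_aboveI2) blast
  have "\<bar>F z\<bar> \<le> dual_norm Z N F" unfolding dual_norm_def by (rule cSUP_upper[OF _ bdd]) (use zZ Nz in simp)
  moreover have "F z = 1 / (C + 1) * F s"
    unfolding z_def using functional_onD[OF dual_functional[OF F] s s, where c = "1 / (C + 1)" and d = 0] by simp
  ultimately have "\<bar>F s\<bar> / (C + 1) \<le> dual_norm Z N F" "0 \<le> dual_norm Z N F"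
    using C(1) abs_ge_zero[of "F z"] by (simp_all only: abs_mult abs_divide) auto
  then show "\<bar>F s\<bar> \<le> (C + 1) * dual_norm Z N F" "0 \<le> dual_norm Z N F"
    using C(1) by (simp_all add: pos_divide_le_eq mult.commute)
qed

section \<open>The discrete spaces\<close>

context bipartite_mesh
begin

lemma bounded_\<Omega>12: "bounded \<Omega>\<^sub>1" "bounded \<Omega>\<^sub>2"
  using bounded_subset[OF bounded_\<Omega>] \<Omega>1_subset \<Omega>2_subset by blast+

lemma lmeasurable_\<Omega>12: "\<Omega>\<^sub>1 \<in> lmeasurable" "\<Omega>\<^sub>2 \<in> lmeasurable"
  using open_\<Omega>1 open_\<Omega>2 bounded_\<Omega>12 by (auto intro!: bounded_set_imp_lmeasurable)

text \<open>The elements of one colour cover the subdomain up to their boundaries, which are null sets.\<close>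

lemma AE_region:
  assumes col: "\<C> = G1 \<or> \<C> = G2"
    and K: "\<And>K. K \<in> \<T> \<Longrightarrow> K \<subseteq> \<Union>\<C> \<Longrightarrow> AE x in lebesgue_on K. Q x"
  shows "AE x in lebesgue_on (\<Union>\<C>). Q x"
proof -
  have op: "open (\<Union>\<C>)" using col open_\<Omega>1 open_\<Omega>2 by blast
  have sub: "\<Union>\<C> \<subseteq> \<Omega>" using col \<Omega>1_subset \<Omega>2_subset by blast
  have fr: "AE x in lebesgue. x \<notin> frontier K" if "K \<in> \<T>" for K
    using negligible_convex_frontier[OF element_convex[OF that]]
    by (intro AE_not_in) (simp add: negligible_iff_null_sets)
  have 1: "AE x in lebesgue. \<forall>K\<in>\<T>. x \<notin> frontier K"
    using fr finite_\<T> by (simp add: AE_finite_all)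
  have 2: "AE x in lebesgue. \<forall>K\<in>\<T>. K \<subseteq> \<Union>\<C> \<longrightarrow> x \<in> K \<longrightarrow> Q x"
  proof (subst AE_finite_all[OF finite_\<T>], intro ballI)
    fix K assume KT: "K \<in> \<T>"
    show "AE x in lebesgue. K \<subseteq> \<Union>\<C> \<longrightarrow> x \<in> K \<longrightarrow> Q x"
    proof (cases "K \<subseteq> \<Union>\<C>")
      case True
      then have "AE x in lebesgue. x \<in> K \<longrightarrow> Q x"
        using K[OF KT True] element_open[OF KT] by (subst (asm) AE_restrict_space_iff) auto
      then show ?thesis by eventually_elim blast
    qed simp
  qed
  have "AE x in lebesgue. x \<in> \<Union>\<C> \<longrightarrow> Q x"
    using 1 2
  proof eventually_elim
    case (elim x)
    show ?case
    proof
      assume x: "x \<in> \<Union>\<C>"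
      then obtain K where KT: "K \<in> \<T>" "x \<in> closure K" using covered sub by blast
      then have xK: "x \<in> K"
        using elim(1) element_open[OF KT(1)] by (auto simp: frontier_def interior_open)
      have "K \<subseteq> \<Union>\<C>"
        using element_colour[OF KT(1)] \<Omega>12_disjoint x xK col by blast
      then show "Q x" using elim(2) KT(1) xK by blast
    qed
  qed
  then show ?thesis using op by (subst AE_restrict_space_iff) auto
qed

lemma AE_\<Omega>1: "(\<And>K. K \<in> \<T> \<Longrightarrow> K \<subseteq> \<Omega>\<^sub>1 \<Longrightarrow> AE x in lebesgue_on K. Q x) \<Longrightarrow> AE x in lebesgue_on \<Omega>\<^sub>1. Q x"
  by (rule AE_region) auto

lemma AE_\<Omega>2: "(\<And>K. K \<in> \<T> \<Longrightarrow> K \<subseteq> \<Omega>\<^sub>2 \<Longrightarrow> AE x in lebesgue_on K. Q x) \<Longrightarrow> AE x in lebesgue_on \<Omega>\<^sub>2. Q x"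
  by (rule AE_region) auto

lemma Hdiv_weak_div:
  assumes "v \<in> Hdiv U" shows "weak_div U v \<in> L2 U" "is_weak_div U v (weak_div U v)"
proof -
  have "\<exists>d. d \<in> L2 U \<and> is_weak_div U v d" using assms by (auto simp: Hdiv_def)
  from someI_ex[OF this] show "weak_div U v \<in> L2 U" "is_weak_div U v (weak_div U v)"
    by (simp_all add: weak_div_def)
qed

lemma H1_weak_grad:
  assumes "q \<in> H1 U" shows "weak_grad U q \<in> L2 U" "is_weak_grad U q (weak_grad U q)"
proof -
  have "\<exists>g. g \<in> L2 U \<and> is_weak_grad U q g" using assms by (auto simp: H1_def)
  from someI_ex[OF this] show "weak_grad U q \<in> L2 U" "is_weak_grad U q (weak_grad U q)"
    by (simp_all add: weak_grad_def)
qed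

abbreviation "RT \<equiv> RT0 \<T> \<Omega>\<^sub>1"
abbreviation "Qh\<^sub>2 \<equiv> Q2 \<T> \<Omega> \<Omega>\<^sub>2"
abbreviation "GQ \<equiv> grad_Q2 \<T> \<Omega> \<Omega>\<^sub>2"
abbreviation "Qh\<^sub>1 \<equiv> Q1 \<T> \<Omega>\<^sub>1"
abbreviation "X \<equiv> X_space \<T> \<Omega> \<Omega>\<^sub>1 \<Omega>\<^sub>2"
abbreviation "Y \<equiv> Y_space \<T> \<Omega> \<Omega>\<^sub>1 \<Omega>\<^sub>2"

abbreviation "div1 \<equiv> weak_div \<Omega>\<^sub>1"
abbreviation "grad2 \<equiv> weak_grad \<Omega>\<^sub>2"

lemma RT_D:
  assumes "v \<in> RT"
  shows "v \<in> Hdiv \<Omega>\<^sub>1" "v \<in> L2 \<Omega>\<^sub>1" "div1 v \<in> L2 \<Omega>\<^sub>1" "is_weak_div \<Omega>\<^sub>1 v (div1 v)"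
proof -
  show h: "v \<in> Hdiv \<Omega>\<^sub>1" using assms by (simp add: RT0_def)
  then show "v \<in> L2 \<Omega>\<^sub>1" by (simp add: Hdiv_def)
  show "div1 v \<in> L2 \<Omega>\<^sub>1" "is_weak_div \<Omega>\<^sub>1 v (div1 v)" by (rule Hdiv_weak_div[OF h])+
qed

lemma RT_coef:
  assumes "v \<in> RT" "K \<in> \<T>" "K \<subseteq> \<Omega>\<^sub>1"
  shows "\<exists>p. AE x in lebesgue_on K. v x = RT_shape p x"
    "AE x in lebesgue_on K. v x = RT_shape (coef RT_shape v K) x"
    "AE x in lebesgue_on K. div1 v x = 2 * snd (coef RT_shape v K)"
proof -
  obtain b c where "AE x in lebesgue_on K. v x = b + c *\<^sub>R x"
    using assms unfolding RT0_def by blast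
  then have "AE x in lebesgue_on K. v x = RT_shape (b, c) x" by (simp add: RT_shape_def)
  then show ex: "\<exists>p. AE x in lebesgue_on K. v x = RT_shape p x" by blast
  show ae: "AE x in lebesgue_on K. v x = RT_shape (coef RT_shape v K) x"
    by (rule coef_AE[OF shape_RT element_open[OF assms(2)] element_nonempty[OF assms(2)] ex])
  obtain P A B where t: "triangle K P A B" using element_triangle[OF assms(2)] by blast
  show "AE x in lebesgue_on K. div1 v x = 2 * snd (coef RT_shape v K)"
  proof (rule weak_div_affine_on_triangle[OF open_\<Omega>1 bounded_\<Omega>12(1) t assms(3) RT_D(3)[OF assms(1)]
        RT_D(4)[OF assms(1)] RT_D(2)[OF assms(1)]])
    show "AE x in lebesgue_on K. v x = fst (coef RT_shape v K) + snd (coef RT_shape v K) *\<^sub>R x"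
      using ae by eventually_elim (simp only: RT_shape_def[of "coef RT_shape v K"])
  qed
qed

lemma Q2_D:
  assumes "q \<in> Qh\<^sub>2"
  shows "q \<in> H1 \<Omega>\<^sub>2" "q \<in> L2 \<Omega>\<^sub>2" "grad2 q \<in> L2 \<Omega>\<^sub>2" "is_weak_grad \<Omega>\<^sub>2 q (grad2 q)"
proof -
  show h: "q \<in> H1 \<Omega>\<^sub>2" using assms by (simp add: Q2_def)
  then show "q \<in> L2 \<Omega>\<^sub>2" by (simp add: H1_def)
  show "grad2 q \<in> L2 \<Omega>\<^sub>2" "is_weak_grad \<Omega>\<^sub>2 q (grad2 q)" by (rule H1_weak_grad[OF h])+
qed

text \<open>The third clause is stated for an arbitrary weak gradient \<open>g\<close>, since the members of
  \<open>GQ\<close> need not be \<open>grad2 q\<close> itself.\<close>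

lemma Q2_coef:
  assumes "q \<in> Qh\<^sub>2" "K \<in> \<T>" "K \<subseteq> \<Omega>\<^sub>2"
  shows "\<exists>p. AE x in lebesgue_on K. q x = P1_shape p x"
    "AE x in lebesgue_on K. q x = P1_shape (coef P1_shape q K) x"
    "g \<in> L2 \<Omega>\<^sub>2 \<Longrightarrow> is_weak_grad \<Omega>\<^sub>2 q g \<Longrightarrow> AE x in lebesgue_on K. g x = snd (coef P1_shape q K)"
proof -
  obtain c b where "AE x in lebesgue_on K. q x = c + b \<bullet> x"
    using assms unfolding Q2_def by blast
  then have "AE x in lebesgue_on K. q x = P1_shape (c, b) x" by (simp add: P1_shape_def)
  then show ex: "\<exists>p. AE x in lebesgue_on K. q x = P1_shape p x" by blast
  show ae: "AE x in lebesgue_on K. q x = P1_shape (coef P1_shape q K) x"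
    by (rule coef_AE[OF shape_P1 element_open[OF assms(2)] element_nonempty[OF assms(2)] ex])
  obtain P A B where t: "triangle K P A B" using element_triangle[OF assms(2)] by blast
  assume g: "g \<in> L2 \<Omega>\<^sub>2" "is_weak_grad \<Omega>\<^sub>2 q g"
  show "AE x in lebesgue_on K. g x = snd (coef P1_shape q K)"
  proof (rule weak_grad_affine_on_triangle[OF open_\<Omega>2 bounded_\<Omega>12(2) t assms(3) g Q2_D(2)[OF assms(1)]])
    show "AE x in lebesgue_on K. q x = fst (coef P1_shape q K) + snd (coef P1_shape q K) \<bullet> x"
      using ae by eventually_elim (simp only: P1_shape_def[of "coef P1_shape q K"])
  qed
qed

lemma grad_Q2_coef:
  assumes "w \<in> GQ" "K \<in> \<T>" "K \<subseteq> \<Omega>\<^sub>2"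
  shows "\<exists>p. AE x in lebesgue_on K. w x = const_shape p x"
    "AE x in lebesgue_on K. w x = coef const_shape w K"
proof -
  obtain q where q: "w \<in> L2 \<Omega>\<^sub>2" "q \<in> Qh\<^sub>2" "is_weak_grad \<Omega>\<^sub>2 q w"
    using assms(1) unfolding grad_Q2_def by blast
  have "AE x in lebesgue_on K. w x = const_shape (snd (coef P1_shape q K)) x"
    unfolding const_shape_def by (rule Q2_coef(3)[OF q(2) assms(2,3) q(1,3)])
  then show ex: "\<exists>p. AE x in lebesgue_on K. w x = const_shape p x" by blast
  show "AE x in lebesgue_on K. w x = coef const_shape w K"
    using coef_AE[OF shape_const element_open[OF assms(2)] element_nonempty[OF assms(2)] ex]
    unfolding const_shape_apply .
qed

lemma Q1_coef:
  assumes "p \<in> Qh\<^sub>1" "K \<in> \<T>" "K \<subseteq> \<Omega>\<^sub>1"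
  shows "\<exists>c. AE x in lebesgue_on K. p x = const_shape c x"
    "AE x in lebesgue_on K. p x = coef const_shape p K"
proof -
  show ex: "\<exists>c. AE x in lebesgue_on K. p x = const_shape c x"
    using assms unfolding Q1_def const_shape_def by blast
  show "AE x in lebesgue_on K. p x = coef const_shape p K"
    using coef_AE[OF shape_const element_open[OF assms(2)] element_nonempty[OF assms(2)] ex]
    unfolding const_shape_apply .
qed

lemma RT_lincomb:
  assumes "v \<in> RT" "w \<in> RT" shows "(\<lambda>x. c *\<^sub>R v x + d *\<^sub>R w x) \<in> RT"
  unfolding RT0_def
proof (intro CollectI conjI ballI impI)
  note v = RT_D[OF assms(1)] and w = RT_D[OF assms(2)]
  have "is_weak_div \<Omega>\<^sub>1 (\<lambda>x. c *\<^sub>R v x + d *\<^sub>R w x) (\<lambda>x. c * div1 v x + d * div1 w x)"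
    by (rule is_weak_div_lincomb[OF open_\<Omega>1 bounded_\<Omega>12(1) v(2) w(2) v(3) w(3) v(4) w(4)])
  moreover have "(\<lambda>x. c * div1 v x + d * div1 w x) \<in> L2 \<Omega>\<^sub>1" by (rule L2_lincomb_real[OF v(3) w(3)])
  moreover have "(\<lambda>x. c *\<^sub>R v x + d *\<^sub>R w x) \<in> L2 \<Omega>\<^sub>1" by (rule L2_lincomb[OF v(2) w(2)])
  ultimately show "(\<lambda>x. c *\<^sub>R v x + d *\<^sub>R w x) \<in> Hdiv \<Omega>\<^sub>1" unfolding Hdiv_def by blast
  fix K assume K: "K \<in> \<T>" "K \<subseteq> \<Omega>\<^sub>1"
  from AE_lincomb_shape[OF shape_RT RT_coef(2)[OF assms(1) K] RT_coef(2)[OF assms(2) K], of c d]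
  show "\<exists>b e. AE x in lebesgue_on K. c *\<^sub>R v x + d *\<^sub>R w x = b + e *\<^sub>R x"
    unfolding RT_shape_def by blast
qed

lemma Q2_lincomb:
  assumes "q \<in> Qh\<^sub>2" "r \<in> Qh\<^sub>2" shows "(\<lambda>x. c * q x + d * r x) \<in> Qh\<^sub>2"
  unfolding Q2_def
proof (intro CollectI conjI ballI impI)
  note q = Q2_D[OF assms(1)] and r = Q2_D[OF assms(2)]
  have H1_lc: "(\<lambda>x. c * q x + d * r x) \<in> H1 U" if U: "open U" "bounded U" and "q \<in> H1 U" "r \<in> H1 U" for U q r
  proof -
    have qr: "q \<in> L2 U" "r \<in> L2 U" using that by (auto simp: H1_def)
    note g = H1_weak_grad[OF that(3)] and h = H1_weak_grad[OF that(4)]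
    have "is_weak_grad U (\<lambda>x. c * q x + d * r x) (\<lambda>x. c *\<^sub>R weak_grad U q x + d *\<^sub>R weak_grad U r x)"
      by (rule is_weak_grad_lincomb[OF U qr g(1) h(1) g(2) h(2)])
    moreover have "(\<lambda>x. c *\<^sub>R weak_grad U q x + d *\<^sub>R weak_grad U r x) \<in> L2 U" by (rule L2_lincomb[OF g(1) h(1)])
    moreover have "(\<lambda>x. c * q x + d * r x) \<in> L2 U" by (rule L2_lincomb_real[OF qr])
    ultimately show ?thesis unfolding H1_def by blast
  qed
  show "(\<lambda>x. c * q x + d * r x) \<in> H1 \<Omega>\<^sub>2" by (rule H1_lc[OF open_\<Omega>2 bounded_\<Omega>12(2) q(1) r(1)])
  obtain \<xi> \<eta> where \<xi>: "\<xi> \<in> H1 \<Omega>" "AE x in lebesgue_on \<Omega>\<^sub>2. q x = \<xi> x"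
    and \<eta>: "\<eta> \<in> H1 \<Omega>" "AE x in lebesgue_on \<Omega>\<^sub>2. r x = \<eta> x"
    using assms unfolding Q2_def by blast
  have "AE x in lebesgue_on \<Omega>\<^sub>2. c * q x + d * r x = c * \<xi> x + d * \<eta> x"
    using \<xi>(2) \<eta>(2) by eventually_elim simp
  then show "\<exists>\<xi>\<in>H1 \<Omega>. AE x in lebesgue_on \<Omega>\<^sub>2. c * q x + d * r x = \<xi> x"
    using H1_lc[OF open_\<Omega> bounded_\<Omega> \<xi>(1) \<eta>(1)] by (intro bexI[of _ "\<lambda>x. c * \<xi> x + d * \<eta> x"])
  fix K assume K: "K \<in> \<T>" "K \<subseteq> \<Omega>\<^sub>2"
  from AE_lincomb_shape[OF shape_P1 Q2_coef(2)[OF assms(1) K] Q2_coef(2)[OF assms(2) K], of c d]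
  show "\<exists>e b. AE x in lebesgue_on K. c * q x + d * r x = e + b \<bullet> x"
    unfolding P1_shape_def real_scaleR_def by blast
qed

lemma grad_Q2_lincomb:
  assumes "v \<in> GQ" "w \<in> GQ" shows "(\<lambda>x. c *\<^sub>R v x + d *\<^sub>R w x) \<in> GQ"
proof -
  obtain q where q: "v \<in> L2 \<Omega>\<^sub>2" "q \<in> Qh\<^sub>2" "is_weak_grad \<Omega>\<^sub>2 q v"
    using assms(1) unfolding grad_Q2_def by blast
  obtain r where r: "w \<in> L2 \<Omega>\<^sub>2" "r \<in> Qh\<^sub>2" "is_weak_grad \<Omega>\<^sub>2 r w"
    using assms(2) unfolding grad_Q2_def by blast
  have "is_weak_grad \<Omega>\<^sub>2 (\<lambda>x. c * q x + d * r x) (\<lambda>x. c *\<^sub>R v x + d *\<^sub>R w x)"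
    by (rule is_weak_grad_lincomb[OF open_\<Omega>2 bounded_\<Omega>12(2) Q2_D(2)[OF q(2)] Q2_D(2)[OF r(2)] q(1) r(1) q(3) r(3)])
  then show ?thesis
    unfolding grad_Q2_def using L2_lincomb[OF q(1) r(1)] Q2_lincomb[OF q(2) r(2)] by blast
qed

lemma Q1_lincomb:
  assumes "p \<in> Qh\<^sub>1" "q \<in> Qh\<^sub>1" shows "(\<lambda>x. c * p x + d * q x) \<in> Qh\<^sub>1"
  unfolding Q1_def
proof (intro CollectI conjI ballI impI)
  show "(\<lambda>x. c * p x + d * q x) \<in> L2 \<Omega>\<^sub>1"
    using assms by (intro L2_lincomb_real) (auto simp: Q1_def)
  fix K assume K: "K \<in> \<T>" "K \<subseteq> \<Omega>\<^sub>1"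
  have "AE x in lebesgue_on K. c * p x + d * q x = c * coef const_shape p K + d * coef const_shape q K"
    using Q1_coef(2)[OF assms(1) K] Q1_coef(2)[OF assms(2) K] by eventually_elim simp
  then show "\<exists>e. AE x in lebesgue_on K. c * p x + d * q x = e" by blast
qed

lemma zero_L2: "(\<lambda>x. 0) \<in> L2 U"
  by (simp add: L2_def)

lemma zero_in_spaces: "(\<lambda>x. 0) \<in> RT" "(\<lambda>x. 0) \<in> Qh\<^sub>2" "(\<lambda>x. 0) \<in> GQ" "(\<lambda>x. 0) \<in> Qh\<^sub>1"
proof -
  have "\<exists>c. AE x in lebesgue_on K. (0::real) = c" for K :: "plane set" by (intro exI[of _ 0]) simp
  then show "(\<lambda>x. 0) \<in> Qh\<^sub>1" unfolding Q1_def using zero_L2 by simp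
  have wd: "is_weak_div U (\<lambda>x. 0) (\<lambda>x. 0)" and wg: "is_weak_grad U (\<lambda>x. 0) (\<lambda>x. 0)" for U
    by (simp_all add: is_weak_div_def is_weak_grad_def)
  have h: "(\<lambda>x. 0) \<in> Hdiv \<Omega>\<^sub>1"
    unfolding Hdiv_def by (intro CollectI conjI bexI[of _ "\<lambda>x. 0"] zero_L2 wd)
  have hq: "(\<lambda>x. 0) \<in> H1 U" for U
    unfolding H1_def by (intro CollectI conjI bexI[of _ "\<lambda>x. 0"] zero_L2 wg)
  have "\<exists>b c. AE x in lebesgue_on K. 0 = b + c *\<^sub>R x" for K :: "plane set"
    by (intro exI[of _ 0]) simp
  then show "(\<lambda>x. 0) \<in> RT" unfolding RT0_def using h by simp
  have "\<exists>c b. AE x in lebesgue_on K. 0 = c + b \<bullet> x" for K :: "plane set"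
    by (intro exI[of _ 0]) simp
  moreover have "\<exists>\<xi>\<in>H1 \<Omega>. AE x in lebesgue_on \<Omega>\<^sub>2. 0 = \<xi> x"
    by (rule bexI[OF _ hq]) simp
  ultimately show q: "(\<lambda>x. 0) \<in> Qh\<^sub>2" unfolding Q2_def using hq by simp
  show "(\<lambda>x. 0) \<in> GQ"
    unfolding grad_Q2_def by (intro CollectI conjI bexI[OF _ q] zero_L2 wg)
qed

lemma mem_XY: "x \<in> X \<longleftrightarrow> fst x \<in> RT \<and> snd x \<in> Qh\<^sub>2" "y \<in> Y \<longleftrightarrow> fst y \<in> GQ \<and> snd y \<in> Qh\<^sub>1"
  by (auto simp: X_space_def Y_space_def mem_Times_iff)

lemma closed_X: "closed_under lc_pair X" and closed_Y: "closed_under lc_pair Y"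
proof -
  have "lc_pair c z d w \<in> X" if "z \<in> X" "w \<in> X" for c z d w
    using RT_lincomb[of "fst z" "fst w" c d] Q2_lincomb[of "snd z" "snd w" c d] that
    by (simp add: mem_XY lc_pair_def)
  moreover have "((\<lambda>x. 0), (\<lambda>x. 0)) \<in> X" using zero_in_spaces by (simp add: mem_XY)
  ultimately show "closed_under lc_pair X" unfolding closed_under_def by blast
  have "lc_pair c z d w \<in> Y" if "z \<in> Y" "w \<in> Y" for c z d w
    using grad_Q2_lincomb[of "fst z" "fst w" c d] Q1_lincomb[of "snd z" "snd w" c d] that
    by (simp add: mem_XY lc_pair_def)
  moreover have "((\<lambda>x. 0), (\<lambda>x. 0)) \<in> Y" using zero_in_spaces by (simp add: mem_XY)
  ultimately show "closed_under lc_pair Y" unfolding closed_under_def by blast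
qed

lemma closed_XY: "closed_under lc (X \<times> Y)"
proof -
  have "lc c z d w \<in> X \<times> Y" if "z \<in> X \<times> Y" "w \<in> X \<times> Y" for c z d w
    using that closed_underD[OF closed_X] closed_underD[OF closed_Y] by (simp add: lc_def mem_Times_iff)
  moreover have "X \<noteq> {}" "Y \<noteq> {}" using closed_X closed_Y unfolding closed_under_def by blast+
  ultimately show ?thesis unfolding closed_under_def by blast
qed

text \<open>All coefficients of a quadruple of fields on one element. Components that do not live on the
  subdomain of the element contribute zero, so that \<open>coords\<close> is linear.\<close>

definition coords :: "field_pair \<times> field_pair \<Rightarrow> plane set \<Rightarrow> (plane \<times> real) \<times> (real \<times> plane) \<times> plane \<times> real" where
  "coords z K =
     (if K \<subseteq> \<Omega>\<^sub>1 then coef RT_shape (fst (fst z)) K else 0, if K \<subseteq> \<Omega>\<^sub>2 then coef P1_shape (snd (fst z)) K else 0,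
      if K \<subseteq> \<Omega>\<^sub>2 then coef const_shape (fst (snd z)) K else 0, if K \<subseteq> \<Omega>\<^sub>1 then coef const_shape (snd (snd z)) K else 0)"

lemma coords_lc:
  assumes z: "z \<in> X \<times> Y" and w: "w \<in> X \<times> Y" and K: "K \<in> \<T>"
  shows "coords (lc c z d w) K = c *\<^sub>R coords z K + d *\<^sub>R coords w K"
proof -
  have m: "fst (fst z) \<in> RT" "snd (fst z) \<in> Qh\<^sub>2" "fst (snd z) \<in> GQ" "snd (snd z) \<in> Qh\<^sub>1"
    "fst (fst w) \<in> RT" "snd (fst w) \<in> Qh\<^sub>2" "fst (snd w) \<in> GQ" "snd (snd w) \<in> Qh\<^sub>1"
    using z w by (auto simp: mem_XY mem_Times_iff)
  note k = element_open[OF K] element_nonempty[OF K]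
  have 1: "coef RT_shape (\<lambda>x. c *\<^sub>R fst (fst z) x + d *\<^sub>R fst (fst w) x) K
    = c *\<^sub>R coef RT_shape (fst (fst z)) K + d *\<^sub>R coef RT_shape (fst (fst w)) K" if "K \<subseteq> \<Omega>\<^sub>1"
    by (rule coef_lincomb[OF shape_RT k RT_coef(1)[OF m(1) K that] RT_coef(1)[OF m(5) K that]])
  have 2: "coef P1_shape (\<lambda>x. c * snd (fst z) x + d * snd (fst w) x) K
    = c *\<^sub>R coef P1_shape (snd (fst z)) K + d *\<^sub>R coef P1_shape (snd (fst w)) K" if "K \<subseteq> \<Omega>\<^sub>2"
    using coef_lincomb[OF shape_P1 k Q2_coef(1)[OF m(2) K that] Q2_coef(1)[OF m(6) K that], of c d] by simp
  have 3: "coef const_shape (\<lambda>x. c *\<^sub>R fst (snd z) x + d *\<^sub>R fst (snd w) x) K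
    = c *\<^sub>R coef const_shape (fst (snd z)) K + d *\<^sub>R coef const_shape (fst (snd w)) K" if "K \<subseteq> \<Omega>\<^sub>2"
    by (rule coef_lincomb[OF shape_const k grad_Q2_coef(1)[OF m(3) K that] grad_Q2_coef(1)[OF m(7) K that]])
  have 4: "coef const_shape (\<lambda>x. c * snd (snd z) x + d * snd (snd w) x) K
    = c * coef const_shape (snd (snd z)) K + d * coef const_shape (snd (snd w)) K" if "K \<subseteq> \<Omega>\<^sub>1"
    using coef_lincomb[OF shape_const k Q1_coef(1)[OF m(4) K that] Q1_coef(1)[OF m(8) K that], of c d] by simp
  show ?thesis
    unfolding coords_def lc_def lc_pair_def fst_conv snd_conv
    by (cases "K \<subseteq> \<Omega>\<^sub>1"; cases "K \<subseteq> \<Omega>\<^sub>2") (simp_all only: 1 2 3 4 if_True if_False scaleR_Pair add_Pair scaleR_zero_right add_0_right mult_zero_right real_scaleR_def)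
qed

section \<open>The surface measure and the traces\<close>

abbreviation "S\<Gamma> \<equiv> surface_measure \<Gamma>"

lemma space_surface: "space S\<Gamma> = \<Gamma>"
  by (simp add: surface_measure_def space_restrict_space)

lemma interface_sets: "\<Gamma> \<in> sets hausdorff1"
  by (rule borel_sets_hausdorff1[OF interface_borel])

lemma AE_surface: "(AE s in S\<Gamma>. Q s) \<longleftrightarrow> (AE s in hausdorff1. s \<in> \<Gamma> \<longrightarrow> Q s)"
  unfolding surface_measure_def using interface_sets by (subst AE_restrict_space_iff) auto

lemma AE_not_vertex: "AE s in S\<Gamma>. s \<in> \<Gamma> \<and> s \<notin> mesh_vertices"
proof -
  have "AE s in hausdorff1. s \<notin> mesh_vertices" by (rule AE_not_in[OF finite_null_hausdorff1[OF finite_mesh_vertices]])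
  then show ?thesis unfolding AE_surface by eventually_elim blast
qed

text \<open>Vertices are finitely many and do not matter for the surface measure.\<close>

lemma AE_flat:
  assumes "\<And>s K1 K2 n r. flat s K1 K2 n r \<Longrightarrow> s \<notin> mesh_vertices \<Longrightarrow> Q s"
  shows "AE s in S\<Gamma>. Q s"
  using AE_not_vertex
proof eventually_elim
  case (elim s)
  then obtain K1 K2 n r where "flat s K1 K2 n r" using interface_flat by blast
  then show ?case using assms elim by blast
qed

text \<open>The interface consists of parts of boundaries of polygons, which are finite unions of segments.\<close>

lemma hausdorff1_finite_interface: "hausdorff1_outer \<Gamma> < \<infinity>"
proof -
  have fr: "hausdorff1_outer (frontier G) < \<infinity>" if G: "G \<in> G1 \<union> G2" for G
  proof -
    have "polygon G" using geom G unfolding geometric_assumptions_def by blast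
    then obtain S where S: "finite S" "frontier G = (\<Union>(p, q)\<in>S. closed_segment p q)"
      unfolding polygon_def by blast
    have "hausdorff1_outer (\<Union>(p, q)\<in>S. closed_segment p q) < \<infinity>"
      using S(1)
    proof (induction S)
      case (insert a S)
      obtain p q where a: "a = (p, q)" by (cases a)
      have "hausdorff1_outer (closed_segment p q \<union> (\<Union>(p, q)\<in>S. closed_segment p q))
        \<le> ennreal (dist p q) + hausdorff1_outer (\<Union>(p, q)\<in>S. closed_segment p q)"
        by (rule order_trans[OF hausdorff1_outer_Un add_right_mono[OF hausdorff1_outer_segment]])
      also have "\<dots> < \<infinity>" using insert.IH by simp
      finally show ?case by (simp add: a)
    qed (simp add: hausdorff1_outer_empty)
    then show ?thesis by (simp add: S(2))
  qed
  have "hausdorff1_outer (\<Union>G\<in>\<G>. frontier G) < \<infinity>" if "finite \<G>" "\<G> \<subseteq> G1 \<union> G2" for \<G>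
    using that
  proof (induction \<G>)
    case (insert G \<G>)
    have "hausdorff1_outer (frontier G \<union> (\<Union>G\<in>\<G>. frontier G))
      \<le> hausdorff1_outer (frontier G) + hausdorff1_outer (\<Union>G\<in>\<G>. frontier G)"
      by (rule hausdorff1_outer_Un)
    also have "\<dots> < \<infinity>" using insert fr[of G] by simp
    finally show ?case by simp
  qed (simp add: hausdorff1_outer_empty)
  from this[OF finite_regions] have "hausdorff1_outer (\<Union>G\<in>G1 \<union> G2. frontier G) < \<infinity>" by simp
  moreover have "\<Gamma> \<subseteq> (\<Union>G\<in>G1 \<union> G2. frontier G)" unfolding interface_def by blast
  ultimately show ?thesis using hausdorff1_outer_mono order_le_less_trans by blast
qed

lemma finite_surface: "finite_measure S\<Gamma>"
proof (rule finite_measureI)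
  have "emeasure S\<Gamma> (space S\<Gamma>) = hausdorff1_outer \<Gamma>"
    using interface_sets emeasure_hausdorff1_borel[OF interface_borel]
    by (simp add: surface_measure_def emeasure_restrict_space space_restrict_space)
  then show "emeasure S\<Gamma> (space S\<Gamma>) \<noteq> \<infinity>" using hausdorff1_finite_interface by simp
qed

lemma Linf_integrable: "f \<in> Linf S\<Gamma> \<Longrightarrow> integrable S\<Gamma> f"
proof -
  interpret finite_measure S\<Gamma> by (rule finite_surface)
  assume "f \<in> Linf S\<Gamma>"
  then obtain C where "AE x in S\<Gamma>. \<bar>f x\<bar> \<le> C" "f \<in> borel_measurable S\<Gamma>" by (auto simp: Linf_def)
  then show ?thesis by (intro integrable_const_bound[of _ C]) auto
qed

lemma Linf_mult: "f \<in> Linf M \<Longrightarrow> g \<in> Linf M \<Longrightarrow> (\<lambda>x. f x * g x) \<in> Linf M"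
proof -
  assume f: "f \<in> Linf M" and g: "g \<in> Linf M"
  obtain C D where "AE x in M. \<bar>f x\<bar> \<le> C" "AE x in M. \<bar>g x\<bar> \<le> D"
    using f g by (auto simp: Linf_def)
  then have "AE x in M. \<bar>f x * g x\<bar> \<le> \<bar>C\<bar> * \<bar>D\<bar>"
    by eventually_elim (auto simp: abs_mult intro!: mult_mono)
  moreover have "(\<lambda>x. f x * g x) \<in> borel_measurable M"
    using f g by (intro borel_measurable_times) (auto simp: Linf_def)
  ultimately show ?thesis by (auto simp: Linf_def)
qed

lemma borel_measurable_surface: "f \<in> borel_measurable borel \<Longrightarrow> f \<in> borel_measurable S\<Gamma>"
  unfolding surface_measure_def
  by (intro measurable_restrict_space1 measurableI)
    (auto dest!: measurable_sets intro: borel_sets_hausdorff1)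

text \<open>Traces and normal components are, near every point of the interface other than a vertex,
  restrictions of continuous functions taken from one of finitely many elements. This gives
  measurability, with the vertices treated separately.\<close>

lemma local_Linf:
  fixes f :: "plane \<Rightarrow> real"
  assumes eq: "\<And>s K1 K2 n r. flat s K1 K2 n r \<Longrightarrow> f s = H K1 K2 n s"
    and cont: "\<And>K1 K2 n. continuous_on UNIV (H K1 K2 n)"
    and bound: "\<And>s K1 K2 n r. flat s K1 K2 n r \<Longrightarrow> \<bar>H K1 K2 n s\<bar> \<le> C"
  shows "f \<in> Linf S\<Gamma>"
proof -
  have fc: "continuous_on (\<Gamma> - mesh_vertices) f"
    unfolding continuous_on_eq_continuous_within
  proof
    fix s assume s: "s \<in> \<Gamma> - mesh_vertices"
    then obtain K1 K2 n r where fl: "flat s K1 K2 n r" using interface_flat by blast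
    have "continuous (at s within \<Gamma> - mesh_vertices) (H K1 K2 n)"
      using cont[of K1 K2 n] by (simp add: continuous_on_eq_continuous_at continuous_at_imp_continuous_at_within)
    then show "continuous (at s within \<Gamma> - mesh_vertices) f"
    proof (rule continuous_transform_within)
      show "0 < r" by (rule flatD(6)[OF fl])
      fix y assume y: "y \<in> \<Gamma> - mesh_vertices" "dist y s < r"
      then have "y \<in> ball s r" by (simp add: dist_commute)
      then show "H K1 K2 n y = f y" using eq[OF flat_shift[OF fl]] y by simp
    qed (rule s)
  qed
  have bor: "\<Gamma> - mesh_vertices \<in> sets borel"
    using interface_borel finite_mesh_vertices by (intro sets.Diff) (auto simp: finite_imp_closed)
  define g where "g s = indicator (\<Gamma> - mesh_vertices) s * f s + (\<Sum>v\<in>mesh_vertices. indicator {v} s * f v)" for s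
  have gb: "g \<in> borel_measurable borel"
  proof -
    have "(\<lambda>s. indicator (\<Gamma> - mesh_vertices) s *\<^sub>R f s) \<in> borel_measurable borel"
      by (rule borel_measurable_continuous_on_indicator[OF bor fc])
    moreover have "(\<lambda>s. \<Sum>v\<in>mesh_vertices. indicator {v} s * f v) \<in> borel_measurable borel"
      by (intro borel_measurable_sum borel_measurable_times borel_measurable_indicator borel_measurable_const) simp
    ultimately show ?thesis unfolding g_def[abs_def] real_scaleR_def by (rule borel_measurable_add)
  qed
  have fg: "f s = g s" if s: "s \<in> \<Gamma>" for s
  proof (cases "s \<in> mesh_vertices")
    case True
    have "(\<Sum>v\<in>mesh_vertices. indicator {v} s * f v) = (\<Sum>v\<in>mesh_vertices. if v = s then f v else 0)"
      by (intro sum.cong refl) (auto simp: indicator_def)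
    also have "\<dots> = f s" using True finite_mesh_vertices by simp
    finally show ?thesis using True by (simp add: g_def)
  next
    case False
    have "(\<Sum>v\<in>mesh_vertices. indicator {v} s * f v) = 0"
      by (intro sum.neutral ballI) (use False in \<open>auto simp: indicator_def\<close>)
    then show ?thesis using False s by (simp add: g_def)
  qed
  have "f \<in> borel_measurable S\<Gamma>"
    using borel_measurable_surface[OF gb] by (subst measurable_cong[of _ f g]) (auto simp: space_surface fg)
  moreover have "AE s in S\<Gamma>. \<bar>f s\<bar> \<le> C"
    by (rule AE_flat) (use eq bound in \<open>simp add: eq\<close>)
  ultimately show ?thesis by (auto simp: Linf_def)
qed

definition tr1 :: "(plane \<Rightarrow> plane) \<Rightarrow> plane \<Rightarrow> real" where
  "tr1 v s = boundary_trace \<Omega>\<^sub>1 v s \<bullet> outer_normal \<Omega>\<^sub>1 s"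

definition tr2 :: "(plane \<Rightarrow> real) \<Rightarrow> plane \<Rightarrow> real" where
  "tr2 q s = boundary_trace \<Omega>\<^sub>2 q s"

lemma tr1_flat:
  assumes v: "v \<in> RT" and f: "flat s K1 K2 n r"
  shows "tr1 v s = RT_shape (coef RT_shape v K1) s \<bullet> n"
  unfolding tr1_def flat_outer_normal[OF f]
    flat_trace(1)[OF f L2_measurable[OF RT_D(2)[OF v]] RT_coef(2)[OF v flatD(1)[OF f] flatD(3)[OF f]] shape_continuous[OF shape_RT]] ..

lemma tr2_flat:
  assumes q: "q \<in> Qh\<^sub>2" and f: "flat s K1 K2 n r"
  shows "tr2 q s = P1_shape (coef P1_shape q K2) s"
  unfolding tr2_def
  by (rule flat_trace(2)[OF f L2_measurable[OF Q2_D(2)[OF q]] Q2_coef(2)[OF q flatD(2)[OF f] flatD(4)[OF f]] shape_continuous[OF shape_P1]])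

lemma \<Omega>_radius: "\<exists>R\<ge>0. \<forall>x\<in>closure \<Omega>. norm x \<le> R"
proof -
  obtain R where R: "\<And>x. x \<in> closure \<Omega> \<Longrightarrow> norm x \<le> R"
    using bounded_closure[OF bounded_\<Omega>] unfolding bounded_iff by blast
  show ?thesis by (intro exI[of _ "max R 0"]) (use R in \<open>auto simp: le_max_iff_disj\<close>)
qed

lemma flat_in_closure: "flat s K1 K2 n r \<Longrightarrow> s \<in> closure \<Omega>"
  using flat_on_boundary(3)[of s K1 K2 n r] interface_subset closure_subset[of \<Omega>] by blast

lemma tr2_Linf: assumes q: "q \<in> Qh\<^sub>2" shows "tr2 q \<in> Linf S\<Gamma>"
proof -
  obtain R where R: "0 \<le> R" "\<And>x. x \<in> closure \<Omega> \<Longrightarrow> norm x \<le> R" using \<Omega>_radius by blast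
  show ?thesis
  proof (rule local_Linf[where H = "\<lambda>K1 K2 n. P1_shape (coef P1_shape q K2)"
        and C = "(\<Sum>K\<in>\<T>. norm (coef P1_shape q K)) * (1 + R)"])
    fix s K1 K2 n r assume f: "flat s K1 K2 n r"
    show "tr2 q s = P1_shape (coef P1_shape q K2) s" by (rule tr2_flat[OF q f])
    have "norm (P1_shape (coef P1_shape q K2) s) \<le> norm (coef P1_shape q K2) * (1 + R)"
      by (rule P1_shape_bound[OF R(2)[OF flat_in_closure[OF f]]])
    also have "\<dots> \<le> (\<Sum>K\<in>\<T>. norm (coef P1_shape q K)) * (1 + R)"
      using member_le_sum[OF flatD(2)[OF f], of "\<lambda>K. norm (coef P1_shape q K)"] finite_\<T> R(1)
      by (intro mult_right_mono) auto
    finally show "\<bar>P1_shape (coef P1_shape q K2) s\<bar> \<le> (\<Sum>K\<in>\<T>. norm (coef P1_shape q K)) * (1 + R)" by simp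
  qed (rule shape_continuous[OF shape_P1])
qed

lemma tr1_Linf: assumes v: "v \<in> RT" shows "tr1 v \<in> Linf S\<Gamma>"
proof -
  obtain R where R: "0 \<le> R" "\<And>x. x \<in> closure \<Omega> \<Longrightarrow> norm x \<le> R" using \<Omega>_radius by blast
  show ?thesis
  proof (rule local_Linf[where H = "\<lambda>K1 K2 n s. RT_shape (coef RT_shape v K1) s \<bullet> n"
        and C = "(\<Sum>K\<in>\<T>. norm (coef RT_shape v K)) * (1 + R)"])
    show "continuous_on UNIV (\<lambda>s. RT_shape (coef RT_shape v K1) s \<bullet> n)" for K1 n
      by (intro continuous_on_inner shape_continuous[OF shape_RT] continuous_on_const)
    fix s K1 K2 n r assume f: "flat s K1 K2 n r"
    show "tr1 v s = RT_shape (coef RT_shape v K1) s \<bullet> n" by (rule tr1_flat[OF v f])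
    have "\<bar>RT_shape (coef RT_shape v K1) s \<bullet> n\<bar> \<le> norm (RT_shape (coef RT_shape v K1) s) * norm n"
      by (rule Cauchy_Schwarz_ineq2)
    also have "\<dots> \<le> norm (coef RT_shape v K1) * (1 + R)"
      using RT_shape_bound[OF R(2)[OF flat_in_closure[OF f]]] flatD(5)[OF f] by simp
    also have "\<dots> \<le> (\<Sum>K\<in>\<T>. norm (coef RT_shape v K)) * (1 + R)"
      using member_le_sum[OF flatD(1)[OF f], of "\<lambda>K. norm (coef RT_shape v K)"] finite_\<T> R(1)
      by (intro mult_right_mono) auto
    finally show "\<bar>RT_shape (coef RT_shape v K1) s \<bullet> n\<bar> \<le> (\<Sum>K\<in>\<T>. norm (coef RT_shape v K)) * (1 + R)" .
  qed
qed

section \<open>Bilinear forms determined by the coefficients\<close>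

text \<open>On \<open>X \<times> Y\<close> this means that all four components vanish almost everywhere on
  their subdomains.\<close>

definition null :: "field_pair \<times> field_pair \<Rightarrow> bool" where
  "null z \<longleftrightarrow> (\<forall>K\<in>\<T>. coords z K = 0)"

text \<open>Both clauses hold only almost everywhere: weak derivatives are determined up to null sets, and
  traces are known only away from the vertices.\<close>

definition linear_in_coefs :: "plane measure \<Rightarrow> (field_pair \<times> field_pair \<Rightarrow> plane \<Rightarrow> 'b::euclidean_space) \<Rightarrow> bool" where
  "linear_in_coefs M F \<longleftrightarrow>
     (\<forall>z\<in>X \<times> Y. \<forall>w\<in>X \<times> Y. \<forall>c d. AE x in M. F (lc c z d w) x = c *\<^sub>R F z x + d *\<^sub>R F w x) \<and>
     (\<forall>z\<in>X \<times> Y. null z \<longrightarrow> (AE x in M. F z x = 0))"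

definition bilinear_in_coefs :: "(field_pair \<times> field_pair \<Rightarrow> field_pair \<times> field_pair \<Rightarrow> real) \<Rightarrow> bool" where
  "bilinear_in_coefs N \<longleftrightarrow> (\<forall>w\<in>X \<times> Y. functional_on lc (X \<times> Y) (\<lambda>z. N z w)) \<and>
     (\<forall>z\<in>X \<times> Y. functional_on lc (X \<times> Y) (N z)) \<and>
     (\<forall>z\<in>X \<times> Y. \<forall>w\<in>X \<times> Y. null z \<or> null w \<longrightarrow> N z w = 0)"

lemma linear_in_coefs_null: "linear_in_coefs M F \<Longrightarrow> z \<in> X \<times> Y \<Longrightarrow> null z \<Longrightarrow> AE x in M. F z x = 0"
  unfolding linear_in_coefs_def by blast

lemma linear_in_coefs_lc: "linear_in_coefs M F \<Longrightarrow> z \<in> X \<times> Y \<Longrightarrow> w \<in> X \<times> Y \<Longrightarrow>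
    AE x in M. F (lc c z d w) x = c *\<^sub>R F z x + d *\<^sub>R F w x"
  unfolding linear_in_coefs_def by blast

lemma bilinear_in_coefs_add: "bilinear_in_coefs N \<Longrightarrow> bilinear_in_coefs N' \<Longrightarrow> bilinear_in_coefs (\<lambda>z w. N z w + N' z w)"
  and bilinear_in_coefs_diff: "bilinear_in_coefs N \<Longrightarrow> bilinear_in_coefs N' \<Longrightarrow> bilinear_in_coefs (\<lambda>z w. N z w - N' z w)"
  unfolding bilinear_in_coefs_def functional_on_def by (simp_all add: algebra_simps)

lemma bilinear_in_coefs_swap: "bilinear_in_coefs N \<Longrightarrow> bilinear_in_coefs (\<lambda>z w. N w z)"
  unfolding bilinear_in_coefs_def by simp

lemma bilinear_in_coefs_integral:
  fixes F G :: "field_pair \<times> field_pair \<Rightarrow> plane \<Rightarrow> 'b::euclidean_space"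
  assumes F: "linear_in_coefs M F" and G: "linear_in_coefs M G"
    and int: "\<And>z w. z \<in> X \<times> Y \<Longrightarrow> w \<in> X \<times> Y \<Longrightarrow> integrable M (\<lambda>x. k x * (F z x \<bullet> G w x))"
  shows "bilinear_in_coefs (\<lambda>z w. LINT x|M. k x * (F z x \<bullet> G w x))"
proof -
  have cl: "lc c z d w \<in> X \<times> Y" if "z \<in> X \<times> Y" "w \<in> X \<times> Y" for z w c d
    by (rule closed_underD[OF closed_XY that])
  have left: "(LINT x|M. k x * (F (lc c z d z') x \<bullet> G w x))
      = c * (LINT x|M. k x * (F z x \<bullet> G w x)) + d * (LINT x|M. k x * (F z' x \<bullet> G w x))"
    if z: "z \<in> X \<times> Y" "z' \<in> X \<times> Y" "w \<in> X \<times> Y" for z z' w c d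
  proof -
    have "(LINT x|M. k x * (F (lc c z d z') x \<bullet> G w x))
        = (LINT x|M. c * (k x * (F z x \<bullet> G w x)) + d * (k x * (F z' x \<bullet> G w x)))"
    proof (rule integral_cong_AE)
      show "(\<lambda>x. k x * (F (lc c z d z') x \<bullet> G w x)) \<in> borel_measurable M"
        by (rule borel_measurable_integrable[OF int[OF cl[OF z(1,2)] z(3)]])
      show "(\<lambda>x. c * (k x * (F z x \<bullet> G w x)) + d * (k x * (F z' x \<bullet> G w x))) \<in> borel_measurable M"
        using int[OF z(1,3)] int[OF z(2,3)] by (intro borel_measurable_integrable Bochner_Integration.integrable_add integrable_mult_right)
      have "AE x in M. F (lc c z d z') x = c *\<^sub>R F z x + d *\<^sub>R F z' x"
        by (rule linear_in_coefs_lc[OF F z(1,2)])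
      then show "AE x in M. k x * (F (lc c z d z') x \<bullet> G w x) = c * (k x * (F z x \<bullet> G w x)) + d * (k x * (F z' x \<bullet> G w x))"
        by eventually_elim (simp add: inner_add_left algebra_simps)
    qed
    also have "\<dots> = c * (LINT x|M. k x * (F z x \<bullet> G w x)) + d * (LINT x|M. k x * (F z' x \<bullet> G w x))"
      using int[OF z(1,3)] int[OF z(2,3)] by simp
    finally show ?thesis .
  qed
  have right: "(LINT x|M. k x * (F w x \<bullet> G (lc c z d z') x))
      = c * (LINT x|M. k x * (F w x \<bullet> G z x)) + d * (LINT x|M. k x * (F w x \<bullet> G z' x))"
    if z: "z \<in> X \<times> Y" "z' \<in> X \<times> Y" "w \<in> X \<times> Y" for z z' w c d
  proof -
    have "(LINT x|M. k x * (F w x \<bullet> G (lc c z d z') x))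
        = (LINT x|M. c * (k x * (F w x \<bullet> G z x)) + d * (k x * (F w x \<bullet> G z' x)))"
    proof (rule integral_cong_AE)
      show "(\<lambda>x. k x * (F w x \<bullet> G (lc c z d z') x)) \<in> borel_measurable M"
        by (rule borel_measurable_integrable[OF int[OF z(3) cl[OF z(1,2)]]])
      show "(\<lambda>x. c * (k x * (F w x \<bullet> G z x)) + d * (k x * (F w x \<bullet> G z' x))) \<in> borel_measurable M"
        using int[OF z(3,1)] int[OF z(3,2)] by (intro borel_measurable_integrable Bochner_Integration.integrable_add integrable_mult_right)
      have "AE x in M. G (lc c z d z') x = c *\<^sub>R G z x + d *\<^sub>R G z' x"
        by (rule linear_in_coefs_lc[OF G z(1,2)])
      then show "AE x in M. k x * (F w x \<bullet> G (lc c z d z') x) = c * (k x * (F w x \<bullet> G z x)) + d * (k x * (F w x \<bullet> G z' x))"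
        by eventually_elim (simp add: inner_add_right algebra_simps)
    qed
    also have "\<dots> = c * (LINT x|M. k x * (F w x \<bullet> G z x)) + d * (LINT x|M. k x * (F w x \<bullet> G z' x))"
      using int[OF z(3,1)] int[OF z(3,2)] by simp
    finally show ?thesis .
  qed
  have zero: "(LINT x|M. k x * (F z x \<bullet> G w x)) = 0"
    if z: "z \<in> X \<times> Y" "w \<in> X \<times> Y" "null z \<or> null w" for z w
  proof -
    have "(AE x in M. F z x = 0) \<or> (AE x in M. G w x = 0)" using linear_in_coefs_null[OF F z(1)] linear_in_coefs_null[OF G z(2)] z(3) by blast
    then have "AE x in M. k x * (F z x \<bullet> G w x) = 0"
    proof
      assume "AE x in M. F z x = 0"
      then show ?thesis by eventually_elim simp
    next
      assume "AE x in M. G w x = 0"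
      then show ?thesis by eventually_elim simp
    qed
    then show ?thesis by (rule integral_eq_zero_AE)
  qed
  show ?thesis
    unfolding bilinear_in_coefs_def functional_on_def
    by (intro conjI ballI allI impI; (rule left | rule right | rule zero); assumption)
qed

definition "v1 z = fst (fst z)" for z :: "field_pair \<times> field_pair"
definition "q2 z = snd (fst z)" for z :: "field_pair \<times> field_pair"
definition "v2 z = fst (snd z)" for z :: "field_pair \<times> field_pair"
definition "q1 z = snd (snd z)" for z :: "field_pair \<times> field_pair"

lemma components_in:
  assumes "z \<in> X \<times> Y" shows "v1 z \<in> RT" "q2 z \<in> Qh\<^sub>2" "v2 z \<in> GQ" "q1 z \<in> Qh\<^sub>1"
  using assms by (auto simp: mem_XY mem_Times_iff v1_def q2_def v2_def q1_def)

lemma coords_components: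
  "K \<subseteq> \<Omega>\<^sub>1 \<Longrightarrow> fst (coords z K) = coef RT_shape (v1 z) K"
  "K \<subseteq> \<Omega>\<^sub>2 \<Longrightarrow> fst (snd (coords z K)) = coef P1_shape (q2 z) K"
  "K \<subseteq> \<Omega>\<^sub>2 \<Longrightarrow> fst (snd (snd (coords z K))) = coef const_shape (v2 z) K"
  "K \<subseteq> \<Omega>\<^sub>1 \<Longrightarrow> snd (snd (snd (coords z K))) = coef const_shape (q1 z) K"
  by (simp_all add: coords_def v1_def q2_def v2_def q1_def)

lemma null_components:
  assumes "null z" "K \<in> \<T>"
  shows "K \<subseteq> \<Omega>\<^sub>1 \<Longrightarrow> coef RT_shape (v1 z) K = 0" "K \<subseteq> \<Omega>\<^sub>2 \<Longrightarrow> coef P1_shape (q2 z) K = 0"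
    "K \<subseteq> \<Omega>\<^sub>2 \<Longrightarrow> coef const_shape (v2 z) K = 0" "K \<subseteq> \<Omega>\<^sub>1 \<Longrightarrow> coef const_shape (q1 z) K = 0"
proof -
  have 0: "coords z K = 0" using assms by (simp add: null_def)
  show "K \<subseteq> \<Omega>\<^sub>1 \<Longrightarrow> coef RT_shape (v1 z) K = 0" "K \<subseteq> \<Omega>\<^sub>2 \<Longrightarrow> coef P1_shape (q2 z) K = 0"
    "K \<subseteq> \<Omega>\<^sub>2 \<Longrightarrow> coef const_shape (v2 z) K = 0" "K \<subseteq> \<Omega>\<^sub>1 \<Longrightarrow> coef const_shape (q1 z) K = 0"
    using coords_components[of K z] by (simp_all add: 0)
qed

lemma lc_components:
  "v1 (lc c z d w) = (\<lambda>x. c *\<^sub>R v1 z x + d *\<^sub>R v1 w x)" "q2 (lc c z d w) = (\<lambda>x. c * q2 z x + d * q2 w x)"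
  "v2 (lc c z d w) = (\<lambda>x. c *\<^sub>R v2 z x + d *\<^sub>R v2 w x)" "q1 (lc c z d w) = (\<lambda>x. c * q1 z x + d * q1 w x)"
  by (simp_all add: v1_def q2_def v2_def q1_def lc_def lc_pair_def)

lemma coef_lc:
  assumes z: "z \<in> X \<times> Y" "w \<in> X \<times> Y" and K: "K \<in> \<T>"
  shows "K \<subseteq> \<Omega>\<^sub>1 \<Longrightarrow> coef RT_shape (v1 (lc c z d w)) K = c *\<^sub>R coef RT_shape (v1 z) K + d *\<^sub>R coef RT_shape (v1 w) K"
    "K \<subseteq> \<Omega>\<^sub>2 \<Longrightarrow> coef P1_shape (q2 (lc c z d w)) K = c *\<^sub>R coef P1_shape (q2 z) K + d *\<^sub>R coef P1_shape (q2 w) K"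
  using coords_lc[OF z K, of c d] coords_components(1,2)[of K] by (simp_all add: prod_eq_iff)

lemma linear_in_coefs_v1: "linear_in_coefs (lebesgue_on \<Omega>\<^sub>1) v1"
  unfolding linear_in_coefs_def
proof (intro conjI ballI allI impI)
  fix z assume z: "z \<in> X \<times> Y" "null z"
  show "AE x in lebesgue_on \<Omega>\<^sub>1. v1 z x = 0"
  proof (rule AE_\<Omega>1)
    fix K assume K: "K \<in> \<T>" "K \<subseteq> \<Omega>\<^sub>1"
    show "AE x in lebesgue_on K. v1 z x = 0"
      using RT_coef(2)[OF components_in(1)[OF z(1)] K]
      by eventually_elim (simp add: null_components(1)[OF z(2) K] shape_linear(2)[OF shape_RT])
  qed
qed (simp add: lc_components)

lemma linear_in_coefs_v2: "linear_in_coefs (lebesgue_on \<Omega>\<^sub>2) v2"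
  unfolding linear_in_coefs_def
proof (intro conjI ballI allI impI)
  fix z assume z: "z \<in> X \<times> Y" "null z"
  show "AE x in lebesgue_on \<Omega>\<^sub>2. v2 z x = 0"
  proof (rule AE_\<Omega>2)
    fix K assume K: "K \<in> \<T>" "K \<subseteq> \<Omega>\<^sub>2"
    show "AE x in lebesgue_on K. v2 z x = 0"
      using grad_Q2_coef(2)[OF components_in(3)[OF z(1)] K]
      by eventually_elim (simp add: null_components(3)[OF z(2) K])
  qed
qed (simp add: lc_components)

lemma linear_in_coefs_q1: "linear_in_coefs (lebesgue_on \<Omega>\<^sub>1) q1"
  unfolding linear_in_coefs_def
proof (intro conjI ballI allI impI)
  fix z assume z: "z \<in> X \<times> Y" "null z"
  show "AE x in lebesgue_on \<Omega>\<^sub>1. q1 z x = 0"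
  proof (rule AE_\<Omega>1)
    fix K assume K: "K \<in> \<T>" "K \<subseteq> \<Omega>\<^sub>1"
    show "AE x in lebesgue_on K. q1 z x = 0"
      using Q1_coef(2)[OF components_in(4)[OF z(1)] K]
      by eventually_elim (simp add: null_components(4)[OF z(2) K])
  qed
qed (simp add: lc_components)

lemma linear_in_coefs_div: "linear_in_coefs (lebesgue_on \<Omega>\<^sub>1) (\<lambda>z. div1 (v1 z))"
  unfolding linear_in_coefs_def
proof (intro conjI ballI allI impI)
  note cl = closed_underD[OF closed_XY]
  fix z w c d assume z: "z \<in> X \<times> Y" "w \<in> X \<times> Y"
  show "AE x in lebesgue_on \<Omega>\<^sub>1. div1 (v1 (lc c z d w)) x = c *\<^sub>R div1 (v1 z) x + d *\<^sub>R div1 (v1 w) x"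
  proof (rule AE_\<Omega>1)
    fix K assume K: "K \<in> \<T>" "K \<subseteq> \<Omega>\<^sub>1"
    show "AE x in lebesgue_on K. div1 (v1 (lc c z d w)) x = c *\<^sub>R div1 (v1 z) x + d *\<^sub>R div1 (v1 w) x"
      using RT_coef(3)[OF components_in(1)[OF z(1)] K] RT_coef(3)[OF components_in(1)[OF z(2)] K]
        RT_coef(3)[OF components_in(1)[OF cl[OF z]] K, of c d]
      by eventually_elim (simp add: coef_lc(1)[OF z K] algebra_simps)
  qed
next
  fix z assume z: "z \<in> X \<times> Y" "null z"
  show "AE x in lebesgue_on \<Omega>\<^sub>1. div1 (v1 z) x = 0"
  proof (rule AE_\<Omega>1)
    fix K assume K: "K \<in> \<T>" "K \<subseteq> \<Omega>\<^sub>1"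
    show "AE x in lebesgue_on K. div1 (v1 z) x = 0"
      using RT_coef(3)[OF components_in(1)[OF z(1)] K]
      by eventually_elim (simp add: null_components(1)[OF z(2) K])
  qed
qed

lemma grad2_coef:
  assumes "q \<in> Qh\<^sub>2" "K \<in> \<T>" "K \<subseteq> \<Omega>\<^sub>2"
  shows "AE x in lebesgue_on K. grad2 q x = snd (coef P1_shape q K)"
  by (rule Q2_coef(3)[OF assms Q2_D(3,4)[OF assms(1)]])

lemma linear_in_coefs_grad: "linear_in_coefs (lebesgue_on \<Omega>\<^sub>2) (\<lambda>z. grad2 (q2 z))"
  unfolding linear_in_coefs_def
proof (intro conjI ballI allI impI)
  note cl = closed_underD[OF closed_XY]
  fix z w c d assume z: "z \<in> X \<times> Y" "w \<in> X \<times> Y"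
  show "AE x in lebesgue_on \<Omega>\<^sub>2. grad2 (q2 (lc c z d w)) x = c *\<^sub>R grad2 (q2 z) x + d *\<^sub>R grad2 (q2 w) x"
  proof (rule AE_\<Omega>2)
    fix K assume K: "K \<in> \<T>" "K \<subseteq> \<Omega>\<^sub>2"
    show "AE x in lebesgue_on K. grad2 (q2 (lc c z d w)) x = c *\<^sub>R grad2 (q2 z) x + d *\<^sub>R grad2 (q2 w) x"
      using grad2_coef[OF components_in(2)[OF z(1)] K] grad2_coef[OF components_in(2)[OF z(2)] K]
        grad2_coef[OF components_in(2)[OF cl[OF z]] K, of c d]
      by eventually_elim (simp add: coef_lc(2)[OF z K])
  qed
next
  fix z assume z: "z \<in> X \<times> Y" "null z"
  show "AE x in lebesgue_on \<Omega>\<^sub>2. grad2 (q2 z) x = 0"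
  proof (rule AE_\<Omega>2)
    fix K assume K: "K \<in> \<T>" "K \<subseteq> \<Omega>\<^sub>2"
    show "AE x in lebesgue_on K. grad2 (q2 z) x = 0"
      using grad2_coef[OF components_in(2)[OF z(1)] K]
      by eventually_elim (simp add: null_components(2)[OF z(2) K])
  qed
qed

lemma linear_in_coefs_tr1: "linear_in_coefs S\<Gamma> (\<lambda>z. tr1 (v1 z))"
  unfolding linear_in_coefs_def
proof (intro conjI ballI allI impI)
  note cl = closed_underD[OF closed_XY]
  fix z w c d assume z: "z \<in> X \<times> Y" "w \<in> X \<times> Y"
  show "AE s in S\<Gamma>. tr1 (v1 (lc c z d w)) s = c *\<^sub>R tr1 (v1 z) s + d *\<^sub>R tr1 (v1 w) s"
  proof (rule AE_flat)
    fix s K1 K2 n r assume f: "flat s K1 K2 n r"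
    show "tr1 (v1 (lc c z d w)) s = c *\<^sub>R tr1 (v1 z) s + d *\<^sub>R tr1 (v1 w) s"
      unfolding tr1_flat[OF components_in(1)[OF z(1)] f] tr1_flat[OF components_in(1)[OF z(2)] f]
        tr1_flat[OF components_in(1)[OF cl[OF z]] f] coef_lc(1)[OF z flatD(1,3)[OF f]]
        shape_linear(1)[OF shape_RT] inner_add_left inner_scaleR_left real_scaleR_def ..
  qed
next
  fix z assume z: "z \<in> X \<times> Y" "null z"
  show "AE s in S\<Gamma>. tr1 (v1 z) s = 0"
  proof (rule AE_flat)
    fix s K1 K2 n r assume f: "flat s K1 K2 n r"
    show "tr1 (v1 z) s = 0"
      unfolding tr1_flat[OF components_in(1)[OF z(1)] f] null_components(1)[OF z(2) flatD(1,3)[OF f]]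
        shape_linear(2)[OF shape_RT] by simp
  qed
qed

lemma linear_in_coefs_tr2: "linear_in_coefs S\<Gamma> (\<lambda>z. tr2 (q2 z))"
  unfolding linear_in_coefs_def
proof (intro conjI ballI allI impI)
  note cl = closed_underD[OF closed_XY]
  fix z w c d assume z: "z \<in> X \<times> Y" "w \<in> X \<times> Y"
  show "AE s in S\<Gamma>. tr2 (q2 (lc c z d w)) s = c *\<^sub>R tr2 (q2 z) s + d *\<^sub>R tr2 (q2 w) s"
  proof (rule AE_flat)
    fix s K1 K2 n r assume f: "flat s K1 K2 n r"
    show "tr2 (q2 (lc c z d w)) s = c *\<^sub>R tr2 (q2 z) s + d *\<^sub>R tr2 (q2 w) s"
      unfolding tr2_flat[OF components_in(2)[OF z(1)] f] tr2_flat[OF components_in(2)[OF z(2)] f]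
        tr2_flat[OF components_in(2)[OF cl[OF z]] f] coef_lc(2)[OF z flatD(2,4)[OF f]]
        shape_linear(1)[OF shape_P1] ..
  qed
next
  fix z assume z: "z \<in> X \<times> Y" "null z"
  show "AE s in S\<Gamma>. tr2 (q2 z) s = 0"
  proof (rule AE_flat)
    fix s K1 K2 n r assume f: "flat s K1 K2 n r"
    show "tr2 (q2 z) s = 0"
      unfolding tr2_flat[OF components_in(2)[OF z(1)] f] null_components(2)[OF z(2) flatD(2,4)[OF f]]
        shape_linear(2)[OF shape_P1] ..
  qed
qed

lemma null_difference_imp_ae_eq:
  assumes z: "z \<in> X \<times> Y" and w: "w \<in> X \<times> Y" and "null (lc 1 z (-1) w)"
  shows "ae_eq \<Omega>\<^sub>1 \<Omega>\<^sub>2 (fst z) (fst w)" "ae_eq \<Omega>\<^sub>2 \<Omega>\<^sub>1 (snd z) (snd w)"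
proof -
  let ?d = "lc 1 z (-1) w"
  have d: "?d \<in> X \<times> Y" by (rule closed_underD[OF closed_XY z w])
  have q2d: "AE x in lebesgue_on \<Omega>\<^sub>2. q2 ?d x = 0"
  proof (rule AE_\<Omega>2)
    fix K assume K: "K \<in> \<T>" "K \<subseteq> \<Omega>\<^sub>2"
    show "AE x in lebesgue_on K. q2 ?d x = 0"
      using Q2_coef(2)[OF components_in(2)[OF d] K]
      by eventually_elim (simp add: null_components(2)[OF assms(3) K] shape_linear(2)[OF shape_P1])
  qed
  have "AE x in lebesgue_on \<Omega>\<^sub>1. v1 ?d x = 0" "AE x in lebesgue_on \<Omega>\<^sub>2. v2 ?d x = 0"
    "AE x in lebesgue_on \<Omega>\<^sub>1. q1 ?d x = 0"
    by (rule linear_in_coefs_null[OF linear_in_coefs_v1 d assms(3)] linear_in_coefs_null[OF linear_in_coefs_v2 d assms(3)]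
        linear_in_coefs_null[OF linear_in_coefs_q1 d assms(3)])+
  with q2d show "ae_eq \<Omega>\<^sub>1 \<Omega>\<^sub>2 (fst z) (fst w)" "ae_eq \<Omega>\<^sub>2 \<Omega>\<^sub>1 (snd z) (snd w)"
    unfolding ae_eq_def lc_components by (simp_all add: v1_def q2_def v2_def q1_def)
qed

end

section \<open>Flux fields of the edges\<close>

text \<open>The lowest-order Raviart-Thomas field with vanishing normal component on the two edges of
  \<open>K\<close> through the vertex \<open>P\<close>.\<close>

definition vertex_field :: "plane set \<Rightarrow> plane \<Rightarrow> plane \<Rightarrow> plane" where
  "vertex_field K P y = indicator K y *\<^sub>R (y - P)"

context bipartite_mesh
begin

text \<open>Along an edge through \<open>P\<close>, the points of the closed triangle on either side of
  \<open>s\<close> satisfy the half-plane condition, which forces the edge to be orthogonal to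
  \<open>n\<close>.\<close>

lemma triangle_boundary_normal:
  assumes t: "triangle K P A B" and r: "0 < r"
    and half: "\<And>y. y \<in> ball s r \<Longrightarrow> y \<in> K \<Longrightarrow> (y - s) \<bullet> n \<le> 0"
    and s: "s \<in> closure K" "s \<notin> K" "s \<notin> {P, A, B}"
  shows "s \<in> open_segment A B \<or> (s - P) \<bullet> n = 0"
proof -
  have side: "(s - P) \<bullet> n = 0" if s: "s \<in> open_segment P E" and E: "E \<in> {A, B}" for E
  proof -
    obtain u where u: "0 < u" "u < 1" "s = (1 - u) *\<^sub>R P + u *\<^sub>R E" using s by (auto simp: in_segment)
    have sP: "s - P = u *\<^sub>R (E - P)" unfolding u(3) by (simp add: algebra_simps)
    define e where "e = min (min u (1 - u)) (r / (2 * (norm (E - P) + 1)))"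
    have e: "0 < e" "e \<le> u" "e \<le> 1 - u" "e \<le> r / (2 * (norm (E - P) + 1))"
      using u r by (auto simp: e_def add_nonneg_pos)
    have en: "e * norm (E - P) < r"
    proof -
      have "e * norm (E - P) \<le> e * (norm (E - P) + 1)" using e by simp
      also have "\<dots> \<le> r / (2 * (norm (E - P) + 1)) * (norm (E - P) + 1)"
        using e by (intro mult_right_mono) auto
      also have "\<dots> = r / 2"
        using norm_ge_zero[of "E - P"] by (simp add: field_simps add_nonneg_eq_0_iff)
      finally show ?thesis using r by simp
    qed
    have le: "d * ((E - P) \<bullet> n) \<le> 0" if d: "d = e \<or> d = - e" for d
    proof -
      let ?y = "s + d *\<^sub>R (E - P)"
      have "?y = (1 - (u + d)) *\<^sub>R P + (u + d) *\<^sub>R E" unfolding u(3) by (simp add: algebra_simps)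
      moreover have "0 \<le> u + d" "u + d \<le> 1" using d e by auto
      ultimately have "?y \<in> closed_segment P E" unfolding closed_segment_def by blast
      moreover have "closed_segment P E \<subseteq> convex hull {P, A, B}"
        using E by (intro closed_segment_subset convex_convex_hull) (auto intro: hull_inc)
      ultimately have "?y \<in> closure K" unfolding triangle_closure[OF t] by blast
      moreover have "?y \<in> ball s r" using d en e by (auto simp: dist_norm)
      ultimately have "(?y - s) \<bullet> n \<le> 0" using closure_half_disc[OF half] by blast
      then show ?thesis by simp
    qed
    have "e * ((E - P) \<bullet> n) \<le> 0" "- e * ((E - P) \<bullet> n) \<le> 0" using le by blast+
    then have "(E - P) \<bullet> n = 0" using e(1) by (simp add: mult_le_0_iff zero_le_mult_iff)
    then show ?thesis by (simp add: sP)
  qed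
  show ?thesis using triangle_boundary_cases[OF t s(1,2)] s(3) side by blast
qed

lemma vertex_field_L2: "K \<in> \<T> \<Longrightarrow> vertex_field K P \<in> L2 \<Omega>\<^sub>1"
proof -
  assume K: "K \<in> \<T>"
  obtain R where R: "0 \<le> R" "\<And>x. x \<in> closure \<Omega> \<Longrightarrow> norm x \<le> R" using \<Omega>_radius by blast
  have "(\<lambda>y. indicator K y *\<^sub>R (y - P)) \<in> borel_measurable borel"
    using element_open[OF K] by (intro borel_measurable_scaleR borel_measurable_indicator) auto
  then have m: "vertex_field K P \<in> borel_measurable (lebesgue_on \<Omega>\<^sub>1)"
    unfolding vertex_field_def[abs_def] by (intro measurable_restrict_space1 measurable_completion) simp
  have "norm (vertex_field K P y) \<le> R + norm P" if "y \<in> \<Omega>\<^sub>1" for y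
  proof -
    have "y \<in> closure \<Omega>" using that \<Omega>1_subset closure_subset[of \<Omega>] by blast
    then have "norm (y - P) \<le> R + norm P" using norm_triangle_ineq4[of y P] R(2)[of y] by simp
    then show ?thesis using R(1) by (simp add: vertex_field_def indicator_def)
  qed
  then have "AE y in lebesgue_on \<Omega>\<^sub>1. norm (vertex_field K P y) \<le> R + norm P"
    by (intro AE_I2) (simp add: space_restrict_space)
  from L2_AE_bounded(1)[OF lmeasurable_\<Omega>12(1) m this] show ?thesis .
qed

lemma indicator_L2: "K \<in> \<T> \<Longrightarrow> (\<lambda>y. 2 * indicator K y :: real) \<in> L2 \<Omega>\<^sub>1"
proof -
  assume K: "K \<in> \<T>"
  have "(\<lambda>y. 2 * indicator K y :: real) \<in> borel_measurable borel"
    using element_open[OF K] by (intro borel_measurable_times borel_measurable_indicator) auto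
  then have m: "(\<lambda>y. 2 * indicator K y :: real) \<in> borel_measurable (lebesgue_on \<Omega>\<^sub>1)"
    by (intro measurable_restrict_space1 measurable_completion) simp
  have "AE y in lebesgue_on \<Omega>\<^sub>1. norm (2 * indicator K y :: real) \<le> 2"
    by (intro AE_I2) (simp add: indicator_def)
  from L2_AE_bounded(1)[OF lmeasurable_\<Omega>12(1) m this] show ?thesis .
qed

text \<open>The weak divergence of \<open>vertex_field K P\<close> on the first subdomain is
  \<open>2\<close> on \<open>K\<close>, up to a contribution of the edge opposite to
  \<open>P\<close>.\<close>

lemma vertex_field_flux:
  assumes K: "K \<in> \<T>" "K \<subseteq> \<Omega>\<^sub>1" "triangle K P A B" and \<phi>: "\<phi> \<in> test_functions \<Omega>\<^sub>1"
  shows "(LINT y|lebesgue_on \<Omega>\<^sub>1. vertex_field K P y \<bullet> gradient \<phi> y) + (LINT y|lebesgue_on \<Omega>\<^sub>1. \<phi> y * (2 * indicator K y))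
    = \<bar>cross2 (A - P) (B - P)\<bar> * edge_integral \<phi> A B"
proof -
  note L = test_function_L2[OF \<phi> open_\<Omega>1 bounded_\<Omega>12(1)]
  note g = test_function_gradient[OF \<phi>]
  have "(LINT y|lebesgue_on \<Omega>\<^sub>1. vertex_field K P y \<bullet> gradient \<phi> y) + (LINT y|lebesgue_on \<Omega>\<^sub>1. \<phi> y * (2 * indicator K y))
     = (LINT y|lebesgue_on \<Omega>\<^sub>1. vertex_field K P y \<bullet> gradient \<phi> y + \<phi> y * (2 * indicator K y))"
    by (intro Bochner_Integration.integral_add[symmetric] L2_inner_integrable L2_mult_integrable
        vertex_field_L2 indicator_L2 K L)
  also have "\<dots> = (LINT y|lebesgue_on K. vertex_field K P y \<bullet> gradient \<phi> y + \<phi> y * (2 * indicator K y))"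
    by (rule integral_vanishing_outside[OF open_\<Omega>1 element_open[OF K(1)] K(2)]) (simp add: vertex_field_def)
  also have "\<dots> = (LINT y|lebesgue_on K. gradient \<phi> y \<bullet> (y - P) + 2 * \<phi> y)"
    by (intro Bochner_Integration.integral_cong refl)
      (simp add: vertex_field_def space_restrict_space inner_commute)
  also have "\<dots> = \<bar>cross2 (A - P) (B - P)\<bar> * edge_integral \<phi> A B"
    by (rule triangle_flux[OF K(3) g])
  finally show ?thesis .
qed

definition edge_field :: "real \<Rightarrow> plane set \<Rightarrow> plane \<Rightarrow> real \<Rightarrow> plane set \<Rightarrow> plane \<Rightarrow> plane \<Rightarrow> plane" where
  "edge_field \<alpha> K P \<alpha>' K' P' y = \<alpha> *\<^sub>R vertex_field K P y + \<alpha>' *\<^sub>R vertex_field K' P' y"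

lemma edge_field_on_element:
  assumes K: "K \<in> \<T>" "K' \<in> \<T>" "K \<noteq> K'" and L: "L \<in> \<T>" "y \<in> L"
  shows "edge_field \<alpha> K P \<alpha>' K' P' y =
    RT_shape (if L = K then (- \<alpha> *\<^sub>R P, \<alpha>) else if L = K' then (- \<alpha>' *\<^sub>R P', \<alpha>') else 0) y"
proof -
  have mem: "y \<in> M \<longleftrightarrow> L = M" if M: "M \<in> \<T>" for M
  proof
    assume "y \<in> M"
    then have "L \<inter> closure M \<noteq> {}" using L(2) closure_subset[of M] by blast
    then show "L = M" by (rule elements_meet_eq[OF L(1) M])
  qed (use L in simp)
  show ?thesis
    using K(3) by (simp add: edge_field_def vertex_field_def RT_shape_def indicator_def mem[OF K(1)] mem[OF K(2)] algebra_simps)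
qed

text \<open>The contributions of the common edge to the weak divergence cancel if the fluxes are opposite.
  If \<open>K'\<close> lies in the second subdomain, there is no second term, but the test
  functions vanish on the edge, which is disjoint from the open set
  \<open>\<Omega>\<^sub>1\<close>.\<close>

lemma edge_field_RT:
  assumes K: "K \<in> \<T>" "K' \<in> \<T>" "K \<noteq> K'" and t: "triangle K P A B" "triangle K' P' A B"
    and K1: "K \<subseteq> \<Omega>\<^sub>1"
    and flux: "(K' \<subseteq> \<Omega>\<^sub>1 \<and> \<alpha> * \<bar>cross2 (A - P) (B - P)\<bar> + \<alpha>' * \<bar>cross2 (A - P') (B - P')\<bar> = 0)
      \<or> (\<alpha>' = 0 \<and> K' \<subseteq> \<Omega>\<^sub>2)"
  shows "edge_field \<alpha> K P \<alpha>' K' P' \<in> RT"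
proof -
  let ?v = "edge_field \<alpha> K P \<alpha>' K' P'"
  let ?d = "\<lambda>y. \<alpha> * (2 * indicator K y) + \<alpha>' * (2 * indicator K' y)"
  have vL: "?v \<in> L2 \<Omega>\<^sub>1" unfolding edge_field_def[abs_def] by (intro L2_lincomb vertex_field_L2 K)
  have dL: "?d \<in> L2 \<Omega>\<^sub>1" by (intro L2_lincomb_real indicator_L2 K)
  have "is_weak_div \<Omega>\<^sub>1 ?v ?d"
    unfolding is_weak_div_def
  proof
    fix \<phi> assume \<phi>: "\<phi> \<in> test_functions \<Omega>\<^sub>1"
    note L = test_function_L2[OF \<phi> open_\<Omega>1 bounded_\<Omega>12(1)]
    let ?E = "\<lambda>K P. LINT y|lebesgue_on \<Omega>\<^sub>1. vertex_field K P y \<bullet> gradient \<phi> y"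
    let ?I = "\<lambda>K. LINT y|lebesgue_on \<Omega>\<^sub>1. \<phi> y * (2 * indicator K y)"
    have "(LINT y|lebesgue_on \<Omega>\<^sub>1. ?v y \<bullet> gradient \<phi> y)
       = (LINT y|lebesgue_on \<Omega>\<^sub>1. \<alpha> * (vertex_field K P y \<bullet> gradient \<phi> y) + \<alpha>' * (vertex_field K' P' y \<bullet> gradient \<phi> y))"
      by (simp add: edge_field_def inner_add_left)
    also have "\<dots> = \<alpha> * ?E K P + \<alpha>' * ?E K' P'"
      using L2_inner_integrable[OF vertex_field_L2[OF K(1)] L(2), of P] L2_inner_integrable[OF vertex_field_L2[OF K(2)] L(2), of P']
      by simp
    finally have 1: "(LINT y|lebesgue_on \<Omega>\<^sub>1. ?v y \<bullet> gradient \<phi> y) = \<alpha> * ?E K P + \<alpha>' * ?E K' P'" .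
    have "(LINT y|lebesgue_on \<Omega>\<^sub>1. \<phi> y * ?d y)
       = (LINT y|lebesgue_on \<Omega>\<^sub>1. \<alpha> * (\<phi> y * (2 * indicator K y)) + \<alpha>' * (\<phi> y * (2 * indicator K' y)))"
      by (intro Bochner_Integration.integral_cong refl) (simp add: algebra_simps)
    also have "\<dots> = (LINT y|lebesgue_on \<Omega>\<^sub>1. \<alpha> * (\<phi> y * (2 * indicator K y))) + (LINT y|lebesgue_on \<Omega>\<^sub>1. \<alpha>' * (\<phi> y * (2 * indicator K' y)))"
      by (intro Bochner_Integration.integral_add integrable_mult_right L2_mult_integrable L indicator_L2 K)
    also have "\<dots> = \<alpha> * ?I K + \<alpha>' * ?I K'"
      by (simp only: integral_mult_right_zero)
    finally have 2: "(LINT y|lebesgue_on \<Omega>\<^sub>1. \<phi> y * ?d y) = \<alpha> * ?I K + \<alpha>' * ?I K'" .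
    have fK: "?E K P + ?I K = \<bar>cross2 (A - P) (B - P)\<bar> * edge_integral \<phi> A B"
      by (rule vertex_field_flux[OF K(1) K1 t(1) \<phi>])
    have "\<alpha> * (?E K P + ?I K) + \<alpha>' * (?E K' P' + ?I K') = 0"
      using flux
    proof
      assume *: "K' \<subseteq> \<Omega>\<^sub>1 \<and> \<alpha> * \<bar>cross2 (A - P) (B - P)\<bar> + \<alpha>' * \<bar>cross2 (A - P') (B - P')\<bar> = 0"
      then have fK': "?E K' P' + ?I K' = \<bar>cross2 (A - P') (B - P')\<bar> * edge_integral \<phi> A B"
        by (intro vertex_field_flux[OF K(2) _ t(2) \<phi>]) blast
      have "\<alpha> * (?E K P + ?I K) + \<alpha>' * (?E K' P' + ?I K')
        = (\<alpha> * \<bar>cross2 (A - P) (B - P)\<bar> + \<alpha>' * \<bar>cross2 (A - P') (B - P')\<bar>) * edge_integral \<phi> A B"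
        unfolding fK fK' by (simp only: distrib_right mult.assoc)
      then show ?thesis using * by simp
    next
      assume *: "\<alpha>' = 0 \<and> K' \<subseteq> \<Omega>\<^sub>2"
      have "\<Omega>\<^sub>1 \<inter> K' = {}" using * \<Omega>12_disjoint by blast
      then have dis: "\<Omega>\<^sub>1 \<inter> closure K' = {}" using open_Int_closure_eq_empty[OF open_\<Omega>1, of K'] by simp
      have seg: "open_segment A B \<subseteq> closure K'"
      proof -
        have "closed_segment A B \<subseteq> convex hull {P', A, B}"
          by (intro closed_segment_subset convex_convex_hull) (auto intro: hull_inc)
        then show ?thesis using segment_open_subset_closed[of A B] triangle_closure[OF t(2)] by simp
      qed
      have "edge_integral \<phi> A B = 0"
      proof (rule edge_integral_zero)
        show "A \<noteq> B" using triangle_distinct[OF t(1)] by blast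
        fix x assume "x \<in> open_segment A B"
        then have "x \<notin> \<Omega>\<^sub>1" using seg dis by blast
        then show "\<phi> x = 0" by (rule test_function_outside(1)[OF \<phi>])
      qed
      then show ?thesis using * fK by simp
    qed
    then show "(LINT y|lebesgue_on \<Omega>\<^sub>1. ?v y \<bullet> gradient \<phi> y) = - (LINT y|lebesgue_on \<Omega>\<^sub>1. \<phi> y * ?d y)"
      unfolding 1 2 by (simp only: distrib_left)
  qed
  then have hd: "?v \<in> Hdiv \<Omega>\<^sub>1" unfolding Hdiv_def using vL dL by blast
  have "\<exists>b c. AE x in lebesgue_on L. ?v x = b + c *\<^sub>R x" if L: "L \<in> \<T>" for L
  proof -
    let ?p = "if L = K then (- \<alpha> *\<^sub>R P, \<alpha>) else if L = K' then (- \<alpha>' *\<^sub>R P', \<alpha>') else 0"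
    have "AE x in lebesgue_on L. ?v x = fst ?p + snd ?p *\<^sub>R x"
      using edge_field_on_element[OF K L] unfolding RT_shape_def by (intro AE_I2) (simp add: space_restrict_space)
    then show ?thesis by blast
  qed
  then show ?thesis unfolding RT0_def using hd by blast
qed

lemma edge_field_coef:
  assumes K: "K \<in> \<T>" "K' \<in> \<T>" "K \<noteq> K'" and L: "L \<in> \<T>"
  shows "coef RT_shape (edge_field \<alpha> K P \<alpha>' K' P') L =
    (if L = K then (- \<alpha> *\<^sub>R P, \<alpha>) else if L = K' then (- \<alpha>' *\<^sub>R P', \<alpha>') else 0)"
proof (rule coef_eqI[OF shape_RT element_open[OF L] element_nonempty[OF L]])
  show "AE x in lebesgue_on L. edge_field \<alpha> K P \<alpha>' K' P' x =
      RT_shape (if L = K then (- \<alpha> *\<^sub>R P, \<alpha>) else if L = K' then (- \<alpha>' *\<^sub>R P', \<alpha>') else 0) x"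
    using edge_field_on_element[OF K L] by (intro AE_I2) (simp add: space_restrict_space)
qed

lemma edge_field_trace:
  assumes K: "K \<in> \<T>" "K' \<in> \<T>" "K \<noteq> K'" and v: "edge_field \<alpha> K P \<alpha>' K' P' \<in> RT" and f: "flat s Ka Kb n r"
  shows "tr1 (edge_field \<alpha> K P \<alpha>' K' P') s =
    (if Ka = K then \<alpha> * ((s - P) \<bullet> n) else if Ka = K' then \<alpha>' * ((s - P') \<bullet> n) else 0)"
  unfolding tr1_flat[OF v f] edge_field_coef[OF K flatD(1)[OF f]]
  by (simp add: RT_shape_def inner_add_left inner_diff_left right_diff_distrib)

text \<open>The sign holds because \<open>P\<close> lies in the closed triangle, on the inner side of the
  interface line through \<open>s\<close>.\<close>

lemma flat_normal_component:
  assumes f: "flat s K Kb n r" and t: "triangle K P A B" and s: "s \<notin> mesh_vertices"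
  shows "s \<in> open_segment A B \<or> (s - P) \<bullet> n = 0" "0 \<le> (s - P) \<bullet> n"
proof -
  note f' = flatD[OF f]
  have half: "(y - s) \<bullet> n \<le> 0" if "y \<in> ball s r" "y \<in> K" for y
    using f'(8)[OF that(1)] that(2) by simp
  have "s \<notin> K" using f'(8)[of s] f'(6) by simp
  moreover have "s \<notin> {P, A, B}" using s triangle_extreme[OF t] f'(1) unfolding mesh_vertices_def by blast
  ultimately show "s \<in> open_segment A B \<or> (s - P) \<bullet> n = 0"
    by (intro triangle_boundary_normal[OF t f'(6) half flat_on_boundary(1)[OF f]])
  define e where "e = min 1 (r / (2 * (norm (P - s) + 1)))"
  have e: "0 < e" "e \<le> 1" "e \<le> r / (2 * (norm (P - s) + 1))"
    using f'(6) by (auto simp: e_def add_nonneg_pos)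
  have "e * norm (P - s) < r"
  proof -
    have "e * norm (P - s) \<le> e * (norm (P - s) + 1)" using e by simp
    also have "\<dots> \<le> r / (2 * (norm (P - s) + 1)) * (norm (P - s) + 1)"
      using e by (intro mult_right_mono) auto
    also have "\<dots> = r / 2"
      using norm_ge_zero[of "P - s"] by (simp add: field_simps add_nonneg_eq_0_iff)
    finally show ?thesis using f'(6) by simp
  qed
  then have b: "s + e *\<^sub>R (P - s) \<in> ball s r" using e by (simp add: dist_norm)
  have "P \<in> closure K" unfolding triangle_closure[OF t] by (auto intro: hull_inc)
  then have "closed_segment s P \<subseteq> closure K"
    using flat_on_boundary(1)[OF f] triangle_convex[OF t] by (intro closed_segment_subset convex_closure)
  moreover have "s + e *\<^sub>R (P - s) \<in> closed_segment s P"
    unfolding closed_segment_def using e by (auto simp: algebra_simps intro!: exI[of _ e])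
  ultimately have "s + e *\<^sub>R (P - s) \<in> closure K" by blast
  from closure_half_disc[OF half this b] have "e * ((P - s) \<bullet> n) \<le> 0" by simp
  then have "(P - s) \<bullet> n \<le> 0" using e(1) by (simp add: mult_le_0_iff)
  then show "0 \<le> (s - P) \<bullet> n" by (simp add: inner_diff_left)
qed

lemma flat_other_element:
  assumes f: "flat s K Kb n r" and K': "K' \<in> \<T>" "K' \<noteq> K" and t': "triangle K' P' A B" and s: "s \<in> open_segment A B"
  shows "Kb = K'"
proof -
  have "closed_segment A B \<subseteq> convex hull {P', A, B}"
    by (intro closed_segment_subset convex_convex_hull) (auto intro: hull_inc)
  then have "s \<in> closure K'" using s segment_open_subset_closed[of A B] triangle_closure[OF t'] by auto
  then show ?thesis using flat_elements[OF f K'(1)] K'(2) by blast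
qed

section \<open>Propagation across edges\<close>

definition vanish :: "(plane \<Rightarrow> real) \<Rightarrow> (plane \<Rightarrow> real) \<Rightarrow> plane set \<Rightarrow> bool" where
  "vanish q p K \<longleftrightarrow> (K \<subseteq> \<Omega>\<^sub>2 \<longrightarrow> coef P1_shape q K = 0) \<and> (K \<subseteq> \<Omega>\<^sub>1 \<longrightarrow> coef const_shape p K = 0)"

lemma element_measure_pos: "K \<in> \<T> \<Longrightarrow> 0 < measure lebesgue K"
proof -
  assume K: "K \<in> \<T>"
  have "bounded K" using bounded_subset[OF bounded_\<Omega> element_subset_\<Omega>[OF K]] .
  then have lm: "K \<in> lmeasurable" using element_open[OF K] by (intro bounded_set_imp_lmeasurable) auto
  have "\<not> negligible K" using element_open[OF K] element_nonempty[OF K] open_not_negligible by blast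
  then have "measure lebesgue K \<noteq> 0" using lm by (simp add: negligible_iff_measure)
  then show ?thesis using measure_nonneg[of lebesgue K] by linarith
qed

text \<open>Only the triangle \<open>K\<close> contributes if \<open>\<alpha>'\<close> or the value of
  \<open>p\<close> on \<open>K'\<close> is zero.\<close>

lemma edge_field_div_integral:
  assumes K: "K \<in> \<T>" "K' \<in> \<T>" "K \<noteq> K'" and v: "edge_field \<alpha> K P \<alpha>' K' P' \<in> RT" and p: "p \<in> Qh\<^sub>1"
    and K1: "K \<subseteq> \<Omega>\<^sub>1" and K'0: "K' \<subseteq> \<Omega>\<^sub>1 \<Longrightarrow> \<alpha>' * coef const_shape p K' = 0"
  shows "(LINT x|lebesgue_on \<Omega>\<^sub>1. div1 (edge_field \<alpha> K P \<alpha>' K' P') x * p x)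
    = 2 * \<alpha> * coef const_shape p K * measure lebesgue K"
proof -
  let ?v = "edge_field \<alpha> K P \<alpha>' K' P'" and ?c = "2 * \<alpha> * coef const_shape p K"
  have pL: "p \<in> L2 \<Omega>\<^sub>1" using p by (simp add: Q1_def)
  have "(LINT x|lebesgue_on \<Omega>\<^sub>1. div1 ?v x * p x) = (LINT x|lebesgue_on \<Omega>\<^sub>1. ?c * indicator K x)"
  proof (rule integral_cong_AE)
    show "(\<lambda>x. div1 ?v x * p x) \<in> borel_measurable (lebesgue_on \<Omega>\<^sub>1)"
      by (rule borel_measurable_integrable[OF L2_mult_integrable[OF RT_D(3)[OF v] pL]])
    show "(\<lambda>x. ?c * indicator K x) \<in> borel_measurable (lebesgue_on \<Omega>\<^sub>1)"
      using element_open[OF K(1)] by (intro measurable_restrict_space1 measurable_completion borel_measurable_times borel_measurable_indicator) auto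
    show "AE x in lebesgue_on \<Omega>\<^sub>1. div1 ?v x * p x = ?c * indicator K x"
    proof (rule AE_\<Omega>1)
      fix L assume L: "L \<in> \<T>" "L \<subseteq> \<Omega>\<^sub>1"
      have mem: "AE x in lebesgue_on L. x \<in> L" by (intro AE_I2) (simp add: space_restrict_space)
      have div: "AE x in lebesgue_on L. div1 ?v x = 2 * (if L = K then \<alpha> else if L = K' then \<alpha>' else 0)"
        using RT_coef(3)[OF v L] K(3) unfolding edge_field_coef[OF K L(1)]
        by (cases "L = K"; cases "L = K'") simp_all
      show "AE x in lebesgue_on L. div1 ?v x * p x = ?c * indicator K x"
        using mem div Q1_coef(2)[OF p L]
      proof eventually_elim
        case (elim x)
        have ind: "x \<in> K \<longleftrightarrow> L = K"
        proof
          assume "x \<in> K"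
          then have "L \<inter> closure K \<noteq> {}" using elim(1) closure_subset[of K] by blast
          then show "L = K" by (rule elements_meet_eq[OF L(1) K(1)])
        qed (use elim in simp)
        show ?case using elim(2,3) K'0 L(2) K(3) by (auto simp: indicator_def ind)
      qed
    qed
  qed
  also have "\<dots> = ?c * (LINT x|lebesgue_on \<Omega>\<^sub>1. indicator K x)" by (rule integral_mult_right_zero)
  also have "(LINT x|lebesgue_on \<Omega>\<^sub>1. indicator K x) = (LINT x|lebesgue_on K. indicator K x :: real)"
    by (rule integral_vanishing_outside[OF open_\<Omega>1 element_open[OF K(1)] K1]) simp
  also have "\<dots> = (LINT x|lebesgue_on K. 1)"
    by (intro Bochner_Integration.integral_cong refl) (simp add: space_restrict_space)
  also have "\<dots> = measure lebesgue K"
    using element_open[OF K(1)] by (simp add: measure_restrict_space space_restrict_space)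
  finally show ?thesis .
qed

lemma edge_nbhd_apex_side:
  assumes e: "edge_nbhd x K K' P P' A B n r" shows "0 < (P' - x) \<bullet> n"
proof -
  note e' = edge_nbhdD[OF e]
  let ?y = "x + (r / 2) *\<^sub>R n"
  note pts = point_in_opposite_half[OF e'(7) e'(9), of x]
  have "?y \<in> K'" using e'(12)[OF pts(1)] pts(2) e'(9) by simp
  then obtain a b where y: "?y = P' + a *\<^sub>R (A - P') + b *\<^sub>R (B - P')" "0 < a" "0 < b" "a + b < 1"
    using e'(5) unfolding triangle_def tri_def by blast
  note An = open_segment_normal[OF e'(6) e'(8)]
  have "(?y - x) \<bullet> n = P' \<bullet> n + a * (A \<bullet> n - P' \<bullet> n) + b * (B \<bullet> n - P' \<bullet> n) - x \<bullet> n"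
    unfolding y(1) by (simp only: inner_add_left inner_diff_left inner_scaleR_left)
  also have "\<dots> = (1 - a - b) * ((P' - x) \<bullet> n)"
  proof -
    have "p + s * (q - p) + t * (q - p) - q = (1 - s - t) * (p - q)" for p q s t :: real by algebra
    then show ?thesis unfolding An inner_diff_left by blast
  qed
  finally have "0 < (1 - a - b) * ((P' - x) \<bullet> n)" using pts(2) e'(9) by simp
  then show ?thesis using y(4) by (simp add: zero_less_mult_iff)
qed

lemma AE_restrict_element:
  assumes "AE x in lebesgue_on U. Q x" "open U" "K \<in> \<T>" "K \<subseteq> U"
  shows "AE x in lebesgue_on K. Q x"
proof -
  have "AE x in lebesgue. x \<in> U \<longrightarrow> Q x" using assms(1,2) by (subst (asm) AE_restrict_space_iff) auto
  then have "AE x in lebesgue. x \<in> K \<longrightarrow> Q x" by eventually_elim (use assms(4) in blast)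
  then show ?thesis using element_open[OF assms(3)] by (subst AE_restrict_space_iff) auto
qed

lemma coef_grad_zero:
  assumes q: "q \<in> Qh\<^sub>2" and grad0: "AE x in lebesgue_on \<Omega>\<^sub>2. grad2 q x = 0"
    and K: "K \<in> \<T>" "K \<subseteq> \<Omega>\<^sub>2"
  shows "snd (coef P1_shape q K) = 0"
proof -
  note k = element_open[OF K(1)] element_nonempty[OF K(1)]
  have "coef const_shape (grad2 q) K = 0"
    by (rule coef_eqI[OF shape_const k]) (use AE_restrict_element[OF grad0 open_\<Omega>2 K] in \<open>simp add: const_shape_apply\<close>)
  moreover have "coef const_shape (grad2 q) K = snd (coef P1_shape q K)"
    by (rule coef_eqI[OF shape_const k]) (use grad2_coef[OF q K] in \<open>simp add: const_shape_apply\<close>)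
  ultimately show ?thesis by simp
qed

text \<open>Let \<open>\<phi>\<close> be a bump at \<open>x\<close>. Since \<open>q\<close> has weak
  gradient zero, is zero on \<open>K\<close> and equals a constant \<open>c\<close> on
  \<open>K'\<close>, the definition of the weak gradient reads \<open>c \<integral> \<nabla>
  \<phi> = 0\<close> with the integral over \<open>K'\<close>. But this integral is nonzero: the flux formulas with apex
  \<open>P'\<close> and with apex \<open>A\<close> show that its component along \<open>A -
  P'\<close> is a positive multiple of the integral of \<open>\<phi>\<close> over the edge.\<close>

lemma P1_coef_zero_across_edge:
  assumes e: "edge_nbhd x K K' P P' A B n r" and K: "K \<subseteq> \<Omega>\<^sub>2" "K' \<subseteq> \<Omega>\<^sub>2"
    and q: "q \<in> Qh\<^sub>2" and grad0: "AE x in lebesgue_on \<Omega>\<^sub>2. grad2 q x = 0" and zero: "coef P1_shape q K = 0"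
  shows "coef P1_shape q K' = 0"
proof -
  note e' = edge_nbhdD[OF e]
  obtain G where G: "G \<in> G2" "ball x r \<subseteq> G" using same_colour_edge_interior[OF e disjI2[OF refl] K] by blast
  then have ball: "ball x r \<subseteq> \<Omega>\<^sub>2" by blast
  have xb: "x \<in> ball x r" using e'(9) by simp
  obtain l u where lu': "cbox l u \<subseteq> ball x r" "x \<in> box l u" "\<forall>i\<in>Basis. l \<bullet> i < u \<bullet> i"
    by (rule open_contains_cbox[OF open_ball xb])
  note lu = lu'(2,1)
  define \<phi> where "\<phi> = box_bump 1 l u"
  have \<phi>b: "\<phi> \<in> test_functions (ball x r)" unfolding \<phi>_def by (rule box_bump_test_function[OF _ lu(2)]) simp
  then have \<phi>: "\<phi> \<in> test_functions \<Omega>\<^sub>2" using test_functions_mono[OF ball] by blast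
  have \<phi>pos: "0 < \<phi> x" "\<And>y. 0 \<le> \<phi> y" using lu(1) by (simp_all add: \<phi>_def box_bump_pos_iff box_bump_bounds)
  note g = test_function_gradient[OF \<phi>]
  note out = test_function_outside[OF \<phi>b]
  note L = test_function_L2[OF \<phi> open_\<Omega>2 bounded_\<Omega>12(2)]
  have KT: "K' \<in> \<T>" "open K'" using e'(2) element_open[OF e'(2)] by auto
  let ?c = "fst (coef P1_shape q K')"
  have grad_zero: "snd (coef P1_shape q K') = 0" by (rule coef_grad_zero[OF q grad0 KT(1) K(2)])
  have "(LINT y|lebesgue_on \<Omega>\<^sub>2. q y *\<^sub>R gradient \<phi> y) = - (LINT y|lebesgue_on \<Omega>\<^sub>2. \<phi> y *\<^sub>R grad2 q y)"
    using Q2_D(4)[OF q] \<phi> by (simp add: is_weak_grad_def)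
  also have "(LINT y|lebesgue_on \<Omega>\<^sub>2. \<phi> y *\<^sub>R grad2 q y) = 0"
  proof (rule integral_eq_zero_AE)
    show "AE y in lebesgue_on \<Omega>\<^sub>2. \<phi> y *\<^sub>R grad2 q y = 0" using grad0 by eventually_elim simp
  qed
  finally have 0: "(LINT y|lebesgue_on \<Omega>\<^sub>2. q y *\<^sub>R gradient \<phi> y) = 0" by simp
  have "(LINT y|lebesgue_on \<Omega>\<^sub>2. q y *\<^sub>R gradient \<phi> y)
     = (LINT y|lebesgue_on \<Omega>\<^sub>2. ?c *\<^sub>R (indicator K' y *\<^sub>R gradient \<phi> y))"
  proof (rule integral_cong_AE)
    show "(\<lambda>y. q y *\<^sub>R gradient \<phi> y) \<in> borel_measurable (lebesgue_on \<Omega>\<^sub>2)"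
      by (rule borel_measurable_integrable[OF L2_scaleR_integrable[OF Q2_D(2)[OF q] L(2)]])
    have "(\<lambda>y. indicator K' y :: real) \<in> borel_measurable (lebesgue_on \<Omega>\<^sub>2)"
      using KT(2) by (intro measurable_restrict_space1 measurable_completion borel_measurable_indicator) auto
    then show "(\<lambda>y. ?c *\<^sub>R (indicator K' y *\<^sub>R gradient \<phi> y)) \<in> borel_measurable (lebesgue_on \<Omega>\<^sub>2)"
      using L2_measurable[OF L(2)] by (intro borel_measurable_scaleR borel_measurable_const)
    show "AE y in lebesgue_on \<Omega>\<^sub>2. q y *\<^sub>R gradient \<phi> y = ?c *\<^sub>R (indicator K' y *\<^sub>R gradient \<phi> y)"
    proof (rule AE_\<Omega>2)
      fix M assume M: "M \<in> \<T>" "M \<subseteq> \<Omega>\<^sub>2"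
      have mem: "AE y in lebesgue_on M. y \<in> M" by (intro AE_I2) (simp add: space_restrict_space)
      show "AE y in lebesgue_on M. q y *\<^sub>R gradient \<phi> y = ?c *\<^sub>R (indicator K' y *\<^sub>R gradient \<phi> y)"
        using mem Q2_coef(2)[OF q M]
      proof eventually_elim
        case (elim y)
        have ind: "y \<in> K' \<longleftrightarrow> M = K'"
        proof
          assume "y \<in> K'"
          then have "M \<inter> closure K' \<noteq> {}" using elim(1) closure_subset[of K'] by blast
          then show "M = K'" by (rule elements_meet_eq[OF M(1) KT(1)])
        qed (use elim in simp)
        consider "M = K" | "M = K'" | "M \<noteq> K" "M \<noteq> K'" by blast
        then show ?case
        proof cases
          case 1
          then have "q y = 0" using elim(2) zero by (simp add: shape_linear(2)[OF shape_P1])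
          then show ?thesis using 1 ind e'(3) by simp
        next
          case 2
          then have "q y = ?c" using elim(2) grad_zero by (simp add: P1_shape_def)
          then show ?thesis using 2 ind by simp
        next
          case 3
          then have "y \<notin> ball x r" using e'(13)[OF M(1) 3] elim(1) closure_subset[of M] by blast
          then show ?thesis using out(2) by simp
        qed
      qed
    qed
  qed
  also have "\<dots> = ?c *\<^sub>R (LINT y|lebesgue_on \<Omega>\<^sub>2. indicator K' y *\<^sub>R gradient \<phi> y)"
    by (rule integral_scaleR_right)
  also have "(LINT y|lebesgue_on \<Omega>\<^sub>2. indicator K' y *\<^sub>R gradient \<phi> y) = (LINT y|lebesgue_on K'. indicator K' y *\<^sub>R gradient \<phi> y)"
    by (rule integral_vanishing_outside[OF open_\<Omega>2 KT(2) K(2)]) simp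
  also have "\<dots> = (LINT y|lebesgue_on K'. gradient \<phi> y)"
    by (intro Bochner_Integration.integral_cong refl) (simp add: space_restrict_space)
  finally have cI: "?c *\<^sub>R (LINT y|lebesgue_on K'. gradient \<phi> y) = 0" using 0 by simp
  have bK': "bounded K'" by (rule triangle_bounded[OF e'(5)])
  have ig: "integrable (lebesgue_on K') (gradient \<phi>)"
    by (rule L2_integrable[OF test_function_L2(2)[OF \<phi> KT(2) bK'] KT(2) bK'])
  have igx: "integrable (lebesgue_on K') (\<lambda>y. gradient \<phi> y \<bullet> (y - Q) + 2 * \<phi> y)" for Q
  proof -
    have "continuous_on UNIV (\<lambda>y. gradient \<phi> y \<bullet> (y - Q) + 2 * \<phi> y)"
      by (intro continuous_intros g test_function_continuous[OF \<phi>])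
    then show ?thesis using L2_integrable[OF continuous_L2[OF _ KT(2) bK'] KT(2) bK'] by blast
  qed
  have tA: "triangle K' A P' B" using e'(5) by (simp add: triangle_eq_interior insert_commute)
  (* The edge from P' to B stays outside the support of the bump. *)
  have far: "edge_integral \<phi> P' B = 0"
  proof (rule edge_integral_zero)
    show "P' \<noteq> B" using triangle_distinct[OF e'(5)] by blast
    fix y assume y: "y \<in> open_segment P' B"
    have "y \<notin> ball x r"
    proof
      assume yb: "y \<in> ball x r"
      have "y \<notin> K'" by (rule edge_points_not_in_tri[OF tA y])
      then have ny: "\<not> 0 < (y - x) \<bullet> n" using e'(12)[OF yb] by simp
      obtain t where t: "0 < t" "t < 1" "y = (1 - t) *\<^sub>R P' + t *\<^sub>R B" using y by (auto simp: in_segment)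
      have "(y - x) \<bullet> n = (1 - t) * (P' \<bullet> n) + t * (B \<bullet> n) - x \<bullet> n"
        unfolding t(3) by (simp only: inner_add_left inner_diff_left inner_scaleR_left)
      also have "\<dots> = (1 - t) * ((P' - x) \<bullet> n)"
        unfolding open_segment_normal(2)[OF e'(6) e'(8)] inner_diff_left by algebra
      finally have "0 < (y - x) \<bullet> n" using edge_nbhd_apex_side[OF e] t by simp
      with ny show False by blast
    qed
    then show "\<phi> y = 0" by (rule out(1))
  qed
  have "(LINT y|lebesgue_on K'. gradient \<phi> y \<bullet> (y - P') + 2 * \<phi> y) - (LINT y|lebesgue_on K'. gradient \<phi> y \<bullet> (y - A) + 2 * \<phi> y)
     = (LINT y|lebesgue_on K'. (gradient \<phi> y \<bullet> (y - P') + 2 * \<phi> y) - (gradient \<phi> y \<bullet> (y - A) + 2 * \<phi> y))"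
    by (rule Bochner_Integration.integral_diff[OF igx igx, symmetric])
  also have "\<dots> = (LINT y|lebesgue_on K'. gradient \<phi> y \<bullet> (A - P'))"
    by (intro Bochner_Integration.integral_cong refl) (simp add: inner_diff_right)
  also have "\<dots> = (LINT y|lebesgue_on K'. gradient \<phi> y) \<bullet> (A - P')"
    using ig by simp
  finally have "(LINT y|lebesgue_on K'. gradient \<phi> y) \<bullet> (A - P') = \<bar>cross2 (A - P') (B - P')\<bar> * edge_integral \<phi> A B"
    unfolding triangle_flux[OF e'(5) g] triangle_flux[OF tA g] far by simp
  moreover have "0 < edge_integral \<phi> A B"
    by (rule edge_integral_pos[OF test_function_continuous[OF \<phi>] \<phi>pos(2) e'(6) \<phi>pos(1)])
  moreover have "cross2 (A - P') (B - P') \<noteq> 0" using e'(5) by (simp add: triangle_def)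
  ultimately have "(LINT y|lebesgue_on K'. gradient \<phi> y) \<noteq> 0" by auto
  then have "?c = 0" using cI by simp
  then show ?thesis using grad_zero by (simp add: prod_eq_iff)
qed

text \<open>The cases are numbered by the colours of \<open>K\<close> and \<open>K'\<close>. Whenever
  \<open>K'\<close> or \<open>K\<close> has the first colour, the test field is supported on the
  elements of that colour next to the edge, and its normal component on the interface vanishes
  off that edge.\<close>

lemma vanish_across_edge:
  assumes e: "edge_nbhd x K K' P P' A B n r" and q: "q \<in> Qh\<^sub>2" and p: "p \<in> Qh\<^sub>1"
    and grad0: "AE x in lebesgue_on \<Omega>\<^sub>2. grad2 q x = 0"
    and test: "\<And>v. v \<in> RT \<Longrightarrow> (LINT s|S\<Gamma>. tr2 q s * tr1 v s) + (LINT x|lebesgue_on \<Omega>\<^sub>1. div1 v x * p x) = 0"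
    and zero: "vanish q p K"
  shows "vanish q p K'"
proof -
  note e' = edge_nbhdD[OF e]
  have inv: "K \<noteq> K'" "K' \<noteq> K" using e'(3) by auto
  have meas': "coef const_shape p K' = 0" if "2 * \<alpha> * coef const_shape p K' * measure lebesgue K' = 0" "\<alpha> \<noteq> 0" for \<alpha>
    using that element_measure_pos[OF e'(2)] by simp
  consider (11) "K \<subseteq> \<Omega>\<^sub>1" "K' \<subseteq> \<Omega>\<^sub>1" | (12) "K \<subseteq> \<Omega>\<^sub>1" "K' \<subseteq> \<Omega>\<^sub>2"
    | (21) "K \<subseteq> \<Omega>\<^sub>2" "K' \<subseteq> \<Omega>\<^sub>1" | (22) "K \<subseteq> \<Omega>\<^sub>2" "K' \<subseteq> \<Omega>\<^sub>2"
    using element_colour[OF e'(1)] element_colour[OF e'(2)] by argo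
  then show ?thesis
  proof cases
    case 22
    have "coef P1_shape q K' = 0"
      by (rule P1_coef_zero_across_edge[OF e 22 q grad0]) (use zero 22 in \<open>simp add: vanish_def\<close>)
    moreover have "\<not> K' \<subseteq> \<Omega>\<^sub>1" using element_not_both(1)[OF e'(2)] 22 by blast
    ultimately show ?thesis by (simp add: vanish_def)
  next
    case 11
    have n2: "\<not> K' \<subseteq> \<Omega>\<^sub>2" using element_not_both(1)[OF e'(2)] 11 by blast
    define D D' where "D = \<bar>cross2 (A - P) (B - P)\<bar>" and "D' = \<bar>cross2 (A - P') (B - P')\<bar>"
    have D: "D \<noteq> 0" "D' \<noteq> 0" using e'(4,5) by (auto simp: D_def D'_def triangle_def)
    (* The factors D and -D' make the fluxes through the common edge opposite; since that edge
       is not on the interface, the boundary term vanishes. *)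
    let ?v = "edge_field D K' P' (- D') K P"
    have v: "?v \<in> RT"
      by (rule edge_field_RT[OF e'(2,1) inv(2) e'(5,4) 11(2)]) (use 11 in \<open>simp add: D_def D'_def\<close>)
    have "AE s in S\<Gamma>. tr2 q s * tr1 ?v s = 0"
    proof (rule AE_flat)
      fix s Ka Kb m \<rho> assume f: "flat s Ka Kb m \<rho>" and s: "s \<notin> mesh_vertices"
      have no: "\<not> (Kb = K \<or> Kb = K')"
        using flatD(4)[OF f] element_not_both(1)[OF e'(1) 11(1)] element_not_both(1)[OF e'(2) 11(2)] by metis
      have "tr1 ?v s = 0"
      proof (cases "Ka = K' \<or> Ka = K")
        case True
        then show ?thesis
        proof
          assume Ka: "Ka = K'"
          have "s \<notin> open_segment A B"
          proof
            assume "s \<in> open_segment A B"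
            from flat_other_element[OF f[unfolded Ka] e'(1) inv(1) e'(4) this] no show False by simp
          qed
          then have "(s - P') \<bullet> m = 0" using flat_normal_component(1)[OF f[unfolded Ka] e'(5) s] by simp
          then show ?thesis using edge_field_trace[OF e'(2,1) inv(2) v f] Ka by simp
        next
          assume Ka: "Ka = K"
          have "s \<notin> open_segment A B"
          proof
            assume "s \<in> open_segment A B"
            from flat_other_element[OF f[unfolded Ka] e'(2) inv(2) e'(5) this] no show False by simp
          qed
          then have "(s - P) \<bullet> m = 0" using flat_normal_component(1)[OF f[unfolded Ka] e'(4) s] by simp
          then show ?thesis using edge_field_trace[OF e'(2,1) inv(2) v f] Ka inv by simp
        qed
      next
        case False
        then show ?thesis using edge_field_trace[OF e'(2,1) inv(2) v f] by simp
      qed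
      then show "tr2 q s * tr1 ?v s = 0" by simp
    qed
    then have "(LINT s|S\<Gamma>. tr2 q s * tr1 ?v s) = 0" by (rule integral_eq_zero_AE)
    moreover have "(LINT x|lebesgue_on \<Omega>\<^sub>1. div1 ?v x * p x) = 2 * D * coef const_shape p K' * measure lebesgue K'"
      by (rule edge_field_div_integral[OF e'(2,1) inv(2) v p 11(2)]) (use zero 11 in \<open>simp add: vanish_def\<close>)
    ultimately have "coef const_shape p K' = 0" using test[OF v] meas'[OF _ D(1)] by simp
    then show ?thesis using n2 by (simp add: vanish_def)
  next
    case 21
    have n2: "\<not> K' \<subseteq> \<Omega>\<^sub>2" using element_not_both(1)[OF e'(2)] 21 by blast
    (* The boundary term lives on the common edge only, where the trace of q comes from K and is
       zero. *)
    let ?v = "edge_field 1 K' P' 0 K P"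
    have v: "?v \<in> RT"
      by (rule edge_field_RT[OF e'(2,1) inv(2) e'(5,4) 21(2)]) (use 21 in simp)
    have "AE s in S\<Gamma>. tr2 q s * tr1 ?v s = 0"
    proof (rule AE_flat)
      fix s Ka Kb m \<rho> assume f: "flat s Ka Kb m \<rho>" and s: "s \<notin> mesh_vertices"
      show "tr2 q s * tr1 ?v s = 0"
      proof (cases "Ka = K' \<and> s \<in> open_segment A B")
        case True
        then have "flat s K' Kb m \<rho>" "s \<in> open_segment A B" using f by simp_all
        then have "Kb = K" by (rule flat_other_element[OF _ e'(1) inv(1) e'(4)])
        then have "tr2 q s = 0"
          using tr2_flat[OF q f] zero 21(1) by (simp add: vanish_def shape_linear(2)[OF shape_P1])
        then show ?thesis by simp
      next
        case False
        have "tr1 ?v s = 0"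
        proof (cases "Ka = K'")
          case True
          then have "flat s K' Kb m \<rho>" using f by simp
          from flat_normal_component(1)[OF this e'(5) s] have "(s - P') \<bullet> m = 0"
            using False True by simp
          then show ?thesis using edge_field_trace[OF e'(2,1) inv(2) v f] True by simp
        next
          case False
          then show ?thesis using edge_field_trace[OF e'(2,1) inv(2) v f] by simp
        qed
        then show ?thesis by simp
      qed
    qed
    then have "(LINT s|S\<Gamma>. tr2 q s * tr1 ?v s) = 0" by (rule integral_eq_zero_AE)
    moreover have "(LINT x|lebesgue_on \<Omega>\<^sub>1. div1 ?v x * p x) = 2 * 1 * coef const_shape p K' * measure lebesgue K'"
      by (rule edge_field_div_integral[OF e'(2,1) inv(2) v p 21(2)]) simp
    ultimately have "coef const_shape p K' = 0" using test[OF v] meas'[of 1] by simp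
    then show ?thesis using n2 by (simp add: vanish_def)
  next
    case 12
    have n1: "\<not> K' \<subseteq> \<Omega>\<^sub>1" using element_not_both(1)[OF e'(2)] 12 by blast
    (* The divergence term vanishes with p on K. The boundary term is the constant value of q on
       K' times the flux through the common edge, which is positive. *)
    let ?v = "edge_field 1 K P 0 K' P'"
    have v: "?v \<in> RT"
      by (rule edge_field_RT[OF e'(1,2) inv(1) e'(4,5) 12(1)]) (use 12 in simp)
    have fx: "flat x K K' n r" by (rule edge_nbhd_flat[OF e 12])
    let ?c = "fst (coef P1_shape q K')"
    have grad_zero: "snd (coef P1_shape q K') = 0" by (rule coef_grad_zero[OF q grad0 e'(2) 12(2)])
    have prod: "AE s in S\<Gamma>. tr2 q s * tr1 ?v s = ?c * tr1 ?v s"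
    proof (rule AE_flat)
      fix s Ka Kb m \<rho> assume f: "flat s Ka Kb m \<rho>" and s: "s \<notin> mesh_vertices"
      show "tr2 q s * tr1 ?v s = ?c * tr1 ?v s"
      proof (cases "Ka = K \<and> s \<in> open_segment A B")
        case True
        then have "flat s K Kb m \<rho>" "s \<in> open_segment A B" using f by simp_all
        then have "Kb = K'" by (rule flat_other_element[OF _ e'(2) inv(2) e'(5)])
        then have "tr2 q s = ?c" using tr2_flat[OF q f] grad_zero by (simp add: P1_shape_def)
        then show ?thesis by simp
      next
        case False
        have "tr1 ?v s = 0"
        proof (cases "Ka = K")
          case True
          then have "flat s K Kb m \<rho>" using f by simp
          from flat_normal_component(1)[OF this e'(4) s] have "(s - P) \<bullet> m = 0"
            using False True by simp
          then show ?thesis using edge_field_trace[OF e'(1,2) inv(1) v f] True by simp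
        next
          case False
          then show ?thesis using edge_field_trace[OF e'(1,2) inv(1) v f] by simp
        qed
        then show ?thesis by simp
      qed
    qed
    have nonneg: "AE s in S\<Gamma>. 0 \<le> tr1 ?v s"
    proof (rule AE_flat)
      fix s Ka Kb m \<rho> assume f: "flat s Ka Kb m \<rho>" and s: "s \<notin> mesh_vertices"
      show "0 \<le> tr1 ?v s"
      proof (cases "Ka = K")
        case True
        then have "flat s K Kb m \<rho>" using f by simp
        from flat_normal_component(2)[OF this e'(4) s] show ?thesis
          using edge_field_trace[OF e'(1,2) inv(1) v f] True by simp
      next
        case False
        then show ?thesis using edge_field_trace[OF e'(1,2) inv(1) v f] by simp
      qed
    qed
    have int: "integrable S\<Gamma> (tr1 ?v)" by (rule Linf_integrable[OF tr1_Linf[OF v]])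
    have "(LINT s|S\<Gamma>. tr1 ?v s) \<noteq> 0"
    proof
      assume "(LINT s|S\<Gamma>. tr1 ?v s) = 0"
      then have "AE s in S\<Gamma>. tr1 ?v s = 0"
        using integral_nonneg_eq_0_iff_AE[OF int nonneg] by simp
      then have ae: "AE s in hausdorff1. s \<in> \<Gamma> \<longrightarrow> tr1 ?v s = 0" unfolding AE_surface .
      (* The normal component is a nonzero constant on the part of the edge near x, which has
         positive length. *)
      let ?L = "{y \<in> ball x r. (y - x) \<bullet> n = 0}"
      have "s \<in> \<Gamma> \<and> tr1 ?v s \<noteq> 0" if s: "s \<in> ?L" for s
      proof
        have sb: "s \<in> ball x r" "(s - x) \<bullet> n = 0" using s by auto
        show sG: "s \<in> \<Gamma>" using flatD(11)[OF fx sb(1)] sb(2) by simp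
        have "tr1 ?v s = (s - P) \<bullet> n"
          using edge_field_trace[OF e'(1,2) inv(1) v flat_shift[OF fx sG sb(1)]] by simp
        also have "\<dots> = - ((P - x) \<bullet> n)" using sb(2) by (simp add: inner_diff_left)
        finally show "tr1 ?v s \<noteq> 0"
          using edge_nbhd_apex_side[OF edge_nbhd_swap[OF e]] by simp
      qed
      note L = this
      have "AE s in hausdorff1. s \<notin> ?L"
        using ae
      proof eventually_elim
        case (elim s)
        then show ?case using L[of s] by auto
      qed
      moreover have Lb: "?L \<in> sets borel"
      proof -
        have "?L = ball x r \<inter> {y. (y - x) \<bullet> n = 0}" by blast
        moreover have "closed {y. (y - x) \<bullet> n = 0}" by (intro closed_Collect_eq continuous_intros)
        ultimately show ?thesis by simp
      qed
      ultimately have "?L \<in> null_sets hausdorff1"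
        using AE_iff_null_sets[OF borel_sets_hausdorff1[OF Lb]] by simp
      then show False
        using half_disc_line_not_null[OF e'(7) e'(9), of x] unfolding hausdorff1_null_sets_iff[OF Lb] by simp
    qed
    moreover have "(LINT s|S\<Gamma>. tr2 q s * tr1 ?v s) = ?c * (LINT s|S\<Gamma>. tr1 ?v s)"
    proof -
      have "(LINT s|S\<Gamma>. tr2 q s * tr1 ?v s) = (LINT s|S\<Gamma>. ?c * tr1 ?v s)"
      proof (rule integral_cong_AE[OF _ _ prod])
        show "(\<lambda>s. tr2 q s * tr1 ?v s) \<in> borel_measurable S\<Gamma>"
          by (rule borel_measurable_integrable[OF Linf_integrable[OF Linf_mult[OF tr2_Linf[OF q] tr1_Linf[OF v]]]])
        show "(\<lambda>s. ?c * tr1 ?v s) \<in> borel_measurable S\<Gamma>"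
          by (rule borel_measurable_integrable[OF integrable_mult_right[OF int]])
      qed
      then show ?thesis by simp
    qed
    moreover have "(LINT x|lebesgue_on \<Omega>\<^sub>1. div1 ?v x * p x) = 2 * 1 * coef const_shape p K * measure lebesgue K"
      by (rule edge_field_div_integral[OF e'(1,2) inv(1) v p 12(1)]) simp
    moreover have "coef const_shape p K = 0" using zero 12(1) by (simp add: vanish_def)
    ultimately have "?c = 0" using test[OF v] by simp
    then have "coef P1_shape q K' = 0" using grad_zero by (simp add: prod_eq_iff)
    then show ?thesis using n1 by (simp add: vanish_def)
  qed
qed

section \<open>The norms are controlled by the coefficients\<close>

abbreviation "normX \<equiv> X_norm \<Omega>\<^sub>1 \<Omega>\<^sub>2"
abbreviation "normY \<equiv> Y_norm \<Omega>\<^sub>1 \<Omega>\<^sub>2"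

definition coef_size :: "field_pair \<times> field_pair \<Rightarrow> real" where
  "coef_size z = (\<Sum>K\<in>\<T>. norm (coords z K))"

lemma coef_size_nonneg: "0 \<le> coef_size z"
  unfolding coef_size_def by (intro sum_nonneg) simp

lemma norm_coords_le_coef_size: "K \<in> \<T> \<Longrightarrow> norm (coords z K) \<le> coef_size z"
  unfolding coef_size_def using finite_\<T> by (intro member_le_sum) auto

lemma component_norms:
  assumes K: "K \<in> \<T>"
  shows "K \<subseteq> \<Omega>\<^sub>1 \<Longrightarrow> norm (coef RT_shape (v1 z) K) \<le> coef_size z" "K \<subseteq> \<Omega>\<^sub>2 \<Longrightarrow> norm (coef P1_shape (q2 z) K) \<le> coef_size z"
    "K \<subseteq> \<Omega>\<^sub>2 \<Longrightarrow> norm (coef const_shape (v2 z) K) \<le> coef_size z" "K \<subseteq> \<Omega>\<^sub>1 \<Longrightarrow> \<bar>coef const_shape (q1 z) K\<bar> \<le> coef_size z"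
proof -
  note S = norm_coords_le_coef_size[OF K, of z]
  have 1: "norm (fst c) \<le> norm c" "norm (fst (snd c)) \<le> norm c" "norm (fst (snd (snd c))) \<le> norm c"
    "norm (snd (snd (snd c))) \<le> norm c" for c :: "(plane \<times> real) \<times> (real \<times> plane) \<times> plane \<times> real"
    using norm_fst_le[of "fst c" "snd c"] norm_snd_le[of "snd c" "fst c"]
      norm_fst_le[of "fst (snd c)" "snd (snd c)"] norm_snd_le[of "snd (snd c)" "fst (snd c)"]
      norm_fst_le[of "fst (snd (snd c))" "snd (snd (snd c))"] norm_snd_le[of "snd (snd (snd c))" "fst (snd (snd c))"]
    unfolding prod.collapse by linarith+
  show "K \<subseteq> \<Omega>\<^sub>1 \<Longrightarrow> norm (coef RT_shape (v1 z) K) \<le> coef_size z" "K \<subseteq> \<Omega>\<^sub>2 \<Longrightarrow> norm (coef P1_shape (q2 z) K) \<le> coef_size z"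
    "K \<subseteq> \<Omega>\<^sub>2 \<Longrightarrow> norm (coef const_shape (v2 z) K) \<le> coef_size z" "K \<subseteq> \<Omega>\<^sub>1 \<Longrightarrow> \<bar>coef const_shape (q1 z) K\<bar> \<le> coef_size z"
    using coords_components[of K z] order_trans[OF 1(1) S] order_trans[OF 1(2) S]
      order_trans[OF 1(3) S] order_trans[OF 1(4) S] by simp_all
qed

text \<open>On a bounded domain the components and their derivatives are bounded by the coefficients,
  uniformly on every element.\<close>

lemma norm_le_coef_size:
  "\<exists>C\<ge>0. \<forall>z\<in>X \<times> Y. normX (fst z) + normY (snd z) \<le> C * coef_size z"
proof -
  obtain R where R: "0 \<le> R" "\<And>x. x \<in> closure \<Omega> \<Longrightarrow> norm x \<le> R" using \<Omega>_radius by blast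
  define m where "m = sqrt (measure lebesgue \<Omega>\<^sub>1) + sqrt (measure lebesgue \<Omega>\<^sub>2)"
  have m: "0 \<le> m" "sqrt (measure lebesgue \<Omega>\<^sub>1) \<le> m" "sqrt (measure lebesgue \<Omega>\<^sub>2) \<le> m"
    by (simp_all add: m_def)
  have inR: "norm x \<le> R" if "x \<in> K" "K \<in> \<T>" for x K
    using R(2) that element_subset_\<Omega>[OF that(2)] closure_subset[of \<Omega>] by blast
  have sqrt_le: "sqrt (((a::real)\<^sup>2 + b\<^sup>2) + (c\<^sup>2 + d\<^sup>2)) \<le> a + b + c + d" "sqrt (a\<^sup>2 + b\<^sup>2) \<le> a + b"
    if "0 \<le> a" "0 \<le> b" "0 \<le> c" "0 \<le> d" for a b c d
    using that by (auto intro!: real_le_lsqrt simp: power2_eq_square algebra_simps)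
  (* Covers the factors 1 + R for values of affine fields, 2 for divergences and 1 for gradients
     and constants. *)
  define k where "k = 2 + R"
  have k: "0 \<le> k" "1 + R \<le> k" "2 \<le> k" "1 \<le> k" using R(1) by (auto simp: k_def)
  have "normX (fst z) + normY (snd z) \<le> 6 * k * m * coef_size z" if z: "z \<in> X \<times> Y" for z
  proof -
    note c = components_in[OF z]
    note cn = component_norms[where z = z]
    have kS: "0 \<le> k * coef_size z" using k(1) coef_size_nonneg by simp
    have scale: "t \<le> k * coef_size z" if "t \<le> s * e" "s \<le> coef_size z" "0 \<le> s" "e \<le> k" for t s e
    proof -
      have "s * e \<le> s * k" using that by (intro mult_left_mono) auto
      also have "\<dots> \<le> coef_size z * k" using that k(1) by (intro mult_right_mono) auto
      finally show ?thesis using that(1) by (simp add: mult.commute)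
    qed
    have L: "L2_norm U f \<le> k * m * coef_size z"
      if "U \<in> lmeasurable" "sqrt (measure lebesgue U) \<le> m" "f \<in> L2 U" "AE x in lebesgue_on U. norm (f x) \<le> k * coef_size z"
      for U and f :: "plane \<Rightarrow> 'b::euclidean_space"
    proof -
      have "L2_norm U f \<le> (k * coef_size z) * sqrt (measure lebesgue U)"
        by (rule L2_AE_bounded(2)[OF that(1) L2_measurable[OF that(3)] that(4) kS])
      also have "\<dots> \<le> (k * coef_size z) * m" using that(2) kS by (rule mult_left_mono)
      finally show ?thesis by (simp add: mult_ac)
    qed
    have b1: "AE x in lebesgue_on \<Omega>\<^sub>1. norm (v1 z x) \<le> k * coef_size z"
    proof (rule AE_\<Omega>1)
      fix K assume K: "K \<in> \<T>" "K \<subseteq> \<Omega>\<^sub>1"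
      have mem: "AE y in lebesgue_on K. y \<in> K" by (intro AE_I2) (simp add: space_restrict_space)
      show "AE x in lebesgue_on K. norm (v1 z x) \<le> k * coef_size z"
        using mem RT_coef(2)[OF c(1) K]
      proof eventually_elim
        case (elim x)
        show ?case unfolding elim(2)
          by (rule scale[OF RT_shape_bound[OF inR[OF elim(1) K(1)]] cn(1)[OF K] _ k(2)]) simp
      qed
    qed
    have b2: "AE x in lebesgue_on \<Omega>\<^sub>1. norm (div1 (v1 z) x) \<le> k * coef_size z"
    proof (rule AE_\<Omega>1)
      fix K assume K: "K \<in> \<T>" "K \<subseteq> \<Omega>\<^sub>1"
      show "AE x in lebesgue_on K. norm (div1 (v1 z) x) \<le> k * coef_size z"
        using RT_coef(3)[OF c(1) K]
      proof eventually_elim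
        case (elim x)
        have "norm (snd (coef RT_shape (v1 z) K)) \<le> coef_size z"
          using norm_snd_le[of "snd (coef RT_shape (v1 z) K)" "fst (coef RT_shape (v1 z) K)"] cn(1)[OF K] by simp
        then show ?case unfolding elim
          by (intro scale[OF _ _ _ k(3), of _ "norm (snd (coef RT_shape (v1 z) K))"]) (simp_all add: abs_mult)
      qed
    qed
    have b3: "AE x in lebesgue_on \<Omega>\<^sub>2. norm (q2 z x) \<le> k * coef_size z"
    proof (rule AE_\<Omega>2)
      fix K assume K: "K \<in> \<T>" "K \<subseteq> \<Omega>\<^sub>2"
      have mem: "AE y in lebesgue_on K. y \<in> K" by (intro AE_I2) (simp add: space_restrict_space)
      show "AE x in lebesgue_on K. norm (q2 z x) \<le> k * coef_size z"
        using mem Q2_coef(2)[OF c(2) K]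
      proof eventually_elim
        case (elim x)
        show ?case unfolding elim(2)
          by (rule scale[OF P1_shape_bound[OF inR[OF elim(1) K(1)]] cn(2)[OF K] _ k(2)]) simp
      qed
    qed
    have b4: "AE x in lebesgue_on \<Omega>\<^sub>2. norm (grad2 (q2 z) x) \<le> k * coef_size z"
    proof (rule AE_\<Omega>2)
      fix K assume K: "K \<in> \<T>" "K \<subseteq> \<Omega>\<^sub>2"
      show "AE x in lebesgue_on K. norm (grad2 (q2 z) x) \<le> k * coef_size z"
        using grad2_coef[OF c(2) K]
      proof eventually_elim
        case (elim x)
        have "norm (snd (coef P1_shape (q2 z) K)) \<le> coef_size z"
          using norm_snd_le[of "snd (coef P1_shape (q2 z) K)" "fst (coef P1_shape (q2 z) K)"] cn(2)[OF K] by simp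
        then show ?case unfolding elim
          by (intro scale[OF _ _ _ k(4), of _ "norm (snd (coef P1_shape (q2 z) K))"]) simp_all
      qed
    qed
    have b5: "AE x in lebesgue_on \<Omega>\<^sub>2. norm (v2 z x) \<le> k * coef_size z"
    proof (rule AE_\<Omega>2)
      fix K assume K: "K \<in> \<T>" "K \<subseteq> \<Omega>\<^sub>2"
      show "AE x in lebesgue_on K. norm (v2 z x) \<le> k * coef_size z"
        using grad_Q2_coef(2)[OF c(3) K]
      proof eventually_elim
        case (elim x)
        show ?case unfolding elim
          by (rule scale[OF _ cn(3)[OF K] _ k(4)]) simp_all
      qed
    qed
    have b6: "AE x in lebesgue_on \<Omega>\<^sub>1. norm (q1 z x) \<le> k * coef_size z"
    proof (rule AE_\<Omega>1)
      fix K assume K: "K \<in> \<T>" "K \<subseteq> \<Omega>\<^sub>1"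
      show "AE x in lebesgue_on K. norm (q1 z x) \<le> k * coef_size z"
        using Q1_coef(2)[OF c(4) K]
      proof eventually_elim
        case (elim x)
        show ?case unfolding elim
          by (rule scale[OF _ cn(4)[OF K] _ k(4)]) simp_all
      qed
    qed
    have v2L: "v2 z \<in> L2 \<Omega>\<^sub>2" using c(3) by (simp add: grad_Q2_def)
    have q1L: "q1 z \<in> L2 \<Omega>\<^sub>1" using c(4) by (simp add: Q1_def)
    have "normX (fst z) \<le> L2_norm \<Omega>\<^sub>1 (v1 z) + L2_norm \<Omega>\<^sub>1 (div1 (v1 z)) + L2_norm \<Omega>\<^sub>2 (q2 z) + L2_norm \<Omega>\<^sub>2 (grad2 (q2 z))"
      unfolding X_norm_def case_prod_beta v1_def[symmetric] q2_def[symmetric]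
      by (intro sqrt_le L2_norm_nonneg)
    also have "\<dots> \<le> k * m * coef_size z + k * m * coef_size z + k * m * coef_size z + k * m * coef_size z"
      by (intro add_mono L b1 b2 b3 b4 lmeasurable_\<Omega>12 m RT_D[OF c(1)] Q2_D[OF c(2)])
    finally have nX: "normX (fst z) \<le> 4 * (k * m * coef_size z)" by simp
    have "normY (snd z) \<le> L2_norm \<Omega>\<^sub>2 (v2 z) + L2_norm \<Omega>\<^sub>1 (q1 z)"
      unfolding Y_norm_def case_prod_beta v2_def[symmetric] q1_def[symmetric]
      by (rule sqrt_le(2)[OF _ _ order_refl order_refl]) (rule L2_norm_nonneg)+
    also have "\<dots> \<le> k * m * coef_size z + k * m * coef_size z"
      by (intro add_mono L b5 b6 lmeasurable_\<Omega>12 m v2L q1L)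
    finally show ?thesis using nX by simp
  qed
  moreover have "0 \<le> 6 * k * m" using k m by simp
  ultimately show ?thesis by blast
qed

lemma normX_nonneg: "0 \<le> normX x" and normY_nonneg: "0 \<le> normY y"
  unfolding X_norm_def Y_norm_def case_prod_beta by (intro real_sqrt_ge_zero add_nonneg_nonneg zero_le_power2)+

lemma coef_size_null: "coef_size z = 0 \<longleftrightarrow> null z"
  unfolding coef_size_def null_def using finite_\<T> by (simp add: sum_nonneg_eq_0_iff)

end

section \<open>The mixed problem\<close>

locale mixed_problem = bipartite_mesh +
  fixes a \<beta> :: "plane \<Rightarrow> real"
  assumes a_pos: "\<forall>x\<in>\<Omega>. a x > 0" and a_Linf: "a \<in> Linf (lebesgue_on \<Omega>)"
    and \<beta>_nonneg: "\<forall>s\<in>\<Gamma>. \<beta> s \<ge> 0" and \<beta>_Linf: "\<beta> \<in> Linf (surface_measure \<Gamma>)"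
    and \<beta>_pos: "(LINT s|surface_measure \<Gamma>. \<bar>\<beta> s\<bar>) > 0"
begin

abbreviation "A_form \<equiv> A_op \<Omega>\<^sub>1 \<Omega>\<^sub>2 \<Gamma> a \<beta>"
abbreviation "B_form \<equiv> B_op \<Omega>\<^sub>1 \<Omega>\<^sub>2"
abbreviation "C_form \<equiv> C_op \<Omega>\<^sub>2 a"

text \<open>The factor \<open>1\<close> and the inner product of reals give all six forms the same shape, that of
  \<open>bilinear_in_coefs_integral\<close>.\<close>

definition "form_a1 z w = (LINT x|lebesgue_on \<Omega>\<^sub>1. a x * (v1 z x \<bullet> v1 w x))" for z w
definition "form_a2 z w = (LINT x|lebesgue_on \<Omega>\<^sub>2. a x * (v2 z x \<bullet> v2 w x))" for z w
definition "form_beta z w = (LINT s|S\<Gamma>. \<beta> s * (tr2 (q2 z) s \<bullet> tr2 (q2 w) s))" for z w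
definition "form_trace z w = (LINT s|S\<Gamma>. 1 * (tr2 (q2 z) s \<bullet> tr1 (v1 w) s))" for z w
definition "form_div z w = (LINT x|lebesgue_on \<Omega>\<^sub>1. 1 * (div1 (v1 z) x \<bullet> q1 w x))" for z w
definition "form_grad z w = (LINT x|lebesgue_on \<Omega>\<^sub>2. 1 * (grad2 (q2 z) x \<bullet> v2 w x))" for z w

lemma A_form_eq: "A_form (fst z) (fst w) = form_a1 z w + form_beta z w - form_trace w z + form_trace z w"
  unfolding A_op_def form_a1_def form_beta_def form_trace_def case_prod_beta v1_def q2_def tr1_def tr2_def
  by (simp add: mult_ac)

lemma B_form_eq: "B_form (fst z) (snd w) = form_div z w + form_grad z w"
  unfolding B_op_def form_div_def form_grad_def case_prod_beta v1_def q2_def v2_def q1_def by simp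

lemma C_form_eq: "C_form (snd z) (snd w) = form_a2 z w"
  unfolding C_op_def form_a2_def case_prod_beta v2_def by simp

lemma a_Linf_sub: "a \<in> Linf (lebesgue_on \<Omega>\<^sub>1)" "a \<in> Linf (lebesgue_on \<Omega>\<^sub>2)"
proof -
  have "a \<in> Linf (lebesgue_on U)" if U: "open U" "U \<subseteq> \<Omega>" for U
  proof -
    obtain C where C: "AE x in lebesgue_on \<Omega>. \<bar>a x\<bar> \<le> C" "a \<in> borel_measurable (lebesgue_on \<Omega>)"
      using a_Linf by (auto simp: Linf_def)
    have "AE x in lebesgue. x \<in> \<Omega> \<longrightarrow> \<bar>a x\<bar> \<le> C" using C(1) open_\<Omega> by (subst (asm) AE_restrict_space_iff) auto
    then have "AE x in lebesgue. x \<in> U \<longrightarrow> \<bar>a x\<bar> \<le> C" by eventually_elim (use U(2) in blast)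
    then have "AE x in lebesgue_on U. \<bar>a x\<bar> \<le> C" using U(1) by (subst AE_restrict_space_iff) auto
    moreover have "a \<in> borel_measurable (lebesgue_on U)" by (rule measurable_restrict_mono[OF C(2) U(2)])
    ultimately show ?thesis by (auto simp: Linf_def)
  qed
  then show "a \<in> Linf (lebesgue_on \<Omega>\<^sub>1)" "a \<in> Linf (lebesgue_on \<Omega>\<^sub>2)"
    using open_\<Omega>1 open_\<Omega>2 \<Omega>1_subset \<Omega>2_subset by blast+
qed

lemma v2_L2: "z \<in> X \<times> Y \<Longrightarrow> v2 z \<in> L2 \<Omega>\<^sub>2" and q1_L2: "z \<in> X \<times> Y \<Longrightarrow> q1 z \<in> L2 \<Omega>\<^sub>1"
  using components_in(3,4)[of z] by (auto simp: grad_Q2_def Q1_def)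

lemma integrable_form_a1: "z \<in> X \<times> Y \<Longrightarrow> w \<in> X \<times> Y \<Longrightarrow> integrable (lebesgue_on \<Omega>\<^sub>1) (\<lambda>x. a x * (v1 z x \<bullet> v1 w x))"
  by (intro Linf_mult_integrable a_Linf_sub L2_inner_integrable RT_D(2) components_in)

lemma integrable_form_a2: "z \<in> X \<times> Y \<Longrightarrow> w \<in> X \<times> Y \<Longrightarrow> integrable (lebesgue_on \<Omega>\<^sub>2) (\<lambda>x. a x * (v2 z x \<bullet> v2 w x))"
  by (intro Linf_mult_integrable a_Linf_sub L2_inner_integrable v2_L2)

lemma integrable_form_beta: "z \<in> X \<times> Y \<Longrightarrow> w \<in> X \<times> Y \<Longrightarrow> integrable S\<Gamma> (\<lambda>s. \<beta> s * (tr2 (q2 z) s \<bullet> tr2 (q2 w) s))"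
  unfolding inner_real_def by (intro Linf_integrable Linf_mult \<beta>_Linf tr2_Linf components_in)

lemma bilinear_in_coefs_forms: "bilinear_in_coefs form_a1" "bilinear_in_coefs form_a2" "bilinear_in_coefs form_beta" "bilinear_in_coefs form_trace" "bilinear_in_coefs form_div" "bilinear_in_coefs form_grad"
proof -
  show "bilinear_in_coefs form_a1" unfolding form_a1_def by (rule bilinear_in_coefs_integral[OF linear_in_coefs_v1 linear_in_coefs_v1 integrable_form_a1])
  show "bilinear_in_coefs form_a2" unfolding form_a2_def by (rule bilinear_in_coefs_integral[OF linear_in_coefs_v2 linear_in_coefs_v2 integrable_form_a2])
  show "bilinear_in_coefs form_beta" unfolding form_beta_def by (rule bilinear_in_coefs_integral[OF linear_in_coefs_tr2 linear_in_coefs_tr2 integrable_form_beta])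
  show "bilinear_in_coefs form_trace" unfolding form_trace_def
  proof (rule bilinear_in_coefs_integral[OF linear_in_coefs_tr2 linear_in_coefs_tr1])
    fix z w assume "z \<in> X \<times> Y" "w \<in> X \<times> Y"
    then show "integrable S\<Gamma> (\<lambda>s. 1 * (tr2 (q2 z) s \<bullet> tr1 (v1 w) s))"
      unfolding inner_real_def mult_1_left by (intro Linf_integrable Linf_mult tr1_Linf tr2_Linf components_in)
  qed
  show "bilinear_in_coefs form_div" unfolding form_div_def
  proof (rule bilinear_in_coefs_integral[OF linear_in_coefs_div linear_in_coefs_q1])
    fix z w assume "z \<in> X \<times> Y" "w \<in> X \<times> Y"
    then show "integrable (lebesgue_on \<Omega>\<^sub>1) (\<lambda>x. 1 * (div1 (v1 z) x \<bullet> q1 w x))"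
      unfolding mult_1_left by (intro L2_inner_integrable RT_D(3) q1_L2 components_in)
  qed
  show "bilinear_in_coefs form_grad" unfolding form_grad_def
  proof (rule bilinear_in_coefs_integral[OF linear_in_coefs_grad linear_in_coefs_v2])
    fix z w assume "z \<in> X \<times> Y" "w \<in> X \<times> Y"
    then show "integrable (lebesgue_on \<Omega>\<^sub>2) (\<lambda>x. 1 * (grad2 (q2 z) x \<bullet> v2 w x))"
      unfolding mult_1_left by (intro L2_inner_integrable Q2_D(3) v2_L2 components_in)
  qed
qed

definition energy :: "field_pair \<times> field_pair \<Rightarrow> field_pair \<times> field_pair \<Rightarrow> real" where
  "energy z w = form_a1 z w + form_beta z w + form_a2 z w"

definition coupling :: "field_pair \<times> field_pair \<Rightarrow> field_pair \<times> field_pair \<Rightarrow> real" where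
  "coupling z w = (form_trace z w - form_trace w z) + (form_div w z - form_div z w) + (form_grad w z - form_grad z w)"

lemma bilinear_in_coefs_energy_coupling: "bilinear_in_coefs energy" "bilinear_in_coefs coupling"
  unfolding energy_def[abs_def] coupling_def[abs_def]
  by (intro bilinear_in_coefs_add bilinear_in_coefs_diff bilinear_in_coefs_forms bilinear_in_coefs_swap)+

lemma energy_commute: "energy z w = energy w z" and coupling_anticommute: "coupling z w = - coupling w z"
  by (simp_all add: energy_def coupling_def form_a1_def form_beta_def form_a2_def inner_commute mult.commute)

definition mixed_form :: "field_pair \<times> field_pair \<Rightarrow> field_pair \<times> field_pair \<Rightarrow> real" where
  "mixed_form z w = energy z w + coupling z w"

lemma mixed_form_eq: "mixed_form z w = (A_form (fst z) (fst w) + B_form (fst w) (snd z)) + (- B_form (fst z) (snd w) + C_form (snd z) (snd w))"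
  unfolding A_form_eq B_form_eq C_form_eq mixed_form_def energy_def coupling_def by simp

lemma RT_coef_zero:
  assumes "v \<in> RT" "AE x in lebesgue_on \<Omega>\<^sub>1. v x = 0"
  shows "K \<in> \<T> \<Longrightarrow> K \<subseteq> \<Omega>\<^sub>1 \<Longrightarrow> coef RT_shape v K = 0"
proof -
  assume K: "K \<in> \<T>" "K \<subseteq> \<Omega>\<^sub>1"
  have "AE x in lebesgue_on K. v x = 0" by (rule AE_restrict_element[OF assms(2) open_\<Omega>1 K])
  then have "AE x in lebesgue_on K. v x = RT_shape 0 x" by (simp add: shape_linear(2)[OF shape_RT])
  then show "coef RT_shape v K = 0" by (rule coef_eqI[OF shape_RT element_open[OF K(1)] element_nonempty[OF K(1)]])
qed

text \<open>Testing with \<open>z\<close> itself removes \<open>coupling\<close> and shows that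
  \<open>energy z z = 0\<close>; the remaining equations do not involve the sign
  \<open>\<sigma>\<close>. For \<open>\<sigma> = 1\<close> this concerns the left kernel of
  \<open>mixed_form\<close>, for \<open>\<sigma> = - 1\<close> the right one.\<close>

lemma kernel_trivial:
  assumes z: "z \<in> X \<times> Y" and \<sigma>: "\<sigma> = 1 \<or> \<sigma> = -1"
    and ker: "\<And>w. w \<in> X \<times> Y \<Longrightarrow> energy z w + \<sigma> * coupling z w = 0"
  shows "null z"
proof -
  note c = components_in[OF z]
  have skew0: "coupling z z = 0" by (simp add: coupling_def)
  have sum0: "form_a1 z z + form_beta z z + form_a2 z z = 0" using ker[OF z] skew0 by (simp add: energy_def)
  have a1: "AE x in lebesgue_on \<Omega>\<^sub>1. 0 < a x" and a2: "AE x in lebesgue_on \<Omega>\<^sub>2. 0 < a x"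
    by (intro AE_I2, simp add: space_restrict_space, use a_pos \<Omega>1_subset \<Omega>2_subset in blast)+
  have n1: "AE x in lebesgue_on \<Omega>\<^sub>1. 0 \<le> a x * (v1 z x \<bullet> v1 z x)" using a1 by eventually_elim simp
  have n2: "AE x in lebesgue_on \<Omega>\<^sub>2. 0 \<le> a x * (v2 z x \<bullet> v2 z x)" using a2 by eventually_elim simp
  have n3: "AE s in S\<Gamma>. 0 \<le> \<beta> s * (tr2 (q2 z) s \<bullet> tr2 (q2 z) s)"
    using \<beta>_nonneg by (auto intro!: AE_I2 simp: space_surface)
  have "0 \<le> form_a1 z z" "0 \<le> form_beta z z" "0 \<le> form_a2 z z"
    unfolding form_a1_def form_beta_def form_a2_def by (rule integral_nonneg_AE[OF n1] integral_nonneg_AE[OF n2] integral_nonneg_AE[OF n3])+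
  then have "form_a1 z z = 0" "form_beta z z = 0" "form_a2 z z = 0" using sum0 by linarith+
  then have e1: "AE x in lebesgue_on \<Omega>\<^sub>1. a x * (v1 z x \<bullet> v1 z x) = 0"
    and e3: "AE s in S\<Gamma>. \<beta> s * (tr2 (q2 z) s \<bullet> tr2 (q2 z) s) = 0"
    and e2: "AE x in lebesgue_on \<Omega>\<^sub>2. a x * (v2 z x \<bullet> v2 z x) = 0"
    using integral_nonneg_eq_0_iff_AE[OF integrable_form_a1[OF z z] n1]
      integral_nonneg_eq_0_iff_AE[OF integrable_form_beta[OF z z] n3]
      integral_nonneg_eq_0_iff_AE[OF integrable_form_a2[OF z z] n2]
    by (simp_all add: form_a1_def form_beta_def form_a2_def)
  have v10: "AE x in lebesgue_on \<Omega>\<^sub>1. v1 z x = 0" using e1 a1 by eventually_elim simp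
  have v20: "AE x in lebesgue_on \<Omega>\<^sub>2. v2 z x = 0" using e2 a2 by eventually_elim simp
  have \<beta>0: "AE s in S\<Gamma>. \<beta> s * tr2 (q2 z) s = 0" using e3 by eventually_elim simp
  have coef1: "coef RT_shape (v1 z) K = 0" if "K \<in> \<T>" "K \<subseteq> \<Omega>\<^sub>1" for K
    by (rule RT_coef_zero[OF c(1) v10 that])
  have sym0: "energy z w = 0" for w
  proof -
    have "form_a1 z w = 0" unfolding form_a1_def by (rule integral_eq_zero_AE) (use v10 in eventually_elim, simp)
    moreover have "form_a2 z w = 0" unfolding form_a2_def by (rule integral_eq_zero_AE) (use v20 in eventually_elim, simp)
    moreover have "form_beta z w = 0" unfolding form_beta_def by (rule integral_eq_zero_AE) (use \<beta>0 in eventually_elim, auto)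
    ultimately show ?thesis by (simp add: energy_def)
  qed
  have tr10: "AE s in S\<Gamma>. tr1 (v1 z) s = 0"
  proof (rule AE_flat)
    fix s K1 K2 n r assume f: "flat s K1 K2 n r"
    show "tr1 (v1 z) s = 0"
      unfolding tr1_flat[OF c(1) f] coef1[OF flatD(1,3)[OF f]] shape_linear(2)[OF shape_RT] by simp
  qed
  have div0: "AE x in lebesgue_on \<Omega>\<^sub>1. div1 (v1 z) x = 0"
  proof (rule AE_\<Omega>1)
    fix K assume K: "K \<in> \<T>" "K \<subseteq> \<Omega>\<^sub>1"
    show "AE x in lebesgue_on K. div1 (v1 z) x = 0"
      using RT_coef(3)[OF c(1) K] by eventually_elim (simp add: coef1[OF K])
  qed
  (* What remains of the kernel condition once v1 and v2 are known to vanish. *)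
  have red: "form_trace z w + form_div w z - form_grad z w = 0" if w: "w \<in> X \<times> Y" for w
  proof -
    have "\<sigma> * coupling z w = 0" using ker[OF w] sym0 by simp
    then have "coupling z w = 0" using \<sigma> by auto
    moreover have "form_trace w z = 0" unfolding form_trace_def by (rule integral_eq_zero_AE) (use tr10 in eventually_elim, simp)
    moreover have "form_div z w = 0" unfolding form_div_def by (rule integral_eq_zero_AE) (use div0 in eventually_elim, simp)
    moreover have "form_grad w z = 0" unfolding form_grad_def by (rule integral_eq_zero_AE) (use v20 in eventually_elim, simp)
    ultimately show ?thesis by (simp add: coupling_def)
  qed
  have zero_RT: "tr1 (\<lambda>x. 0) s = 0" if "flat s K1 K2 n r" for s K1 K2 n r
  proof -
    have "coef RT_shape (\<lambda>x. 0) K1 = 0"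
      by (rule RT_coef_zero[OF zero_in_spaces(1) _ flatD(1,3)[OF that]]) simp
    then show ?thesis unfolding tr1_flat[OF zero_in_spaces(1) that] by (simp add: shape_linear(2)[OF shape_RT])
  qed
  have zero_div: "AE x in lebesgue_on \<Omega>\<^sub>1. div1 (\<lambda>x. 0) x = 0"
  proof (rule AE_\<Omega>1)
    fix K assume K: "K \<in> \<T>" "K \<subseteq> \<Omega>\<^sub>1"
    have "coef RT_shape (\<lambda>x. 0) K = 0"
      by (rule RT_coef_zero[OF zero_in_spaces(1) _ K]) simp
    then show "AE x in lebesgue_on K. div1 (\<lambda>x. 0) x = 0"
      using RT_coef(3)[OF zero_in_spaces(1) K] by simp
  qed
  have grad0: "AE x in lebesgue_on \<Omega>\<^sub>2. grad2 (q2 z) x = 0"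
  proof -
    (* The gradient of q2 is an admissible test function for the third component. *)
    let ?w = "((\<lambda>x. 0, \<lambda>x. 0), (grad2 (q2 z), \<lambda>x. 0)) :: field_pair \<times> field_pair"
    have G: "grad2 (q2 z) \<in> GQ" unfolding grad_Q2_def using Q2_D(3,4)[OF c(2)] c(2) by blast
    have w: "?w \<in> X \<times> Y" using zero_in_spaces G by (simp add: mem_XY)
    have comp: "v1 ?w = (\<lambda>x. 0)" "v2 ?w = grad2 (q2 z)" by (simp_all add: v1_def v2_def)
    have "form_trace z ?w = 0"
    proof -
      have tr: "AE s in S\<Gamma>. tr1 (v1 ?w) s = 0" unfolding comp by (rule AE_flat) (rule zero_RT)
      show ?thesis unfolding form_trace_def by (rule integral_eq_zero_AE) (use tr in eventually_elim, simp)
    qed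
    moreover have "form_div ?w z = 0"
      unfolding form_div_def comp by (rule integral_eq_zero_AE) (use zero_div in eventually_elim, simp)
    ultimately have "form_grad z ?w = 0" using red[OF w] by simp
    then have i0: "(LINT x|lebesgue_on \<Omega>\<^sub>2. grad2 (q2 z) x \<bullet> grad2 (q2 z) x) = 0" by (simp add: form_grad_def comp)
    have i: "integrable (lebesgue_on \<Omega>\<^sub>2) (\<lambda>x. grad2 (q2 z) x \<bullet> grad2 (q2 z) x)"
      by (intro L2_inner_integrable Q2_D(3) c)
    have "AE x in lebesgue_on \<Omega>\<^sub>2. grad2 (q2 z) x \<bullet> grad2 (q2 z) x = 0"
      using integral_nonneg_eq_0_iff_AE[OF i] i0 by simp
    then show ?thesis by eventually_elim simp
  qed
  have test: "(LINT s|S\<Gamma>. tr2 (q2 z) s * tr1 v s) + (LINT x|lebesgue_on \<Omega>\<^sub>1. div1 v x * q1 z x) = 0"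
    if v: "v \<in> RT" for v
  proof -
    let ?w = "((v, \<lambda>x. 0), (\<lambda>x. 0, \<lambda>x. 0)) :: field_pair \<times> field_pair"
    have w: "?w \<in> X \<times> Y" using zero_in_spaces v by (simp add: mem_XY)
    have comp: "v1 ?w = v" "v2 ?w = (\<lambda>x. 0)" by (simp_all add: v1_def v2_def)
    have "form_grad z ?w = 0" by (simp add: form_grad_def comp)
    then show ?thesis using red[OF w] by (simp add: form_trace_def form_div_def comp)
  qed
  (* The set of elements on which q2 and q1 vanish is nonempty, since otherwise the trace of q2
     would be nonzero almost everywhere and the weight would vanish; it is closed under crossing
     edges. *)
  let ?Z = "{K \<in> \<T>. vanish (q2 z) (q1 z) K}"
  have "?Z = \<T>"
  proof (rule edge_connected)
    show "?Z \<subseteq> \<T>" by blast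
    show "?Z \<noteq> {}"
    proof
      assume empty: "?Z = {}"
      have "AE s in S\<Gamma>. tr2 (q2 z) s \<noteq> 0"
      proof (rule AE_flat)
        fix s K1 K2 n r assume f: "flat s K1 K2 n r"
        note K = flatD(2,4)[OF f]
        have snd0: "snd (coef P1_shape (q2 z) K2) = 0" by (rule coef_grad_zero[OF c(2) grad0 K])
        show "tr2 (q2 z) s \<noteq> 0"
        proof
          assume "tr2 (q2 z) s = 0"
          then have "coef P1_shape (q2 z) K2 = 0"
            using tr2_flat[OF c(2) f] snd0 by (simp add: P1_shape_def prod_eq_iff)
          moreover have "\<not> K2 \<subseteq> \<Omega>\<^sub>1" using element_not_both(1)[OF K(1)] K(2) by blast
          ultimately have "K2 \<in> ?Z" using K(1) by (simp add: vanish_def)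
          then show False using empty by blast
        qed
      qed
      then have "AE s in S\<Gamma>. \<bar>\<beta> s\<bar> = 0" using \<beta>0 by eventually_elim simp
      then have "(LINT s|S\<Gamma>. \<bar>\<beta> s\<bar>) = 0" by (rule integral_eq_zero_AE)
      then show False using \<beta>_pos by simp
    qed
    fix x K K' P P' A B n r assume K: "K \<in> ?Z" and e: "edge_nbhd x K K' P P' A B n r"
    have "vanish (q2 z) (q1 z) K'"
      by (rule vanish_across_edge[OF e c(2) c(4) grad0 test]) (use K in simp_all)
    then show "K' \<in> ?Z" using edge_nbhdD(2)[OF e] by blast
  qed
  then have van: "vanish (q2 z) (q1 z) K" if "K \<in> \<T>" for K using that by blast
  have coef2: "coef const_shape (v2 z) K = 0" if K: "K \<in> \<T>" "K \<subseteq> \<Omega>\<^sub>2" for K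
  proof -
    have "AE y in lebesgue_on K. v2 z y = const_shape 0 y"
      unfolding const_shape_apply by (rule AE_restrict_element[OF v20 open_\<Omega>2 K])
    then show ?thesis by (rule coef_eqI[OF shape_const element_open[OF K(1)] element_nonempty[OF K(1)]])
  qed
  have "coords z K = 0" if K: "K \<in> \<T>" for K
  proof -
    have "coords z K = (if K \<subseteq> \<Omega>\<^sub>1 then coef RT_shape (v1 z) K else 0, if K \<subseteq> \<Omega>\<^sub>2 then coef P1_shape (q2 z) K else 0,
      if K \<subseteq> \<Omega>\<^sub>2 then coef const_shape (v2 z) K else 0, if K \<subseteq> \<Omega>\<^sub>1 then coef const_shape (q1 z) K else 0)"
      by (simp only: coords_def v1_def q2_def v2_def q1_def)
    also have "\<dots> = 0"
      using coef1[OF K] coef2[OF K] van[OF K] by (simp add: vanish_def zero_prod_def)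
    finally show ?thesis .
  qed
  then show ?thesis by (simp add: null_def)
qed

section \<open>Well-posedness\<close>

abbreviation "X\<^sub>d \<equiv> dual_space X normX"
abbreviation "Y\<^sub>d \<equiv> dual_space Y normY"

lemma bilinear_in_coefs_mixed_form: "bilinear_in_coefs mixed_form"
  unfolding mixed_form_def[abs_def] by (intro bilinear_in_coefs_add bilinear_in_coefs_energy_coupling)

lemma null_iff_coordinates:
  "null z \<longleftrightarrow> (\<forall>i\<in>\<T> \<times> Basis. coords z (fst i) \<bullet> snd i = 0)"
  unfolding null_def by (auto simp: euclidean_eq_iff[of "coords z _"])

sublocale lin: finite_bilinear lc "X \<times> Y" "\<T> \<times> Basis" "\<lambda>i z. coords z (fst i) \<bullet> snd i" mixed_form
proof
  show "closed_under lc (X \<times> Y)" by (rule closed_XY)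
  show "finite (\<T> \<times> (Basis :: ((plane \<times> real) \<times> (real \<times> plane) \<times> plane \<times> real) set))" using finite_\<T> by simp
next
  fix i :: "plane set \<times> ((plane \<times> real) \<times> (real \<times> plane) \<times> plane \<times> real)"
  assume i: "i \<in> \<T> \<times> Basis"
  then have "fst i \<in> \<T>" by auto
  then show "functional_on lc (X \<times> Y) (\<lambda>z. coords z (fst i) \<bullet> snd i)"
    unfolding functional_on_def by (simp add: coords_lc inner_add_left)
  {
    fix z assume z: "z \<in> X \<times> Y" "\<And>w. w \<in> X \<times> Y \<Longrightarrow> mixed_form z w = 0"
    have "null z" by (rule kernel_trivial[OF z(1), of 1]) (use z(2) in \<open>simp_all add: mixed_form_def\<close>)
    then show "coords z (fst i) \<bullet> snd i = 0" using i null_iff_coordinates by blast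
  }
  {
    fix w assume w: "w \<in> X \<times> Y" "\<And>z. z \<in> X \<times> Y \<Longrightarrow> mixed_form z w = 0"
    have "energy w z + - 1 * coupling w z = 0" if "z \<in> X \<times> Y" for z
      using w(2)[OF that] energy_commute[of z w] coupling_anticommute[of z w] by (simp add: mixed_form_def)
    then have "null w" by (intro kernel_trivial[OF w(1), of "- 1"]) simp_all
    then show "coords w (fst i) \<bullet> snd i = 0" using i null_iff_coordinates by blast
  }
next
  show "functional_on lc (X \<times> Y) (\<lambda>z. mixed_form z w)" if "w \<in> X \<times> Y" for w using bilinear_in_coefs_mixed_form that unfolding bilinear_in_coefs_def by blast
  show "functional_on lc (X \<times> Y) (mixed_form z)" if "z \<in> X \<times> Y" for z using bilinear_in_coefs_mixed_form that unfolding bilinear_in_coefs_def by blast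
next
  fix z w assume zw: "z \<in> X \<times> Y" "w \<in> X \<times> Y"
  have 0: "null z \<or> null w \<Longrightarrow> mixed_form z w = 0" using bilinear_in_coefs_mixed_form zw unfolding bilinear_in_coefs_def by blast
  show "mixed_form z w = 0" if "\<And>i. i \<in> \<T> \<times> Basis \<Longrightarrow> coords z (fst i) \<bullet> snd i = 0"
    using 0 null_iff_coordinates[of z] that by blast
  show "mixed_form z w = 0" if "\<And>i. i \<in> \<T> \<times> Basis \<Longrightarrow> coords w (fst i) \<bullet> snd i = 0"
    using 0 null_iff_coordinates[of w] that by blast
qed

text \<open>The two equations are recovered from their sum by testing with elements one of whose parts is
  zero.\<close>

lemma solution_iff:
  assumes F1: "F1 \<in> X\<^sub>d" and F2: "F2 \<in> Y\<^sub>d"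
  shows "discrete_solution \<T> \<Omega> G1 G2 a \<beta> F1 F2 x y \<longleftrightarrow>
    (x, y) \<in> X \<times> Y \<and> (\<forall>w\<in>X \<times> Y. mixed_form (x, y) w = F1 (fst w) + F2 (snd w))"
proof -
  let ?P = "\<lambda>x y w. A_form x (fst w) + B_form (fst w) y" and ?Q = "\<lambda>x y w. - B_form x (snd w) + C_form y (snd w)"
  have def: "discrete_solution \<T> \<Omega> G1 G2 a \<beta> F1 F2 x y \<longleftrightarrow>
    x \<in> X \<and> y \<in> Y \<and> (\<forall>z\<in>X. A_form x z + B_form z y = F1 z) \<and> (\<forall>z\<in>Y. - B_form x z + C_form y z = F2 z)"
    by (simp add: discrete_solution_def dual_op_def Let_def)
  have Mw: "mixed_form (x, y) w = ?P x y w + ?Q x y w" for w using mixed_form_eq[of "(x, y)" w] by simp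
  have "(\<forall>z\<in>X. A_form x z + B_form z y = F1 z) \<and> (\<forall>z\<in>Y. - B_form x z + C_form y z = F2 z)"
    if x: "x \<in> X" and y: "y \<in> Y" and eq: "\<And>w. w \<in> X \<times> Y \<Longrightarrow> mixed_form (x, y) w = F1 (fst w) + F2 (snd w)"
  proof -
    have xy: "(x, y) \<in> X \<times> Y" using x y by simp
    have "bilinear_in_coefs (\<lambda>z w. (form_a1 z w + form_beta z w - form_trace w z + form_trace z w) + (form_div w z + form_grad w z))"
      by (intro bilinear_in_coefs_add bilinear_in_coefs_diff bilinear_in_coefs_forms bilinear_in_coefs_swap)
    then have P: "functional_on lc (X \<times> Y) (?P x y)"
      unfolding bilinear_in_coefs_def A_form_eq[symmetric] B_form_eq[symmetric] using xy by fastforce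
    have zX: "lc_pair 0 z 0 z \<in> X" if "z \<in> X" for z by (rule closed_underD[OF closed_X that that])
    have zY: "lc_pair 0 z 0 z \<in> Y" if "z \<in> Y" for z by (rule closed_underD[OF closed_Y that that])
    have F0: "z \<in> X \<Longrightarrow> F1 (lc_pair 0 z 0 z) = 0" "w \<in> Y \<Longrightarrow> F2 (lc_pair 0 w 0 w) = 0" for z w
      using functional_onD[OF dual_functional[OF F1], where z = z and w = z and c = 0 and d = 0]
        functional_onD[OF dual_functional[OF F2], where z = w and w = w and c = 0 and d = 0] by simp_all
    show ?thesis
    proof (intro conjI ballI)
      fix z assume z: "z \<in> X"
      let ?w = "(z, lc_pair 0 y 0 y)"
      have "?Q x y ?w = 0" by (simp add: B_op_def C_op_def lc_pair_def case_prod_beta)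
      moreover have "mixed_form (x, y) ?w = F1 z" using eq[of ?w] z zY[OF y] F0(2)[OF y] by simp
      ultimately show "A_form x z + B_form z y = F1 z" using Mw[of ?w] by simp
    next
      fix z assume z: "z \<in> Y"
      let ?w = "(lc_pair 0 x 0 x, z)"
      (* Traces and weak derivatives of the zero field are only known through linearity of the
         form. *)
      have "?P x y (lc 0 (x, z) 0 (x, z)) = 0"
        using functional_onD[OF P, of "(x, z)" "(x, z)" 0 0] x z by simp
      then have "?P x y ?w = 0" by (simp add: lc_def)
      moreover have "mixed_form (x, y) ?w = F2 z" using eq[of ?w] z zX[OF x] F0(1)[OF x] by simp
      ultimately show "- B_form x z + C_form y z = F2 z" using Mw[of ?w] by simp
    qed
  qed
  then show ?thesis unfolding def using Mw by fastforce
qed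

text \<open>Bounded functionals vanish on elements of norm zero, in particular on null elements.\<close>

lemma dual_determined:
  assumes F1: "F1 \<in> X\<^sub>d" and F2: "F2 \<in> Y\<^sub>d"
  shows "lin.determined (\<lambda>w. F1 (fst w) + F2 (snd w))"
proof -
  note L = functional_onD[OF dual_functional[OF F1]] functional_onD[OF dual_functional[OF F2]]
  have "functional_on lc (X \<times> Y) (\<lambda>w. F1 (fst w) + F2 (snd w))"
    unfolding functional_on_def lc_def by (auto simp: L algebra_simps)
  moreover have "F1 (fst z) + F2 (snd z) = 0" if z: "z \<in> X \<times> Y" and n: "null z" for z
  proof -
    obtain C where C: "normX (fst z) + normY (snd z) \<le> C * coef_size z" using norm_le_coef_size z by blast
    then have "normX (fst z) = 0" "normY (snd z) = 0"
      using n coef_size_null[of z] normX_nonneg[of "fst z"] normY_nonneg[of "snd z"] by auto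
    moreover obtain D1 where "\<And>w. w \<in> X \<Longrightarrow> \<bar>F1 w\<bar> \<le> D1 * normX w" using dual_bounded[OF F1] by blast
    moreover obtain D2 where "\<And>w. w \<in> Y \<Longrightarrow> \<bar>F2 w\<bar> \<le> D2 * normY w" using dual_bounded[OF F2] by blast
    ultimately have "\<bar>F1 (fst z)\<bar> \<le> 0" "\<bar>F2 (snd z)\<bar> \<le> 0" using z by (metis mem_Times_iff mult_zero_right)+
    then show ?thesis by simp
  qed
  ultimately show ?thesis unfolding lin.determined_def using null_iff_coordinates by blast
qed

lemma solution_exists:
  assumes "F1 \<in> X\<^sub>d" "F2 \<in> Y\<^sub>d"
  shows "\<exists>x y. discrete_solution \<T> \<Omega> G1 G2 a \<beta> F1 F2 x y"
  using lin.solvable[OF dual_determined[OF assms]] unfolding solution_iff[OF assms] by (metis prod.collapse)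

lemma solution_unique:
  assumes F: "F1 \<in> X\<^sub>d" "F2 \<in> Y\<^sub>d" and xy: "discrete_solution \<T> \<Omega> G1 G2 a \<beta> F1 F2 x y"
    and xy': "discrete_solution \<T> \<Omega> G1 G2 a \<beta> F1 F2 x' y'"
  shows "ae_eq \<Omega>\<^sub>1 \<Omega>\<^sub>2 x' x" "ae_eq \<Omega>\<^sub>2 \<Omega>\<^sub>1 y' y"
proof -
  note s = xy[unfolded solution_iff[OF F]] xy'[unfolded solution_iff[OF F]]
  have in': "(x', y') \<in> X \<times> Y" "(x, y) \<in> X \<times> Y" using s by blast+
  let ?d = "lc 1 (x', y') (- 1) (x, y)"
  have d: "?d \<in> X \<times> Y" by (rule closed_underD[OF closed_XY in'])
  have "mixed_form ?d w = 0" if w: "w \<in> X \<times> Y" for w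
    using functional_onD[OF lin.left[OF w] in', of 1 "- 1"] s w by simp
  then have "null ?d" unfolding null_iff_coordinates using lin.left_kernel[OF d] by blast
  then show "ae_eq \<Omega>\<^sub>1 \<Omega>\<^sub>2 x' x" "ae_eq \<Omega>\<^sub>2 \<Omega>\<^sub>1 y' y"
    using null_difference_imp_ae_eq[OF in'] by simp_all
qed

text \<open>The coordinates of a solution are fixed combinations of values of the right-hand side on
  finitely many test elements, and these values are bounded by the dual norms.\<close>

lemma solution_bound:
  "\<exists>c>0. \<forall>F1\<in>X\<^sub>d. \<forall>F2\<in>Y\<^sub>d. \<forall>x y. discrete_solution \<T> \<Omega> G1 G2 a \<beta> F1 F2 x y \<longrightarrow>
     normX x + normY y \<le> c * (dual_norm X normX F1 + dual_norm Y normY F2)"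
proof -
  obtain C where C: "0 \<le> C" "\<And>z. z \<in> X \<times> Y \<Longrightarrow> normX (fst z) + normY (snd z) \<le> C * coef_size z"
    using norm_le_coef_size by blast
  obtain S b where S: "finite S" "S \<subseteq> X \<times> Y" and b: "\<And>i z. i \<in> \<T> \<times> Basis \<Longrightarrow> z \<in> X \<times> Y \<Longrightarrow>
      coords z (fst i) \<bullet> snd i = (\<Sum>s\<in>S. b i s * mixed_form z s)"
    using lin.coordinates_from_tests by blast
  define D where "D s = C * coef_size s + 1" for s
  define c where "c = (\<Sum>K\<in>\<T>. \<Sum>e\<in>Basis. \<Sum>s\<in>S. \<bar>b (K, e) s\<bar> * D s)"
  have c: "0 \<le> c" unfolding c_def D_def using C(1) coef_size_nonneg
    by (intro sum_nonneg mult_nonneg_nonneg add_nonneg_nonneg) auto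
  have "normX x + normY y \<le> (C * c + 1) * (dual_norm X normX F1 + dual_norm Y normY F2)"
    if F: "F1 \<in> X\<^sub>d" "F2 \<in> Y\<^sub>d" and xy: "discrete_solution \<T> \<Omega> G1 G2 a \<beta> F1 F2 x y" for F1 F2 x y
  proof -
    let ?N = "dual_norm X normX F1 + dual_norm Y normY F2"
    have test: "\<bar>F1 (fst s)\<bar> \<le> D s * dual_norm X normX F1" "0 \<le> dual_norm X normX F1"
      "\<bar>F2 (snd s)\<bar> \<le> D s * dual_norm Y normY F2" "0 \<le> dual_norm Y normY F2" if s: "s \<in> X \<times> Y" for s
    proof -
      have "normX (fst (lc t s 0 s)) + normY (snd (lc t s 0 s)) \<le> \<bar>t\<bar> * (C * coef_size s)" for t
      proof -
        have "coef_size (lc t s 0 s) = \<bar>t\<bar> * coef_size s"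
          unfolding coef_size_def sum_distrib_left by (intro sum.cong refl) (simp add: coords_lc[OF s s])
        then show ?thesis using C(2)[OF closed_underD[OF closed_XY s s], of t 0] by (simp add: mult_ac)
      qed
      then have "normX (lc_pair t (fst s) 0 (fst s)) \<le> \<bar>t\<bar> * (C * coef_size s)"
        "normY (lc_pair t (snd s) 0 (snd s)) \<le> \<bar>t\<bar> * (C * coef_size s)" for t
        using normX_nonneg[of "lc_pair t (fst s) 0 (fst s)"] normY_nonneg[of "lc_pair t (snd s) 0 (snd s)"]
        unfolding lc_def fst_conv snd_conv by (smt (verit))+
      moreover have "0 \<le> C * coef_size s" using C(1) coef_size_nonneg by simp
      moreover have "fst s \<in> X" "snd s \<in> Y" using s by auto
      ultimately show "\<bar>F1 (fst s)\<bar> \<le> D s * dual_norm X normX F1" "0 \<le> dual_norm X normX F1"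
        "\<bar>F2 (snd s)\<bar> \<le> D s * dual_norm Y normY F2" "0 \<le> dual_norm Y normY F2"
        unfolding D_def by - (rule dual_norm_test[OF F(1) closed_X _ normX_nonneg] dual_norm_test[OF F(2) closed_Y _ normY_nonneg]; assumption)+
    qed
    note sol = xy[unfolded solution_iff[OF F]]
    have z: "(x, y) \<in> X \<times> Y" using sol by blast
    note N = test(2,4)[OF z]
    have Ms: "\<bar>mixed_form (x, y) s\<bar> \<le> D s * ?N" if "s \<in> S" for s
    proof -
      have s: "s \<in> X \<times> Y" using S(2) that by blast
      have "mixed_form (x, y) s = F1 (fst s) + F2 (snd s)" using sol s by blast
      then show ?thesis using test(1,3)[OF s] by (simp add: distrib_left)
    qed
    have coord: "\<bar>coords (x, y) K \<bullet> e\<bar> \<le> (\<Sum>s\<in>S. \<bar>b (K, e) s\<bar> * D s) * ?N" if "K \<in> \<T>" "e \<in> Basis" for K e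
    proof -
      have "\<bar>coords (x, y) K \<bullet> e\<bar> = \<bar>\<Sum>s\<in>S. b (K, e) s * mixed_form (x, y) s\<bar>" using b[of "(K, e)" "(x, y)"] that z by simp
      also have "\<dots> \<le> (\<Sum>s\<in>S. \<bar>b (K, e) s * mixed_form (x, y) s\<bar>)" by (rule sum_abs)
      also have "\<dots> \<le> (\<Sum>s\<in>S. \<bar>b (K, e) s\<bar> * (D s * ?N))"
        unfolding abs_mult by (intro sum_mono mult_left_mono Ms abs_ge_zero)
      finally show ?thesis by (simp add: sum_distrib_right mult.assoc)
    qed
    have "coef_size (x, y) \<le> (\<Sum>K\<in>\<T>. \<Sum>e\<in>Basis. \<bar>coords (x, y) K \<bullet> e\<bar>)"
      unfolding coef_size_def by (intro sum_mono norm_le_l1)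
    also have "\<dots> \<le> (\<Sum>K\<in>\<T>. \<Sum>e\<in>Basis. (\<Sum>s\<in>S. \<bar>b (K, e) s\<bar> * D s) * ?N)" by (intro sum_mono coord)
    also have "\<dots> = c * ?N" unfolding c_def by (simp only: sum_distrib_right)
    finally have "C * coef_size (x, y) \<le> C * (c * ?N)" using C(1) by (rule mult_left_mono)
    then have "normX x + normY y \<le> C * (c * ?N)" using C(2)[OF z] by simp
    also have "\<dots> \<le> (C * c + 1) * ?N" using N by (simp add: distrib_right mult.assoc)
    finally show ?thesis .
  qed
  moreover have "0 < C * c + 1" using C(1) c by (simp add: add_nonneg_pos)
  ultimately show ?thesis by blast
qed

end

theorem theorem8:
  fixes \<Omega> :: "plane set" and G1 G2 \<T> :: "plane set set"
    and a \<beta> :: "plane \<Rightarrow> real"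
  assumes "polygon \<Omega>"
    and "bipartite_map \<Omega> G1 G2"
    and "geometric_assumptions G1 G2"
    and "triangulation_of \<Omega> \<T>"
    and "consistent_with \<T> G1 G2"
    and "\<forall>x\<in>\<Omega>. a x > 0"
    and "a \<in> Linf (lebesgue_on \<Omega>)"
    and "(\<lambda>x. 1 / a x) \<in> Linf (lebesgue_on \<Omega>)"
    and "\<forall>s\<in>interface \<Omega> G1 G2. \<beta> s \<ge> 0"
    and "\<beta> \<in> Linf (surface_measure (interface \<Omega> G1 G2))"
    and "(LINT s|surface_measure (interface \<Omega> G1 G2). \<bar>\<beta> s\<bar>) > 0"
  shows "let X = X_space \<T> \<Omega> (\<Union>G1) (\<Union>G2); normX = X_norm (\<Union>G1) (\<Union>G2);
             Y = Y_space \<T> \<Omega> (\<Union>G1) (\<Union>G2); normY = Y_norm (\<Union>G1) (\<Union>G2)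
         in (\<forall>F1\<in>dual_space X normX. \<forall>F2\<in>dual_space Y normY.
               \<exists>x y. discrete_solution \<T> \<Omega> G1 G2 a \<beta> F1 F2 x y \<and>
                 (\<forall>x' y'. discrete_solution \<T> \<Omega> G1 G2 a \<beta> F1 F2 x' y' \<longrightarrow>
                    ae_eq (\<Union>G1) (\<Union>G2) x' x \<and> ae_eq (\<Union>G2) (\<Union>G1) y' y)) \<and>
            (\<exists>c>0. \<forall>F1\<in>dual_space X normX. \<forall>F2\<in>dual_space Y normY. \<forall>x y.
               discrete_solution \<T> \<Omega> G1 G2 a \<beta> F1 F2 x y \<longrightarrow>
               normX x + normY y \<le> c * (dual_norm X normX F1 + dual_norm Y normY F2))"
proof -
  interpret mixed_problem \<Omega> G1 G2 \<T> a \<beta>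
    by unfold_locales (fact assms)+
  have "\<exists>x y. discrete_solution \<T> \<Omega> G1 G2 a \<beta> F1 F2 x y \<and>
      (\<forall>x' y'. discrete_solution \<T> \<Omega> G1 G2 a \<beta> F1 F2 x' y' \<longrightarrow>
        ae_eq (\<Union>G1) (\<Union>G2) x' x \<and> ae_eq (\<Union>G2) (\<Union>G1) y' y)"
    if F: "F1 \<in> X\<^sub>d" "F2 \<in> Y\<^sub>d" for F1 F2
  proof -
    obtain x y where "discrete_solution \<T> \<Omega> G1 G2 a \<beta> F1 F2 x y" using solution_exists[OF F] by blast
    then show ?thesis using solution_unique[OF F] by blast
  qed
  then show ?thesis unfolding Let_def using solution_bound by blast
qed

end
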